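(* Let $K$ be a compact metrizable hypergroup and let $1<p\le 2\le q<\infty$. There is a constant $C>0$ such that for every left Fourier multiplier $A$ on $K$ with symbol $\sigma_A$, $$\|A\|_{L^p(K)\to L^q(K)}\le C\,\sup_{y>0}\,y\left(\sum_{\pi\in\widehat K,\ \|\sigma_A(\pi)\|_{\mathrm{op}}\ge y}k_\pi^2\right)^{\frac1p-\frac1q} ;$$ that is, if the right-hand side is finite, then $A$ extends to a bounded linear operator $L^p(K)\to L^q(K)$ whose norm satisfies this bound.
   Context: A compact hypergroup is a nonempty compact Hausdorff space $K$ with a weakly continuous associative convolution $*$ on the Banach space $M(K)$ of bounded regular (complex) Borel measures, making $(M(K),* )$ a Banach algebra, such that: (i) for $x,y\in K$, $\delta_x*\delta_y$ is a probability measure with compact support and $(x,y)\mapsto\operatorname{supp}(\delta_x*\delta_y)$ is continuous from $K\times K$ into the space of nonempty compact subsets of $K$ with the Michael (Vietoris) topology; (ii) there is a unique $e\in K$ with $\delta_x*\delta_e=\delta_e*\delta_x=\delta_x$ for all $x$; (iii) there is a homeomorphism $x\mapsto\check x$ of $K$ of order two inducing an involution on $M(K)$, where $\check\mu(E)=\mu(\check E)$ for Borel $E$, and $e\in\operatorname{supp}(\delta_x*\delta_y)$ if and only if $x=\check y$. $\lambda$ denotes the normalized Haar measure of $K$ (the left-invariant one: $\int_K f(x*y)\,d\lambda(y)=\int_K f(y)\,d\lambda(y)$ for all $x\in K$ and continuous $f$, where $f(x*y)=\int f\,d(\delta_x*\delta_y)$), and $L^p(K)=L^p(K,\lambda)$.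 $\widehat K$ is the set of equivalence classes of irreducible representations of $K$, i.e. irreducible $*$-algebra representations $\pi$ of $M(K)$ on a Hilbert space $\mathcal H_\pi$ with $\pi(\delta_e)=I$ and $\mu\mapsto\langle\pi(\mu)u,v\rangle$ continuous on the cone $M(K)^+$ of positive measures with the weak topology; write $\pi(x)=\pi(\delta_x)$. All such $\pi$ are finite dimensional; $d_\pi=\dim\mathcal H_\pi$, and $\pi(x)=[\pi_{i,j}(x)]$ is the matrix in a fixed orthonormal basis. $\widehat K$ is countable since $K$ is metrizable. The hyperdimension $k_\pi\ge d_\pi$ is the constant with $\int_K\pi_{i,j}\overline{\pi'_{m,l}}\,d\lambda=1/k_\pi$ if $i=m$, $j=l$, $\pi=\pi'$, and $0$ otherwise. The Fourier transform is $\widehat f(\pi)=\int_K f(x)\,\bar\pi(x)\,d\lambda(x)\in\mathbb C^{d_\pi\times d_\pi}$ with $\bar\pi$ the conjugate representation (entries $\overline{\pi_{i,j}}$). A left Fourier multiplier with symbol $\sigma_A$ is a linear operator $A$ defined on $C(K)$, with values in $L^1(K)$, for which there is a family $\sigma_A(\pi)\in\mathbb C^{d_\pi\times d_\pi}$ ($\pi\in\widehat K$) with $\widehat{Af}(\pi)=\sigma_A(\pi)\widehat f(\pi)$ for all $\pi\in\widehat K$ and all $f\in C(K)$. $\|\cdot\|_{\mathrm{op}}$ is the operator norm of matrices. Conventions: empty sums are zero; when the exponent $\frac1p-\frac1q$ is $0$ (i.e. $p=q=2$), the bracket raised to the power $0$ is read as $1$ if the index set is nonempty (even if the sum is infinite)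 and $0$ if it is empty. *)

theory Defs
  imports
    "HOL-Analysis.Analysis"
    "Jordan_Normal_Form.Schur_Decomposition"
begin

text \<open>
  A complex Borel measure is a set function on the Borel sets, extended by 0 to all other sets,
  so that equality of measures is equality of functions.
\<close>

definition complex_borel_measure :: "('a::topological_space set \<Rightarrow> complex) \<Rightarrow> bool" where
  "complex_borel_measure \<mu> \<longleftrightarrow>
     (\<forall>A. A \<notin> sets borel \<longrightarrow> \<mu> A = 0) \<and> \<mu> {} = 0 \<and>
     (\<forall>A :: nat \<Rightarrow> 'a set. range A \<subseteq> sets borel \<longrightarrow> disjoint_family A \<longrightarrow>
        (\<lambda>i. \<mu> (A i)) sums \<mu> (\<Union>i. A i))"

definition total_variation :: "('a::topological_space set \<Rightarrow> complex) \<Rightarrow> 'a set \<Rightarrow> real" where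
  "total_variation \<mu> A =
     (SUP P \<in> {P. finite P \<and> P \<subseteq> sets borel \<and> disjoint P \<and> \<Union>P \<subseteq> A}. \<Sum>B\<in>P. cmod (\<mu> B))"

text \<open>The space \<open>M(K)\<close>; complex measures are automatically bounded.\<close>

definition reg_measures :: "('a::topological_space set \<Rightarrow> complex) set" where
  "reg_measures = {\<mu>. complex_borel_measure \<mu> \<and>
     (\<forall>A\<in>sets borel. \<forall>\<epsilon>>0. \<exists>C U. compact C \<and> open U \<and> C \<subseteq> A \<and> A \<subseteq> U \<and>
        total_variation \<mu> (U - C) < \<epsilon>)}"

definition pos_measures :: "('a::topological_space set \<Rightarrow> complex) set" where
  "pos_measures = {\<mu> \<in> reg_measures. \<forall>A. \<mu> A \<in> \<real>\<^sub>\<ge>\<^sub>0}"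

definition prob_measures :: "('a::topological_space set \<Rightarrow> complex) set" where
  "prob_measures = {\<mu> \<in> pos_measures. \<mu> UNIV = 1}"

definition tv_norm :: "('a::topological_space set \<Rightarrow> complex) \<Rightarrow> real" where
  "tv_norm \<mu> = total_variation \<mu> UNIV"

definition dirac :: "'a::topological_space \<Rightarrow> 'a set \<Rightarrow> complex" where
  "dirac x A = (if A \<in> sets borel \<and> x \<in> A then 1 else 0)"

definition msupp :: "('a::topological_space set \<Rightarrow> complex) \<Rightarrow> 'a set" where
  "msupp \<mu> = {x. \<forall>U. open U \<longrightarrow> x \<in> U \<longrightarrow> total_variation \<mu> U \<noteq> 0}"

text \<open>
  The positive variation in the Jordan decomposition of a finite signed measure \<open>\<nu>\<close>; the negative
  one is the positive variation of \<open>- \<nu>\<close>. Integration against a complex measure goes through the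
  Jordan decompositions of its real and imaginary parts.
\<close>

definition pos_variation :: "('a::topological_space set \<Rightarrow> real) \<Rightarrow> 'a measure" where
  "pos_variation \<nu> =
     measure_of UNIV (sets borel) (\<lambda>A. ennreal (SUP B \<in> {B \<in> sets borel. B \<subseteq> A}. \<nu> B))"

definition cm_integral ::
    "('a::topological_space set \<Rightarrow> complex) \<Rightarrow> ('a \<Rightarrow> complex) \<Rightarrow> complex" where
  "cm_integral \<mu> f =
     (integral\<^sup>L (pos_variation (\<lambda>A. Re (\<mu> A))) f - integral\<^sup>L (pos_variation (\<lambda>A. - Re (\<mu> A))) f)
     + \<i> * (integral\<^sup>L (pos_variation (\<lambda>A. Im (\<mu> A))) f
            - integral\<^sup>L (pos_variation (\<lambda>A. - Im (\<mu> A))) f)"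

text \<open>The weak topology on \<open>M(K)\<close> (for compact \<open>K\<close>), i.e. the one induced by \<open>C(K)\<close>.\<close>

definition weak_topology :: "('a::topological_space set \<Rightarrow> complex) topology" where
  "weak_topology = topology_generated_by
     {{\<mu> \<in> reg_measures. cm_integral \<mu> f \<in> V} | f V. continuous_on UNIV f \<and> open V}"

text \<open>The Michael (Vietoris) topology on the nonempty compact subsets.\<close>

definition vietoris_topology :: "'a::topological_space set topology" where
  "vietoris_topology = topology_generated_by
     ({{C. compact C \<and> C \<noteq> {} \<and> C \<subseteq> U} | U. open U} \<union>
      {{C. compact C \<and> C \<noteq> {} \<and> C \<inter> U \<noteq> {}} | U. open U})"

definition check_measure :: "('a \<Rightarrow> 'a) \<Rightarrow> ('a set \<Rightarrow> complex) \<Rightarrow> 'a set \<Rightarrow> complex" where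
  "check_measure ck \<mu> = (\<lambda>E. \<mu> (ck ` E))"

text \<open>
  Joint weak continuity of the convolution is required on the cone \<open>M(K)\<^sup>+\<close>, as is standard; on the
  whole of \<open>M(K)\<close> it already fails for infinite compact groups. In a theorem about compact metrizable
  \<open>K\<close> the base type has sort \<open>polish_space\<close>: every compact metrizable space is second countable and
  complete in any compatible metric.
  The involution \<open>ck\<close> has order two in the sense \<open>ck \<circ> ck = id\<close>.
\<close>

locale compact_hypergroup =
  fixes conv :: "('a::t2_space set \<Rightarrow> complex) \<Rightarrow> ('a set \<Rightarrow> complex) \<Rightarrow> ('a set \<Rightarrow> complex)"
      (infixl \<open>\<star>\<close> 70)
    and e :: 'a
    and ck :: "'a \<Rightarrow> 'a"
  assumes compact_UNIV: "compact (UNIV :: 'a set)"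
    and conv_closed: "\<lbrakk>\<mu> \<in> reg_measures; \<nu> \<in> reg_measures\<rbrakk> \<Longrightarrow> \<mu> \<star> \<nu> \<in> reg_measures"
    and conv_add_left: "\<lbrakk>\<mu> \<in> reg_measures; \<mu>' \<in> reg_measures; \<nu> \<in> reg_measures\<rbrakk> \<Longrightarrow>
           (\<lambda>A. \<mu> A + \<mu>' A) \<star> \<nu> = (\<lambda>A. (\<mu> \<star> \<nu>) A + (\<mu>' \<star> \<nu>) A)"
    and conv_add_right: "\<lbrakk>\<mu> \<in> reg_measures; \<nu> \<in> reg_measures; \<nu>' \<in> reg_measures\<rbrakk> \<Longrightarrow>
           \<mu> \<star> (\<lambda>A. \<nu> A + \<nu>' A) = (\<lambda>A. (\<mu> \<star> \<nu>) A + (\<mu> \<star> \<nu>') A)"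
    and conv_scale_left: "\<lbrakk>\<mu> \<in> reg_measures; \<nu> \<in> reg_measures\<rbrakk> \<Longrightarrow>
           (\<lambda>A. c * \<mu> A) \<star> \<nu> = (\<lambda>A. c * (\<mu> \<star> \<nu>) A)"
    and conv_scale_right: "\<lbrakk>\<mu> \<in> reg_measures; \<nu> \<in> reg_measures\<rbrakk> \<Longrightarrow>
           \<mu> \<star> (\<lambda>A. c * \<nu> A) = (\<lambda>A. c * (\<mu> \<star> \<nu>) A)"
    and conv_assoc: "\<lbrakk>\<mu> \<in> reg_measures; \<nu> \<in> reg_measures; \<rho> \<in> reg_measures\<rbrakk> \<Longrightarrow>
           (\<mu> \<star> \<nu>) \<star> \<rho> = \<mu> \<star> (\<nu> \<star> \<rho>)"
    and conv_norm: "\<lbrakk>\<mu> \<in> reg_measures; \<nu> \<in> reg_measures\<rbrakk> \<Longrightarrow>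
           tv_norm (\<mu> \<star> \<nu>) \<le> tv_norm \<mu> * tv_norm \<nu>"
    and conv_weakly_continuous: "continuous_map
           (prod_topology (subtopology weak_topology pos_measures)
                          (subtopology weak_topology pos_measures))
           weak_topology (\<lambda>(\<mu>, \<nu>). \<mu> \<star> \<nu>)"
    and conv_dirac_prob: "dirac x \<star> dirac y \<in> prob_measures"
    and conv_dirac_compact_supp: "compact (msupp (dirac x \<star> dirac y))"
    and supp_continuous:
          "continuous_map euclidean vietoris_topology (\<lambda>(x, y). msupp (dirac x \<star> dirac y))"
    and unit: "dirac x \<star> dirac e = dirac x" "dirac e \<star> dirac x = dirac x"
    and unit_unique: "(\<And>x. dirac x \<star> dirac e' = dirac x \<and> dirac e' \<star> dirac x = dirac x) \<Longrightarrow> e' = e"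
    and check_homeomorphism: "homeomorphism UNIV UNIV ck ck"
    and check_involution: "\<lbrakk>\<mu> \<in> reg_measures; \<nu> \<in> reg_measures\<rbrakk> \<Longrightarrow>
           check_measure ck (\<mu> \<star> \<nu>) = check_measure ck \<nu> \<star> check_measure ck \<mu>"
    and unit_in_supp: "e \<in> msupp (dirac x \<star> dirac y) \<longleftrightarrow> x = ck y"

definition haar_measure ::
    "(('a::t2_space set \<Rightarrow> complex) \<Rightarrow> ('a set \<Rightarrow> complex) \<Rightarrow> 'a set \<Rightarrow> complex) \<Rightarrow>
     'a measure \<Rightarrow> bool" where
  "haar_measure conv haar \<longleftrightarrow>
     sets haar = sets borel \<and> emeasure haar UNIV = 1 \<and>
     (\<lambda>A. complex_of_real (measure haar A)) \<in> reg_measures \<and>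
     (\<forall>x. \<forall>f :: 'a \<Rightarrow> complex. continuous_on UNIV f \<longrightarrow>
        (LINT y|haar. cm_integral (conv (dirac x) (dirac y)) f) = (LINT y|haar. f y))"

text \<open>
  Irreducible representations of a compact hypergroup are finite dimensional, so they are taken as
  matrix representations on \<open>\<complex>\<^sup>d\<close> in the standard orthonormal basis. The dimension is read off from
  \<open>\<pi>(\<delta>\<^sub>e) = I\<close>. The adjoint in the \<open>*\<close>-algebra \<open>M(K)\<close> is \<open>\<mu>\<^sup>* = \<close> complex conjugate
  of \<open>check_measure ck \<mu>\<close>; without the conjugation there are no nonzero \<open>*\<close>-representations.
\<close>

type_synonym 'a meas_rep = "('a set \<Rightarrow> complex) \<Rightarrow> complex mat"

definition rep_dim :: "'a::t2_space \<Rightarrow> 'a meas_rep \<Rightarrow> nat" where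
  "rep_dim e \<pi> = dim_row (\<pi> (dirac e))"

definition representation ::
    "(('a::t2_space set \<Rightarrow> complex) \<Rightarrow> ('a set \<Rightarrow> complex) \<Rightarrow> 'a set \<Rightarrow> complex) \<Rightarrow>
     'a \<Rightarrow> ('a \<Rightarrow> 'a) \<Rightarrow> 'a meas_rep \<Rightarrow> bool" where
  "representation conv e ck \<pi> \<longleftrightarrow> (let d = rep_dim e \<pi> in
     (\<forall>\<mu>\<in>reg_measures. \<pi> \<mu> \<in> carrier_mat d d) \<and>
     \<pi> (dirac e) = 1\<^sub>m d \<and>
     (\<forall>\<mu>\<in>reg_measures. \<forall>\<nu>\<in>reg_measures. \<pi> (\<lambda>A. \<mu> A + \<nu> A) = \<pi> \<mu> + \<pi> \<nu>) \<and>
     (\<forall>\<mu>\<in>reg_measures. \<forall>c. \<pi> (\<lambda>A. c * \<mu> A) = c \<cdot>\<^sub>m \<pi> \<mu>) \<and>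
     (\<forall>\<mu>\<in>reg_measures. \<forall>\<nu>\<in>reg_measures. \<pi> (conv \<mu> \<nu>) = \<pi> \<mu> * \<pi> \<nu>) \<and>
     (\<forall>\<mu>\<in>reg_measures. \<pi> (\<lambda>A. cnj (check_measure ck \<mu> A)) = mat_adjoint (\<pi> \<mu>)) \<and>
     (\<forall>u\<in>carrier_vec d. \<forall>v\<in>carrier_vec d.
        continuous_map (subtopology weak_topology pos_measures) euclidean
          (\<lambda>\<mu>. (\<pi> \<mu> *\<^sub>v u) \<bullet>c v)))"

definition invariant_subspace :: "'a::t2_space \<Rightarrow> 'a meas_rep \<Rightarrow> complex Matrix.vec set \<Rightarrow> bool" where
  "invariant_subspace e \<pi> W \<longleftrightarrow>
     W \<subseteq> carrier_vec (rep_dim e \<pi>) \<and> 0\<^sub>v (rep_dim e \<pi>) \<in> W \<and>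
     (\<forall>u\<in>W. \<forall>v\<in>W. u + v \<in> W) \<and> (\<forall>c. \<forall>v\<in>W. c \<cdot>\<^sub>v v \<in> W) \<and>
     (\<forall>\<mu>\<in>reg_measures. \<forall>v\<in>W. \<pi> \<mu> *\<^sub>v v \<in> W)"

definition irreducible_rep ::
    "(('a::t2_space set \<Rightarrow> complex) \<Rightarrow> ('a set \<Rightarrow> complex) \<Rightarrow> 'a set \<Rightarrow> complex) \<Rightarrow>
     'a \<Rightarrow> ('a \<Rightarrow> 'a) \<Rightarrow> 'a meas_rep \<Rightarrow> bool" where
  "irreducible_rep conv e ck \<pi> \<longleftrightarrow>
     representation conv e ck \<pi> \<and> rep_dim e \<pi> > 0 \<and>
     (\<forall>W. invariant_subspace e \<pi> W \<longrightarrow>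
        W = {0\<^sub>v (rep_dim e \<pi>)} \<or> W = carrier_vec (rep_dim e \<pi>))"

definition rep_equiv :: "'a::t2_space \<Rightarrow> 'a meas_rep \<Rightarrow> 'a meas_rep \<Rightarrow> bool" where
  "rep_equiv e \<pi> \<pi>' \<longleftrightarrow> rep_dim e \<pi>' = rep_dim e \<pi> \<and>
     (\<exists>U \<in> carrier_mat (rep_dim e \<pi>) (rep_dim e \<pi>).
        U * mat_adjoint U = 1\<^sub>m (rep_dim e \<pi>) \<and> mat_adjoint U * U = 1\<^sub>m (rep_dim e \<pi>) \<and>
        (\<forall>\<mu>\<in>reg_measures. \<pi>' \<mu> = U * \<pi> \<mu> * mat_adjoint U))"

definition dual ::
    "(('a::t2_space set \<Rightarrow> complex) \<Rightarrow> ('a set \<Rightarrow> complex) \<Rightarrow> 'a set \<Rightarrow> complex) \<Rightarrow>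
     'a \<Rightarrow> ('a \<Rightarrow> 'a) \<Rightarrow> 'a meas_rep set set" where
  "dual conv e ck = {\<pi>. irreducible_rep conv e ck \<pi>} //
     {(\<pi>, \<pi>'). irreducible_rep conv e ck \<pi> \<and> irreducible_rep conv e ck \<pi>' \<and> rep_equiv e \<pi> \<pi>'}"

definition hyperdim :: "'a::t2_space \<Rightarrow> 'a measure \<Rightarrow> 'a meas_rep \<Rightarrow> real" where
  "hyperdim e haar \<pi> = (THE k.
     \<forall>i<rep_dim e \<pi>. \<forall>j<rep_dim e \<pi>. \<forall>m<rep_dim e \<pi>. \<forall>l<rep_dim e \<pi>.
       (LINT x|haar. \<pi> (dirac x) $$ (i, j) * cnj (\<pi> (dirac x) $$ (m, l)))
         = (if i = m \<and> j = l then complex_of_real (1 / k) else 0))"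

definition fourier ::
    "'a::t2_space \<Rightarrow> 'a measure \<Rightarrow> ('a \<Rightarrow> complex) \<Rightarrow> 'a meas_rep \<Rightarrow> complex mat" where
  "fourier e haar f \<pi> = Matrix.mat (rep_dim e \<pi>) (rep_dim e \<pi>)
     (\<lambda>(i, j). LINT x|haar. f x * cnj (\<pi> (dirac x) $$ (i, j)))"

definition cvec_norm :: "complex Matrix.vec \<Rightarrow> real" where
  "cvec_norm v = L2_set (\<lambda>i. cmod (vec_index v i)) {..<dim_vec v}"

definition mat_op_norm :: "complex mat \<Rightarrow> real" where
  "mat_op_norm M = (SUP v \<in> {v \<in> carrier_vec (dim_col M). cvec_norm v \<le> 1}. cvec_norm (M *\<^sub>v v))"

text \<open>
  Elements of \<open>L\<^sup>p\<close> are represented by functions, and operators into \<open>L\<^sup>p\<close> by a choice of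
  representatives; identities between their values hold almost everywhere.
\<close>

definition Lp_space :: "'a measure \<Rightarrow> real \<Rightarrow> ('a \<Rightarrow> complex) set" where
  "Lp_space M p = {f \<in> borel_measurable M. integrable M (\<lambda>x. cmod (f x) powr p)}"

definition Lp_norm :: "'a measure \<Rightarrow> real \<Rightarrow> ('a \<Rightarrow> complex) \<Rightarrow> real" where
  "Lp_norm M p f = (LINT x|M. cmod (f x) powr p) powr (1 / p)"

definition linear_op_on ::
    "'a measure \<Rightarrow> ('a \<Rightarrow> complex) set \<Rightarrow> (('a \<Rightarrow> complex) \<Rightarrow> 'a \<Rightarrow> complex) \<Rightarrow> bool" where
  "linear_op_on M D T \<longleftrightarrow>
     (\<forall>f\<in>D. \<forall>g\<in>D. (AE x in M. f x = g x) \<longrightarrow> (AE x in M. T f x = T g x)) \<and>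
     (\<forall>f\<in>D. \<forall>g\<in>D. AE x in M. T (\<lambda>t. f t + g t) x = T f x + T g x) \<and>
     (\<forall>c. \<forall>f\<in>D. AE x in M. T (\<lambda>t. c * f t) x = c * T f x)"

definition bounded_Lp_Lq ::
    "'a measure \<Rightarrow> real \<Rightarrow> real \<Rightarrow> (('a \<Rightarrow> complex) \<Rightarrow> 'a \<Rightarrow> complex) \<Rightarrow> bool" where
  "bounded_Lp_Lq M p q T \<longleftrightarrow>
     linear_op_on M (Lp_space M p) T \<and> T ` Lp_space M p \<subseteq> Lp_space M q \<and>
     (\<exists>c. \<forall>f\<in>Lp_space M p. Lp_norm M q (T f) \<le> c * Lp_norm M p f)"

definition Lp_Lq_norm ::
    "'a measure \<Rightarrow> real \<Rightarrow> real \<Rightarrow> (('a \<Rightarrow> complex) \<Rightarrow> 'a \<Rightarrow> complex) \<Rightarrow> ennreal" where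
  "Lp_Lq_norm M p q T =
     (SUP f \<in> {f \<in> Lp_space M p. Lp_norm M p f \<le> 1}. ennreal (Lp_norm M q (T f)))"

text \<open>
  Here \<open>rep\<close> chooses a matrix realisation of each class in the dual, that is, a representative
  together with an orthonormal basis. The target \<open>L\<^sup>1\<close> is \<open>Lp_space haar 1\<close>.
\<close>

definition left_fourier_multiplier ::
    "(('a::t2_space set \<Rightarrow> complex) \<Rightarrow> ('a set \<Rightarrow> complex) \<Rightarrow> 'a set \<Rightarrow> complex) \<Rightarrow>
     'a \<Rightarrow> ('a \<Rightarrow> 'a) \<Rightarrow> 'a measure \<Rightarrow> ('a meas_rep set \<Rightarrow> 'a meas_rep) \<Rightarrow>
     (('a \<Rightarrow> complex) \<Rightarrow> 'a \<Rightarrow> complex) \<Rightarrow> ('a meas_rep set \<Rightarrow> complex mat) \<Rightarrow> bool" where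
  "left_fourier_multiplier conv e ck haar rep A \<sigma> \<longleftrightarrow>
     linear_op_on haar {f. continuous_on UNIV f} A \<and>
     A ` {f. continuous_on UNIV f} \<subseteq> Lp_space haar 1 \<and>
     (\<forall>c \<in> dual conv e ck.
        \<sigma> c \<in> carrier_mat (rep_dim e (rep c)) (rep_dim e (rep c)) \<and>
        (\<forall>f. continuous_on UNIV f \<longrightarrow>
           fourier e haar (A f) (rep c) = \<sigma> c * fourier e haar f (rep c)))"

text \<open>
  \<open>sum_power I a r = (\<Sum>i\<in>I. a i)\<^sup>r\<close> in \<open>[0, \<infinity>]\<close>: empty sums give 0 even for \<open>r = 0\<close>, and
  otherwise the exponent 0 gives 1, even if the sum is infinite.
\<close>

definition sum_power :: "'i set \<Rightarrow> ('i \<Rightarrow> real) \<Rightarrow> real \<Rightarrow> ennreal" where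
  "sum_power I a r = (let S = (\<Sum>\<^sub>\<infinity>i\<in>I. ennreal (a i)) in
     if I = {} then 0 else if r = 0 then 1 else if S = \<infinity> then \<infinity> else ennreal (enn2real S powr r))"

definition hoermander_bound ::
    "(('a::t2_space set \<Rightarrow> complex) \<Rightarrow> ('a set \<Rightarrow> complex) \<Rightarrow> 'a set \<Rightarrow> complex) \<Rightarrow>
     'a \<Rightarrow> ('a \<Rightarrow> 'a) \<Rightarrow> 'a measure \<Rightarrow> ('a meas_rep set \<Rightarrow> 'a meas_rep) \<Rightarrow> real \<Rightarrow> real \<Rightarrow>
     ('a meas_rep set \<Rightarrow> complex mat) \<Rightarrow> ennreal" where
  "hoermander_bound conv e ck haar rep p q \<sigma> =
     (SUP y \<in> {0<..}. ennreal y *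
        sum_power {c \<in> dual conv e ck. mat_op_norm (\<sigma> c) \<ge> y}
          (\<lambda>c. (hyperdim e haar (rep c))\<^sup>2) (1 / p - 1 / q))"

end

theory Submission
  imports Defs "HOL-Complex_Analysis.Great_Picard" "HOL-Probability.Probability_Measure" "Jordan_Normal_Form.Spectral_Radius"
begin

text \<open>
  For continuous \<open>f\<close> and a trigonometric polynomial \<open>g\<close>, Parseval's identity and the Cauchy--Schwarz
  inequality bound \<open>\<langle>A f, g\<rangle>\<close> by the sum of \<open>k \<cdot> w \<cdot> \<parallel>F f\<parallel> \<cdot> \<parallel>F g\<parallel>\<close> over the dual, with \<open>F\<close> the
  Fourier transform, Hilbert--Schmidt norms and \<open>w = \<parallel>\<sigma>(\<pi>)\<parallel>\<close>. Splitting \<open>w\<close> into two powers separates \<open>f\<close> from \<open>g\<close>, and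
  each factor is controlled by a Paley inequality with weights in weak \<open>\<ell>\<^sup>r\<close> relative to the measure
  \<open>k\<^sup>2\<close>; that inequality follows by dyadic cutting from Bessel's inequality and from
  \<open>\<parallel>F f(\<pi>)\<parallel>\<^sup>2 \<le> k \<parallel>f\<parallel>\<^sub>1\<^sup>2\<close>, which rests on \<open>d \<le> k\<close>. Density of trigonometric polynomials in \<open>C(K)\<close>
  comes from the eigenspaces of the compact self-adjoint operators of convolution with symmetric approximate
  units: they are finite dimensional and translation invariant, hence spanned by coefficients of irreducible
  representations. Duality gives \<open>\<parallel>A f\<parallel>\<^sub>q \<le> C \<parallel>f\<parallel>\<^sub>p\<close> on \<open>C(K)\<close>, and the closure of the graph of \<open>A\<close> is
  the graph of the extension.
\<close>

section \<open>Signed and complex Borel measures\<close>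

text \<open>The axioms speak only of measures: the convolution is bilinear on M(K) and jointly
  weakly continuous on the positive cone. Everything analytic is therefore moved to the translates
  \<open>tr f x y\<close>, by approximating measures with finite combinations of point masses. The
  real obstacle is the identity that moves a translation from one factor of an integral to the
  other. On a group it is a change of variables; on a hypergroup translation is not multiplicative,
  and left invariance of the Haar measure does not give it directly. It is proved first for smoothed
  functions, where the translation can be passed to a symmetric kernel, and then in the limit. The
  kernels concentrate on the diagonal because \<open>e\<close> lies in the support of the
  convolution of \<open>dirac (ck y)\<close> and \<open>dirac z\<close> only for y = z, which
  Vietoris continuity makes uniform. This identity yields the averaged intertwiners of Schur theory
  and the commutation of smoothing with translations. Density of trigonometric polynomials is needed
  in the supremum norm, not only in the mean, because \<open>A f\<close> is known beforehand only to
  be integrable.\<close>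

definition signed_borel_measure :: "('a::topological_space set \<Rightarrow> real) \<Rightarrow> bool" where
  "signed_borel_measure \<nu> \<longleftrightarrow> \<nu> {} = 0 \<and>
     (\<forall>A :: nat \<Rightarrow> 'a set. range A \<subseteq> sets borel \<longrightarrow> disjoint_family A \<longrightarrow>
        (\<lambda>i. \<nu> (A i)) sums \<nu> (\<Union>i. A i))"

lemma signed_sums:
  "signed_borel_measure \<nu> \<Longrightarrow> (\<And>i::nat. A i \<in> sets borel) \<Longrightarrow> disjoint_family A \<Longrightarrow>
     (\<lambda>i. \<nu> (A i)) sums \<nu> (\<Union>i. A i)"
  unfolding signed_borel_measure_def by auto

lemma signed_Un:
  assumes "signed_borel_measure \<nu>" "A \<in> sets borel" "B \<in> sets borel" "A \<inter> B = {}"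
  shows "\<nu> (A \<union> B) = \<nu> A + \<nu> B"
proof -
  define F where "F = (\<lambda>i::nat. if i = 0 then A else if i = 1 then B else {})"
  have "(\<lambda>i. \<nu> (F i)) sums \<nu> (\<Union>i. F i)"
    by (rule signed_sums[OF assms(1)])
       (use assms in \<open>auto simp: F_def disjoint_family_on_def\<close>)
  moreover have "(\<Union>i. F i) = A \<union> B"
    unfolding F_def by (auto split: if_splits intro: exI[of _ 0] exI[of _ 1])
  moreover have "(\<lambda>i. \<nu> (F i)) sums (\<Sum>i\<in>{0,1}. \<nu> (F i))"
    by (rule sums_finite) (use assms in \<open>auto simp: F_def signed_borel_measure_def\<close>)
  ultimately show ?thesis
    using sums_unique2 by (fastforce simp: F_def)
qed

lemma signed_Diff:
  assumes "signed_borel_measure \<nu>" "A \<in> sets borel" "B \<in> sets borel" "B \<subseteq> A"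
  shows "\<nu> (A - B) = \<nu> A - \<nu> B"
  using signed_Un[of \<nu> B "A - B"] assms by (simp add: Un_absorb1)

lemma signed_uminus: "signed_borel_measure \<nu> \<Longrightarrow> signed_borel_measure (\<lambda>A. - \<nu> A)"
  unfolding signed_borel_measure_def by (auto intro!: sums_minus)

definition positive_set :: "('a::topological_space set \<Rightarrow> real) \<Rightarrow> 'a set \<Rightarrow> bool" where
  "positive_set \<nu> P \<longleftrightarrow> P \<in> sets borel \<and> (\<forall>B\<in>sets borel. B \<subseteq> P \<longrightarrow> 0 \<le> \<nu> B)"

text \<open>The set is exhausted greedily: from each remainder a piece of nonpositive value is cut
  off that is comparable with the most negative one available. The pieces are disjoint, so their
  values are summable and tend to 0, and nothing negative is left in the intersection of the
  remainders.\<close>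

lemma positive_set_subset_exists:
  assumes nu: "signed_borel_measure \<nu>" and A: "A \<in> sets borel"
  shows "\<exists>P\<subseteq>A. positive_set \<nu> P \<and> \<nu> A \<le> \<nu> P"
proof -
  \<comment> \<open>\<open>Q X Y\<close> says that \<open>X - Y\<close> is an admissible piece. The
    bound -1 is there because the values on subsets of \<open>X\<close> are not known to be bounded
    below; when the pieces tend to 0 it still excludes a negative \<open>B\<close>.\<close>
  define Q where "Q X Y \<longleftrightarrow> Y \<in> sets borel \<and> Y \<subseteq> X \<and> \<nu> (X - Y) \<le> 0 \<and>
      (\<forall>B\<in>sets borel. B \<subseteq> X \<longrightarrow> \<nu> (X - Y) \<le> max (-1) (\<nu> B / 2))" for X Y
  have step: "\<exists>Y. Q X Y" if X: "X \<in> sets borel" for X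
  proof (cases "\<exists>B\<in>sets borel. B \<subseteq> X \<and> \<nu> B \<le> -1")
    case True
    then obtain B where B: "B \<in> sets borel" "B \<subseteq> X" "\<nu> B \<le> -1" by blast
    moreover have "X - (X - B) = B" using B by auto
    ultimately have "Q X (X - B)" using X unfolding Q_def by auto
    then show ?thesis by blast
  next
    case False
    define I where "I = \<nu> ` {B\<in>sets borel. B \<subseteq> X}"
    have I0: "0 \<in> I" using nu by (auto simp: I_def signed_borel_measure_def intro!: image_eqI[of _ _ "{}"])
    have bd: "bdd_below I" unfolding I_def using False by (intro bdd_belowI[of _ "-1"]) force
    have le0: "Inf I \<le> 0" using I0 bd by (rule cInf_lower)
    have "\<exists>b\<in>I. b \<le> Inf I / 2 \<and> b \<le> 0"
    proof (cases "Inf I < 0")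
      case True
      then have "Inf I < Inf I / 2" by simp
      then obtain b where "b \<in> I" "b < Inf I / 2" using cInf_lessD I0 by blast
      then show ?thesis using True by (intro bexI[of _ b]) auto
    qed (use I0 le0 in auto)
    then obtain B where B: "B \<in> sets borel" "B \<subseteq> X" "\<nu> B \<le> Inf I / 2" "\<nu> B \<le> 0"
      unfolding I_def by blast
    have "\<nu> B \<le> \<nu> C / 2" if "C \<in> sets borel" "C \<subseteq> X" for C
      using B(3) cInf_lower[OF _ bd, of "\<nu> C"] that unfolding I_def by force
    moreover have "X - (X - B) = B" using B by auto
    ultimately have "Q X (X - B)" using X B unfolding Q_def by (auto simp: max.coboundedI2)
    then show ?thesis by blast
  qed
  have "\<exists>F. F 0 = A \<and> (\<forall>n. F n \<in> sets borel \<and> Q (F n) (F (Suc n)))"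
  proof -
    have "\<exists>F. \<forall>n. (F n \<in> sets borel \<and> (n = 0 \<longrightarrow> F n = A)) \<and> Q (F n) (F (Suc n))"
    proof (rule dependent_nat_choice)
      fix X and n :: nat assume "X \<in> sets borel \<and> (n = 0 \<longrightarrow> X = A)"
      then obtain Y where "Q X Y" using step by blast
      then show "\<exists>Y. (Y \<in> sets borel \<and> (Suc n = 0 \<longrightarrow> Y = A)) \<and> Q X Y"
        unfolding Q_def by blast
    qed (use A in auto)
    then obtain F where "\<forall>n. (F n \<in> sets borel \<and> (n = 0 \<longrightarrow> F n = A)) \<and> Q (F n) (F (Suc n))" ..
    then show ?thesis by (intro exI[of _ F]) simp
  qed
  then obtain F where F: "F 0 = A" "\<And>n. F n \<in> sets borel" "\<And>n. Q (F n) (F (Suc n))" by blast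
  define P where "P = (\<Inter>n. F n)"
  define D where "D n = F n - F (Suc n)" for n
  have dec: "F (Suc n) \<subseteq> F n" for n using F(3) Q_def by blast
  have decm: "m \<le> n \<Longrightarrow> F n \<subseteq> F m" for m n using dec by (rule lift_Suc_antimono_le)
  have Pb: "P \<in> sets borel" unfolding P_def using F(2) by auto
  have disj: "disjoint_family D"
    unfolding disjoint_family_on_def
  proof (intro ballI impI)
    fix m n :: nat assume "m \<noteq> n"
    then consider "Suc m \<le> n" | "Suc n \<le> m" by linarith
    then show "D m \<inter> D n = {}"
      by cases (use decm in \<open>unfold D_def, blast+\<close>)
  qed
  have sumD: "(\<lambda>n. \<nu> (D n)) sums \<nu> (\<Union>n. D n)"
    by (rule signed_sums[OF nu]) (use F(2) disj in \<open>auto simp: D_def[abs_def]\<close>)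
  have Dle: "\<nu> (D n) \<le> 0" for n using F(3) unfolding Q_def D_def by blast
  have sD: "\<nu> (\<Union>n. D n) \<le> 0" using sums_le[OF _ sumD sums_zero] Dle by simp
  have "A - P = (\<Union>n. D n)"
  proof
    show "(\<Union>n. D n) \<subseteq> A - P" unfolding D_def P_def using decm[of 0] F(1) by blast
    show "A - P \<subseteq> (\<Union>n. D n)"
    proof
      fix x assume x: "x \<in> A - P"
      then have ex: "\<exists>n. x \<notin> F n" unfolding P_def by auto
      define n where "n = (LEAST n. x \<notin> F n)"
      have n1: "x \<notin> F n" unfolding n_def using LeastI_ex[OF ex] .
      then have "n \<noteq> 0" using x F(1) by (metis DiffD1)
      then obtain m where m: "n = Suc m" using not0_implies_Suc by blast
      have "x \<in> F m" using not_less_Least[of m "\<lambda>n. x \<notin> F n"] m n_def by auto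
      then show "x \<in> (\<Union>n. D n)" using n1 m unfolding D_def by auto
    qed
  qed
  moreover have PA: "P \<subseteq> A" unfolding P_def using F(1) by auto
  ultimately have "\<nu> A \<le> \<nu> P" using signed_Diff[OF nu A Pb PA] sD by simp
  moreover have "positive_set \<nu> P" unfolding positive_set_def
  proof (intro conjI ballI impI Pb)
    fix B assume B: "B \<in> sets borel" "B \<subseteq> P"
    have "\<nu> (D n) \<le> max (-1) (\<nu> B / 2)" for n
      using F(3)[of n] B unfolding Q_def D_def P_def by blast
    moreover have "(\<lambda>n. \<nu> (D n)) \<longlonglongrightarrow> 0" using sumD sums_summable summable_LIMSEQ_zero by blast
    ultimately have "0 \<le> max (-1) (\<nu> B / 2)" using LIMSEQ_le_const2 by blast
    then show "0 \<le> \<nu> B" by auto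
  qed
  ultimately show ?thesis using PA by blast
qed

lemma positive_set_UN:
  assumes nu: "signed_borel_measure \<nu>" and P: "\<And>n::nat. positive_set \<nu> (P n)"
  shows "positive_set \<nu> (\<Union>n. P n)"
  unfolding positive_set_def
proof (intro conjI ballI impI)
  show "(\<Union>n. P n) \<in> sets borel" using P unfolding positive_set_def by auto
  fix B assume B: "B \<in> sets borel" "B \<subseteq> (\<Union>n. P n)"
  define E where "E n = B \<inter> disjointed P n" for n
  have meas: "disjointed P n \<in> sets borel" for n
    using P sets.range_disjointed_sets[of P borel] unfolding positive_set_def by auto
  have dj: "disjoint_family E"
    using disjoint_family_disjointed[of P] unfolding disjoint_family_on_def E_def by blast
  have "(\<lambda>n. \<nu> (E n)) sums \<nu> (\<Union>n. E n)"
    by (rule signed_sums[OF nu _ dj]) (use B meas in \<open>auto simp: E_def\<close>)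
  moreover have "(\<Union>n. E n) = B"
    unfolding E_def Int_UN_distrib[symmetric] UN_disjointed_eq using B(2) by (rule Int_absorb2)
  moreover have "0 \<le> \<nu> (E n)" for n
  proof -
    have "E n \<subseteq> P n" using disjointed_subset[of P n] unfolding E_def by auto
    moreover have "E n \<in> sets borel" using B meas unfolding E_def by auto
    ultimately show ?thesis using P[of n] unfolding positive_set_def by auto
  qed
  ultimately show "0 \<le> \<nu> B" using sums_le[of "\<lambda>_. 0" "\<lambda>n. \<nu> (E n)" 0] by simp
qed

text \<open>The values on positive sets are not known to be bounded. A countable dense set of these
  values is realized by positive sets whose union dominates every value, so the supremum is
  attained. A set of positive value outside the union would contain a positive set that could still
  be added.\<close>

theorem signed_Hahn_decomposition:
  assumes nu: "signed_borel_measure \<nu>"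
  shows "\<exists>H. positive_set \<nu> H \<and> (\<forall>B\<in>sets borel. B \<inter> H = {} \<longrightarrow> \<nu> B \<le> 0)"
proof -
  define S where "S = \<nu> ` Collect (positive_set \<nu>)"
  obtain T where T: "countable T" "T \<subseteq> S" "S \<subseteq> closure T" using separable by blast
  have "positive_set \<nu> {}" using nu unfolding positive_set_def signed_borel_measure_def by auto
  then have "S \<noteq> {}" unfolding S_def by auto
  then have "T \<noteq> {}" using T by auto
  then obtain t where t: "T = range (t :: nat \<Rightarrow> real)" using range_from_nat_into[OF _ T(1)] by metis
  have "\<forall>n. \<exists>P. positive_set \<nu> P \<and> \<nu> P = t n"
  proof
    fix n
    have "t n \<in> S" using T(2) t by auto
    then show "\<exists>P. positive_set \<nu> P \<and> \<nu> P = t n" unfolding S_def by auto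
  qed
  then obtain P where P: "\<And>n. positive_set \<nu> (P n)" "\<And>n. \<nu> (P n) = t n" by metis
  define H where "H = (\<Union>n. P n)"
  have H: "positive_set \<nu> H" unfolding H_def by (rule positive_set_UN[OF nu P(1)])
  have mono: "\<nu> X \<le> \<nu> H" if "X \<subseteq> H" "X \<in> sets borel" for X
  proof -
    have "\<nu> (H - X) = \<nu> H - \<nu> X" using H that by (intro signed_Diff[OF nu]) (auto simp: positive_set_def)
    moreover have "0 \<le> \<nu> (H - X)" using H that unfolding positive_set_def by auto
    ultimately show ?thesis by simp
  qed
  have "t n \<le> \<nu> H" for n using mono[of "P n"] P unfolding H_def positive_set_def by fastforce
  then have "T \<subseteq> {..\<nu> H}" using t by auto
  then have "S \<subseteq> {..\<nu> H}" using T(3) closure_minimal[of T "{..\<nu> H}"] by auto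
  then have sup: "\<nu> Q \<le> \<nu> H" if "positive_set \<nu> Q" for Q using that unfolding S_def by auto
  have "\<nu> B \<le> 0" if B: "B \<in> sets borel" "B \<inter> H = {}" for B
  proof (rule ccontr)
    assume "\<not> \<nu> B \<le> 0"
    obtain Q where Q: "Q \<subseteq> B" "positive_set \<nu> Q" "\<nu> B \<le> \<nu> Q"
      using positive_set_subset_exists[OF nu B(1)] by blast
    have "positive_set \<nu> (\<Union>n::nat. if n = 0 then H else Q)"
      by (rule positive_set_UN[OF nu]) (use H Q in auto)
    moreover have "(\<Union>n::nat. if n = 0 then H else Q) = H \<union> Q"
      by (auto split: if_splits intro: exI[of _ 0] exI[of _ 1])
    ultimately have "\<nu> (H \<union> Q) \<le> \<nu> H" using sup by auto
    moreover have "\<nu> (H \<union> Q) = \<nu> H + \<nu> Q"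
      by (rule signed_Un[OF nu]) (use H Q B in \<open>auto simp: positive_set_def\<close>)
    ultimately show False using Q \<open>\<not> \<nu> B \<le> 0\<close> by simp
  qed
  then show ?thesis using H by blast
qed

text \<open>The supremum in \<open>pos_variation\<close> is attained at \<open>A \<inter> H\<close>:
  parts outside \<open>H\<close> only lose mass and filling up inside \<open>H\<close> only gains.
  This shows that the set function handed to \<open>measure_of\<close> really is a finite
  measure.\<close>

lemma pos_variation_Hahn:
  assumes nu: "signed_borel_measure \<nu>" and H: "positive_set \<nu> H"
    and N: "\<And>B. B \<in> sets borel \<Longrightarrow> B \<inter> H = {} \<Longrightarrow> \<nu> B \<le> 0"
  shows "sets (pos_variation \<nu>) = sets borel" "finite_measure (pos_variation \<nu>)"
    "A \<in> sets borel \<Longrightarrow> measure (pos_variation \<nu>) A = \<nu> (A \<inter> H)"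
proof -
  have Hb: "H \<in> sets borel" using H unfolding positive_set_def by auto
  have s: "sets (pos_variation \<nu>) = sets borel" unfolding pos_variation_def
    using sets.sigma_sets_eq[of borel] by (simp add: sets_measure_of)
  then show "sets (pos_variation \<nu>) = sets borel" .
  have sup: "(SUP B \<in> {B \<in> sets borel. B \<subseteq> A}. \<nu> B) = \<nu> (A \<inter> H)" if A: "A \<in> sets borel" for A
  proof (rule cSup_eq_maximum)
    show "\<nu> (A \<inter> H) \<in> \<nu> ` {B \<in> sets borel. B \<subseteq> A}" using A Hb by auto
    fix x assume "x \<in> \<nu> ` {B \<in> sets borel. B \<subseteq> A}"
    then obtain B where B: "B \<in> sets borel" "B \<subseteq> A" "x = \<nu> B" by auto
    have "\<nu> B = \<nu> (B \<inter> H) + \<nu> (B - H)"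
      using signed_Un[OF nu, of "B \<inter> H" "B - H"] B Hb by (simp add: Int_Diff_Un Int_Diff_disjoint)
    moreover have "\<nu> (B - H) \<le> 0" using N B Hb by auto
    moreover have "A \<inter> H = (B \<inter> H) \<union> ((A - B) \<inter> H)" using B by auto
    then have "\<nu> (A \<inter> H) = \<nu> (B \<inter> H) + \<nu> ((A - B) \<inter> H)"
      using signed_Un[OF nu, of "B \<inter> H" "(A - B) \<inter> H"] A B Hb by auto
    moreover have "0 \<le> \<nu> ((A - B) \<inter> H)" using H A B unfolding positive_set_def by auto
    ultimately show "x \<le> \<nu> (A \<inter> H)" using B by simp
  qed
  have nn: "0 \<le> \<nu> (A \<inter> H)" if "A \<in> sets borel" for A
    using H that Hb unfolding positive_set_def by auto
  have em: "emeasure (pos_variation \<nu>) A = ennreal (\<nu> (A \<inter> H))" if A: "A \<in> sets borel" for A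
  proof -
    have "emeasure (pos_variation \<nu>) A = ennreal (SUP B \<in> {B \<in> sets borel. B \<subseteq> A}. \<nu> B)"
    proof (rule emeasure_measure_of[OF pos_variation_def])
      show "positive (sets (pos_variation \<nu>)) (\<lambda>A. ennreal (SUP B \<in> {B \<in> sets borel. B \<subseteq> A}. \<nu> B))"
        unfolding s positive_def using sup[of "{}"] nu by (simp add: signed_borel_measure_def)
      show "countably_additive (sets (pos_variation \<nu>))
         (\<lambda>A. ennreal (SUP B \<in> {B \<in> sets borel. B \<subseteq> A}. \<nu> B))"
        unfolding s
      proof (rule countably_additiveI)
        fix F :: "nat \<Rightarrow> 'a set"
        assume F: "range F \<subseteq> sets borel" "disjoint_family F" "(\<Union>i. F i) \<in> sets borel"
        have "(\<lambda>i. \<nu> (F i \<inter> H)) sums \<nu> (\<Union>i. F i \<inter> H)"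
          by (rule signed_sums[OF nu]) (use F Hb in \<open>auto simp: disjoint_family_on_def\<close>)
        then have "(\<Sum>i. ennreal (\<nu> (F i \<inter> H))) = ennreal (\<nu> ((\<Union>i. F i) \<inter> H))"
          using F nn by (subst suminf_ennreal2) (auto simp: sums_iff)
        moreover have "\<And>i. F i \<in> sets borel" using F by auto
        ultimately show "(\<Sum>i. ennreal (SUP B \<in> {B \<in> sets borel. B \<subseteq> F i}. \<nu> B)) =
            ennreal (SUP B \<in> {B \<in> sets borel. B \<subseteq> \<Union> (range F)}. \<nu> B)"
          using F by (simp add: sup)
      qed
    qed (use s A in \<open>auto simp: sets.space_closed\<close>)
    then show ?thesis using sup[OF A] by simp
  qed
  show "finite_measure (pos_variation \<nu>)"
    by (rule finite_measureI) (use em[of UNIV] sets_eq_imp_space_eq[OF s] in auto)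
  show "A \<in> sets borel \<Longrightarrow> measure (pos_variation \<nu>) A = \<nu> (A \<inter> H)"
    unfolding measure_def using em nn by simp
qed

lemma Jordan_decomposition:
  assumes nu: "signed_borel_measure \<nu>"
  defines "P \<equiv> pos_variation \<nu>" and "N \<equiv> pos_variation (\<lambda>A. - \<nu> A)"
  shows "sets P = sets borel" "sets N = sets borel" "finite_measure P" "finite_measure N"
    "A \<in> sets borel \<Longrightarrow> \<nu> A = measure P A - measure N A"
proof -
  obtain H where H: "positive_set \<nu> H" "\<And>B. B \<in> sets borel \<Longrightarrow> B \<inter> H = {} \<Longrightarrow> \<nu> B \<le> 0"
    using signed_Hahn_decomposition[OF nu] by blast
  have Hb: "H \<in> sets borel" using H unfolding positive_set_def by auto
  have H': "positive_set (\<lambda>A. - \<nu> A) (- H)"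
    unfolding positive_set_def
  proof (intro conjI ballI impI)
    fix B assume "B \<in> sets borel" "B \<subseteq> - H"
    then have "\<nu> B \<le> 0" by (intro H(2)) auto
    then show "0 \<le> - \<nu> B" by simp
  qed (use Hb in auto)
  have N': "- \<nu> B \<le> 0" if "B \<in> sets borel" "B \<inter> - H = {}" for B
  proof -
    have "B \<subseteq> H" using that by auto
    then show ?thesis using H(1) that unfolding positive_set_def by auto
  qed
  have 1: "sets (pos_variation \<nu>) = sets borel" "finite_measure (pos_variation \<nu>)"
    "\<And>A. A \<in> sets borel \<Longrightarrow> measure (pos_variation \<nu>) A = \<nu> (A \<inter> H)"
    using pos_variation_Hahn[OF nu H(1)] H(2) by blast+
  have 2: "sets (pos_variation (\<lambda>A. - \<nu> A)) = sets borel" "finite_measure (pos_variation (\<lambda>A. - \<nu> A))"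
    "\<And>A. A \<in> sets borel \<Longrightarrow> measure (pos_variation (\<lambda>A. - \<nu> A)) A = - \<nu> (A \<inter> - H)"
    using pos_variation_Hahn[OF signed_uminus[OF nu] H'] N' by blast+
  show "sets P = sets borel" "sets N = sets borel" "finite_measure P" "finite_measure N"
    unfolding P_def N_def using 1 2 by auto
  show "\<nu> A = measure P A - measure N A" if A: "A \<in> sets borel"
    unfolding P_def N_def 1(3)[OF A] 2(3)[OF A]
    using signed_Un[OF nu, of "A \<inter> H" "A \<inter> - H"] A Hb by (simp add: Int_Un_distrib[symmetric] Int_assoc)
qed


section \<open>Complex Borel measures, Riemann sums and regularity\<close>

lemma complex_borel_measure_Re_Im:
  assumes "complex_borel_measure \<mu>"
  shows "signed_borel_measure (\<lambda>A. Re (\<mu> A))" "signed_borel_measure (\<lambda>A. Im (\<mu> A))"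
  using assms unfolding complex_borel_measure_def signed_borel_measure_def
  by (auto intro!: sums_Re sums_Im)

lemma complex_borel_measure_of_measure:
  assumes "finite_measure M" "sets M = sets borel"
  shows "complex_borel_measure (\<lambda>A. complex_of_real (measure M A))"
  unfolding complex_borel_measure_def
proof (intro conjI allI impI)
  interpret finite_measure M by fact
  show "complex_of_real (measure M A) = 0" if "A \<notin> sets borel" for A
    using that assms by (simp add: measure_notin_sets)
  show "(\<lambda>i. complex_of_real (measure M (A i))) sums complex_of_real (measure M (\<Union>i. A i))"
    if "range A \<subseteq> sets borel" "disjoint_family A" for A :: "nat \<Rightarrow> 'a set"
    using finite_measure_UNION[of A] that assms by (intro sums_of_real) auto
qed simp

lemma complex_borel_measure_add:
  "complex_borel_measure \<mu> \<Longrightarrow> complex_borel_measure \<nu> \<Longrightarrow> complex_borel_measure (\<lambda>A. \<mu> A + \<nu> A)"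
  unfolding complex_borel_measure_def by (auto intro!: sums_add)

lemma complex_borel_measure_scale:
  "complex_borel_measure \<mu> \<Longrightarrow> complex_borel_measure (\<lambda>A. c * \<mu> A)"
  unfolding complex_borel_measure_def by (auto intro!: sums_mult)

lemma complex_borel_measure_cnj:
  "complex_borel_measure \<mu> \<Longrightarrow> complex_borel_measure (\<lambda>A. cnj (\<mu> A))"
  unfolding complex_borel_measure_def by (auto simp: sums_cnj)

text \<open>A sequence of finite Borel partitions with a tag for each cell, encoded as the map from
  a point to the tag of its cell; the fibres of \<open>r n\<close> are the cells. A tag need not lie
  in its cell, only uniformly close to it.\<close>

definition tagging :: "(nat \<Rightarrow> 'a::metric_space \<Rightarrow> 'a) \<Rightarrow> bool" where
  "tagging r \<longleftrightarrow> (\<forall>n. finite (range (r n)) \<and> (\<forall>t. r n -` {t} \<in> sets borel)) \<and>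
     (\<forall>\<epsilon>>0. \<forall>\<^sub>F n in sequentially. \<forall>x. dist (r n x) x < \<epsilon>)"

definition riemann_sum :: "('a \<Rightarrow> 'a) \<Rightarrow> ('a set \<Rightarrow> complex) \<Rightarrow> ('a \<Rightarrow> complex) \<Rightarrow> complex" where
  "riemann_sum r \<mu> f = (\<Sum>t\<in>range r. \<mu> (r -` {t}) * f t)"

lemma simple_tag_exists:
  assumes "compact (UNIV :: 'a::metric_space set)" "0 < \<epsilon>"
  shows "\<exists>r. finite (range r) \<and> (\<forall>t. r -` {t} \<in> sets borel) \<and> (\<forall>x::'a. dist (r x) x < \<epsilon>)"
proof -
  obtain X where X: "finite X" "(UNIV :: 'a set) \<subseteq> (\<Union>x\<in>X. ball x \<epsilon>)"
    using assms(1)[unfolded compact_eq_totally_bounded] assms(2) by blast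
  obtain xs where xs: "set xs = X" using finite_list[OF X(1)] by blast
  \<comment> \<open>Each point gets the first centre of a fixed list that is within
    \<open>\<epsilon>\<close>; taking the first one turns the overlapping balls into disjoint Borel
    cells.\<close>
  define N where "N x = (LEAST i. i < length xs \<and> dist (xs ! i) x < \<epsilon>)" for x
  have ex: "\<exists>i. i < length xs \<and> dist (xs ! i) x < \<epsilon>" for x
  proof -
    have "x \<in> (\<Union>x\<in>X. ball x \<epsilon>)" by (rule subsetD[OF X(2) UNIV_I])
    then obtain y where y: "y \<in> X" "dist y x < \<epsilon>" unfolding UN_iff mem_ball by blast
    then obtain i where "i < length xs" "xs ! i = y" using xs in_set_conv_nth by metis
    then show ?thesis using y by blast
  qed
  have N: "N x < length xs" "dist (xs ! N x) x < \<epsilon>" for x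
    using LeastI_ex[OF ex[of x]] unfolding N_def by auto
  have m: "N \<in> borel \<rightarrow>\<^sub>M count_space UNIV" unfolding N_def
  proof (rule measurable_Least)
    fix i
    have "{x. dist (xs ! i) x < \<epsilon>} = ball (xs ! i) \<epsilon>" by auto
    then have "{x. dist (xs ! i) x < \<epsilon>} \<in> sets borel" by simp
    then show "(\<lambda>x. i < length xs \<and> dist (xs ! i) x < \<epsilon>) \<in> borel \<rightarrow>\<^sub>M count_space UNIV"
      by (cases "i < length xs") (auto simp: pred_def)
  qed
  have "(\<lambda>x. xs ! N x) \<in> borel \<rightarrow>\<^sub>M count_space UNIV"
    using m by (rule measurable_compose) simp
  then have "(\<lambda>x. xs ! N x) -` {t} \<in> sets borel" for t
    using measurable_sets[of "\<lambda>x. xs ! N x" borel "count_space UNIV" "{t}"] by simp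
  moreover have "range (\<lambda>x. xs ! N x) \<subseteq> set xs" using N by auto
  then have "finite (range (\<lambda>x. xs ! N x))" using finite_subset by blast
  ultimately show ?thesis using N by blast
qed

lemma tagging_exists:
  assumes "compact (UNIV :: 'a::metric_space set)"
  shows "\<exists>r :: nat \<Rightarrow> 'a \<Rightarrow> 'a. tagging r"
proof -
  have "\<forall>n. \<exists>r. finite (range r) \<and> (\<forall>t. r -` {t} \<in> sets borel) \<and> (\<forall>x::'a. dist (r x) x < inverse (real (Suc n)))"
    using simple_tag_exists[OF assms] by simp
  then obtain r where r: "\<And>n. finite (range (r n))" "\<And>n t. r n -` {t} \<in> sets borel"
    "\<And>n x::'a. dist (r n x) x < inverse (real (Suc n))" by metis
  have "\<forall>\<^sub>F n in sequentially. \<forall>x. dist (r n x) x < \<epsilon>" if "\<epsilon> > 0" for \<epsilon>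
  proof -
    have "\<forall>\<^sub>F n in sequentially. inverse (real (Suc n)) < \<epsilon>"
      by (rule order_tendstoD(2)[OF LIMSEQ_inverse_real_of_nat that])
    then show ?thesis using r(3) by (auto elim!: eventually_mono intro: less_trans)
  qed
  then show ?thesis using r unfolding tagging_def by blast
qed

lemma continuous_on_compact_bounded:
  fixes f :: "'a::topological_space \<Rightarrow> 'b::real_normed_vector"
  assumes "compact (UNIV :: 'a set)" "continuous_on UNIV f"
  obtains B where "B > 0" "\<And>x. norm (f x) \<le> B"
proof -
  have "bounded (range f)" using compact_continuous_image[OF assms(2,1)] compact_imp_bounded by auto
  then show ?thesis using that unfolding bounded_pos by auto
qed

lemma integrable_bounded:
  fixes f :: "'a::topological_space \<Rightarrow> complex"
  assumes "finite_measure M" "sets M = sets borel" "f \<in> borel_measurable borel" "\<And>x. norm (f x) \<le> B"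
  shows "integrable M f"
proof -
  interpret finite_measure M by fact
  have "f \<in> borel_measurable M" using assms measurable_cong_sets by blast
  then show ?thesis using assms(4) by (intro integrable_const_bound[of _ B]) auto
qed

lemma integrable_continuous:
  fixes f :: "'a::topological_space \<Rightarrow> complex"
  assumes "compact (UNIV :: 'a set)" "finite_measure M" "sets M = sets borel" "continuous_on UNIV f"
  shows "integrable M f"
  using continuous_on_compact_bounded[OF assms(1,4)] integrable_bounded[OF assms(2,3)]
    borel_measurable_continuous_onI[OF assms(4)] by metis

lemma riemann_sum_integral:
  assumes M: "finite_measure M" "sets M = sets borel" and r: "finite (range r)" "\<And>t. r -` {t} \<in> sets borel"
  shows "riemann_sum r (\<lambda>A. complex_of_real (measure M A)) f = (LINT x|M. f (r x))"
    "integrable M (\<lambda>x. f (r x))"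
proof -
  interpret finite_measure M by fact
  have sp: "space M = UNIV" using sets_eq_imp_space_eq[OF M(2)] by simp
  have eq: "f (r x) = (\<Sum>t\<in>range r. indicat_real (r -` {t}) x *\<^sub>R f t)" for x
  proof -
    have "(\<Sum>t\<in>range r. indicat_real (r -` {t}) x *\<^sub>R f t) = (\<Sum>t\<in>range r. if t = r x then f t else 0)"
      by (intro sum.cong refl) (auto simp: indicator_def)
    then show ?thesis using r(1) by simp
  qed
  have int1: "integrable M (indicat_real (r -` {t}))" for t
    using r(2) M by (auto simp: emeasure_eq_measure)
  then have int: "integrable M (\<lambda>x. indicat_real (r -` {t}) x *\<^sub>R f t)" for t
    by (intro integrable_scaleR_left) auto
  have "(LINT x|M. indicat_real (r -` {t}) x *\<^sub>R f t) = measure M (r -` {t}) * f t" for t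
    using int1[of t] r(2) M by (subst integral_scaleR_left) (auto simp: sp scaleR_conv_of_real)
  then show "riemann_sum r (\<lambda>A. complex_of_real (measure M A)) f = (LINT x|M. f (r x))"
    unfolding eq riemann_sum_def using int by (subst Bochner_Integration.integral_sum) auto
  show "integrable M (\<lambda>x. f (r x))" unfolding eq using int by (intro Bochner_Integration.integrable_sum) auto
qed

lemma riemann_sum_tendsto_integral:
  fixes r :: "nat \<Rightarrow> 'a::metric_space \<Rightarrow> 'a"
  assumes K: "compact (UNIV :: 'a set)" and M: "finite_measure M" "sets M = sets borel" and r: "tagging r"
    and f: "continuous_on UNIV f"
  shows "(\<lambda>n. riemann_sum (r n) (\<lambda>A. complex_of_real (measure M A)) f) \<longlonglongrightarrow> (LINT x|M. f x)"
proof -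
  interpret finite_measure M by fact
  have eq: "riemann_sum (r n) (\<lambda>A. complex_of_real (measure M A)) f = (LINT x|M. f (r n x))" for n
    by (rule riemann_sum_integral[OF M]) (use r in \<open>auto simp: tagging_def\<close>)
  obtain B where B: "\<And>x. norm (f x) \<le> B" using continuous_on_compact_bounded[OF K f] by blast
  show ?thesis unfolding eq
  proof (rule integral_dominated_convergence[where w = "\<lambda>_. B"])
    have "f \<in> borel_measurable borel" using f by (rule borel_measurable_continuous_onI)
    then show "f \<in> borel_measurable M" using M measurable_cong_sets by blast
    show "(\<lambda>x. f (r n x)) \<in> borel_measurable M" for n
      using riemann_sum_integral(2)[OF M, of "r n" f] r unfolding tagging_def by (simp add: borel_measurable_integrable)
    show "AE x in M. (\<lambda>n. f (r n x)) \<longlonglongrightarrow> f x"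
    proof (intro AE_I2)
      fix x
      have "(\<lambda>n. r n x) \<longlonglongrightarrow> x" unfolding tendsto_iff
        using r unfolding tagging_def by (auto elim!: allE eventually_mono)
      then show "(\<lambda>n. f (r n x)) \<longlonglongrightarrow> f x"
        using f continuous_on_tendsto_compose[of UNIV f] by simp
    qed
  qed (use B in auto)
qed

text \<open>The four Jordan parts inside \<open>cm_integral\<close> do not depend additively on the
  measure, whereas a Riemann sum is linear in the measure and in the function. Linearity,
  conjugation and reflection of \<open>cm_integral\<close> are all read off from this limit.\<close>

lemma riemann_sum_tendsto:
  fixes r :: "nat \<Rightarrow> 'a::metric_space \<Rightarrow> 'a"
  assumes K: "compact (UNIV :: 'a set)" and mu: "complex_borel_measure \<mu>" and r: "tagging r"
    and f: "continuous_on UNIV f"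
  shows "(\<lambda>n. riemann_sum (r n) \<mu> f) \<longlonglongrightarrow> cm_integral \<mu> f"
proof -
  note R = complex_borel_measure_Re_Im[OF mu]
  note 1 = Jordan_decomposition[OF R(1)] and 2 = Jordan_decomposition[OF R(2)]
  let ?m = "\<lambda>\<nu> A. complex_of_real (measure (pos_variation \<nu>) A)"
  have lim: "(\<lambda>n. riemann_sum (r n) (?m \<nu>) f) \<longlonglongrightarrow> integral\<^sup>L (pos_variation \<nu>) f"
    if "sets (pos_variation \<nu>) = sets borel" "finite_measure (pos_variation \<nu>)" for \<nu>
    by (rule riemann_sum_tendsto_integral[OF K that(2,1) r f])
  have "(\<lambda>n. (riemann_sum (r n) (?m (\<lambda>A. Re (\<mu> A))) f - riemann_sum (r n) (?m (\<lambda>A. - Re (\<mu> A))) f)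
      + \<i> * (riemann_sum (r n) (?m (\<lambda>A. Im (\<mu> A))) f - riemann_sum (r n) (?m (\<lambda>A. - Im (\<mu> A))) f))
      \<longlonglongrightarrow> cm_integral \<mu> f"
    unfolding cm_integral_def using 1 2 by (intro tendsto_intros lim) auto
  moreover have E: "\<mu> (r n -` {t}) = (?m (\<lambda>A. Re (\<mu> A)) (r n -` {t}) - ?m (\<lambda>A. - Re (\<mu> A)) (r n -` {t}))
      + \<i> * (?m (\<lambda>A. Im (\<mu> A)) (r n -` {t}) - ?m (\<lambda>A. - Im (\<mu> A)) (r n -` {t}))" for n t
    using 1(5)[of "r n -` {t}"] 2(5)[of "r n -` {t}"] r unfolding tagging_def
    by (simp add: complex_eq_iff)
  have "riemann_sum (r n) \<mu> f =
      (riemann_sum (r n) (?m (\<lambda>A. Re (\<mu> A))) f - riemann_sum (r n) (?m (\<lambda>A. - Re (\<mu> A))) f)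
      + \<i> * (riemann_sum (r n) (?m (\<lambda>A. Im (\<mu> A))) f - riemann_sum (r n) (?m (\<lambda>A. - Im (\<mu> A))) f)" for n
    unfolding riemann_sum_def sum_subtractf[symmetric] sum_distrib_left sum.distrib[symmetric]
    by (intro sum.cong refl) (subst E, simp add: algebra_simps)
  ultimately show ?thesis by simp
qed

text \<open>One pair of sets serves the whole family, because uniting the compact sets and
  intersecting the open ones only shrinks \<open>U - C\<close>. A complex measure needs this for its
  four Jordan parts at once.\<close>

lemma measure_regular_finite_family:
  fixes M :: "'i \<Rightarrow> 'a::polish_space measure"
  assumes "finite I" "\<And>i. i \<in> I \<Longrightarrow> finite_measure (M i)" "\<And>i. i \<in> I \<Longrightarrow> sets (M i) = sets borel"
    and A: "A \<in> sets borel" and e: "0 < \<epsilon>"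
  shows "\<exists>C U. compact C \<and> open U \<and> C \<subseteq> A \<and> A \<subseteq> U \<and> (\<forall>i\<in>I. measure (M i) (U - C) < \<epsilon>)"
  using assms(1-3)
proof (induction I)
  case empty
  then show ?case by (intro exI[of _ "{}"] exI[of _ UNIV]) auto
next
  case (insert i I)
  then obtain C U where CU: "compact C" "open U" "C \<subseteq> A" "A \<subseteq> U" "\<forall>i\<in>I. measure (M i) (U - C) < \<epsilon>"
    by auto
  have s: "sets (M i) = sets borel" using insert.prems by auto
  interpret finite_measure "M i" using insert.prems by auto
  have fin: "emeasure (M i) (space (M i)) \<noteq> \<infinity>" by (simp add: emeasure_eq_measure)
  obtain D where D: "compact D" "D \<subseteq> A" "measure (M i) A < measure (M i) D + \<epsilon>/2"
  proof (cases "measure (M i) A < \<epsilon>/2")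
    case True then show ?thesis using that[of "{}"] by simp
  next
    case False
    have "ennreal (measure (M i) A - \<epsilon>/2) < emeasure (M i) A"
      using False e by (simp add: emeasure_eq_measure ennreal_less_iff)
    then obtain D where "compact D" "D \<subseteq> A" "ennreal (measure (M i) A - \<epsilon>/2) < emeasure (M i) D"
      unfolding inner_regular[OF s fin A] less_SUP_iff by auto
    then show ?thesis using that[of D] False by (simp add: emeasure_eq_measure ennreal_less_iff)
  qed
  have "emeasure (M i) A < ennreal (measure (M i) A + \<epsilon>/2)"
    using e by (simp add: emeasure_eq_measure ennreal_less_iff)
  then obtain V where V: "open V" "A \<subseteq> V" "emeasure (M i) V < ennreal (measure (M i) A + \<epsilon>/2)"
    unfolding outer_regular[OF s fin A] INF_less_iff by auto
  then have V': "measure (M i) V < measure (M i) A + \<epsilon>/2"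
    by (simp add: emeasure_eq_measure ennreal_less_iff)
  have meas: "C \<in> sets borel" "D \<in> sets borel" "U \<in> sets borel" "V \<in> sets borel"
    using CU D V by (auto intro: borel_compact)
  have "measure (M i) (V - D) = measure (M i) V - measure (M i) D"
    using D V meas s by (intro finite_measure_Diff) auto
  then have "measure (M i) (V - D) < \<epsilon>" using V' D by simp
  moreover have "measure (M i) (U \<inter> V - (C \<union> D)) \<le> measure (M i) (V - D)"
    using meas s by (intro finite_measure_mono) auto
  moreover have "measure (M j) (U \<inter> V - (C \<union> D)) < \<epsilon>" if j: "j \<in> I" for j
  proof -
    interpret J: finite_measure "M j" using insert.prems j by auto
    have "sets (M j) = sets borel" using insert.prems j by auto
    then have "measure (M j) (U \<inter> V - (C \<union> D)) \<le> measure (M j) (U - C)"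
      using meas by (intro J.finite_measure_mono) auto
    then show ?thesis using CU(5) j by force
  qed
  ultimately show ?case
    by (intro exI[of _ "C \<union> D"] exI[of _ "U \<inter> V"]) (use CU D V in auto)
qed

text \<open>Intended for members of \<open>pos_measures\<close>, where the positive variation of the
  real part is the whole measure.\<close>

definition meas_of :: "('a::topological_space set \<Rightarrow> complex) \<Rightarrow> 'a measure" where
  "meas_of \<mu> = pos_variation (\<lambda>A. Re (\<mu> A))"

lemma complex_Jordan:
  assumes mu: "complex_borel_measure \<mu>"
  obtains M :: "nat \<Rightarrow> 'a::topological_space measure" and a :: "nat \<Rightarrow> complex"
  where "\<And>i. finite_measure (M i)" "\<And>i. sets (M i) = sets borel" "\<And>i. cmod (a i) = 1"
    "\<mu> = (\<lambda>A. \<Sum>i<4. a i * complex_of_real (measure (M i) A))"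
proof -
  note R = complex_borel_measure_Re_Im[OF mu]
  note 1 = Jordan_decomposition[OF R(1)] and 2 = Jordan_decomposition[OF R(2)]
  \<comment> \<open>The last branch is taken by every index from 3 on, so finiteness and the Borel
    sigma-algebra hold for all indices and no range condition has to be carried along.\<close>
  define M where "M i = (if i = 0 then pos_variation (\<lambda>A. Re (\<mu> A)) else if i = 1 then pos_variation (\<lambda>A. - Re (\<mu> A))
     else if i = 2 then pos_variation (\<lambda>A. Im (\<mu> A)) else pos_variation (\<lambda>A. - Im (\<mu> A)))" for i :: nat
  define a where "a i = (if i = 0 then 1 else if i = 1 then -1 else if i = 2 then \<i> else - \<i>)" for i :: nat
  have s: "sets (M i) = sets borel" for i using 1 2 unfolding M_def by auto
  have eq: "(\<Sum>i<4. a i * complex_of_real (measure (M i) A)) =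
     a 0 * measure (M 0) A + a 1 * measure (M 1) A + a 2 * measure (M 2) A + a 3 * measure (M 3) A" for A
    by (simp add: eval_nat_numeral)
  have "\<mu> A = (\<Sum>i<4. a i * complex_of_real (measure (M i) A))" for A
  proof (cases "A \<in> sets borel")
    case True
    then show ?thesis unfolding eq using 1(5)[OF True] 2(5)[OF True]
      by (simp add: M_def a_def complex_eq_iff)
  next
    case False
    then show ?thesis using mu s by (simp add: complex_borel_measure_def measure_notin_sets)
  qed
  then have eq': "\<mu> = (\<lambda>A. \<Sum>i<4. a i * complex_of_real (measure (M i) A))" by blast
  have fm: "finite_measure (M i)" for i using 1 2 unfolding M_def by auto
  have ca: "cmod (a i) = 1" for i unfolding a_def by simp
  show ?thesis by (rule that[OF fm s ca eq'])
qed

text \<open>Finite Borel measures on a Polish space are regular, and the total variation is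
  dominated by the sum of the Jordan parts. Membership in M(K) thus reduces to countable
  additivity.\<close>

lemma reg_measures_polish: "reg_measures = {\<mu> :: 'a::polish_space set \<Rightarrow> complex. complex_borel_measure \<mu>}"
proof -
  have "\<exists>C U. compact C \<and> open U \<and> C \<subseteq> A \<and> A \<subseteq> U \<and> total_variation \<mu> (U - C) < \<epsilon>"
    if mu: "complex_borel_measure \<mu>" and A: "A \<in> sets borel" and e: "\<epsilon> > 0"
    for \<mu> :: "'a set \<Rightarrow> complex" and A \<epsilon>
  proof -
    obtain M :: "nat \<Rightarrow> 'a measure" and a where M: "\<And>i. finite_measure (M i)" "\<And>i. sets (M i) = sets borel"
      "\<And>i. cmod (a i) = 1" "\<mu> = (\<lambda>A. \<Sum>i<4. a i * complex_of_real (measure (M i) A))"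
      by (rule complex_Jordan[OF mu]) (rule that)
    \<comment> \<open>Four parts, each below \<open>\<epsilon>/5\<close>, leave a strict inequality
      at the end.\<close>
    obtain C U where CU: "compact C" "open U" "C \<subseteq> A" "A \<subseteq> U" "\<forall>i\<in>{..<4}. measure (M i) (U - C) < \<epsilon>/5"
      using measure_regular_finite_family[of "{..<4::nat}" M A "\<epsilon>/5"] M A e by auto
    have le: "cmod (\<mu> B) \<le> (\<Sum>i<4. measure (M i) B)" for B
      unfolding M(4) by (rule sum_norm_le) (simp add: norm_mult M)
    have UC: "U - C \<in> sets borel" using CU by (auto intro: borel_compact)
    have "total_variation \<mu> (U - C) \<le> (\<Sum>i<4::nat. measure (M i) (U - C))"
      unfolding total_variation_def
    proof (rule cSUP_least)
      fix P assume "P \<in> {P. finite P \<and> P \<subseteq> sets borel \<and> disjoint P \<and> \<Union>P \<subseteq> U - C}"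
      then have P: "finite P" "P \<subseteq> sets borel" "disjoint P" "\<Union>P \<subseteq> U - C" by auto
      have "(\<Sum>B\<in>P. cmod (\<mu> B)) \<le> (\<Sum>B\<in>P. \<Sum>i<4. measure (M i) B)" by (intro sum_mono le)
      also have "\<dots> = (\<Sum>i<4. \<Sum>B\<in>P. measure (M i) B)" by (rule sum.swap)
      also have "\<dots> \<le> (\<Sum>i<4. measure (M i) (U - C))"
      proof (rule sum_mono)
        fix i :: nat
        interpret finite_measure "M i" by (rule M)
        have "(\<Sum>B\<in>P. measure (M i) B) = measure (M i) (\<Union>B\<in>P. B)"
          using P M by (intro finite_measure_finite_Union[symmetric])
            (auto simp: disjoint_def disjoint_family_on_def)
        also have "\<dots> \<le> measure (M i) (U - C)" using P UC M by (intro finite_measure_mono) auto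
        finally show "(\<Sum>B\<in>P. measure (M i) B) \<le> measure (M i) (U - C)" .
      qed
      finally show "(\<Sum>B\<in>P. cmod (\<mu> B)) \<le> (\<Sum>i<4. measure (M i) (U - C))" .
    qed (auto intro: exI[of _ "{}"])
    also have "\<dots> \<le> (\<Sum>i<4::nat. \<epsilon>/5)" using CU(5) by (intro sum_mono) (auto intro: less_imp_le)
    also have "\<dots> < \<epsilon>" using e by simp
    finally show ?thesis using CU by blast
  qed
  then show ?thesis unfolding reg_measures_def by auto
qed

lemma pos_measures_of_measure:
  fixes M :: "'a::polish_space measure"
  assumes "finite_measure M" "sets M = sets borel"
  shows "(\<lambda>A. complex_of_real (measure M A)) \<in> pos_measures"
  using complex_borel_measure_of_measure[OF assms] unfolding pos_measures_def reg_measures_polish by simp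

lemma meas_of:
  fixes \<mu> :: "'a::polish_space set \<Rightarrow> complex"
  assumes "\<mu> \<in> pos_measures"
  shows "finite_measure (meas_of \<mu>)" "sets (meas_of \<mu>) = sets borel"
    "\<mu> = (\<lambda>A. complex_of_real (measure (meas_of \<mu>) A))"
proof -
  have mu: "complex_borel_measure \<mu>" "\<And>A. \<mu> A \<in> \<real>\<^sub>\<ge>\<^sub>0"
    using assms unfolding pos_measures_def reg_measures_polish by auto
  have nn: "0 \<le> Re (\<mu> A)" "Im (\<mu> A) = 0" for A using mu(2)[of A] by (auto simp: complex_nonneg_Reals_iff)
  note R = complex_borel_measure_Re_Im(1)[OF mu(1)]
  have P: "positive_set (\<lambda>A. Re (\<mu> A)) UNIV" unfolding positive_set_def using nn by auto
  have e: "Re (\<mu> B) \<le> 0" if "B \<inter> UNIV = {}" for B using R that unfolding signed_borel_measure_def by simp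
  note H = pos_variation_Hahn[OF R P, OF e]
  show 1: "finite_measure (meas_of \<mu>)" "sets (meas_of \<mu>) = sets borel" unfolding meas_of_def using H by auto
  have "\<mu> A = complex_of_real (measure (meas_of \<mu>) A)" for A
  proof (cases "A \<in> sets borel")
    case True
    then show ?thesis unfolding meas_of_def using H(3)[OF _ True] nn by (simp add: complex_eq_iff)
  next
    case False
    then show ?thesis using mu 1 by (simp add: complex_borel_measure_def measure_notin_sets)
  qed
  then show "\<mu> = (\<lambda>A. complex_of_real (measure (meas_of \<mu>) A))" by blast
qed

lemma cm_integral_of_measure:
  fixes f :: "'a::polish_space \<Rightarrow> complex"
  assumes "compact (UNIV :: 'a set)" "finite_measure M" "sets M = sets borel" "continuous_on UNIV f"
  shows "cm_integral (\<lambda>A. complex_of_real (measure M A)) f = (LINT x|M. f x)"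
proof -
  obtain r :: "nat \<Rightarrow> 'a \<Rightarrow> 'a" where r: "tagging r" using tagging_exists[OF assms(1)] by blast
  show ?thesis
    using LIMSEQ_unique[OF riemann_sum_tendsto[OF assms(1) complex_borel_measure_of_measure[OF assms(2,3)] r assms(4)]
      riemann_sum_tendsto_integral[OF assms(1-3) r assms(4)]] .
qed

lemma cm_integral_pos:
  fixes f :: "'a::polish_space \<Rightarrow> complex"
  assumes "compact (UNIV :: 'a set)" "\<mu> \<in> pos_measures" "continuous_on UNIV f"
  shows "cm_integral \<mu> f = (LINT x|meas_of \<mu>. f x)"
  by (subst meas_of(3)[OF assms(2)]) (rule cm_integral_of_measure[OF assms(1) meas_of(1,2)[OF assms(2)] assms(3)])

context
  fixes ty :: "'a::polish_space itself"
  assumes K: "compact (UNIV :: 'a set)"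
begin

lemma cm_integral_sum_measure:
  fixes f :: "'a \<Rightarrow> complex"
  assumes m: "\<And>i. i \<in> I \<Longrightarrow> complex_borel_measure (m i)" and f: "continuous_on UNIV f" and I: "finite I"
  shows "complex_borel_measure (\<lambda>A. \<Sum>i\<in>I. a i * m i A)"
    "cm_integral (\<lambda>A. \<Sum>i\<in>I. a i * m i A) f = (\<Sum>i\<in>I. a i * cm_integral (m i) f)"
proof -
  show cb: "complex_borel_measure (\<lambda>A. \<Sum>i\<in>I. a i * m i A)" using I m
  proof (induction I)
    case empty
    then show ?case by (simp add: complex_borel_measure_def)
  next
    case (insert i I)
    then show ?case by (simp add: complex_borel_measure_add complex_borel_measure_scale)
  qed
  obtain r :: "nat \<Rightarrow> 'a \<Rightarrow> 'a" where r: "tagging r" using tagging_exists[OF K] by blast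
  have "riemann_sum (r n) (\<lambda>A. \<Sum>i\<in>I. a i * m i A) f = (\<Sum>i\<in>I. a i * riemann_sum (r n) (m i) f)" for n
    unfolding riemann_sum_def sum_distrib_left sum_distrib_right
    by (subst sum.swap) (simp add: mult.assoc)
  moreover have "(\<lambda>n. \<Sum>i\<in>I. a i * riemann_sum (r n) (m i) f) \<longlonglongrightarrow> (\<Sum>i\<in>I. a i * cm_integral (m i) f)"
    by (intro tendsto_intros riemann_sum_tendsto[OF K _ r f] m)
  ultimately show "cm_integral (\<lambda>A. \<Sum>i\<in>I. a i * m i A) f = (\<Sum>i\<in>I. a i * cm_integral (m i) f)"
    using LIMSEQ_unique[OF riemann_sum_tendsto[OF K cb r f]] by simp
qed

lemma cm_integral_add_measure:
  fixes f :: "'a \<Rightarrow> complex"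
  assumes "complex_borel_measure \<mu>" "complex_borel_measure \<nu>" "continuous_on UNIV f"
  shows "cm_integral (\<lambda>A. \<mu> A + \<nu> A) f = cm_integral \<mu> f + cm_integral \<nu> f"
  using cm_integral_sum_measure(2)[of "{False,True}" "\<lambda>b. if b then \<nu> else \<mu>" f "\<lambda>_. 1"] assms by simp

lemma cm_integral_scale_measure:
  fixes f :: "'a \<Rightarrow> complex"
  assumes "complex_borel_measure \<mu>" "continuous_on UNIV f"
  shows "cm_integral (\<lambda>A. c * \<mu> A) f = c * cm_integral \<mu> f"
  using cm_integral_sum_measure(2)[of "{()}" "\<lambda>b. \<mu>" f "\<lambda>_. c"] assms by simp

lemma cm_integral_sum_fun:
  fixes f :: "'i \<Rightarrow> 'a \<Rightarrow> complex"
  assumes mu: "complex_borel_measure \<mu>" and f: "\<And>i. i \<in> I \<Longrightarrow> continuous_on UNIV (f i)"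
  shows "cm_integral \<mu> (\<lambda>x. \<Sum>i\<in>I. a i * f i x) = (\<Sum>i\<in>I. a i * cm_integral \<mu> (f i))"
proof -
  obtain r :: "nat \<Rightarrow> 'a \<Rightarrow> 'a" where r: "tagging r" using tagging_exists[OF K] by blast
  have c: "continuous_on UNIV (\<lambda>x. \<Sum>i\<in>I. a i * f i x)" by (intro continuous_intros f)
  have "riemann_sum (r n) \<mu> (\<lambda>x. \<Sum>i\<in>I. a i * f i x) = (\<Sum>i\<in>I. a i * riemann_sum (r n) \<mu> (f i))" for n
    unfolding riemann_sum_def sum_distrib_left sum_distrib_right
    by (subst sum.swap) (simp add: mult_ac)
  moreover have "(\<lambda>n. \<Sum>i\<in>I. a i * riemann_sum (r n) \<mu> (f i)) \<longlonglongrightarrow> (\<Sum>i\<in>I. a i * cm_integral \<mu> (f i))"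
    by (intro tendsto_intros riemann_sum_tendsto[OF K mu r] f)
  ultimately show ?thesis
    using LIMSEQ_unique[OF riemann_sum_tendsto[OF K mu r c]] by simp
qed

lemma cm_integral_cnj:
  fixes f :: "'a \<Rightarrow> complex"
  assumes mu: "complex_borel_measure \<mu>" and f: "continuous_on UNIV f"
  shows "cm_integral (\<lambda>A. cnj (\<mu> A)) (\<lambda>x. cnj (f x)) = cnj (cm_integral \<mu> f)"
proof -
  obtain r :: "nat \<Rightarrow> 'a \<Rightarrow> 'a" where r: "tagging r" using tagging_exists[OF K] by blast
  have "riemann_sum (r n) (\<lambda>A. cnj (\<mu> A)) (\<lambda>x. cnj (f x)) = cnj (riemann_sum (r n) \<mu> f)" for n
    unfolding riemann_sum_def by simp
  then show ?thesis
    using LIMSEQ_unique[OF riemann_sum_tendsto[OF K complex_borel_measure_cnj[OF mu] r continuous_on_cnj[OF f]]]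
      tendsto_cnj[OF riemann_sum_tendsto[OF K mu r f]] by simp
qed

lemma dirac_pos: "dirac (x :: 'a) \<in> pos_measures"
proof -
  have "complex_borel_measure (dirac x)"
    unfolding complex_borel_measure_def
  proof (intro conjI allI impI)
    fix A :: "nat \<Rightarrow> 'a set" assume A: "range A \<subseteq> sets borel" "disjoint_family A"
    show "(\<lambda>i. dirac x (A i)) sums dirac x (\<Union>i. A i)"
    proof (cases "\<exists>j. x \<in> A j")
      case True
      then obtain j where j: "x \<in> A j" by blast
      have "x \<notin> A i" if "i \<noteq> j" for i using A(2) j that unfolding disjoint_family_on_def by blast
      then have "(\<lambda>i. dirac x (A i)) = (\<lambda>i. if i = j then 1 else 0)"
        using j A(1) by (auto simp: dirac_def)
      moreover have "dirac x (\<Union>i. A i) = 1" using j A(1) by (auto simp: dirac_def)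
      ultimately show ?thesis using sums_single[of j "\<lambda>_. 1 :: complex"] by simp
    qed (simp add: dirac_def)
  qed (auto simp: dirac_def)
  then show ?thesis unfolding pos_measures_def reg_measures_polish by (simp add: dirac_def)
qed

lemma cm_integral_dirac:
  fixes f :: "'a \<Rightarrow> complex"
  assumes f: "continuous_on UNIV f"
  shows "cm_integral (dirac x) f = f x"
proof -
  obtain r :: "nat \<Rightarrow> 'a \<Rightarrow> 'a" where r: "tagging r" using tagging_exists[OF K] by blast
  have "riemann_sum (r n) (dirac x) f = f (r n x)" for n
  proof -
    have "riemann_sum (r n) (dirac x) f = (\<Sum>t\<in>range (r n). if t = r n x then f t else 0)"
      unfolding riemann_sum_def using r by (intro sum.cong refl) (auto simp: dirac_def tagging_def)
    then show ?thesis using r by (simp add: tagging_def)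
  qed
  moreover have "(\<lambda>n. f (r n x)) \<longlonglongrightarrow> f x"
  proof (rule continuous_on_tendsto_compose[OF f])
    show "(\<lambda>n. r n x) \<longlonglongrightarrow> x" unfolding tendsto_iff
      using r unfolding tagging_def by (auto elim!: allE eventually_mono)
  qed auto
  moreover have "complex_borel_measure (dirac x)"
    using dirac_pos unfolding pos_measures_def reg_measures_polish by auto
  ultimately show ?thesis
    using LIMSEQ_unique[OF riemann_sum_tendsto[OF K _ r f, of "dirac x"]] by simp
qed

lemma cm_integral_check:
  fixes f :: "'a \<Rightarrow> complex"
  assumes mu: "complex_borel_measure \<mu>" and f: "continuous_on UNIV f"
    and ck: "continuous_on UNIV ck" "\<And>x. ck (ck x) = x"
  shows "complex_borel_measure (check_measure ck \<mu>)"
    "cm_integral (check_measure ck \<mu>) f = cm_integral \<mu> (\<lambda>x. f (ck x))"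
proof -
  have im: "ck ` A = ck -` A" for A using ck(2) by (metis (no_types, lifting) bij_betw_def bij_vimage_eq_inv_image involuntory_imp_bij inv_equality)
  have bi: "ck ` A \<in> sets borel \<longleftrightarrow> A \<in> sets borel" for A
  proof -
    have 1: "B \<in> sets borel \<Longrightarrow> ck ` B \<in> sets borel" for B
      unfolding im using measurable_sets[OF borel_measurable_continuous_onI[OF ck(1)]] by force
    have "ck ` (ck ` A) = A" using ck(2) by (force simp: image_image)
    then show ?thesis using 1 by metis
  qed
  have inj: "inj ck" using ck(2) by (metis injI)
  show cb: "complex_borel_measure (check_measure ck \<mu>)"
    unfolding complex_borel_measure_def
  proof (intro conjI allI impI)
    fix A :: "nat \<Rightarrow> 'a set" assume A: "range A \<subseteq> sets borel" "disjoint_family A"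
    have "disjoint_family (\<lambda>i. ck ` A i)" "range (\<lambda>i. ck ` A i) \<subseteq> sets borel"
      using A inj bi unfolding disjoint_family_on_def by (auto simp: image_Int[symmetric] inj_def)
    then show "(\<lambda>i. check_measure ck \<mu> (A i)) sums check_measure ck \<mu> (\<Union>i. A i)"
      using mu unfolding complex_borel_measure_def check_measure_def image_UN by blast
  qed (use mu bi in \<open>auto simp: complex_borel_measure_def check_measure_def\<close>)
  obtain r :: "nat \<Rightarrow> 'a \<Rightarrow> 'a" where r: "tagging r" using tagging_exists[OF K] by blast
  \<comment> \<open>Conjugating the tags by \<open>ck\<close> gives a tagging again, by uniform
    continuity of \<open>ck\<close>. Its Riemann sums for the reflected measure agree exactly with
    those of \<open>\<mu>\<close> for the reflected function.\<close>
  define r' where "r' n = (\<lambda>x. ck (r n (ck x)))" for n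
  have pre: "r' n -` {t} = ck ` (r n -` {ck t})" for n t
    unfolding im r'_def by (auto simp: ck(2))
  have ran: "range (r' n) = ck ` range (r n)" for n
    unfolding r'_def using ck(2) by (auto, metis rangeI imageI)
  have r': "tagging r'"
    unfolding tagging_def
  proof (intro conjI allI impI)
    fix n t
    show "finite (range (r' n))" unfolding ran using r by (auto simp: tagging_def)
    show "r' n -` {t} \<in> sets borel" unfolding pre bi using r by (auto simp: tagging_def)
  next
    fix \<epsilon> :: real assume e: "\<epsilon> > 0"
    obtain d where d: "d > 0" "\<And>x y. dist x y < d \<Longrightarrow> dist (ck x) (ck y) < \<epsilon>"
      using compact_uniformly_continuous[OF ck(1) K] e unfolding uniformly_continuous_on_def by (metis UNIV_I dist_commute)
    have "\<forall>\<^sub>F n in sequentially. \<forall>x. dist (r n x) x < d" using r d(1) unfolding tagging_def by blast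
    then show "\<forall>\<^sub>F n in sequentially. \<forall>x. dist (r' n x) x < \<epsilon>"
    proof eventually_elim
      case (elim n)
      show ?case
      proof
        fix x show "dist (r' n x) x < \<epsilon>" using d(2)[OF elim[rule_format, of "ck x"]] ck(2) by (simp add: r'_def)
      qed
    qed
  qed
  have "riemann_sum (r' n) (check_measure ck \<mu>) f = riemann_sum (r n) \<mu> (\<lambda>x. f (ck x))" for n
  proof -
    have "ck ` ck ` A = A" for A using ck(2) by (force simp: image_image)
    then show ?thesis
      unfolding riemann_sum_def ran pre check_measure_def
      by (subst sum.reindex) (use ck(2) inj in \<open>auto simp: inj_on_def\<close>)
  qed
  moreover have c: "continuous_on UNIV (\<lambda>x. f (ck x))"
    using continuous_on_compose2[OF f ck(1)] by simp
  ultimately show "cm_integral (check_measure ck \<mu>) f = cm_integral \<mu> (\<lambda>x. f (ck x))"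
    using LIMSEQ_unique[OF riemann_sum_tendsto[OF K cb r' f]] riemann_sum_tendsto[OF K mu r c] by simp
qed

end

section \<open>Convergence in the weak topology\<close>

lemma limitin_topology_generated_by:
  "limitin (topology_generated_by S) g l F \<longleftrightarrow>
     l \<in> \<Union>S \<and> (\<forall>s\<in>S. l \<in> s \<longrightarrow> (\<forall>\<^sub>F n in F. g n \<in> s))" (is "_ \<longleftrightarrow> ?R")
proof
  assume "limitin (topology_generated_by S) g l F"
  then show ?R unfolding limitin_def by (simp add: topology_generated_by_Basis)
next
  assume R: ?R
  have "\<forall>\<^sub>F n in F. g n \<in> U" if "generate_topology_on S U" "l \<in> U" for U
    using that
  proof (induction)
    case (Int a b)
    then show ?case by (auto intro: eventually_conj)
  next
    case (UN k)
    then obtain u where u: "u \<in> k" "l \<in> u" by auto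
    then have "\<forall>\<^sub>F n in F. g n \<in> u" using UN by auto
    then show ?case using u by (auto elim!: eventually_mono)
  qed (use R in auto)
  then show "limitin (topology_generated_by S) g l F"
    using R unfolding limitin_def by (simp add: openin_topology_generated_by_iff)
qed

lemma limitin_weak_topology:
  "limitin weak_topology m \<mu> F \<longleftrightarrow> \<mu> \<in> reg_measures \<and> (\<forall>\<^sub>F n in F. m n \<in> reg_measures) \<and>
     (\<forall>f. continuous_on UNIV f \<longrightarrow> ((\<lambda>n. cm_integral (m n) f) \<longlongrightarrow> cm_integral \<mu> f) F)" (is "_ \<longleftrightarrow> ?R")
proof -
  let ?S = "{{\<mu> \<in> reg_measures. cm_integral \<mu> f \<in> V} | f V. continuous_on UNIV f \<and> open V}"
  have basic: "{\<mu> \<in> reg_measures. cm_integral \<mu> f \<in> V} \<in> ?S" if "continuous_on UNIV f" "open V" for f V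
    using that by blast
  have R: "\<mu> \<in> \<Union> ?S \<longleftrightarrow> \<mu> \<in> reg_measures"
  proof
    assume "\<mu> \<in> reg_measures"
    then show "\<mu> \<in> \<Union> ?S" using basic[of "\<lambda>_. 0" UNIV] by blast
  qed blast
  show ?thesis
  proof
    assume "limitin weak_topology m \<mu> F"
    then have L: "\<mu> \<in> reg_measures \<and> (\<forall>s\<in>?S. \<mu> \<in> s \<longrightarrow> (\<forall>\<^sub>F n in F. m n \<in> s))"
      unfolding weak_topology_def limitin_topology_generated_by R .
    have L2: "\<forall>\<^sub>F n in F. m n \<in> reg_measures \<and> cm_integral (m n) f \<in> V"
      if "continuous_on UNIV f" "open V" "cm_integral \<mu> f \<in> V" for f V
      using L[THEN conjunct2, rule_format, OF basic[OF that(1,2)]] L[THEN conjunct1] that(3) by simp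
    show ?R
    proof (intro conjI allI impI topological_tendstoI)
      show "\<forall>\<^sub>F n in F. m n \<in> reg_measures" using L2[of "\<lambda>_. 0" UNIV] by simp
      show "\<forall>\<^sub>F n in F. cm_integral (m n) f \<in> V"
        if "continuous_on UNIV f" "open V" "cm_integral \<mu> f \<in> V" for f V
        using L2[OF that] by (rule eventually_mono) simp
    qed (fact L[THEN conjunct1])
  next
    assume r: ?R
    show "limitin weak_topology m \<mu> F"
      unfolding weak_topology_def limitin_topology_generated_by R
    proof (intro conjI ballI impI)
      fix s assume "s \<in> ?S" "\<mu> \<in> s"
      then obtain f V where s: "s = {\<mu> \<in> reg_measures. cm_integral \<mu> f \<in> V}" "continuous_on UNIV f" "open V"
        "cm_integral \<mu> f \<in> V" by blast
      have "((\<lambda>n. cm_integral (m n) f) \<longlongrightarrow> cm_integral \<mu> f) F"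
        using r[THEN conjunct2, THEN conjunct2, rule_format, OF s(2)] .
      then have "\<forall>\<^sub>F n in F. cm_integral (m n) f \<in> V" using s(3,4) by (rule topological_tendstoD)
      then show "\<forall>\<^sub>F n in F. m n \<in> s" unfolding s(1) using r by (simp add: eventually_conj)
    qed (use r in simp)
  qed
qed

section \<open>Translation and Haar measure\<close>

lemma integrable_pair_continuous:
  fixes F :: "'a::polish_space \<Rightarrow> 'a \<Rightarrow> complex"
  assumes K: "compact (UNIV :: 'a set)" and M: "finite_measure M" "sets M = sets borel"
    and N: "finite_measure N" "sets N = sets borel"
    and F: "continuous_on UNIV (\<lambda>(x, y). F x y)" and h: "integrable N h"
  shows "integrable (M \<Otimes>\<^sub>M N) (\<lambda>(x, y). F x y * h y)"
proof -
  interpret M: finite_measure M by fact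
  interpret N: finite_measure N by fact
  interpret pair_sigma_finite M N ..
  have "compact (UNIV :: ('a \<times> 'a) set)" using compact_Times[OF K K] by simp
  then obtain B where B: "\<And>p. norm ((\<lambda>(x, y). F x y) p) \<le> B"
    using continuous_on_compact_bounded[OF _ F] by blast
  have B': "cmod (F x y) \<le> B" for x y using B[of "(x, y)"] by simp
  have s: "sets (M \<Otimes>\<^sub>M N) = sets (borel :: ('a \<times> 'a) measure)"
    using sets_pair_measure_cong[OF M(2) N(2)] borel_prod by metis
  have mF: "(\<lambda>(x, y). F x y) \<in> borel_measurable (M \<Otimes>\<^sub>M N)"
    using borel_measurable_continuous_onI[OF F] measurable_cong_sets[OF s] by blast
  have mh: "h \<in> borel_measurable N" using h by auto
  have m: "(\<lambda>(x, y). F x y * h y) \<in> borel_measurable (M \<Otimes>\<^sub>M N)"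
  proof -
    have "(\<lambda>p. (\<lambda>(x, y). F x y) p * h (snd p)) \<in> borel_measurable (M \<Otimes>\<^sub>M N)"
      by (intro borel_measurable_times mF measurable_compose[OF measurable_snd mh])
    then show ?thesis by (simp add: case_prod_beta)
  qed
  have mFx: "(\<lambda>y. F x y) \<in> borel_measurable N" for x
    using measurable_compose[OF measurable_Pair1' mF, of x] sets_eq_imp_space_eq[OF M(2)] by simp
  have ix: "integrable N (\<lambda>y. F x y * h y)" for x
  proof (rule Bochner_Integration.integrable_bound)
    show "integrable N (\<lambda>y. of_real B * h y)" using h by auto
    show "AE y in N. norm (F x y * h y) \<le> norm (of_real B * h y)"
      using order_trans[OF B' abs_ge_self] by (intro AE_I2) (auto simp: norm_mult intro!: mult_right_mono)
  qed (use mFx[of x] mh in auto)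
  show ?thesis
  proof (rule Fubini_integrable[OF m])
    show "AE x in M. integrable N (\<lambda>y. case (x, y) of (x, y) \<Rightarrow> F x y * h y)" using ix by simp
    show "integrable M (\<lambda>x. LINT y|N. norm (case (x, y) of (x, y) \<Rightarrow> F x y * h y))"
    proof (rule M.integrable_const_bound)
      show "AE x in M. norm (LINT y|N. norm (case (x, y) of (x, y) \<Rightarrow> F x y * h y)) \<le> (LINT y|N. B * norm (h y))"
      proof (intro AE_I2)
        fix x
        have "(LINT y|N. norm (F x y * h y)) \<le> (LINT y|N. B * norm (h y))"
          using integrable_norm[OF ix[of x]] h B' by (intro integral_mono) (auto simp: norm_mult intro!: mult_right_mono)
        then show "norm (LINT y|N. norm (case (x, y) of (x, y) \<Rightarrow> F x y * h y)) \<le> (LINT y|N. B * norm (h y))"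
          by (simp add: integral_nonneg_AE)
      qed
      show "(\<lambda>x. LINT y|N. norm (case (x, y) of (x, y) \<Rightarrow> F x y * h y)) \<in> borel_measurable M"
        using m by (intro N.borel_measurable_lebesgue_integral) (auto simp: case_prod_beta)
    qed
  qed
qed

lemma Fubini_continuous_times:
  fixes F :: "'a::polish_space \<Rightarrow> 'a \<Rightarrow> complex"
  assumes K: "compact (UNIV :: 'a set)" and M: "finite_measure M" "sets M = sets borel"
    and N: "finite_measure N" "sets N = sets borel"
    and F: "continuous_on UNIV (\<lambda>(x, y). F x y)" and h: "integrable N h"
  shows "(LINT x|M. LINT y|N. F x y * h y) = (LINT y|N. (LINT x|M. F x y) * h y)"
proof -
  interpret M: finite_measure M by fact
  interpret N: finite_measure N by fact
  interpret pair_sigma_finite M N ..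
  have "(LINT y|N. LINT x|M. F x y * h y) = (LINT x|M. LINT y|N. F x y * h y)"
    by (rule Fubini_integral) (use integrable_pair_continuous[OF assms] in simp)
  then show ?thesis by simp
qed

lemma Fubini_continuous:
  fixes F :: "'a::polish_space \<Rightarrow> 'a \<Rightarrow> complex"
  assumes K: "compact (UNIV :: 'a set)" and M: "finite_measure M" "sets M = sets borel"
    and N: "finite_measure N" "sets N = sets borel"
    and F: "continuous_on UNIV (\<lambda>(x, y). F x y)"
  shows "(LINT x|M. LINT y|N. F x y) = (LINT y|N. LINT x|M. F x y)"
  using Fubini_continuous_times[OF assms finite_measure.integrable_const[OF N(1), of "1"]] by simp

lemma continuous_on_section:
  assumes "continuous_on UNIV (\<lambda>(x, y). F x y)"
  shows "continuous_on UNIV (\<lambda>y. F x y)" "continuous_on UNIV (\<lambda>x. F x y)"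
proof -
  have "continuous_on UNIV (\<lambda>y. (x, y))" "continuous_on UNIV (\<lambda>x. (x, y))"
    by (intro continuous_intros)+
  then show "continuous_on UNIV (\<lambda>y. F x y)" "continuous_on UNIV (\<lambda>x. F x y)"
    using continuous_on_compose2[OF assms, of UNIV "\<lambda>y. (x, y)"]
      continuous_on_compose2[OF assms, of UNIV "\<lambda>x. (x, y)"] by simp_all
qed

lemma continuous_on_param_integral:
  fixes F :: "'b::metric_space \<Rightarrow> 'a::polish_space \<Rightarrow> complex"
  assumes N: "sets N = sets borel" and w: "integrable N w"
    and F: "\<And>y. continuous_on UNIV (\<lambda>x. F x y)" "\<And>x. F x \<in> borel_measurable borel"
    and B: "\<And>x y. norm (F x y) \<le> w y"
  shows "continuous_on UNIV (\<lambda>x. LINT y|N. F x y)"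
  unfolding continuous_on_sequentially
proof (intro allI ballI impI, elim conjE)
  fix u :: "nat \<Rightarrow> 'b" and a assume u: "u \<longlonglongrightarrow> a"
  have mF: "F x \<in> borel_measurable N" for x
    using F(2)[of x] measurable_cong_sets[OF N] by blast
  show "((\<lambda>x. LINT y|N. F x y) \<circ> u) \<longlonglongrightarrow> (LINT y|N. F a y)"
    unfolding comp_def
  proof (rule integral_dominated_convergence[where w = w])
    show "AE y in N. (\<lambda>n. F (u n) y) \<longlonglongrightarrow> F a y"
      using continuous_on_tendsto_compose[OF F(1) u] by simp
  qed (use mF w B in auto)
qed

lemma uniformly_continuous_section:
  fixes F :: "'a::metric_space \<Rightarrow> 'a \<Rightarrow> 'b::metric_space"
  assumes K: "compact (UNIV :: 'a set)" and F: "continuous_on UNIV (\<lambda>(x, y). F x y)" and e: "\<epsilon> > 0"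
  shows "\<exists>\<delta>>0. \<forall>x x' y y'. dist x x' < \<delta> \<longrightarrow> dist y y' < \<delta> \<longrightarrow> dist (F x y) (F x' y') < \<epsilon>"
proof -
  have "compact (UNIV :: ('a \<times> 'a) set)" using compact_Times[OF K K] by simp
  then have "uniformly_continuous_on UNIV (\<lambda>(x, y). F x y)" by (rule compact_uniformly_continuous[OF F])
  then obtain d where d: "d > 0" "\<And>p q. dist q p < d \<Longrightarrow> dist ((\<lambda>(x, y). F x y) q) ((\<lambda>(x, y). F x y) p) < \<epsilon>"
    using e unfolding uniformly_continuous_on_def by (meson UNIV_I)
  have "dist (F x y) (F x' y') < \<epsilon>" if "dist x x' < d/2" "dist y y' < d/2" for x x' y y'
  proof -
    have "dist (x, y) (x', y') \<le> dist x x' + dist y y'"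
      unfolding dist_Pair_Pair using sqrt_sum_squares_le_sum[of "dist x x'" "dist y y'"] by simp
    then show ?thesis using d(2)[of "(x, y)" "(x', y')"] that by simp
  qed
  then show ?thesis using d(1) by (intro exI[of _ "d/2"]) auto
qed

locale haar_hypergroup = compact_hypergroup conv e ck
  for conv :: "('a::polish_space set \<Rightarrow> complex) \<Rightarrow> ('a set \<Rightarrow> complex) \<Rightarrow> 'a set \<Rightarrow> complex"
      (infixl \<open>\<star>\<close> 70)
    and e :: 'a and ck :: "'a \<Rightarrow> 'a" +
  fixes haar :: "'a measure"
  assumes haar: "haar_measure conv haar"
begin

section \<open>Translates of functions and the integral formula for the convolution\<close>

lemmas K = compact_UNIV

abbreviation cts :: "('a \<Rightarrow> complex) \<Rightarrow> bool" where "cts f \<equiv> continuous_on UNIV f"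

text \<open>The generalized translate, commonly written f(x * y). Once the convolution is expressed
  through it, the arguments take place among continuous functions.\<close>

definition tr :: "('a \<Rightarrow> complex) \<Rightarrow> 'a \<Rightarrow> 'a \<Rightarrow> complex" where
  "tr f x y = cm_integral (dirac x \<star> dirac y) f"

definition tmeas :: "'a \<Rightarrow> 'a \<Rightarrow> 'a measure" where
  "tmeas x y = meas_of (dirac x \<star> dirac y)"

lemma ck_ck [simp]: "ck (ck x) = x"
  using check_homeomorphism unfolding homeomorphism_def by auto

lemma ck_cont: "continuous_on UNIV ck"
  using check_homeomorphism unfolding homeomorphism_def by auto

lemma cts_ck: "cts f \<Longrightarrow> cts (\<lambda>x. f (ck x))"
  using continuous_on_compose2[of UNIV f UNIV ck] ck_cont by simp

lemma pos_reg: "\<mu> \<in> pos_measures \<Longrightarrow> \<mu> \<in> reg_measures" unfolding pos_measures_def by simp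

lemma reg_complex: "\<mu> \<in> reg_measures \<longleftrightarrow> complex_borel_measure (\<mu> :: 'a set \<Rightarrow> complex)"
  unfolding reg_measures_polish by simp

lemma dirac_reg: "dirac (x :: 'a) \<in> reg_measures"
  using dirac_pos[OF K] pos_reg by blast

lemma conv_dirac_pos: "dirac x \<star> dirac y \<in> pos_measures"
  using conv_dirac_prob unfolding prob_measures_def by auto

lemma sets_tmeas [simp]: "sets (tmeas x y) = sets borel"
  unfolding tmeas_def using meas_of[OF conv_dirac_pos] by auto

lemma space_tmeas [simp]: "space (tmeas x y) = UNIV"
  using sets_eq_imp_space_eq[OF sets_tmeas] by simp

lemma prob_tmeas: "prob_space (tmeas x y)"
proof (rule prob_spaceI)
  interpret finite_measure "tmeas x y" unfolding tmeas_def by (rule meas_of(1)[OF conv_dirac_pos])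
  have "complex_of_real (measure (tmeas x y) UNIV) = (dirac x \<star> dirac y) UNIV"
    unfolding tmeas_def using meas_of(3)[OF conv_dirac_pos] by metis
  also have "\<dots> = 1" using conv_dirac_prob unfolding prob_measures_def by simp
  finally show "emeasure (tmeas x y) (space (tmeas x y)) = 1" by (simp add: emeasure_eq_measure)
qed

lemma finite_tmeas: "finite_measure (tmeas x y)" using prob_tmeas prob_space.axioms(1) by blast

lemma tr_integral: "cts f \<Longrightarrow> tr f x y = (LINT t|tmeas x y. f t)"
  unfolding tr_def tmeas_def by (rule cm_integral_pos[OF K conv_dirac_pos])

lemma sets_haar [simp]: "sets haar = sets borel" using haar unfolding haar_measure_def by simp

lemma space_haar [simp]: "space haar = UNIV" using sets_eq_imp_space_eq[OF sets_haar] by simp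

lemma prob_haar: "prob_space haar"
  using haar unfolding haar_measure_def by (intro prob_spaceI) simp

lemma finite_haar: "finite_measure haar" using prob_haar prob_space.axioms(1) by blast

lemma haar_invariant: "cts f \<Longrightarrow> (LINT y|haar. tr f x y) = (LINT y|haar. f y)"
  using haar unfolding haar_measure_def tr_def by auto

lemma cts_borel_haar: "cts f \<Longrightarrow> f \<in> borel_measurable haar"
  using borel_measurable_continuous_onI measurable_cong_sets[OF sets_haar] by blast

lemma integrable_haar: "cts f \<Longrightarrow> integrable haar f"
  by (rule integrable_continuous[OF K finite_haar sets_haar])

lemma integrable_tmeas: "cts f \<Longrightarrow> integrable (tmeas x y) f"
  by (rule integrable_continuous[OF K finite_tmeas sets_tmeas])

text \<open>The continuity axiom in the form in which it is applied. All members have to be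
  positive, since the axiom concerns the cone only.\<close>

lemma conv_tendsto:
  assumes m: "\<And>n. m n \<in> pos_measures" "\<mu> \<in> pos_measures" "\<And>f. cts f \<Longrightarrow> ((\<lambda>n. cm_integral (m n) f) \<longlongrightarrow> cm_integral \<mu> f) F"
    and l: "\<And>n. l n \<in> pos_measures" "\<nu> \<in> pos_measures" "\<And>f. cts f \<Longrightarrow> ((\<lambda>n. cm_integral (l n) f) \<longlongrightarrow> cm_integral \<nu> f) F"
    and f: "cts f"
  shows "((\<lambda>n. cm_integral (m n \<star> l n) f) \<longlongrightarrow> cm_integral (\<mu> \<star> \<nu>) f) F"
proof -
  let ?W = "subtopology weak_topology pos_measures"
  have "limitin ?W m \<mu> F" "limitin ?W l \<nu> F"
    unfolding limitin_subtopology limitin_weak_topology using m l by (auto intro!: always_eventually pos_reg)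
  then have "limitin (prod_topology ?W ?W) (\<lambda>n. (m n, l n)) (\<mu>, \<nu>) F"
    unfolding limitin_pairwise by (simp add: comp_def)
  from continuous_map_limit[OF conv_weakly_continuous this]
  have "limitin weak_topology (\<lambda>n. m n \<star> l n) (\<mu> \<star> \<nu>) F" by (simp add: comp_def)
  then show ?thesis unfolding limitin_weak_topology using f by blast
qed

text \<open>Point masses depend weakly continuously on their points and are positive, so the joint
  continuity of the convolution on the cone passes to the pair of points.\<close>

lemma tr_continuous:
  assumes f: "cts f"
  shows "continuous_on UNIV (\<lambda>(x, y). tr f x y)"
  unfolding continuous_on_def
proof
  fix a :: "'a \<times> 'a"
  have "((\<lambda>p. cm_integral (dirac (fst p) \<star> dirac (snd p)) f) \<longlongrightarrow> cm_integral (dirac (fst a) \<star> dirac (snd a)) f) (at a)"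
  proof (rule conv_tendsto[OF dirac_pos[OF K] dirac_pos[OF K] _ dirac_pos[OF K] dirac_pos[OF K] _ f])
    fix g :: "'a \<Rightarrow> complex" assume g: "cts g"
    then have c: "isCont g x" for x by (simp add: continuous_on_eq_continuous_at)
    show "((\<lambda>p. cm_integral (dirac (fst p)) g) \<longlongrightarrow> cm_integral (dirac (fst a)) g) (at a)"
      unfolding cm_integral_dirac[OF K g] by (intro isCont_tendsto_compose[OF c] tendsto_intros)
    show "((\<lambda>p. cm_integral (dirac (snd p)) g) \<longlongrightarrow> cm_integral (dirac (snd a)) g) (at a)"
      unfolding cm_integral_dirac[OF K g] by (intro isCont_tendsto_compose[OF c] tendsto_intros)
  qed
  then show "((\<lambda>(x, y). tr f x y) \<longlongrightarrow> (case a of (x, y) \<Rightarrow> tr f x y)) (at a within UNIV)"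
    by (simp add: tr_def case_prod_beta')
qed

lemma cts_tr: "cts f \<Longrightarrow> cts (tr f x)" "cts f \<Longrightarrow> cts (\<lambda>x. tr f x y)"
  using continuous_on_section[OF tr_continuous] by auto

lemma conv_sum_left:
  assumes "finite T" "\<And>t. t \<in> T \<Longrightarrow> m t \<in> reg_measures" "\<nu> \<in> reg_measures"
  shows "(\<lambda>A. \<Sum>t\<in>T. c t * m t A) \<star> \<nu> = (\<lambda>A. \<Sum>t\<in>T. c t * (m t \<star> \<nu>) A)"
  using assms(1,2)
proof (induction T)
  case empty
  \<comment> \<open>The zero measure is 0 times a point mass, so homogeneity settles the empty
    sum.\<close>
  then show ?case using conv_scale_left[OF dirac_reg[of e] assms(3), of 0] by simp
next
  case (insert t T)
  have "(\<lambda>A. c t * m t A) \<in> reg_measures" "(\<lambda>A. \<Sum>t\<in>T. c t * m t A) \<in> reg_measures"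
    using insert(1,2) insert.prems cm_integral_sum_measure(1)[OF K, of T m "\<lambda>_. 0" c]
    by (auto simp: reg_complex intro: complex_borel_measure_scale)
  then show ?case
    using insert conv_add_left[of "\<lambda>A. c t * m t A" "\<lambda>A. \<Sum>t\<in>T. c t * m t A" \<nu>] assms(3)
    by (simp add: conv_scale_left)
qed

lemma conv_sum_right:
  assumes "finite T" "\<And>t. t \<in> T \<Longrightarrow> m t \<in> reg_measures" "\<nu> \<in> reg_measures"
  shows "\<nu> \<star> (\<lambda>A. \<Sum>t\<in>T. c t * m t A) = (\<lambda>A. \<Sum>t\<in>T. c t * (\<nu> \<star> m t) A)"
  using assms(1,2)
proof (induction T)
  case empty
  then show ?case using conv_scale_right[OF assms(3) dirac_reg[of e], of 0] by simp
next
  case (insert t T)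
  have "(\<lambda>A. c t * m t A) \<in> reg_measures" "(\<lambda>A. \<Sum>t\<in>T. c t * m t A) \<in> reg_measures"
    using insert(1,2) insert.prems cm_integral_sum_measure(1)[OF K, of T m "\<lambda>_. 0" c]
    by (auto simp: reg_complex intro: complex_borel_measure_scale)
  then show ?case
    using insert conv_add_right[of \<nu> "\<lambda>A. c t * m t A" "\<lambda>A. \<Sum>t\<in>T. c t * m t A"] assms(3)
    by (simp add: conv_scale_right)
qed

lemma cm_integral_conv_sum:
  assumes fin: "finite S" "finite T" and m: "\<And>t. t \<in> S \<Longrightarrow> m t \<in> reg_measures" "\<And>t. t \<in> T \<Longrightarrow> l t \<in> reg_measures"
    and f: "cts f"
  shows "cm_integral ((\<lambda>A. \<Sum>s\<in>S. a s * m s A) \<star> (\<lambda>A. \<Sum>t\<in>T. b t * l t A)) f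
    = (\<Sum>s\<in>S. a s * (\<Sum>t\<in>T. b t * cm_integral (m s \<star> l t) f))"
proof -
  have r: "(\<lambda>A. \<Sum>t\<in>T. b t * l t A) \<in> reg_measures"
    using m cm_integral_sum_measure(1)[OF K, of T l "\<lambda>_. 0" b] fin by (auto simp: reg_complex)
  have cb: "complex_borel_measure (m s \<star> l t)" if "s \<in> S" "t \<in> T" for s t
    using conv_closed m that reg_complex by blast
  have "(\<lambda>A. \<Sum>s\<in>S. a s * m s A) \<star> (\<lambda>A. \<Sum>t\<in>T. b t * l t A)
      = (\<lambda>A. \<Sum>s\<in>S. a s * (\<Sum>t\<in>T. b t * (m s \<star> l t) A))"
    using conv_sum_left[OF fin(1) m(1) r] conv_sum_right[OF fin(2) m(2) m(1)] by (auto intro!: sum.cong)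
  moreover have "cm_integral (\<lambda>A. \<Sum>s\<in>S. a s * (\<lambda>A. \<Sum>t\<in>T. b t * (m s \<star> l t) A) A) f
      = (\<Sum>s\<in>S. a s * cm_integral (\<lambda>A. \<Sum>t\<in>T. b t * (m s \<star> l t) A) f)"
    using cm_integral_sum_measure(1)[OF K cb f fin(2)] by (intro cm_integral_sum_measure(2)[OF K _ f fin(1)])
  moreover have "cm_integral (\<lambda>A. \<Sum>t\<in>T. b t * (m s \<star> l t) A) f = (\<Sum>t\<in>T. b t * cm_integral (m s \<star> l t) f)"
    if "s \<in> S" for s using cb[OF that] by (rule cm_integral_sum_measure(2)[OF K _ f fin(2)])
  ultimately show ?thesis by simp
qed

text \<open>The image of \<open>\<mu>\<close> under the tag map \<open>r\<close>. It is a finite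
  combination of point masses, on which bilinearity computes the convolution, and it stays in the
  positive cone, on which the convolution is continuous.\<close>

definition discretize :: "('a \<Rightarrow> 'a) \<Rightarrow> ('a set \<Rightarrow> complex) \<Rightarrow> 'a set \<Rightarrow> complex" where
  "discretize r \<mu> = (\<lambda>A. \<Sum>t\<in>range r. \<mu> (r -` {t}) * dirac t A)"

lemma discretize:
  assumes "finite (range r)" "\<mu> \<in> pos_measures"
  shows "discretize r \<mu> \<in> pos_measures" "cts f \<Longrightarrow> cm_integral (discretize r \<mu>) f = riemann_sum r \<mu> f"
proof -
  have d: "complex_borel_measure (dirac (t :: 'a))" for t using dirac_reg reg_complex by blast
  have "complex_borel_measure (discretize r \<mu>)"
    unfolding discretize_def using cm_integral_sum_measure(1)[OF K d _ assms(1), of "\<lambda>_. 0"] by simp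
  moreover have "discretize r \<mu> A \<in> \<real>\<^sub>\<ge>\<^sub>0" for A
  proof -
    have "\<mu> (r -` {t}) * dirac t A \<in> \<real>\<^sub>\<ge>\<^sub>0" for t
      using assms(2) dirac_pos[OF K] by (intro nonneg_Reals_mult_I) (auto simp: pos_measures_def)
    then show ?thesis unfolding discretize_def by (simp add: complex_nonneg_Reals_iff sum_nonneg)
  qed
  ultimately show "discretize r \<mu> \<in> pos_measures"
    unfolding pos_measures_def reg_measures_polish by simp
  show "cts f \<Longrightarrow> cm_integral (discretize r \<mu>) f = riemann_sum r \<mu> f"
    unfolding discretize_def riemann_sum_def
    using cm_integral_sum_measure(2)[OF K d _ assms(1), of f] cm_integral_dirac[OF K] by simp
qed

text \<open>Both factors are discretized along the same tagging. On the discretizations bilinearity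
  yields an iterated Riemann sum of \<open>tr f\<close>; the left side converges by weak continuity
  on the cone and the right side by two dominated convergences.\<close>

lemma conv_integral_pos:
  assumes mu: "\<mu> \<in> pos_measures" and nu: "\<nu> \<in> pos_measures" and f: "cts f"
  shows "cm_integral (\<mu> \<star> \<nu>) f = (LINT x|meas_of \<mu>. LINT y|meas_of \<nu>. tr f x y)"
proof -
  obtain r :: "nat \<Rightarrow> 'a \<Rightarrow> 'a" where r: "tagging r" using tagging_exists[OF K] by blast
  then have rf: "finite (range (r n))" "r n -` {t} \<in> sets borel" for n t by (auto simp: tagging_def)
  have rl: "(\<lambda>n. r n x) \<longlonglongrightarrow> x" for x unfolding tendsto_iff
    using r unfolding tagging_def by (auto elim!: allE eventually_mono)
  let ?M = "meas_of \<mu>" and ?N = "meas_of \<nu>"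
  note M = meas_of(1,2)[OF mu] and N = meas_of(1,2)[OF nu]
  interpret M: finite_measure ?M by (rule M)
  interpret N: finite_measure ?N by (rule N)
  have cb: "complex_borel_measure \<mu>" "complex_borel_measure \<nu>" using mu nu pos_reg reg_complex by auto
  have "compact (UNIV :: ('a \<times> 'a) set)" using compact_Times[OF K K] by simp
  then obtain B where B: "\<And>p. norm ((\<lambda>(x, y). tr f x y) p) \<le> B"
    using continuous_on_compact_bounded[OF _ tr_continuous[OF f]] by blast
  have B': "cmod (tr f x y) \<le> B" for x y using B[of "(x, y)"] by simp
  have lim: "(\<lambda>n. cm_integral (discretize (r n) \<mu> \<star> discretize (r n) \<nu>) f) \<longlonglongrightarrow> cm_integral (\<mu> \<star> \<nu>) f"
    using riemann_sum_tendsto[OF K _ r] cb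
    by (intro conv_tendsto f mu nu discretize rf) (simp_all add: discretize(2)[OF rf(1)] mu nu)
  have "cm_integral (discretize (r n) \<mu> \<star> discretize (r n) \<nu>) f =
      (LINT x|?M. LINT y|?N. tr f (r n x) (r n y))" for n
  proof -
    have "cm_integral (discretize (r n) \<mu> \<star> discretize (r n) \<nu>) f =
       riemann_sum (r n) \<mu> (\<lambda>s. riemann_sum (r n) \<nu> (\<lambda>t. tr f s t))"
      unfolding discretize_def riemann_sum_def
      using cm_integral_conv_sum[OF rf(1) rf(1) dirac_reg dirac_reg f] by (simp add: tr_def)
    also have "(\<lambda>s. riemann_sum (r n) \<nu> (\<lambda>t. tr f s t)) = (\<lambda>s. LINT y|?N. tr f s (r n y))"
      using riemann_sum_integral(1)[OF N rf] meas_of(3)[OF nu, symmetric] by simp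
    also have "riemann_sum (r n) \<mu> \<dots> = (LINT x|?M. LINT y|?N. tr f (r n x) (r n y))"
      using riemann_sum_integral(1)[OF M rf, of n] meas_of(3)[OF mu, symmetric] by simp
    finally show ?thesis .
  qed
  moreover have "(\<lambda>n. LINT x|?M. LINT y|?N. tr f (r n x) (r n y)) \<longlonglongrightarrow> (LINT x|?M. LINT y|?N. tr f x y)"
  proof (rule integral_dominated_convergence[where w = "\<lambda>_. B * measure ?N (space ?N)"])
    show "(\<lambda>x. LINT y|?N. tr f (r n x) (r n y)) \<in> borel_measurable ?M" for n
      using riemann_sum_integral(2)[OF M rf(1)[of n] rf(2), of "\<lambda>s. LINT y|?N. tr f s (r n y)"]
      by (simp add: borel_measurable_integrable)
    have "continuous_on UNIV (\<lambda>x. LINT y|?N. tr f x y)"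
      using cts_tr[OF f] B' N by (intro continuous_on_param_integral[of _ "\<lambda>_. B"])
        (auto intro: borel_measurable_continuous_onI)
    then show "(\<lambda>x. LINT y|?N. tr f x y) \<in> borel_measurable ?M"
      using borel_measurable_continuous_onI measurable_cong_sets[OF M(2)] by blast
    show "AE x in ?M. (\<lambda>n. LINT y|?N. tr f (r n x) (r n y)) \<longlonglongrightarrow> (LINT y|?N. tr f x y)"
    proof (intro AE_I2)
      fix x
      show "(\<lambda>n. LINT y|?N. tr f (r n x) (r n y)) \<longlonglongrightarrow> (LINT y|?N. tr f x y)"
      proof (rule integral_dominated_convergence[where w = "\<lambda>_. B"])
        show "(\<lambda>y. tr f (r n x) (r n y)) \<in> borel_measurable ?N" for n
          using riemann_sum_integral(2)[OF N rf(1)[of n] rf(2), of "tr f (r n x)"]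
          by (simp add: borel_measurable_integrable)
        show "tr f x \<in> borel_measurable ?N"
          using borel_measurable_continuous_onI[OF cts_tr(1)[OF f]] measurable_cong_sets[OF N(2)] by blast
        show "AE y in ?N. (\<lambda>n. tr f (r n x) (r n y)) \<longlonglongrightarrow> tr f x y"
          using continuous_on_tendsto_compose[OF tr_continuous[OF f] tendsto_Pair[OF rl rl]] by simp
      qed (use B' in auto)
    qed
    show "AE x in ?M. norm (LINT y|?N. tr f (r n x) (r n y)) \<le> B * measure ?N (space ?N)" for n
    proof (intro AE_I2)
      fix x
      have "norm (LINT y|?N. tr f (r n x) (r n y)) \<le> (LINT y|?N. norm (tr f (r n x) (r n y)))"
        by (rule integral_norm_bound)
      also have "\<dots> \<le> (LINT y|?N. B)"
        using riemann_sum_integral(2)[OF N rf(1)[of n] rf(2), of "tr f (r n x)"] B' by (intro integral_mono) auto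
      finally show "norm (LINT y|?N. tr f (r n x) (r n y)) \<le> B * measure ?N (space ?N)" by (simp add: mult.commute)
    qed
  qed auto
  ultimately show ?thesis using LIMSEQ_unique[OF lim] by simp
qed


lemma cts_tr_integral: "finite_measure N \<Longrightarrow> sets N = sets borel \<Longrightarrow> cts f \<Longrightarrow> cts (\<lambda>x. LINT y|N. tr f x y)"
proof -
  assume N: "finite_measure N" "sets N = sets borel" and f: "cts f"
  have "compact (UNIV :: ('a \<times> 'a) set)" using compact_Times[OF K K] by simp
  then obtain B where B: "\<And>p. norm ((\<lambda>(x, y). tr f x y) p) \<le> B"
    using continuous_on_compact_bounded[OF _ tr_continuous[OF f]] by blast
  have B': "cmod (tr f x y) \<le> B" for x y using B[of "(x, y)"] by simp
  show ?thesis
    using cts_tr[OF f] B' N by (intro continuous_on_param_integral[of _ "\<lambda>_. B"])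
        (auto intro: borel_measurable_continuous_onI finite_measure.integrable_const)
qed

text \<open>Continuity is available only for positive measures, so both factors are split into their
  four Jordan parts and the positive case is recombined by bilinearity.\<close>

lemma conv_integral:
  assumes mu: "\<mu> \<in> reg_measures" and nu: "\<nu> \<in> reg_measures" and f: "cts f"
  shows "cm_integral (\<mu> \<star> \<nu>) f = cm_integral \<mu> (\<lambda>x. cm_integral \<nu> (tr f x))"
    "cts (\<lambda>x. cm_integral \<nu> (tr f x))"
proof -
  obtain M :: "nat \<Rightarrow> 'a measure" and a where M: "\<And>i. finite_measure (M i)" "\<And>i. sets (M i) = sets borel"
      "\<And>i. cmod (a i) = 1" "\<mu> = (\<lambda>A. \<Sum>i<4. a i * complex_of_real (measure (M i) A))"
    by (rule complex_Jordan[OF mu[unfolded reg_complex]]) (rule that)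
  obtain N :: "nat \<Rightarrow> 'a measure" and b where N: "\<And>i. finite_measure (N i)" "\<And>i. sets (N i) = sets borel"
      "\<And>i. cmod (b i) = 1" "\<nu> = (\<lambda>A. \<Sum>i<4. b i * complex_of_real (measure (N i) A))"
    by (rule complex_Jordan[OF nu[unfolded reg_complex]]) (rule that)
  define m where "m i = (\<lambda>A. complex_of_real (measure (M i) A))" for i
  define n where "n i = (\<lambda>A. complex_of_real (measure (N i) A))" for i
  have mp: "m i \<in> pos_measures" and np: "n i \<in> pos_measures" for i
    unfolding m_def n_def using pos_measures_of_measure M N by blast+
  then have mc: "complex_borel_measure (m i)" and nc: "complex_borel_measure (n i)"
    and mr: "m i \<in> reg_measures" and nr: "n i \<in> reg_measures" for i
    using pos_reg reg_complex by blast+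
  have mu_eq: "\<mu> = (\<lambda>A. \<Sum>i<4. a i * m i A)" and nu_eq: "\<nu> = (\<lambda>A. \<Sum>i<4. b i * n i A)"
    using M N unfolding m_def n_def by blast+
  have c: "cts (\<lambda>x. cm_integral (n i) (tr f x))" for i
    using cts_tr_integral[OF N(1,2) f] cm_integral_of_measure[OF K N(1,2) cts_tr(1)[OF f]]
    unfolding n_def by simp
  have pos: "cm_integral (m i \<star> n j) f = cm_integral (m i) (\<lambda>x. cm_integral (n j) (tr f x))" for i j
    using conv_integral_pos[OF mp np f] cm_integral_pos[OF K mp c] cm_integral_pos[OF K np cts_tr(1)[OF f]] by simp
  have nu_int: "cm_integral \<nu> (tr f x) = (\<Sum>j<4. b j * cm_integral (n j) (tr f x))" for x
    unfolding nu_eq by (rule cm_integral_sum_measure(2)[OF K nc cts_tr(1)[OF f]]) simp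
  show "cts (\<lambda>x. cm_integral \<nu> (tr f x))" unfolding nu_int by (intro continuous_intros c)
  have "cm_integral (\<mu> \<star> \<nu>) f = (\<Sum>i<4. a i * (\<Sum>j<4. b j * cm_integral (m i \<star> n j) f))"
    unfolding mu_eq nu_eq by (rule cm_integral_conv_sum[OF _ _ mr nr f]) auto
  also have "\<dots> = (\<Sum>i<4. a i * cm_integral (m i) (\<lambda>x. cm_integral \<nu> (tr f x)))"
    unfolding pos nu_int using cm_integral_sum_fun[OF K mc, of "{..<4}" "\<lambda>j x. cm_integral (n j) (tr f x)" _ b] c by simp
  also have "\<dots> = cm_integral \<mu> (\<lambda>x. cm_integral \<nu> (tr f x))"
    unfolding mu_eq using cm_integral_sum_measure(2)[OF K mc \<open>cts (\<lambda>x. cm_integral \<nu> (tr f x))\<close>, of "{..<4}" a] by simp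
  finally show "cm_integral (\<mu> \<star> \<nu>) f = cm_integral \<mu> (\<lambda>x. cm_integral \<nu> (tr f x))" .
qed

text \<open>Associativity for three point masses, read on functions: f((x * y) * z) = f(x * (y *
  z)).\<close>

lemma tr_assoc: "cts f \<Longrightarrow> tr (\<lambda>t. tr f t z) x y = tr (tr f x) y z"
proof -
  assume f: "cts f"
  have r: "dirac x \<star> dirac y \<in> reg_measures" "dirac y \<star> dirac z \<in> reg_measures"
    using conv_dirac_pos pos_reg by blast+
  have "tr (\<lambda>t. tr f t z) x y = cm_integral ((dirac x \<star> dirac y) \<star> dirac z) f"
    using conv_integral(1)[OF r(1) dirac_reg f] cm_integral_dirac[OF K cts_tr(1)[OF f]] by (simp add: tr_def)
  also have "\<dots> = cm_integral (dirac x \<star> (dirac y \<star> dirac z)) f"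
    using conv_assoc[OF dirac_reg dirac_reg dirac_reg] by simp
  also have "\<dots> = tr (tr f x) y z"
    using conv_integral[OF dirac_reg r(2) f] cm_integral_dirac[OF K conv_integral(2)[OF dirac_reg r(2) f]]
      cm_integral_dirac[OF K conv_integral(2)[OF r(2) r(2) f]]
    by (simp add: tr_def[of "tr f x"])
  finally show ?thesis .
qed

lemma tr_unit [simp]: "cts f \<Longrightarrow> tr f x e = f x" "cts f \<Longrightarrow> tr f e x = f x"
  unfolding tr_def unit by (simp_all add: cm_integral_dirac[OF K])

lemma check_dirac: "check_measure ck (dirac x) = dirac (ck x)"
proof
  fix A :: "'a set"
  have im: "ck ` A = ck -` A" for A by (auto intro: rev_image_eqI)
  have 1: "B \<in> sets borel \<Longrightarrow> ck ` B \<in> sets borel" for B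
    unfolding im using measurable_sets[OF borel_measurable_continuous_onI[OF ck_cont]] by force
  have "ck ` ck ` A = A" by (force simp: image_image)
  then have "ck ` A \<in> sets borel \<longleftrightarrow> A \<in> sets borel" using 1 by metis
  then show "check_measure ck (dirac x) A = dirac (ck x) A"
    unfolding check_measure_def dirac_def im by simp
qed

lemma tr_check: "cts f \<Longrightarrow> tr f (ck y) (ck x) = tr (\<lambda>t. f (ck t)) x y"
proof -
  assume f: "cts f"
  have cb: "complex_borel_measure (dirac x \<star> dirac y)" using conv_dirac_pos pos_reg reg_complex by blast
  have "tr f (ck y) (ck x) = cm_integral (check_measure ck (dirac x \<star> dirac y)) f"
    unfolding tr_def check_involution[OF dirac_reg dirac_reg] check_dirac ..
  also have "\<dots> = tr (\<lambda>t. f (ck t)) x y"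
    unfolding tr_def by (rule cm_integral_check(2)[OF K cb f ck_cont ck_ck])
  finally show ?thesis .
qed

lemma tr_sum: "(\<And>i. i \<in> I \<Longrightarrow> cts (f i)) \<Longrightarrow> tr (\<lambda>t. \<Sum>i\<in>I. a i * f i t) x y = (\<Sum>i\<in>I. a i * tr (f i) x y)"
  unfolding tr_def using conv_dirac_pos pos_reg reg_complex by (intro cm_integral_sum_fun[OF K]) blast+

lemma tr_add: "cts f \<Longrightarrow> cts g \<Longrightarrow> tr (\<lambda>t. f t + g t) x y = tr f x y + tr g x y"
  using tr_sum[of "{False, True}" "\<lambda>b. if b then g else f" "\<lambda>_. 1"] by simp

lemma tr_scale: "cts f \<Longrightarrow> tr (\<lambda>t. c * f t) x y = c * tr f x y"
  using tr_sum[of "{()}" "\<lambda>_. f" "\<lambda>_. c"] by simp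

lemma tr_cnj: "cts f \<Longrightarrow> tr (\<lambda>t. cnj (f t)) x y = cnj (tr f x y)"
  by (simp add: tr_integral continuous_on_cnj)

lemma tr_const: "tr (\<lambda>_. c) x y = c"
proof -
  interpret prob_space "tmeas x y" by (rule prob_tmeas)
  show ?thesis by (simp add: tr_integral prob_space[unfolded space_tmeas])
qed

lemma tr_diff: "cts f \<Longrightarrow> cts g \<Longrightarrow> tr (\<lambda>t. f t - g t) x y = tr f x y - tr g x y"
  using tr_add[of f "\<lambda>t. (-1) * g t"] tr_scale[of g "-1"] by (simp add: continuous_on_minus)

lemma tr_bound:
  assumes f: "cts f" and B: "\<And>t. cmod (f t) \<le> B"
  shows "cmod (tr f x y) \<le> B"
proof -
  interpret prob_space "tmeas x y" by (rule prob_tmeas)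
  have "cmod (tr f x y) \<le> (LINT t|tmeas x y. cmod (f t))"
    unfolding tr_integral[OF f] by (rule integral_norm_bound)
  also have "\<dots> \<le> (LINT t|tmeas x y. B)"
    using integrable_norm[OF integrable_tmeas[OF f]] B by (intro integral_mono) auto
  finally show ?thesis by (simp add: prob_space[unfolded space_tmeas])
qed

lemma tr_nonneg:
  assumes f: "cts f" and nn: "\<And>t. f t = complex_of_real (g t)" "\<And>t. 0 \<le> g t"
  shows "tr f x y = complex_of_real (Re (tr f x y))" "0 \<le> Re (tr f x y)"
proof -
  have "tr f x y = complex_of_real (LINT t|tmeas x y. g t)"
    unfolding tr_integral[OF f] nn(1) by simp
  moreover have "0 \<le> (LINT t|tmeas x y. g t)" using nn(2) by simp
  ultimately show "tr f x y = complex_of_real (Re (tr f x y))" "0 \<le> Re (tr f x y)" by auto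
qed

section \<open>Supports of convolved point masses and of the Haar measure\<close>

lemma total_variation_pos:
  fixes M :: "'a measure"
  assumes M: "finite_measure M" "sets M = sets borel" and A: "A \<in> sets borel"
  shows "total_variation (\<lambda>A. complex_of_real (measure M A)) A = measure M A"
  unfolding total_variation_def
proof (rule cSup_eq_maximum)
  interpret finite_measure M by fact
  show "measure M A \<in> (\<lambda>P. \<Sum>B\<in>P. cmod (complex_of_real (measure M B))) `
      {P. finite P \<and> P \<subseteq> sets borel \<and> disjoint P \<and> \<Union> P \<subseteq> A}"
    using A by (intro image_eqI[of _ _ "{A}"]) auto
  fix s assume "s \<in> (\<lambda>P. \<Sum>B\<in>P. cmod (complex_of_real (measure M B))) `
      {P. finite P \<and> P \<subseteq> sets borel \<and> disjoint P \<and> \<Union> P \<subseteq> A}"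
  then obtain P where P: "finite P" "P \<subseteq> sets borel" "disjoint P" "\<Union>P \<subseteq> A"
    and s: "s = (\<Sum>B\<in>P. measure M B)" by auto
  have "(\<Sum>B\<in>P. measure M B) = measure M (\<Union>B\<in>P. B)"
    using P M by (intro finite_measure_finite_Union[symmetric]) (auto simp: disjoint_def disjoint_family_on_def)
  also have "\<dots> \<le> measure M A" using P A M by (intro finite_measure_mono) auto
  finally show "s \<le> measure M A" unfolding s .
qed

lemma msupp_tmeas: "msupp (dirac x \<star> dirac y) = {t. \<forall>U. open U \<longrightarrow> t \<in> U \<longrightarrow> measure (tmeas x y) U \<noteq> 0}"
proof -
  have "total_variation (dirac x \<star> dirac y) U = measure (tmeas x y) U" if "open U" for U
    using total_variation_pos[OF finite_tmeas[of x y] sets_tmeas, of U] that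
    unfolding tmeas_def using meas_of(3)[OF conv_dirac_pos[of x y]] by simp
  then show ?thesis unfolding msupp_def by auto
qed

lemma tmeas_null_outside_supp:
  assumes C: "compact C" "C \<inter> msupp (dirac x \<star> dirac y) = {}"
  shows "measure (tmeas x y) C = 0"
proof -
  interpret prob_space "tmeas x y" by (rule prob_tmeas)
  have "\<forall>t\<in>C. \<exists>U. open U \<and> t \<in> U \<and> measure (tmeas x y) U = 0" using C(2) unfolding msupp_tmeas by blast
  then obtain U where U: "\<And>t. t \<in> C \<Longrightarrow> open (U t) \<and> t \<in> U t \<and> measure (tmeas x y) (U t) = 0" by metis
  obtain T where T: "T \<subseteq> C" "finite T" "C \<subseteq> (\<Union>t\<in>T. U t)"
    by (rule compactE_image[OF C(1), of C U]) (use U in auto)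
  have "measure (tmeas x y) C \<le> measure (tmeas x y) (\<Union>t\<in>T. U t)"
    using T U by (intro finite_measure_mono) (auto intro!: borel_open)
  also have "\<dots> \<le> (\<Sum>t\<in>T. measure (tmeas x y) (U t))"
    using T U by (intro finite_measure_subadditive_finite) (auto intro!: borel_open)
  also have "\<dots> = 0" using T U by (intro sum.neutral) auto
  finally show ?thesis using measure_nonneg[of "tmeas x y" C] by simp
qed

lemma closed_msupp: "closed (msupp (dirac x \<star> dirac y))"
  unfolding msupp_tmeas closed_def open_subopen[of "- _"] by blast

text \<open>For y \<noteq> z the unit lies outside the support of the convolution of
  \<open>dirac (ck y)\<close> and \<open>dirac z\<close>. That support varies continuously, and the
  pairs at distance at least \<open>\<epsilon>\<close> form a compact set, so one ball around
  \<open>e\<close> is missed by all these supports.\<close>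

lemma separation:
  assumes e: "\<epsilon> > 0"
  shows "\<exists>r>0. \<forall>y z. \<epsilon> \<le> dist y z \<longrightarrow> cball e r \<inter> msupp (dirac (ck y) \<star> dirac z) = {}"
proof -
  define D where "D = {p :: 'a \<times> 'a. \<epsilon> \<le> dist (fst p) (snd p)}"
  have "closed D" unfolding D_def by (intro closed_Collect_le continuous_intros)
  moreover have "compact (UNIV :: ('a \<times> 'a) set)" using compact_Times[OF K K] by simp
  ultimately have D: "compact D" using compact_Int_closed[of UNIV D] by simp
  have ex: "\<exists>r U. r > 0 \<and> open U \<and> p \<in> U \<and> (\<forall>q\<in>U. cball e r \<inter> msupp (dirac (ck (fst q)) \<star> dirac (snd q)) = {})"
    if p: "p \<in> D" for p
  proof -
    have "fst p \<noteq> snd p" using p e unfolding D_def by auto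
    then have "ck (fst p) \<noteq> ck (snd p)" by (metis ck_ck)
    then have "e \<in> - msupp (dirac (ck (fst p)) \<star> dirac (snd p))" using unit_in_supp by auto
    then obtain r where r: "r > 0" "cball e r \<subseteq> - msupp (dirac (ck (fst p)) \<star> dirac (snd p))"
      using closed_msupp open_contains_cball open_Compl by metis
    \<comment> \<open>Compact sets contained in the complement of a closed ball form a basic
      Vietoris-open set; hence the ball is missed by the supports of all nearby pairs as
      well.\<close>
    define V where "V = {C :: 'a set. compact C \<and> C \<noteq> {} \<and> C \<subseteq> - cball e r}"
    have V: "openin vietoris_topology V"
      unfolding vietoris_topology_def V_def by (rule topology_generated_by_Basis) (auto intro!: exI[of _ "- cball e r"])
    define U where "U = {q. msupp (dirac (ck (fst q)) \<star> dirac (snd q)) \<in> V}"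
    have "open ((\<lambda>(x, y). msupp (dirac x \<star> dirac y)) -` V)"
      using openin_continuous_map_preimage[OF supp_continuous V] by (simp add: vimage_def)
    moreover have "continuous_on UNIV (\<lambda>q :: 'a \<times> 'a. (ck (fst q), snd q))"
      by (intro continuous_intros continuous_on_compose2[OF ck_cont]) auto
    ultimately have "open ((\<lambda>q. (ck (fst q), snd q)) -` ((\<lambda>(x, y). msupp (dirac x \<star> dirac y)) -` V))"
      by (rule open_vimage)
    also have "\<dots> = U" unfolding U_def by auto
    finally have "open U" .
    moreover have "p \<in> U"
    proof -
      have "msupp (dirac (ck (fst p)) \<star> dirac (snd p)) \<in> topspace vietoris_topology"
        using supp_continuous unfolding continuous_map_def by (auto simp: Pi_iff)
      then have "msupp (dirac (ck (fst p)) \<star> dirac (snd p)) \<noteq> {}"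
        unfolding vietoris_topology_def by auto
      then show ?thesis using conv_dirac_compact_supp r unfolding U_def V_def by auto
    qed
    moreover have "cball e r \<inter> msupp (dirac (ck (fst q)) \<star> dirac (snd q)) = {}" if "q \<in> U" for q
      using that unfolding U_def V_def by auto
    ultimately show ?thesis using r(1) by blast
  qed
  then obtain r U where rU: "\<And>p. p \<in> D \<Longrightarrow> r p > 0 \<and> open (U p) \<and> p \<in> U p \<and>
      (\<forall>q\<in>U p. cball e (r p) \<inter> msupp (dirac (ck (fst q)) \<star> dirac (snd q)) = {})" by metis
  obtain T where T: "T \<subseteq> D" "finite T" "D \<subseteq> (\<Union>p\<in>T. U p)"
    by (rule compactE_image[OF D, of D U]) (use rU in auto)
  define R where "R = Min (insert 1 (r ` T))"
  have R: "R > 0" unfolding R_def using T rU by (subst Min_gr_iff) auto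
  have "cball e R \<inter> msupp (dirac (ck y) \<star> dirac z) = {}" if "\<epsilon> \<le> dist y z" for y z
  proof -
    have "(y, z) \<in> D" using that unfolding D_def by simp
    then obtain p where p: "p \<in> T" "(y, z) \<in> U p" using T by blast
    then have "cball e (r p) \<inter> msupp (dirac (ck y) \<star> dirac z) = {}" using rU[of p] T by fastforce
    moreover have "R \<le> r p" unfolding R_def using p T by (intro Min_le) auto
    ultimately show ?thesis by (meson disjoint_iff subset_cball subsetD)
  qed
  then show ?thesis using R by blast
qed

text \<open>By compactness some point \<open>y0\<close> lies in the support of the Haar measure. If
  \<open>g\<close> is nonzero at \<open>x\<close>, some translate of \<open>g\<close> is positive at
  \<open>y0\<close>: otherwise f(x * ck y0 * y0) would vanish, although \<open>e\<close> is in the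
  support of ck y0 * y0 and f(x * e) > 0. Left invariance then makes the integral of
  \<open>g\<close> positive.\<close>

lemma haar_full_support:
  assumes g: "continuous_on UNIV g" "\<And>x. 0 \<le> g x" and z: "(LINT x|haar. g x) = (0::real)"
  shows "g x = 0"
proof (rule ccontr)
  interpret prob_space haar by (rule prob_haar)
  assume gx: "g x \<noteq> 0"
  define f where "f t = complex_of_real (g t)" for t
  have f: "cts f" unfolding f_def by (intro continuous_intros g)
  have "\<exists>y0. \<forall>U. open U \<longrightarrow> y0 \<in> U \<longrightarrow> measure haar U \<noteq> 0"
  proof (rule ccontr)
    assume "\<nexists>y0. \<forall>U. open U \<longrightarrow> y0 \<in> U \<longrightarrow> measure haar U \<noteq> 0"
    then have "\<forall>y. \<exists>U. open U \<and> y \<in> U \<and> measure haar U = 0" by blast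
    then obtain U where U: "\<And>y. open (U y) \<and> y \<in> U y \<and> measure haar (U y) = 0" by metis
    obtain T where T: "finite T" "UNIV \<subseteq> (\<Union>t\<in>T. U t)"
      by (rule compactE_image[OF K, of UNIV U]) (use U in auto)
    have "measure haar UNIV \<le> measure haar (\<Union>t\<in>T. U t)"
      using T U by (intro finite_measure_mono) (auto intro!: borel_open)
    also have "\<dots> \<le> (\<Sum>t\<in>T. measure haar (U t))"
      using T U by (intro finite_measure_subadditive_finite) (auto intro!: borel_open)
    also have "\<dots> = 0" using T U by (intro sum.neutral) auto
    finally show False using prob_space by simp
  qed
  then obtain y0 where y0: "\<And>U. open U \<Longrightarrow> y0 \<in> U \<Longrightarrow> measure haar U \<noteq> 0" by blast
  text \<open>Translating by \<open>x * y0\<close>-check moves the mass of \<open>g\<close> near \<open>x\<close> to \<open>y0\<close>.\<close>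
  have sup: "\<exists>w. 0 < Re (tr f w y0)"
  proof -
    have "e \<in> msupp (dirac (ck y0) \<star> dirac y0)" using unit_in_supp by simp
    define h where "h t = tr f x t" for t
    have h: "cts h" unfolding h_def using cts_tr(1)[OF f] by simp
    have hr: "h t = complex_of_real (Re (h t))" "0 \<le> Re (h t)" for t
      unfolding h_def using tr_nonneg[OF f f_def g(2)] by auto
    have he: "Re (h e) > 0" unfolding h_def using f gx g(2)[of x] by (simp add: f_def)
    define V where "V = {t. Re (h e) / 2 < Re (h t)}"
    have V: "open V" unfolding V_def using h by (intro open_Collect_less continuous_intros) auto
    have eV: "e \<in> V" using he unfolding V_def by simp
    have mV: "measure (tmeas (ck y0) y0) V > 0"
      using \<open>e \<in> msupp _\<close> V eV unfolding msupp_tmeas using measure_nonneg[of "tmeas (ck y0) y0" V] by (metis (mono_tags, lifting) less_eq_real_def mem_Collect_eq)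
    interpret T: prob_space "tmeas (ck y0) y0" by (rule prob_tmeas)
    have "0 < Re (h e) / 2 * measure (tmeas (ck y0) y0) V" using he mV by simp
    also have "\<dots> = (LINT t|tmeas (ck y0) y0. Re (h e) / 2 * indicator V t)" using V by simp
    also have "\<dots> \<le> (LINT t|tmeas (ck y0) y0. Re (h t))"
    proof (rule integral_mono)
      show "integrable (tmeas (ck y0) y0) (\<lambda>t. Re (h e) / 2 * indicator V t)"
        using V by (intro integrable_mult_right) (auto simp: T.emeasure_eq_measure)
      show "integrable (tmeas (ck y0) y0) (\<lambda>t. Re (h t))" using integrable_tmeas[OF h] by simp
      show "Re (h e) / 2 * indicator V t \<le> Re (h t)" for t
        using hr(2)[of t] by (auto simp: indicator_def V_def)
    qed
    also have "\<dots> = Re (tr h (ck y0) y0)"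
      unfolding tr_integral[OF h] using integrable_tmeas[OF h] by simp
    also have "tr h (ck y0) y0 = tr (\<lambda>t. tr f t y0) x (ck y0)"
      unfolding h_def using tr_assoc[OF f, of y0 x "ck y0"] by (simp add: h_def[abs_def])
    finally have pos: "0 < Re (tr (\<lambda>t. tr f t y0) x (ck y0))" .
    show ?thesis
    proof (rule ccontr)
      assume "\<not> ?thesis"
      then have "tr f w y0 = 0" for w using tr_nonneg[OF f f_def g(2), of w y0] by (metis antisym_conv1 of_real_0)
      then show False using pos tr_const[of 0] by simp
    qed
  qed
  then obtain w where w: "0 < Re (tr f w y0)" by blast
  define U where "U = {y. Re (tr f w y0) / 2 < Re (tr f w y)}"
  have U: "open U" unfolding U_def using cts_tr(1)[OF f] by (intro open_Collect_less continuous_intros) auto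
  have "measure haar U \<noteq> 0" using y0[OF U] w unfolding U_def by simp
  then have mU: "measure haar U > 0" using measure_nonneg[of haar U] by linarith
  have "0 < Re (tr f w y0) / 2 * measure haar U" using w mU by simp
  also have "\<dots> = (LINT y|haar. Re (tr f w y0) / 2 * indicator U y)" using U by simp
  also have "\<dots> \<le> (LINT y|haar. Re (tr f w y))"
  proof (rule integral_mono)
    show "integrable haar (\<lambda>t. Re (tr f w y0) / 2 * indicator U t)"
      using U by (intro integrable_mult_right) (auto simp: emeasure_eq_measure)
    show "integrable haar (\<lambda>t. Re (tr f w t))" using integrable_haar[OF cts_tr(1)[OF f]] by simp
    show "Re (tr f w y0) / 2 * indicator U t \<le> Re (tr f w t)" for t
      using tr_nonneg(2)[OF f f_def g(2), of w t] by (auto simp: indicator_def U_def)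
  qed
  also have "\<dots> = Re (LINT y|haar. tr f w y)" using integrable_haar[OF cts_tr(1)[OF f]] by simp
  also have "\<dots> = Re (LINT y|haar. f y)" using haar_invariant[OF f] by simp
  also have "\<dots> = 0" unfolding f_def using z by simp
  finally show False by simp
qed


section \<open>Smoothing operators and the adjoint of a translation\<close>

definition ker :: "('a \<Rightarrow> complex) \<Rightarrow> 'a \<Rightarrow> 'a \<Rightarrow> complex" where
  "ker u y z = tr u (ck y) z"

text \<open>On a group the kernel is u(y^-1 z), so this is a convolution operator acting from the
  right; such operators commute with the left translates \<open>tr g x\<close>.\<close>

definition smooth :: "('a \<Rightarrow> complex) \<Rightarrow> ('a \<Rightarrow> complex) \<Rightarrow> 'a \<Rightarrow> complex" where
  "smooth u g y = (LINT z|haar. ker u y z * g z)"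

definition sym_unit :: "('a \<Rightarrow> complex) \<Rightarrow> bool" where
  "sym_unit u \<longleftrightarrow> cts u \<and> (\<forall>t. u (ck t) = u t) \<and> (\<exists>v. \<forall>t. u t = complex_of_real (v t) \<and> 0 \<le> v t) \<and>
     (LINT t|haar. u t) = 1"

lemma sym_unit_cts: "sym_unit u \<Longrightarrow> cts u" unfolding sym_unit_def by simp

text \<open>The double integral of f(ck x * y) is evaluated in both orders. Integrating over
  \<open>y\<close> first gives the integral of \<open>f\<close> by left invariance; since f(ck x *
  y) is the reflected function at ck y * x, integrating over \<open>x\<close> first gives the
  integral of the reflected function.\<close>

lemma haar_symmetric:
  assumes f: "cts f"
  shows "(LINT x|haar. f (ck x)) = (LINT x|haar. f x)"
proof -
  interpret prob_space haar by (rule prob_haar)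
  have "continuous_on UNIV (\<lambda>q :: 'a \<times> 'a. (ck (fst q), snd q))"
    by (intro continuous_intros continuous_on_compose2[OF ck_cont]) auto
  then have c: "continuous_on UNIV (\<lambda>(x, y). tr f (ck x) y)"
    using continuous_on_compose2[OF tr_continuous[OF f], of UNIV "\<lambda>q. (ck (fst q), snd q)"]
    by (simp add: case_prod_beta')
  have "(LINT x|haar. f x) = (LINT x|haar. LINT y|haar. tr f (ck x) y)"
    using haar_invariant[OF f] by (simp add: prob_space[unfolded space_haar])
  also have "\<dots> = (LINT y|haar. LINT x|haar. tr f (ck x) y)"
    by (rule Fubini_continuous[OF K finite_haar sets_haar finite_haar sets_haar c])
  also have "\<dots> = (LINT y|haar. LINT x|haar. tr (\<lambda>t. f (ck t)) (ck y) x)"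
  proof -
    have "tr f (ck x) y = tr (\<lambda>t. f (ck t)) (ck y) x" for x y
      using tr_check[OF f, of x "ck y"] by simp
    then show ?thesis by simp
  qed
  also have "\<dots> = (LINT x|haar. f (ck x))"
    using haar_invariant[OF cts_ck[OF f]] by (simp add: prob_space[unfolded space_haar])
  finally show ?thesis by simp
qed

lemma ck_e: "ck e = e"
proof -
  have "measure (tmeas e e) U \<noteq> 0" if U: "open U" "e \<in> U" for U
  proof -
    have "complex_of_real (measure (tmeas e e) U) = (dirac e \<star> dirac e) U"
      unfolding tmeas_def using meas_of(3)[OF conv_dirac_pos] by metis
    also have "\<dots> = 1" using U unfolding unit by (simp add: dirac_def)
    finally show ?thesis by auto
  qed
  then have "e \<in> msupp (dirac e \<star> dirac e)" unfolding msupp_tmeas by blast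
  then show ?thesis using unit_in_supp by simp
qed

lemma sym_unit_exists:
  assumes eps: "\<epsilon> > 0"
  shows "\<exists>u. sym_unit u \<and> (\<forall>y z. \<epsilon> \<le> dist y z \<longrightarrow> ker u y z = 0)"
proof -
  obtain r where r: "r > 0" "\<And>y z. \<epsilon> \<le> dist y z \<Longrightarrow> cball e r \<inter> msupp (dirac (ck y) \<star> dirac z) = {}"
    using separation[OF eps] by blast
  \<comment> \<open>A tent at \<open>e\<close> times its reflection: invariant under
    \<open>ck\<close>, zero outside \<open>cball e r\<close>, and positive at \<open>e\<close>
    because \<open>ck e = e\<close>. Positivity at one point makes the normalizing integral positive
    by \<open>haar_full_support\<close>.\<close>
  define w where "w t = max 0 (r - dist e t) * max 0 (r - dist e (ck t))" for t
  have w: "continuous_on UNIV w" unfolding w_def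
    by (intro continuous_intros continuous_on_compose2[OF ck_cont]) (auto simp: ck_cont)
  have w0: "0 \<le> w t" for t unfolding w_def by simp
  define c where "c = (LINT t|haar. w t)"
  have "w e \<noteq> 0" unfolding w_def ck_e using r(1) by simp
  then have "c \<noteq> 0" using haar_full_support[OF w w0] unfolding c_def by blast
  moreover have "0 \<le> c" unfolding c_def using w0 by simp
  ultimately have c: "c > 0" by simp
  define u where "u t = complex_of_real (w t / c)" for t
  have u: "cts u" unfolding u_def using c by (intro continuous_intros w) auto
  have "sym_unit u" unfolding sym_unit_def
  proof (intro conjI allI u)
    show "u (ck t) = u t" for t unfolding u_def w_def by (simp add: mult.commute)
    show "\<exists>v. \<forall>t. u t = complex_of_real (v t) \<and> 0 \<le> v t"
      using c w0 by (intro exI[of _ "\<lambda>t. w t / c"]) (auto simp: u_def)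
    have "(LINT t|haar. u t) = complex_of_real (LINT t|haar. w t / c)"
      unfolding u_def by (rule integral_complex_of_real)
    also have "(LINT t|haar. w t / c) = 1" using c unfolding c_def by simp
    finally show "(LINT t|haar. u t) = 1" by simp
  qed
  moreover have "ker u y z = 0" if yz: "\<epsilon> \<le> dist y z" for y z
  proof -
    interpret prob_space "tmeas (ck y) z" by (rule prob_tmeas)
    have cc: "compact (cball e r)" using compact_Int_closed[OF K closed_cball] by simp
    have "cball e r \<in> null_sets (tmeas (ck y) z)"
      using tmeas_null_outside_supp[OF cc r(2)[OF yz]] cc
      by (intro null_setsI) (auto simp: emeasure_eq_measure borel_closed)
    then have "AE t in tmeas (ck y) z. u t = 0"
      by (rule AE_I') (auto simp: u_def w_def)
    then show ?thesis
      unfolding ker_def tr_integral[OF u] by (rule integral_eq_zero_AE)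
  qed
  ultimately show ?thesis by blast
qed

lemma ker_continuous:
  assumes u: "cts u"
  shows "continuous_on UNIV (\<lambda>(y, z). ker u y z)"
proof -
  have "continuous_on UNIV (\<lambda>q :: 'a \<times> 'a. (ck (fst q), snd q))"
    by (intro continuous_intros continuous_on_compose2[OF ck_cont]) auto
  then show ?thesis
    using continuous_on_compose2[OF tr_continuous[OF u], of UNIV "\<lambda>q. (ck (fst q), snd q)"]
    by (simp add: case_prod_beta' ker_def)
qed

lemma ker_sym: "sym_unit u \<Longrightarrow> ker u y z = ker u z y"
  using tr_check[of u "z" "ck y"] unfolding sym_unit_def ker_def by simp

lemma ker_real:
  assumes "sym_unit u"
  shows "ker u y z = complex_of_real (Re (ker u y z))" "0 \<le> Re (ker u y z)" "cnj (ker u y z) = ker u y z"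
proof -
  obtain v where "cts u" "\<And>t. u t = complex_of_real (v t)" "\<And>t. 0 \<le> v t"
    using assms unfolding sym_unit_def by blast
  then show 1: "ker u y z = complex_of_real (Re (ker u y z))" "0 \<le> Re (ker u y z)"
    unfolding ker_def using tr_nonneg by blast+
  show "cnj (ker u y z) = ker u y z" by (subst (1 2) 1(1)) simp
qed

lemma ker_integral: "sym_unit u \<Longrightarrow> (LINT z|haar. ker u y z) = 1"
  unfolding ker_def sym_unit_def using haar_invariant by simp

lemma ker_cts: "cts u \<Longrightarrow> cts (ker u y)"
  using continuous_on_section(1)[OF ker_continuous] by blast

lemma ker_bounded:
  assumes u: "cts u"
  obtains B where "B > 0" "\<And>y z. cmod (ker u y z) \<le> B"
proof -
  obtain B where "B > 0" "\<And>t. cmod (u t) \<le> B" using continuous_on_compact_bounded[OF K u] by blast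
  then show ?thesis using that[of B] tr_bound[OF u] unfolding ker_def by blast
qed

lemma ker_times_integrable:
  assumes u: "cts u" and g: "integrable haar g"
  shows "integrable haar (\<lambda>z. ker u y z * g z)"
proof -
  obtain B where B: "B > 0" "\<And>y z. cmod (ker u y z) \<le> B" using ker_bounded[OF u] by blast
  have m: "ker u y \<in> borel_measurable haar"
    by (rule cts_borel_haar[OF ker_cts[OF u]])
  show ?thesis
  proof (rule Bochner_Integration.integrable_bound)
    show "integrable haar (\<lambda>z. complex_of_real B * g z)" using g by simp
    show "AE z in haar. norm (ker u y z * g z) \<le> norm (complex_of_real B * g z)"
      using B by (intro AE_I2) (auto simp: norm_mult intro!: mult_right_mono)
  qed (use m g in auto)
qed

lemma smooth_cts:
  assumes u: "cts u" and g: "integrable haar g"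
  shows "cts (smooth u g)"
proof -
  obtain B where B: "B > 0" "\<And>y z. cmod (ker u y z) \<le> B" using ker_bounded[OF u] by blast
  have gm: "g \<in> borel_measurable borel" using g measurable_cong_sets[OF sets_haar] by (metis borel_measurable_integrable)
  show ?thesis unfolding smooth_def[abs_def]
  proof (rule continuous_on_param_integral[where w = "\<lambda>z. B * norm (g z)"])
    show "continuous_on UNIV (\<lambda>x. ker u x y * g y)" for y
      using continuous_on_section(2)[OF ker_continuous[OF u]] by (intro continuous_intros)
    show "(\<lambda>z. ker u x z * g z) \<in> borel_measurable borel" for x
      using gm borel_measurable_continuous_onI[OF ker_cts[OF u]] by (intro borel_measurable_times) auto
    show "norm (ker u x y * g y) \<le> B * norm (g y)" for x y
      using B by (simp add: norm_mult mult_right_mono)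
  qed (use g in auto)
qed

lemma smooth_bound:
  assumes u: "cts u" and B: "\<And>y z. cmod (ker u y z) \<le> B" and g: "integrable haar g"
  shows "cmod (smooth u g y) \<le> B * (LINT z|haar. cmod (g z))"
proof -
  have "cmod (smooth u g y) \<le> (LINT z|haar. cmod (ker u y z * g z))"
    unfolding smooth_def by (rule integral_norm_bound)
  also have "\<dots> \<le> (LINT z|haar. B * cmod (g z))"
    using integrable_norm[OF ker_times_integrable[OF u g]] g B
    by (intro integral_mono) (auto simp: norm_mult intro!: mult_right_mono)
  finally show ?thesis by simp
qed

lemma smooth_approx:
  assumes u: "sym_unit u" and supp: "\<And>y z. \<epsilon> \<le> dist y z \<Longrightarrow> ker u y z = 0" and g: "cts g"
    and mod: "\<And>y z. dist y z < \<epsilon> \<Longrightarrow> cmod (g z - g y) \<le> \<eta>"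
  shows "cmod (smooth u g y - g y) \<le> \<eta>"
proof -
  note uc = sym_unit_cts[OF u]
  have i: "integrable haar (\<lambda>z. ker u y z * g z)" "integrable haar (\<lambda>z. ker u y z)"
    "integrable haar (\<lambda>z. ker u y z * (g z - g y))"
    using ker_cts[OF uc, of y] g by (auto intro!: integrable_haar continuous_intros)
  have "smooth u g y - g y = (LINT z|haar. ker u y z * g z) - (LINT z|haar. ker u y z) * g y"
    unfolding smooth_def ker_integral[OF u] by simp
  also have "\<dots> = (LINT z|haar. ker u y z * (g z - g y))"
    using i by (simp add: right_diff_distrib)
  also have "cmod \<dots> \<le> (LINT z|haar. cmod (ker u y z * (g z - g y)))" by (rule integral_norm_bound)
  also have "\<dots> \<le> (LINT z|haar. Re (ker u y z) * \<eta>)"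
  proof (rule integral_mono)
    show "cmod (ker u y z * (g z - g y)) \<le> Re (ker u y z) * \<eta>" for z
    proof (cases "dist y z < \<epsilon>")
      case True
      have "cmod (ker u y z) = Re (ker u y z)" using ker_real[OF u, of y z] by (metis norm_of_real abs_of_nonneg)
      then show ?thesis using mod[OF True] ker_real(2)[OF u] by (simp add: norm_mult mult_left_mono)
    qed (use supp in simp)
  qed (use integrable_norm[OF i(3)] i(2) in auto)
  also have "\<dots> = Re (LINT z|haar. ker u y z) * \<eta>" using i(2) by simp
  also have "\<dots> = \<eta>" using ker_integral[OF u] by simp
  finally show ?thesis .
qed

lemma approximate_identity:
  "\<exists>u. (\<forall>n::nat. sym_unit (u n)) \<and>
     (\<forall>g. cts g \<longrightarrow> (\<forall>\<eta>>0. \<forall>\<^sub>F n in sequentially. \<forall>y. cmod (smooth (u n) g y - g y) \<le> \<eta>))"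
proof -
  have "\<forall>n. \<exists>u. sym_unit u \<and> (\<forall>y z. inverse (real (Suc n)) \<le> dist y z \<longrightarrow> ker u y z = 0)"
    using sym_unit_exists by simp
  then obtain u where u: "\<And>n. sym_unit (u n)" "\<And>n y z. inverse (real (Suc n)) \<le> dist y z \<Longrightarrow> ker (u n) y z = 0"
    by metis
  have "\<forall>\<^sub>F n in sequentially. \<forall>y. cmod (smooth (u n) g y - g y) \<le> \<eta>" if g: "cts g" and eta: "\<eta> > 0" for g \<eta>
  proof -
    obtain d where d: "d > 0" "\<And>x y. dist x y < d \<Longrightarrow> dist (g x) (g y) < \<eta>"
      using compact_uniformly_continuous[OF g K] eta unfolding uniformly_continuous_on_def by (metis UNIV_I)
    have "\<forall>\<^sub>F n in sequentially. inverse (real (Suc n)) < d"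
      by (rule order_tendstoD(2)[OF LIMSEQ_inverse_real_of_nat d(1)])
    then show ?thesis
    proof eventually_elim
      case (elim n)
      show ?case
      proof
        fix y show "cmod (smooth (u n) g y - g y) \<le> \<eta>"
        proof (rule smooth_approx[OF u(1) u(2) g])
          fix y z :: 'a assume "dist y z < inverse (real (Suc n))"
          then have "dist z y < d" using elim by (simp add: dist_commute)
          then show "cmod (g z - g y) \<le> \<eta>" using d(2)[of z y] by (simp add: dist_norm)
        qed
      qed
    qed
  qed
  then show ?thesis using u by blast
qed

text \<open>The function being translated varies with the parameter too. On a compact space it does
  so uniformly, and translation does not increase the supremum norm, so the function can be frozen
  at the limit point.\<close>

lemma cts_tr_joint:
  fixes F :: "'a \<Rightarrow> 'a \<Rightarrow> complex"
  assumes F: "continuous_on UNIV (\<lambda>(y, t). F y t)"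
  shows "continuous_on UNIV (\<lambda>(y, z). tr (F y) x z)"
  unfolding continuous_on_def
proof
  fix a :: "'a \<times> 'a"
  obtain y0 z0 where a: "a = (y0, z0)" by force
  note Fc = continuous_on_section(1)[OF F]
  have "((\<lambda>p. tr (F (fst p)) x (snd p) - tr (F y0) x (snd p)) \<longlongrightarrow> 0) (at a)"
  proof (rule tendstoI)
    fix \<epsilon> :: real assume "\<epsilon> > 0"
    then obtain d where d: "d > 0" "\<And>y y' t t'. dist y y' < d \<Longrightarrow> dist t t' < d \<Longrightarrow> dist (F y t) (F y' t') < \<epsilon>/2"
      using uniformly_continuous_section[OF K F, of "\<epsilon>/2"] by auto
    have "((\<lambda>p :: 'a \<times> 'a. fst p) \<longlongrightarrow> y0) (at a)" unfolding a by (auto intro!: tendsto_eq_intros)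
    then have "\<forall>\<^sub>F p in at a. dist (fst p) y0 < d" using d(1) tendstoD by blast
    then show "\<forall>\<^sub>F p in at a. dist (tr (F (fst p)) x (snd p) - tr (F y0) x (snd p)) 0 < \<epsilon>"
    proof eventually_elim
      case (elim p)
      have "cmod (F (fst p) t - F y0 t) \<le> \<epsilon>/2" for t
        using d(2)[OF elim, of t t] d(1) by (simp add: dist_norm)
      then have "cmod (tr (\<lambda>t. F (fst p) t - F y0 t) x (snd p)) \<le> \<epsilon>/2"
        by (intro tr_bound continuous_intros Fc)
      then show ?case using \<open>\<epsilon> > 0\<close> tr_diff[OF Fc Fc] by simp
    qed
  qed
  moreover have "((\<lambda>p. tr (F y0) x (snd p)) \<longlongrightarrow> tr (F y0) x z0) (at a)"
  proof -
    have "isCont (tr (F y0) x) z0" using cts_tr(1)[OF Fc] by (simp add: continuous_on_eq_continuous_at)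
    then show ?thesis by (rule isCont_tendsto_compose) (auto simp: a intro!: tendsto_eq_intros)
  qed
  ultimately have "((\<lambda>p. (tr (F (fst p)) x (snd p) - tr (F y0) x (snd p)) + tr (F y0) x (snd p)) \<longlongrightarrow> 0 + tr (F y0) x z0) (at a)"
    by (rule tendsto_add)
  then show "((\<lambda>(y, z). tr (F y) x z) \<longlongrightarrow> (case a of (y, z) \<Rightarrow> tr (F y) x z)) (at a within UNIV)"
    by (simp add: a case_prod_beta')
qed

text \<open>Averaging the kernel over x * y gives u(ck y * ck x * z), because the involution
  reverses products. The translation has thus been moved from the smoothed function to the
  kernel.\<close>

lemma tr_smooth:
  assumes u: "cts u" and g: "cts g"
  shows "tr (smooth u g) x y = (LINT z|haar. tr (tr u (ck y)) (ck x) z * g z)"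
proof -
  have "tr (smooth u g) x y = (LINT t|tmeas x y. LINT z|haar. ker u t z * g z)"
    unfolding tr_integral[OF smooth_cts[OF u integrable_haar[OF g]]] smooth_def ..
  also have "\<dots> = (LINT z|haar. (LINT t|tmeas x y. ker u t z) * g z)"
    by (rule Fubini_continuous_times[OF K finite_tmeas sets_tmeas finite_haar sets_haar ker_continuous[OF u] integrable_haar[OF g]])
  also have "\<dots> = (LINT z|haar. tr (tr u (ck y)) (ck x) z * g z)"
  proof -
    have "(LINT t|tmeas x y. ker u t z) = tr (\<lambda>t. ker u t z) x y" for z
      using tr_integral[OF continuous_on_section(2)[OF ker_continuous[OF u]]] by simp
    also have "tr (\<lambda>t. ker u t z) x y = tr (\<lambda>s. tr u s z) (ck y) (ck x)" for z
      unfolding ker_def using tr_check[OF cts_tr(2)[OF u]] by simp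
    also have "\<dots> z = tr (tr u (ck y)) (ck x) z" for z by (rule tr_assoc[OF u])
    finally show ?thesis by simp
  qed
  finally show ?thesis .
qed

text \<open>The kernel u(ck y * ck x * z) can be integrated against \<open>f\<close> in z or against
  \<open>g\<close> in y. By symmetry of the kernel the second reading is the smoothing of
  \<open>g\<close> evaluated at ck x * z, which is the translation moved to the other
  factor.\<close>

lemma tr_adjoint_smooth:
  assumes u: "sym_unit u" and f: "cts f" and g: "cts g"
  shows "(LINT y|haar. tr (smooth u f) x y * g y) = (LINT z|haar. f z * tr (smooth u g) (ck x) z)"
proof -
  note uc = sym_unit_cts[OF u]
  have c: "continuous_on UNIV (\<lambda>(y, z). tr (tr u (ck y)) (ck x) z)"
    using cts_tr_joint[OF ker_continuous[OF uc], of "ck x"] unfolding ker_def by simp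
  have c2: "continuous_on UNIV (\<lambda>(y, z). tr (tr u (ck y)) (ck x) z * g y)"
  proof -
    have "continuous_on UNIV (\<lambda>p. (\<lambda>(y, z). tr (tr u (ck y)) (ck x) z) p * g (fst p))"
      by (intro continuous_intros c continuous_on_compose2[OF g]) auto
    then show ?thesis by (simp add: case_prod_beta')
  qed
  have "(LINT y|haar. tr (smooth u f) x y * g y) =
      (LINT y|haar. LINT z|haar. (tr (tr u (ck y)) (ck x) z * g y) * f z)"
    unfolding tr_smooth[OF uc f] integral_mult_left_zero[symmetric] by (simp add: mult_ac)
  also have "\<dots> = (LINT z|haar. (LINT y|haar. tr (tr u (ck y)) (ck x) z * g y) * f z)"
    by (rule Fubini_continuous_times[OF K finite_haar sets_haar finite_haar sets_haar c2 integrable_haar[OF f]])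
  also have "\<dots> = (LINT z|haar. tr (smooth u g) (ck x) z * f z)"
  proof -
    have "(LINT y|haar. tr (tr u (ck y)) (ck x) z * g y) = tr (smooth u g) (ck x) z" for z
    proof -
      have sw: "continuous_on UNIV (\<lambda>(t, y). ker u y t)"
        using ker_continuous[OF uc] ker_sym[OF u] by simp
      have "(LINT y|haar. tr (tr u (ck y)) (ck x) z * g y) = (LINT y|haar. (LINT t|tmeas (ck x) z. ker u y t) * g y)"
        using tr_integral[OF cts_tr(1)[OF uc]] by (simp add: ker_def)
      also have "\<dots> = (LINT t|tmeas (ck x) z. LINT y|haar. ker u y t * g y)"
        by (rule Fubini_continuous_times[OF K finite_tmeas sets_tmeas finite_haar sets_haar sw integrable_haar[OF g], symmetric])
      also have "\<dots> = (LINT t|tmeas (ck x) z. smooth u g t)"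
        unfolding smooth_def using ker_sym[OF u] by simp
      also have "\<dots> = tr (smooth u g) (ck x) z"
        by (rule tr_integral[OF smooth_cts[OF uc integrable_haar[OF g]], symmetric])
      finally show ?thesis .
    qed
    then show ?thesis by simp
  qed
  finally show ?thesis by (simp add: mult.commute)
qed

text \<open>On a group this is the substitution of x^-1 y for y. Here the translate of a product is
  not the product of the translates, so left invariance alone does not give it; the identity holds
  for smoothed functions and passes to the limit along an approximate identity, on both sides at
  once.\<close>

theorem tr_adjoint:
  assumes f: "cts f" and g: "cts g"
  shows "(LINT y|haar. tr f x y * g y) = (LINT y|haar. f y * tr g (ck x) y)"
proof -
  interpret prob_space haar by (rule prob_haar)
  obtain u where u: "\<And>n::nat. sym_unit (u n)"
    and ap: "\<And>g \<eta>. cts g \<Longrightarrow> \<eta> > 0 \<Longrightarrow> \<forall>\<^sub>F n in sequentially. \<forall>y. cmod (smooth (u n) g y - g y) \<le> \<eta>"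
    using approximate_identity by blast
  have sc: "cts (smooth (u n) h)" if "cts h" for n h
    using smooth_cts[OF sym_unit_cts[OF u] integrable_haar[OF that]] .
  have lim: "(\<lambda>n. LINT y|haar. tr (smooth (u n) p) x y * q y) \<longlonglongrightarrow> (LINT y|haar. tr p x y * q y)"
    if p: "cts p" and q: "cts q" for p q x
  proof (rule tendstoI)
    fix \<epsilon> :: real assume eps: "\<epsilon> > 0"
    obtain B where B: "B > 0" "\<And>y. cmod (q y) \<le> B" using continuous_on_compact_bounded[OF K q] by blast
    have "\<epsilon> / (2 * B) > 0" using eps B by simp
    from ap[OF p this] show "\<forall>\<^sub>F n in sequentially. dist (LINT y|haar. tr (smooth (u n) p) x y * q y) (LINT y|haar. tr p x y * q y) < \<epsilon>"
    proof eventually_elim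
      case (elim n)
      have b: "cmod (tr (smooth (u n) p) x y - tr p x y) \<le> \<epsilon> / (2 * B)" for y
        using tr_bound[OF continuous_on_diff[OF sc[OF p] p], of n "\<epsilon> / (2 * B)"] elim tr_diff[OF sc[OF p] p] by simp
      have i: "integrable haar (\<lambda>y. tr (smooth (u n) p) x y * q y)" "integrable haar (\<lambda>y. tr p x y * q y)"
        using cts_tr(1)[OF sc[OF p]] cts_tr(1)[OF p] q by (auto intro!: integrable_haar continuous_intros)
      have "dist (LINT y|haar. tr (smooth (u n) p) x y * q y) (LINT y|haar. tr p x y * q y)
          = cmod (LINT y|haar. tr (smooth (u n) p) x y * q y - tr p x y * q y)"
        using i by (simp add: dist_norm)
      also have "\<dots> \<le> (LINT y|haar. cmod (tr (smooth (u n) p) x y * q y - tr p x y * q y))"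
        by (rule integral_norm_bound)
      also have "\<dots> \<le> (LINT y|haar. \<epsilon> / (2 * B) * B)"
      proof (rule integral_mono)
        show "integrable haar (\<lambda>y. cmod (tr (smooth (u n) p) x y * q y - tr p x y * q y))"
          using i by (intro integrable_norm Bochner_Integration.integrable_diff)
        show "cmod (tr (smooth (u n) p) x y * q y - tr p x y * q y) \<le> \<epsilon> / (2 * B) * B" for y
          using mult_mono[OF b[of y] B(2)[of y]] eps B(1) by (simp add: norm_mult left_diff_distrib[symmetric])
      qed simp
      also have "\<dots> = \<epsilon> / 2" using B(1) by (simp add: prob_space[unfolded space_haar])
      finally show ?case using eps by simp
    qed
  qed
  \<comment> \<open>The smoothed identity rewrites this sequence into one with \<open>g\<close>
    smoothed and translated by \<open>ck x\<close>, to which the same limit lemma applies with the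
    roles of the functions exchanged.\<close>
  have "(\<lambda>n. LINT y|haar. tr (smooth (u n) f) x y * g y) \<longlonglongrightarrow> (LINT y|haar. f y * tr g (ck x) y)"
    unfolding tr_adjoint_smooth[OF u f g] using lim[OF g f, of "ck x"] by (simp add: mult.commute)
  then show ?thesis using LIMSEQ_unique[OF lim[OF f g]] by simp
qed

text \<open>This commutation makes the eigenspaces of smoothing operators invariant under
  translation.\<close>

lemma smooth_tr:
  assumes u: "cts u" and g: "cts g"
  shows "smooth u (tr g x) y = tr (smooth u g) x y"
  unfolding tr_smooth[OF u g] smooth_def ker_def
  using tr_adjoint[OF g cts_tr(1)[OF u, of "ck y"], of x] by (simp add: mult.commute)

lemma smooth_self_adjoint:
  assumes u: "sym_unit u" and f: "integrable haar f" and g: "cts g"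
  shows "(LINT y|haar. smooth u f y * g y) = (LINT y|haar. f y * smooth u g y)"
proof -
  note uc = sym_unit_cts[OF u]
  have c: "continuous_on UNIV (\<lambda>(y, z). ker u y z * g y)"
  proof -
    have "continuous_on UNIV (\<lambda>p. (\<lambda>(y, z). ker u y z) p * g (fst p))"
      by (intro continuous_intros ker_continuous[OF uc] continuous_on_compose2[OF g]) auto
    then show ?thesis by (simp add: case_prod_beta')
  qed
  have "(LINT y|haar. smooth u f y * g y) = (LINT y|haar. LINT z|haar. (ker u y z * g y) * f z)"
    unfolding smooth_def integral_mult_left_zero[symmetric] by (simp add: mult_ac)
  also have "\<dots> = (LINT z|haar. (LINT y|haar. ker u y z * g y) * f z)"
    by (rule Fubini_continuous_times[OF K finite_haar sets_haar finite_haar sets_haar c f])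
  also have "\<dots> = (LINT z|haar. f z * smooth u g z)"
    unfolding smooth_def using ker_sym[OF u] by (simp add: mult.commute)
  finally show ?thesis .
qed

end

section \<open>Representations and Schur orthogonality\<close>

lemma mat_adjoint_index:
  fixes A :: "complex mat"
  shows "dim_row (mat_adjoint A) = dim_col A" "dim_col (mat_adjoint A) = dim_row A"
    "i < dim_col A \<Longrightarrow> j < dim_row A \<Longrightarrow> mat_adjoint A $$ (i, j) = cnj (A $$ (j, i))"
  unfolding mat_adjoint_def by (auto simp: mat_of_rows_index)

lemma mult_mat_index_sum:
  fixes A B :: "complex mat"
  assumes "A \<in> carrier_mat n m" "B \<in> carrier_mat m l" "i < n" "j < l"
  shows "(A * B) $$ (i, j) = (\<Sum>k<m. A $$ (i, k) * B $$ (k, j))"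
  using assms by (auto simp: scalar_prod_def atLeast0LessThan intro!: sum.cong)

lemma mult_mat_vec_index_sum:
  fixes A :: "complex mat"
  assumes "A \<in> carrier_mat n m" "v \<in> carrier_vec m" "i < n"
  shows "vec_index (A *\<^sub>v v) i = (\<Sum>k<m. A $$ (i, k) * vec_index v k)"
  using assms by (auto simp: scalar_prod_def atLeast0LessThan intro!: sum.cong)

lemma sum_unit_right:
  fixes f :: "nat \<Rightarrow> 'b::semiring_1"
  assumes "j < n"
  shows "(\<Sum>k<n. f k * (if k = j then 1 else 0)) = f j"
proof -
  have "(\<Sum>k<n. f k * (if k = j then 1 else 0)) = (\<Sum>k<n. if k = j then f k else 0)" by (intro sum.cong) auto
  then show ?thesis using assms by simp
qed

lemma mult_cnj_cmod: "z * cnj z = complex_of_real ((cmod z)\<^sup>2)"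
  by (rule complex_norm_square[symmetric])

lemma cscalar_prod_unit:
  fixes A :: "complex mat"
  assumes "A \<in> carrier_mat n n" "i < n" "j < n"
  shows "(A *\<^sub>v unit_vec n j) \<bullet>c unit_vec n i = A $$ (i, j)"
proof -
  have "(A *\<^sub>v unit_vec n j) \<bullet>c unit_vec n i = (\<Sum>k<n. vec_index (A *\<^sub>v unit_vec n j) k * (if k = i then 1 else 0))"
    using assms by (auto simp: scalar_prod_def atLeast0LessThan intro!: sum.cong)
  also have "\<dots> = vec_index (A *\<^sub>v unit_vec n j) i" by (rule sum_unit_right[OF assms(2)])
  also have "\<dots> = (\<Sum>k<n. A $$ (i, k) * (if k = j then 1 else 0))"
    using assms by (subst mult_mat_vec_index_sum[of _ n n]) (auto intro!: sum.cong)
  also have "\<dots> = A $$ (i, j)" by (rule sum_unit_right[OF assms(3)])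
  finally show ?thesis .
qed

definition coef :: "'a::t2_space meas_rep \<Rightarrow> nat \<Rightarrow> nat \<Rightarrow> 'a \<Rightarrow> complex" where
  "coef \<pi> i j x = \<pi> (dirac x) $$ (i, j)"

context haar_hypergroup
begin

text \<open>What a matrix representation looks like on point masses. \<open>coef_rep_coef\<close>
  and \<open>rep_of_representation\<close> pass between the two descriptions, and averaging over the
  group variable is carried out on these functions.\<close>

definition coef_rep :: "nat \<Rightarrow> (nat \<Rightarrow> nat \<Rightarrow> 'a \<Rightarrow> complex) \<Rightarrow> bool" where
  "coef_rep d a \<longleftrightarrow> (\<forall>i<d. \<forall>j<d. cts (a i j) \<and> (\<forall>x y. tr (a i j) x y = (\<Sum>l<d. a i l x * a l j y)) \<and>
     (\<forall>x. a i j (ck x) = cnj (a j i x)) \<and> a i j e = (if i = j then 1 else 0))"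

lemma rep_sum:
  assumes rep: "representation conv e ck \<pi>" and T: "finite T" "\<And>t. t \<in> T \<Longrightarrow> m t \<in> reg_measures"
    and ij: "i < rep_dim e \<pi>" "j < rep_dim e \<pi>"
  shows "\<pi> (\<lambda>A. \<Sum>t\<in>T. c t * m t A) $$ (i, j) = (\<Sum>t\<in>T. c t * \<pi> (m t) $$ (i, j))"
  using T
proof (induction T)
  have R: "\<And>\<mu>. \<mu> \<in> reg_measures \<Longrightarrow> \<pi> \<mu> \<in> carrier_mat (rep_dim e \<pi>) (rep_dim e \<pi>)"
    "\<And>\<mu> \<nu>. \<mu> \<in> reg_measures \<Longrightarrow> \<nu> \<in> reg_measures \<Longrightarrow> \<pi> (\<lambda>A. \<mu> A + \<nu> A) = \<pi> \<mu> + \<pi> \<nu>"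
    "\<And>\<mu> c. \<mu> \<in> reg_measures \<Longrightarrow> \<pi> (\<lambda>A. c * \<mu> A) = c \<cdot>\<^sub>m \<pi> \<mu>"
    using rep unfolding representation_def Let_def by blast+
  {
    case empty
    have "\<pi> (\<lambda>A. 0 * dirac e A) = 0 \<cdot>\<^sub>m \<pi> (dirac e)" by (rule R(3)[OF dirac_reg])
    then show ?case using R(1)[OF dirac_reg[of e]] ij by simp
  next
    case (insert t T)
    have 1: "(\<lambda>A. c t * m t A) \<in> reg_measures" "(\<lambda>A. \<Sum>t\<in>T. c t * m t A) \<in> reg_measures"
      using insert(1,2) insert.prems cm_integral_sum_measure(1)[OF K, of T m "\<lambda>_. 0" c]
      by (auto simp: reg_complex intro: complex_borel_measure_scale)
    have "m t \<in> reg_measures" using insert by simp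
    then show ?case using insert R(2)[OF 1] R(1)[OF 1(1)] R(1)[OF 1(2)] R(3)[of "m t" "c t"] R(1)[of "m t"] ij by simp
  }
qed

lemma rep_tendsto:
  assumes rep: "representation conv e ck \<pi>"
    and m: "\<And>n. m n \<in> pos_measures" "\<mu> \<in> pos_measures" "\<And>f. cts f \<Longrightarrow> ((\<lambda>n. cm_integral (m n) f) \<longlongrightarrow> cm_integral \<mu> f) F"
    and ij: "i < rep_dim e \<pi>" "j < rep_dim e \<pi>"
  shows "((\<lambda>n. \<pi> (m n) $$ (i, j)) \<longlongrightarrow> \<pi> \<mu> $$ (i, j)) F"
proof -
  let ?d = "rep_dim e \<pi>"
  have R: "\<And>\<mu>. \<mu> \<in> reg_measures \<Longrightarrow> \<pi> \<mu> \<in> carrier_mat ?d ?d"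
    "continuous_map (subtopology weak_topology pos_measures) euclidean
        (\<lambda>\<mu>. (\<pi> \<mu> *\<^sub>v unit_vec ?d j) \<bullet>c unit_vec ?d i)"
    using rep ij unfolding representation_def Let_def by auto
  have "limitin (subtopology weak_topology pos_measures) m \<mu> F"
    unfolding limitin_subtopology limitin_weak_topology using m by (auto intro!: always_eventually pos_reg)
  from continuous_map_limit[OF R(2) this]
  have "((\<lambda>n. (\<pi> (m n) *\<^sub>v unit_vec ?d j) \<bullet>c unit_vec ?d i) \<longlongrightarrow> (\<pi> \<mu> *\<^sub>v unit_vec ?d j) \<bullet>c unit_vec ?d i) F"
    by (simp add: comp_def)
  then show ?thesis unfolding cscalar_prod_unit[OF R(1)[OF pos_reg[OF m(1)]] ij]
      cscalar_prod_unit[OF R(1)[OF pos_reg[OF m(2)]] ij] .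
qed

lemma coef_cts:
  assumes rep: "representation conv e ck \<pi>" and ij: "i < rep_dim e \<pi>" "j < rep_dim e \<pi>"
  shows "cts (coef \<pi> i j)"
  unfolding continuous_on_def
proof
  fix a :: 'a
  have "((\<lambda>x. \<pi> (dirac x) $$ (i, j)) \<longlongrightarrow> \<pi> (dirac a) $$ (i, j)) (at a)"
  proof (rule rep_tendsto[OF rep dirac_pos[OF K] dirac_pos[OF K] _ ij])
    fix g :: "'a \<Rightarrow> complex" assume g: "cts g"
    then have "isCont g a" by (simp add: continuous_on_eq_continuous_at)
    then show "((\<lambda>x. cm_integral (dirac x) g) \<longlongrightarrow> cm_integral (dirac a) g) (at a)"
      unfolding cm_integral_dirac[OF K g] by (simp add: isCont_def)
  qed
  then show "(coef \<pi> i j \<longlongrightarrow> coef \<pi> i j a) (at a within UNIV)" by (simp add: coef_def[abs_def])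
qed

text \<open>A representation is determined by its values on point masses: on a discretized measure
  linearity gives a Riemann sum of the coefficient, weak continuity gives the limit for positive
  measures, and the Jordan parts give the rest.\<close>

lemma rep_cm_integral:
  assumes rep: "representation conv e ck \<pi>" and ij: "i < rep_dim e \<pi>" "j < rep_dim e \<pi>"
    and mu: "\<mu> \<in> reg_measures"
  shows "\<pi> \<mu> $$ (i, j) = cm_integral \<mu> (coef \<pi> i j)"
proof -
  note c = coef_cts[OF rep ij]
  have pos: "\<pi> \<mu> $$ (i, j) = cm_integral \<mu> (coef \<pi> i j)" if mu: "\<mu> \<in> pos_measures" for \<mu>
  proof -
    obtain r :: "nat \<Rightarrow> 'a \<Rightarrow> 'a" where r: "tagging r" using tagging_exists[OF K] by blast
    then have rf: "finite (range (r n))" for n by (auto simp: tagging_def)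
    have cb: "complex_borel_measure \<mu>" using mu pos_reg reg_complex by blast
    have "(\<lambda>n. \<pi> (discretize (r n) \<mu>) $$ (i, j)) \<longlonglongrightarrow> \<pi> \<mu> $$ (i, j)"
      using riemann_sum_tendsto[OF K cb r]
      by (intro rep_tendsto[OF rep _ _ _ ij] mu discretize rf) (simp_all add: discretize(2)[OF rf] mu)
    moreover have "\<pi> (discretize (r n) \<mu>) $$ (i, j) = riemann_sum (r n) \<mu> (coef \<pi> i j)" for n
      unfolding discretize_def riemann_sum_def coef_def using rep_sum[OF rep rf dirac_reg ij] by simp
    ultimately show ?thesis using LIMSEQ_unique[OF riemann_sum_tendsto[OF K cb r c]] by simp
  qed
  obtain M :: "nat \<Rightarrow> 'a measure" and a where M: "\<And>i. finite_measure (M i)" "\<And>i. sets (M i) = sets borel"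
      "\<And>i. cmod (a i) = 1" "\<mu> = (\<lambda>A. \<Sum>i<4. a i * complex_of_real (measure (M i) A))"
    by (rule complex_Jordan[OF mu[unfolded reg_complex]]) (rule that)
  define m where "m i = (\<lambda>A. complex_of_real (measure (M i) A))" for i
  have mp: "m i \<in> pos_measures" for i unfolding m_def using pos_measures_of_measure M by blast
  then have mr: "m i \<in> reg_measures" and mc: "complex_borel_measure (m i)" for i using pos_reg reg_complex by blast+
  have eq: "\<mu> = (\<lambda>A. \<Sum>i<4. a i * m i A)" using M(4) unfolding m_def .
  show ?thesis unfolding eq
    using rep_sum[OF rep _ mr ij, of "{..<4}" a] cm_integral_sum_measure(2)[OF K mc c, of "{..<4}" a] pos[OF mp] by simp
qed

lemma coef_rep_coef:
  assumes rep: "representation conv e ck \<pi>"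
  shows "coef_rep (rep_dim e \<pi>) (coef \<pi>)"
  unfolding coef_rep_def
proof (intro allI impI conjI)
  let ?d = "rep_dim e \<pi>"
  have R: "\<And>\<mu>. \<mu> \<in> reg_measures \<Longrightarrow> \<pi> \<mu> \<in> carrier_mat ?d ?d" "\<pi> (dirac e) = 1\<^sub>m ?d"
    "\<And>\<mu> \<nu>. \<mu> \<in> reg_measures \<Longrightarrow> \<nu> \<in> reg_measures \<Longrightarrow> \<pi> (\<mu> \<star> \<nu>) = \<pi> \<mu> * \<pi> \<nu>"
    "\<And>\<mu>. \<mu> \<in> reg_measures \<Longrightarrow> \<pi> (\<lambda>A. cnj (check_measure ck \<mu> A)) = mat_adjoint (\<pi> \<mu>)"
    using rep unfolding representation_def Let_def by blast+
  fix i j assume ij: "i < ?d" "j < ?d"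
  show "cts (coef \<pi> i j)" by (rule coef_cts[OF rep ij])
  show "coef \<pi> i j e = (if i = j then 1 else 0)" unfolding coef_def R(2) using ij by simp
  fix x
  show "coef \<pi> i j (ck x) = cnj (coef \<pi> j i x)"
  proof -
    have "(\<lambda>A. cnj (check_measure ck (dirac x) A)) = dirac (ck x)"
      unfolding check_dirac by (auto simp: dirac_def)
    then have "\<pi> (dirac (ck x)) = mat_adjoint (\<pi> (dirac x))" using R(4)[OF dirac_reg, of x] by simp
    then show ?thesis unfolding coef_def using mat_adjoint_index(3)[of i "\<pi> (dirac x)" j] R(1)[OF dirac_reg, of x] ij by simp
  qed
  fix y
  have r: "dirac x \<star> dirac y \<in> reg_measures" using conv_dirac_pos pos_reg by blast
  show "tr (coef \<pi> i j) x y = (\<Sum>l<?d. coef \<pi> i l x * coef \<pi> l j y)"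
    unfolding tr_def rep_cm_integral[OF rep ij r, symmetric] R(3)[OF dirac_reg dirac_reg] coef_def
    by (rule mult_mat_index_sum[OF R(1)[OF dirac_reg] R(1)[OF dirac_reg] ij])
qed

text \<open>Intertwining matrices: a(x) T = T a'(x) at every point, with \<open>T\<close> given by
  its entries so that averages can be inserted directly.\<close>

definition inter :: "nat \<Rightarrow> nat \<Rightarrow> (nat \<Rightarrow> nat \<Rightarrow> 'a \<Rightarrow> complex) \<Rightarrow> (nat \<Rightarrow> nat \<Rightarrow> 'a \<Rightarrow> complex) \<Rightarrow>
    (nat \<Rightarrow> nat \<Rightarrow> complex) \<Rightarrow> bool" where
  "inter d d' a a' T \<longleftrightarrow> (\<forall>i<d. \<forall>j<d'. \<forall>x. (\<Sum>l<d. a i l x * T l j) = (\<Sum>m<d'. T i m * a' m j x))"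

lemma inter_adjoint:
  assumes a: "coef_rep d a" "coef_rep d' a'" and T: "inter d d' a a' T"
  shows "inter d' d a' a (\<lambda>m l. cnj (T l m))"
  unfolding inter_def
proof (intro allI impI)
  fix i j x assume ij: "i < d'" "j < d"
  have "(\<Sum>l<d. a j l (ck x) * T l i) = (\<Sum>m<d'. T j m * a' m i (ck x))"
    using T ij unfolding inter_def by blast
  then have "cnj (\<Sum>l<d. a j l (ck x) * T l i) = cnj (\<Sum>m<d'. T j m * a' m i (ck x))" by simp
  moreover have "a j l (ck x) = cnj (a l j x)" if "l < d" for l using a(1) ij that unfolding coef_rep_def by blast
  moreover have "a' m i (ck x) = cnj (a' i m x)" if "m < d'" for m using a(2) ij that unfolding coef_rep_def by blast
  ultimately show "(\<Sum>l<d'. a' i l x * cnj (T j l)) = (\<Sum>m<d. cnj (T m i) * a m j x)"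
    by (simp add: mult.commute)
qed

lemma inter_comp:
  assumes T: "inter d d' a a' T" and S: "inter d' d'' a' a'' S"
  shows "inter d d'' a a'' (\<lambda>i j. \<Sum>m<d'. T i m * S m j)"
  unfolding inter_def
proof (intro allI impI)
  fix i j x assume ij: "i < d" "j < d''"
  have "(\<Sum>l<d. a i l x * (\<Sum>m<d'. T l m * S m j)) = (\<Sum>m<d'. (\<Sum>l<d. a i l x * T l m) * S m j)"
    by (simp add: sum_distrib_left sum_distrib_right mult.assoc) (rule sum.swap)
  also have "\<dots> = (\<Sum>m<d'. (\<Sum>k<d'. T i k * a' k m x) * S m j)"
    using T ij unfolding inter_def by (intro sum.cong) auto
  also have "\<dots> = (\<Sum>k<d'. T i k * (\<Sum>m<d'. a' k m x * S m j))"
    by (simp add: sum_distrib_left sum_distrib_right mult.assoc) (rule sum.swap)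
  also have "\<dots> = (\<Sum>k<d'. T i k * (\<Sum>m<d''. S k m * a'' m j x))"
    using S ij unfolding inter_def by (intro sum.cong) auto
  also have "\<dots> = (\<Sum>m<d''. (\<Sum>k<d'. T i k * S k m) * a'' m j x)"
    by (simp add: sum_distrib_left sum_distrib_right mult.assoc) (rule sum.swap)
  finally show "(\<Sum>l<d. a i l x * (\<Sum>m<d'. T l m * S m j)) = (\<Sum>m<d''. (\<Sum>k<d'. T i k * S k m) * a'' m j x)" .
qed

lemma Schur:
  assumes irr: "irreducible_rep conv e ck \<pi>" and T: "inter (rep_dim e \<pi>) (rep_dim e \<pi>) (coef \<pi>) (coef \<pi>) T"
  shows "\<exists>c. \<forall>i<rep_dim e \<pi>. \<forall>j<rep_dim e \<pi>. T i j = (if i = j then c else 0)"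
proof -
  let ?d = "rep_dim e \<pi>"
  have rep: "representation conv e ck \<pi>" and d0: "?d > 0" using irr unfolding irreducible_rep_def by auto
  have R: "\<And>\<mu>. \<mu> \<in> reg_measures \<Longrightarrow> \<pi> \<mu> \<in> carrier_mat ?d ?d"
    using rep unfolding representation_def Let_def by blast
  define M where "M = Matrix.mat ?d ?d (\<lambda>(i, j). T i j)"
  have M: "M \<in> carrier_mat ?d ?d" unfolding M_def by simp
  \<comment> \<open>The intertwining relation is given at points only. Integrating the coefficients
    extends it to all measures, which is what \<open>invariant_subspace\<close> asks of the
    eigenspace below.\<close>
  have comm: "\<pi> \<mu> * M = M * \<pi> \<mu>" if mu: "\<mu> \<in> reg_measures" for \<mu>
  proof (rule eq_matI)
    have cb: "complex_borel_measure \<mu>" using mu reg_complex by blast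
    fix i j assume "i < dim_row (M * \<pi> \<mu>)" "j < dim_col (M * \<pi> \<mu>)"
    then have ij: "i < ?d" "j < ?d" using M R[OF mu] by auto
    have "(\<pi> \<mu> * M) $$ (i, j) = (\<Sum>l<?d. T l j * cm_integral \<mu> (coef \<pi> i l))"
      unfolding mult_mat_index_sum[OF R[OF mu] M ij] using rep_cm_integral[OF rep ij(1) _ mu] ij
      by (intro sum.cong) (auto simp: M_def)
    also have "\<dots> = cm_integral \<mu> (\<lambda>x. \<Sum>l<?d. T l j * coef \<pi> i l x)"
      using coef_cts[OF rep ij(1)] by (intro cm_integral_sum_fun[OF K cb, symmetric]) auto
    also have "\<dots> = cm_integral \<mu> (\<lambda>x. \<Sum>m<?d. T i m * coef \<pi> m j x)"
      using T ij unfolding inter_def by (simp add: mult.commute)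
    also have "\<dots> = (\<Sum>m<?d. T i m * cm_integral \<mu> (coef \<pi> m j))"
      using coef_cts[OF rep _ ij(2)] by (intro cm_integral_sum_fun[OF K cb]) auto
    also have "\<dots> = (M * \<pi> \<mu>) $$ (i, j)"
      unfolding mult_mat_index_sum[OF M R[OF mu] ij] using rep_cm_integral[OF rep _ ij(2) mu] ij
      by (intro sum.cong) (auto simp: M_def)
    finally show "(\<pi> \<mu> * M) $$ (i, j) = (M * \<pi> \<mu>) $$ (i, j)" .
  qed (use M R[OF mu] in auto)
  obtain c where "c \<in> spectrum M" using spectrum_non_empty[OF M d0] by blast
  then obtain v where v: "v \<in> carrier_vec ?d" "v \<noteq> 0\<^sub>v ?d" "M *\<^sub>v v = c \<cdot>\<^sub>v v"
    using M unfolding spectrum_def eigenvalue_def eigenvector_def by auto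
  define W where "W = {w \<in> carrier_vec ?d. M *\<^sub>v w = c \<cdot>\<^sub>v w}"
  have "invariant_subspace e \<pi> W"
    unfolding invariant_subspace_def
  proof (intro conjI ballI allI)
    show "0\<^sub>v ?d \<in> W" unfolding W_def using M by auto
    show "u + w \<in> W" if "u \<in> W" "w \<in> W" for u w
      using that M unfolding W_def by (auto simp: mult_add_distrib_mat_vec smult_add_distrib_vec)
    show "k \<cdot>\<^sub>v w \<in> W" if "w \<in> W" for k w
      using that M unfolding W_def by (auto simp: mult_mat_vec smult_smult_assoc mult.commute)
    show "\<pi> \<mu> *\<^sub>v w \<in> W" if mu: "\<mu> \<in> reg_measures" and w: "w \<in> W" for \<mu> w
    proof -
      have wc: "w \<in> carrier_vec ?d" "M *\<^sub>v w = c \<cdot>\<^sub>v w" using w unfolding W_def by auto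
      have "M *\<^sub>v (\<pi> \<mu> *\<^sub>v w) = (M * \<pi> \<mu>) *\<^sub>v w" using M R[OF mu] wc by (simp add: assoc_mult_mat_vec)
      also have "\<dots> = \<pi> \<mu> *\<^sub>v (M *\<^sub>v w)" unfolding comm[OF mu, symmetric] using M R[OF mu] wc by (simp add: assoc_mult_mat_vec)
      also have "\<dots> = c \<cdot>\<^sub>v (\<pi> \<mu> *\<^sub>v w)" unfolding wc(2) using R[OF mu] wc by (simp add: mult_mat_vec)
      finally show ?thesis unfolding W_def using R[OF mu] wc by auto
    qed
  qed (auto simp: W_def)
  then have "W = {0\<^sub>v ?d} \<or> W = carrier_vec ?d" using irr unfolding irreducible_rep_def by blast
  moreover have "v \<in> W" unfolding W_def using v by simp
  ultimately have W: "W = carrier_vec ?d" using v(2) by auto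
  have "T i j = (if i = j then c else 0)" if ij: "i < ?d" "j < ?d" for i j
  proof -
    have "unit_vec ?d j \<in> W" unfolding W by simp
    then have "vec_index (M *\<^sub>v unit_vec ?d j) i = vec_index (c \<cdot>\<^sub>v unit_vec ?d j) i" unfolding W_def by auto
    moreover have "vec_index (M *\<^sub>v unit_vec ?d j) i = (\<Sum>k<?d. T i k * (if k = j then 1 else 0))"
      unfolding mult_mat_vec_index_sum[OF M unit_vec_carrier ij(1)] using ij by (auto simp: M_def intro!: sum.cong)
    ultimately show ?thesis using ij unfolding sum_unit_right[OF ij(2)] by simp
  qed
  then show ?thesis by blast
qed

text \<open>By Schur's lemma T times its adjoint is c times the identity and the reverse product is
  c' times the identity. Evaluating T T^H T (with T^H the adjoint) at a nonzero entry gives c = c',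
  the traces give equal dimensions, and c > 0 is visible in row \<open>i0\<close>. Hence T divided
  by the square root of c is unitary.\<close>

lemma inter_rep_equiv:
  assumes irr: "irreducible_rep conv e ck \<pi>" "irreducible_rep conv e ck \<pi>'"
    and T: "inter (rep_dim e \<pi>) (rep_dim e \<pi>') (coef \<pi>) (coef \<pi>') T"
    and nz: "i0 < rep_dim e \<pi>" "j0 < rep_dim e \<pi>'" "T i0 j0 \<noteq> 0"
  shows "rep_equiv e \<pi>' \<pi>"
proof -
  let ?d = "rep_dim e \<pi>" and ?d' = "rep_dim e \<pi>'"
  have rep: "representation conv e ck \<pi>" "representation conv e ck \<pi>'" using irr unfolding irreducible_rep_def by auto
  note cr = coef_rep_coef[OF rep(1)] coef_rep_coef[OF rep(2)]
  note Ts = inter_adjoint[OF cr T]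
  obtain c where c: "\<And>i j. i < ?d \<Longrightarrow> j < ?d \<Longrightarrow> (\<Sum>m<?d'. T i m * cnj (T j m)) = (if i = j then c else 0)"
    using Schur[OF irr(1) inter_comp[OF T Ts]] by auto
  obtain c' where c': "\<And>i j. i < ?d' \<Longrightarrow> j < ?d' \<Longrightarrow> (\<Sum>m<?d. cnj (T m i) * T m j) = (if i = j then c' else 0)"
    using Schur[OF irr(2) inter_comp[OF Ts T]] by auto
  have "c = (\<Sum>m<?d'. T i0 m * cnj (T i0 m))" using c[OF nz(1) nz(1)] by simp
  also have "\<dots> = complex_of_real (\<Sum>m<?d'. (cmod (T i0 m))\<^sup>2)" unfolding mult_cnj_cmod by simp
  finally have cr': "c = complex_of_real (\<Sum>m<?d'. (cmod (T i0 m))\<^sup>2)" .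
  have "(cmod (T i0 j0))\<^sup>2 \<le> (\<Sum>m<?d'. (cmod (T i0 m))\<^sup>2)" using nz by (intro member_le_sum) auto
  moreover have "(cmod (T i0 j0))\<^sup>2 > 0" using nz(3) by simp
  ultimately obtain C where C: "C > 0" "c = complex_of_real C" using cr' by (metis less_le_trans)
  have "c * T i0 j0 = (\<Sum>l<?d. (\<Sum>m<?d'. T i0 m * cnj (T l m)) * T l j0)"
  proof -
    have "(\<Sum>l<?d. (\<Sum>m<?d'. T i0 m * cnj (T l m)) * T l j0) = (\<Sum>l<?d. (if i0 = l then c else 0) * T l j0)"
      using c[OF nz(1)] by (intro sum.cong) auto
    also have "\<dots> = (\<Sum>l<?d. if i0 = l then c * T l j0 else 0)" by (intro sum.cong) auto
    finally show ?thesis using nz by simp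
  qed
  also have "\<dots> = (\<Sum>m<?d'. T i0 m * (\<Sum>l<?d. cnj (T l m) * T l j0))"
    by (simp add: sum_distrib_left sum_distrib_right mult.assoc) (rule sum.swap)
  also have "\<dots> = (\<Sum>m<?d'. T i0 m * (if m = j0 then c' else 0))"
    using c'[OF _ nz(2)] by (intro sum.cong) auto
  also have "\<dots> = (\<Sum>m<?d'. if m = j0 then T i0 m * c' else 0)" by (intro sum.cong) auto
  also have "\<dots> = c' * T i0 j0" using nz by simp
  finally have cc: "c' = c" using nz(3) by simp
  have "(\<Sum>i<?d. \<Sum>m<?d'. T i m * cnj (T i m)) = of_nat ?d * c" using c by simp
  moreover have "(\<Sum>m<?d'. \<Sum>i<?d. cnj (T i m) * T i m) = of_nat ?d' * c" using c' cc by simp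
  moreover have "(\<Sum>i<?d. \<Sum>m<?d'. T i m * cnj (T i m)) = (\<Sum>m<?d'. \<Sum>i<?d. cnj (T i m) * T i m)"
    by (subst sum.swap) (simp add: mult.commute)
  ultimately have dd: "?d = ?d'" using C by simp
  define U where "U = Matrix.mat ?d ?d (\<lambda>(i, j). T i j / sqrt C)"
  have U: "U \<in> carrier_mat ?d ?d" unfolding U_def by simp
  have Us: "mat_adjoint U \<in> carrier_mat ?d ?d" using U mat_adjoint_index(1,2)[of U] by (metis carrier_matD carrier_matI)
  have Ui: "U $$ (i, j) = T i j / sqrt C" if "i < ?d" "j < ?d" for i j using that unfolding U_def by simp
  have Usi: "mat_adjoint U $$ (i, j) = cnj (T j i) / sqrt C" if "i < ?d" "j < ?d" for i j
    using that U Ui mat_adjoint_index(3)[of i U j] by simp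
  have sq: "complex_of_real (sqrt C) * complex_of_real (sqrt C) = c"
    using C by (metis of_real_mult real_sqrt_mult_self abs_of_pos)
  have u1: "U * mat_adjoint U = 1\<^sub>m ?d"
  proof (rule eq_matI)
    fix i j assume "i < dim_row (1\<^sub>m ?d :: complex mat)" "j < dim_col (1\<^sub>m ?d :: complex mat)"
    then have ij: "i < ?d" "j < ?d" by auto
    have "(U * mat_adjoint U) $$ (i, j) = (\<Sum>k<?d. T i k * cnj (T j k)) / c"
      unfolding mult_mat_index_sum[OF U Us ij] sum_divide_distrib sq[symmetric] using ij Ui Usi
      by (intro sum.cong) auto
    then show "(U * mat_adjoint U) $$ (i, j) = 1\<^sub>m ?d $$ (i, j)" using c[OF ij] ij C dd by auto
  qed (use U Us in auto)
  have u2: "mat_adjoint U * U = 1\<^sub>m ?d"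
  proof (rule eq_matI)
    fix i j assume "i < dim_row (1\<^sub>m ?d :: complex mat)" "j < dim_col (1\<^sub>m ?d :: complex mat)"
    then have ij: "i < ?d" "j < ?d" by auto
    have "(mat_adjoint U * U) $$ (i, j) = (\<Sum>k<?d. cnj (T k i) * T k j) / c"
      unfolding mult_mat_index_sum[OF Us U ij] sum_divide_distrib sq[symmetric] using ij Ui Usi
      by (intro sum.cong) auto
    then show "(mat_adjoint U * U) $$ (i, j) = 1\<^sub>m ?d $$ (i, j)" using c'[of i j] ij C dd cc by auto
  qed (use U Us in auto)
  have R: "\<And>\<mu>. \<mu> \<in> reg_measures \<Longrightarrow> \<pi> \<mu> \<in> carrier_mat ?d ?d" "\<And>\<mu>. \<mu> \<in> reg_measures \<Longrightarrow> \<pi>' \<mu> \<in> carrier_mat ?d ?d"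
    using rep unfolding representation_def Let_def dd by blast+
  have int: "\<pi> \<mu> * U = U * \<pi>' \<mu>" if mu: "\<mu> \<in> reg_measures" for \<mu>
  proof (rule eq_matI)
    have cb: "complex_borel_measure \<mu>" using mu reg_complex by blast
    fix i j assume "i < dim_row (U * \<pi>' \<mu>)" "j < dim_col (U * \<pi>' \<mu>)"
    then have ij: "i < ?d" "j < ?d" using U R(2)[OF mu] by auto
    then have ij': "j < ?d'" using dd by simp
    have "(\<pi> \<mu> * U) $$ (i, j) = (\<Sum>l<?d. T l j / sqrt C * cm_integral \<mu> (coef \<pi> i l))"
      unfolding mult_mat_index_sum[OF R(1)[OF mu] U ij] using rep_cm_integral[OF rep(1) ij(1) _ mu] ij
      by (intro sum.cong) (auto simp: Ui)
    also have "\<dots> = cm_integral \<mu> (\<lambda>x. \<Sum>l<?d. T l j / sqrt C * coef \<pi> i l x)"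
      using coef_cts[OF rep(1) ij(1)] by (intro cm_integral_sum_fun[OF K cb, symmetric]) auto
    also have "\<dots> = cm_integral \<mu> (\<lambda>x. \<Sum>m<?d'. T i m / sqrt C * coef \<pi>' m j x)"
    proof -
      have "(\<Sum>l<?d. T l j / sqrt C * coef \<pi> i l x) = (\<Sum>l<?d. coef \<pi> i l x * T l j) / sqrt C" for x
        by (simp add: sum_divide_distrib mult.commute)
      also have "\<dots> x = (\<Sum>m<?d'. T i m * coef \<pi>' m j x) / sqrt C" for x
        using T ij(1) ij' unfolding inter_def by simp
      finally show ?thesis by (simp add: sum_divide_distrib)
    qed
    also have "\<dots> = (\<Sum>m<?d'. T i m / sqrt C * cm_integral \<mu> (coef \<pi>' m j))"
      using coef_cts[OF rep(2) _ ij'] by (intro cm_integral_sum_fun[OF K cb]) auto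
    also have "\<dots> = (\<Sum>m<?d. T i m / sqrt C * cm_integral \<mu> (coef \<pi>' m j))" using dd by simp
    also have "\<dots> = (U * \<pi>' \<mu>) $$ (i, j)"
      unfolding mult_mat_index_sum[OF U R(2)[OF mu] ij] using rep_cm_integral[OF rep(2) _ ij' mu] ij dd
      by (intro sum.cong) (auto simp: Ui)
    finally show "(\<pi> \<mu> * U) $$ (i, j) = (U * \<pi>' \<mu>) $$ (i, j)" .
  qed (use U R[OF mu] in auto)
  have "\<pi> \<mu> = U * \<pi>' \<mu> * mat_adjoint U" if mu: "\<mu> \<in> reg_measures" for \<mu>
  proof -
    have "U * \<pi>' \<mu> * mat_adjoint U = \<pi> \<mu> * (U * mat_adjoint U)"
      unfolding int[OF mu, symmetric] using R[OF mu] U Us by (simp add: assoc_mult_mat)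
    then show ?thesis unfolding u1 using R(1)[OF mu] by simp
  qed
  then show ?thesis unfolding rep_equiv_def using U u1 u2 dd by metis
qed

text \<open>The matrix is the average of a(x) E a'(x)^H, where E is the matrix unit at (b, b') and
  ^H denotes the adjoint. The substitution used for groups is replaced by
  \<open>tr_adjoint\<close>.\<close>

lemma inter_average:
  assumes a: "coef_rep d a" "coef_rep d' a'" and b: "b < d" "b' < d'"
  shows "inter d d' a a' (\<lambda>i j. LINT x|haar. a i b x * cnj (a' j b' x))"
  unfolding inter_def
proof (intro allI impI)
  fix i j y assume ij: "i < d" "j < d'"
  have ca: "cts (a i l)" if "i < d" "l < d" for i l using a(1) that unfolding coef_rep_def by blast
  have ca': "cts (a' i l)" if "i < d'" "l < d'" for i l using a(2) that unfolding coef_rep_def by blast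
  have int: "integrable haar (\<lambda>x. a i b x * cnj (a' j b' x))" if "i < d" "j < d'" for i j
    using ca ca' that b by (intro integrable_haar continuous_intros) auto
  have "(\<Sum>l<d. a i l y * (LINT x|haar. a l b x * cnj (a' j b' x)))
      = (LINT x|haar. (\<Sum>l<d. a i l y * (a l b x * cnj (a' j b' x))))"
    using int ij by (subst Bochner_Integration.integral_sum) auto
  also have "\<dots> = (LINT x|haar. tr (a i b) y x * cnj (a' j b' x))"
    using a(1) ij b unfolding coef_rep_def by (simp add: sum_distrib_right mult.assoc)
  also have "\<dots> = (LINT x|haar. a i b x * tr (\<lambda>x. cnj (a' j b' x)) (ck y) x)"
    using ca ca' ij b by (intro tr_adjoint continuous_intros) auto
  also have "\<dots> = (LINT x|haar. (\<Sum>m<d'. (a i b x * cnj (a' m b' x)) * a' m j y))"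
  proof -
    have "tr (\<lambda>x. cnj (a' j b' x)) (ck y) x = (\<Sum>m<d'. cnj (a' m b' x) * a' m j y)" for x
    proof -
      have "tr (a' j b') (ck y) x = (\<Sum>m<d'. a' j m (ck y) * a' m b' x)"
        using a(2) ij b unfolding coef_rep_def by blast
      also have "\<dots> = (\<Sum>m<d'. cnj (a' m j y) * a' m b' x)"
        using a(2) ij unfolding coef_rep_def by (intro sum.cong) auto
      finally show ?thesis unfolding tr_cnj[OF ca'[OF ij(2) b(2)]] by (simp add: mult.commute)
    qed
    then show ?thesis by (simp add: sum_distrib_left mult.assoc)
  qed
  also have "\<dots> = (\<Sum>m<d'. (LINT x|haar. a i b x * cnj (a' m b' x)) * a' m j y)"
    using int ij by (subst Bochner_Integration.integral_sum) auto
  finally show "(\<Sum>l<d. a i l y * (LINT x|haar. a l b x * cnj (a' j b' x)))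
      = (\<Sum>m<d'. (LINT x|haar. a i b x * cnj (a' m b' x)) * a' m j y)" .
qed

lemma orthogonality_inequivalent:
  assumes irr: "irreducible_rep conv e ck \<pi>" "irreducible_rep conv e ck \<pi>'" and ne: "\<not> rep_equiv e \<pi>' \<pi>"
    and "i < rep_dim e \<pi>" "b < rep_dim e \<pi>" "j < rep_dim e \<pi>'" "b' < rep_dim e \<pi>'"
  shows "(LINT x|haar. coef \<pi> i b x * cnj (coef \<pi>' j b' x)) = 0"
proof -
  have "representation conv e ck \<pi>" "representation conv e ck \<pi>'" using irr unfolding irreducible_rep_def by auto
  then show ?thesis
    using inter_rep_equiv[OF irr inter_average[OF coef_rep_coef coef_rep_coef]] assms(3-) by blast
qed

text \<open>Schur's lemma forces equal row indices and a constant depending on the column indices.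
  Invariance of the Haar measure under \<open>ck\<close> exchanges rows and columns, so the columns
  must agree as well and one constant is left; it is positive because the coefficient is 1 at
  \<open>e\<close>.\<close>

lemma orthogonality_same:
  assumes irr: "irreducible_rep conv e ck \<pi>"
  shows "\<exists>k>0. \<forall>i<rep_dim e \<pi>. \<forall>j<rep_dim e \<pi>. \<forall>m<rep_dim e \<pi>. \<forall>l<rep_dim e \<pi>.
    (LINT x|haar. coef \<pi> i j x * cnj (coef \<pi> m l x)) = (if i = m \<and> j = l then complex_of_real (1 / k) else 0)"
proof -
  let ?d = "rep_dim e \<pi>" and ?a = "coef \<pi>"
  have rep: "representation conv e ck \<pi>" and d0: "0 < ?d" using irr unfolding irreducible_rep_def by auto
  note cr = coef_rep_coef[OF rep]
  have "\<exists>c. \<forall>i<?d. \<forall>j<?d. (LINT x|haar. ?a i b x * cnj (?a j b' x)) = (if i = j then c else 0)"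
    if "b < ?d" "b' < ?d" for b b' using Schur[OF irr inter_average[OF cr cr that]] .
  then obtain C where C: "\<And>b b' i j. b < ?d \<Longrightarrow> b' < ?d \<Longrightarrow> i < ?d \<Longrightarrow> j < ?d \<Longrightarrow>
      (LINT x|haar. ?a i b x * cnj (?a j b' x)) = (if i = j then C b b' else 0)" by metis
  have sym: "(if i = j then C b b' else 0) = (if b' = b then C j i else 0)"
    if h: "b < ?d" "b' < ?d" "i < ?d" "j < ?d" for i j b b'
  proof -
    have ct: "cts (\<lambda>x. ?a i b x * cnj (?a j b' x))" using coef_cts[OF rep] h by (intro continuous_intros) auto
    have "(LINT x|haar. ?a i b x * cnj (?a j b' x)) = (LINT x|haar. ?a i b (ck x) * cnj (?a j b' (ck x)))"
      by (rule haar_symmetric[OF ct, symmetric])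
    also have "\<dots> = (LINT x|haar. ?a b' j x * cnj (?a b i x))"
      using cr h unfolding coef_rep_def by (simp add: mult.commute)
    finally show ?thesis unfolding C[OF h] C[OF h(4,3,2,1)] .
  qed
  have Cb: "C b b' = (if b = b' then C 0 0 else 0)" if "b < ?d" "b' < ?d" for b b'
    using sym[OF that d0 d0] by auto
  have sq: "?a 0 0 x * cnj (?a 0 0 x) = complex_of_real ((cmod (?a 0 0 x))\<^sup>2)" for x by (rule complex_norm_square[symmetric])
  have "C 0 0 = (LINT x|haar. ?a 0 0 x * cnj (?a 0 0 x))" using C[OF d0 d0 d0 d0] by simp
  also have "\<dots> = complex_of_real (LINT x|haar. (cmod (?a 0 0 x))\<^sup>2)" unfolding sq by (rule integral_complex_of_real)
  finally have C0: "C 0 0 = complex_of_real (LINT x|haar. (cmod (?a 0 0 x))\<^sup>2)" .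
  have "(LINT x|haar. (cmod (?a 0 0 x))\<^sup>2) \<noteq> 0"
  proof
    assume "(LINT x|haar. (cmod (?a 0 0 x))\<^sup>2) = 0"
    then have "(cmod (?a 0 0 e))\<^sup>2 = 0"
    proof (rule haar_full_support[rotated 2])
      show "continuous_on UNIV (\<lambda>x. (cmod (?a 0 0 x))\<^sup>2)" by (intro continuous_intros coef_cts[OF rep d0 d0])
    qed simp
    then show False using cr d0 unfolding coef_rep_def by simp
  qed
  moreover have "0 \<le> (LINT x|haar. (cmod (?a 0 0 x))\<^sup>2)" by simp
  ultimately have "(LINT x|haar. (cmod (?a 0 0 x))\<^sup>2) > 0" by linarith
  moreover define k where "k = 1 / (LINT x|haar. (cmod (?a 0 0 x))\<^sup>2)"
  ultimately have k: "k > 0" "C 0 0 = complex_of_real (1 / k)" using C0 by auto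
  show ?thesis
    using k C Cb by (intro exI[of _ k]) auto
qed

lemma hyperdim_orthogonality:
  assumes irr: "irreducible_rep conv e ck \<pi>"
  shows "hyperdim e haar \<pi> > 0"
    "i < rep_dim e \<pi> \<Longrightarrow> j < rep_dim e \<pi> \<Longrightarrow> m < rep_dim e \<pi> \<Longrightarrow> l < rep_dim e \<pi> \<Longrightarrow>
    (LINT x|haar. coef \<pi> i j x * cnj (coef \<pi> m l x)) =
      (if i = m \<and> j = l then complex_of_real (1 / hyperdim e haar \<pi>) else 0)"
proof -
  obtain k where k: "k > 0" "\<forall>i<rep_dim e \<pi>. \<forall>j<rep_dim e \<pi>. \<forall>m<rep_dim e \<pi>. \<forall>l<rep_dim e \<pi>.
    (LINT x|haar. coef \<pi> i j x * cnj (coef \<pi> m l x)) = (if i = m \<and> j = l then complex_of_real (1 / k) else 0)"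
    using orthogonality_same[OF irr] by blast
  have d0: "0 < rep_dim e \<pi>" using irr unfolding irreducible_rep_def by auto
  have "hyperdim e haar \<pi> = k"
    unfolding hyperdim_def coef_def[symmetric]
  proof (rule the_equality)
    fix k' assume k': "\<forall>i<rep_dim e \<pi>. \<forall>j<rep_dim e \<pi>. \<forall>m<rep_dim e \<pi>. \<forall>l<rep_dim e \<pi>.
      (LINT x|haar. coef \<pi> i j x * cnj (coef \<pi> m l x)) = (if i = m \<and> j = l then complex_of_real (1 / k') else 0)"
    have "(LINT x|haar. coef \<pi> 0 0 x * cnj (coef \<pi> 0 0 x)) = complex_of_real (1 / k)" using k(2) d0 by auto
    moreover have "(LINT x|haar. coef \<pi> 0 0 x * cnj (coef \<pi> 0 0 x)) = complex_of_real (1 / k')" using k' d0 by auto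
    ultimately have "1 / k' = 1 / k" by (metis of_real_eq_iff)
    then show "k' = k" by (metis divide_cancel_left one_neq_zero)
  qed (fact k(2))
  then show "hyperdim e haar \<pi> > 0"
    "i < rep_dim e \<pi> \<Longrightarrow> j < rep_dim e \<pi> \<Longrightarrow> m < rep_dim e \<pi> \<Longrightarrow> l < rep_dim e \<pi> \<Longrightarrow>
    (LINT x|haar. coef \<pi> i j x * cnj (coef \<pi> m l x)) =
      (if i = m \<and> j = l then complex_of_real (1 / hyperdim e haar \<pi>) else 0)"
    using k by auto
qed

text \<open>The maximum \<open>m\<close> of the norm of a column of \<open>\<pi>(x)\<close> satisfies \<open>m\<^sup>2 \<le> m\<close>, because
  \<open>\<pi>(x)\<^sup>* \<pi>(x)\<close> is an average of the matrices \<open>\<pi>(t)\<close>.\<close>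

lemma coef_column_bound:
  assumes a: "coef_rep d a" and j: "j < d"
  shows "(\<Sum>i<d. (cmod (a i j x))\<^sup>2) \<le> 1"
proof -
  define g where "g x = (\<Sum>i<d. (cmod (a i j x))\<^sup>2)" for x
  have ca: "cts (a i l)" if "i < d" "l < d" for i l using a(1) that unfolding coef_rep_def by blast
  have g: "continuous_on UNIV g" unfolding g_def using ca j by (intro continuous_intros) auto
  obtain x0 where x0: "\<And>y. g y \<le> g x0" using continuous_attains_sup[OF K _ g] by auto
  have g0: "0 \<le> g y" for y unfolding g_def by (intro sum_nonneg) auto
  have "complex_of_real (g x0) = (\<Sum>i<d. a i j x0 * cnj (a i j x0))"
    unfolding g_def mult_cnj_cmod by simp
  also have "\<dots> = (\<Sum>i<d. a j i (ck x0) * a i j x0)"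
    using a j unfolding coef_rep_def by (simp add: mult.commute)
  also have "\<dots> = tr (a j j) (ck x0) x0" using a j unfolding coef_rep_def by simp
  finally have "g x0 = cmod (tr (a j j) (ck x0) x0)" using g0[of x0] by (metis norm_of_real abs_of_nonneg)
  also have "\<dots> \<le> sqrt (g x0)"
  proof (rule tr_bound[OF ca[OF j j]])
    fix t
    have "(cmod (a j j t))\<^sup>2 \<le> g t" unfolding g_def using j by (intro member_le_sum) auto
    then have "(cmod (a j j t))\<^sup>2 \<le> g x0" using x0[of t] by simp
    then show "cmod (a j j t) \<le> sqrt (g x0)" by (rule real_le_rsqrt)
  qed
  finally have "g x0 \<le> sqrt (g x0)" .
  then have "(g x0)\<^sup>2 \<le> g x0" using g0[of x0] power_mono[of "g x0" "sqrt (g x0)" 2] by simp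
  then have "g x0 \<le> 1" using g0[of x0] mult_le_cancel_left1[of "g x0" "g x0"] by (cases "g x0 = 0") (auto simp: power2_eq_square)
  then show ?thesis using x0[of x] unfolding g_def by simp
qed

lemma coef_sum_bound:
  assumes a: "coef_rep d a"
  shows "(\<Sum>i<d. \<Sum>j<d. (cmod (a i j x))\<^sup>2) \<le> d"
proof -
  have "(\<Sum>i<d. \<Sum>j<d. (cmod (a i j x))\<^sup>2) = (\<Sum>j<d. \<Sum>i<d. (cmod (a i j x))\<^sup>2)" by (rule sum.swap)
  also have "\<dots> \<le> (\<Sum>j<d. 1)" using coef_column_bound[OF a] by (intro sum_mono) auto
  finally show ?thesis by simp
qed

text \<open>Integrating the pointwise bound d on the squared Hilbert-Schmidt norm of the matrix
  gives d^2 / k \<le> d, since each of the d^2 coefficients has squared norm 1/k. On a group the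
  pointwise bound is an equality and k = d.\<close>

lemma dim_le_hyperdim:
  assumes irr: "irreducible_rep conv e ck \<pi>"
  shows "real (rep_dim e \<pi>) \<le> hyperdim e haar \<pi>"
proof -
  interpret prob_space haar by (rule prob_haar)
  let ?d = "rep_dim e \<pi>" and ?k = "hyperdim e haar \<pi>"
  have rep: "representation conv e ck \<pi>" and d0: "0 < ?d" using irr unfolding irreducible_rep_def by auto
  note k = hyperdim_orthogonality[OF irr]
  have i: "integrable haar (\<lambda>x. (cmod (coef \<pi> i j x))\<^sup>2)" if "i < ?d" "j < ?d" for i j
  proof -
    have "integrable haar (\<lambda>x. coef \<pi> i j x * cnj (coef \<pi> i j x))"
      using coef_cts[OF rep that] by (intro integrable_haar continuous_intros)
    then show ?thesis unfolding mult_cnj_cmod complex_of_real_integrable_eq .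
  qed
  have v: "(LINT x|haar. (cmod (coef \<pi> i j x))\<^sup>2) = 1 / ?k" if "i < ?d" "j < ?d" for i j
  proof -
    have "complex_of_real (LINT x|haar. (cmod (coef \<pi> i j x))\<^sup>2) = (LINT x|haar. coef \<pi> i j x * cnj (coef \<pi> i j x))"
      unfolding mult_cnj_cmod by (rule integral_complex_of_real[symmetric])
    also have "\<dots> = complex_of_real (1 / ?k)" using k(2)[OF that that] by simp
    finally show ?thesis by (metis of_real_eq_iff)
  qed
  have "real ?d * real ?d / ?k = (\<Sum>i<?d. \<Sum>j<?d. (LINT x|haar. (cmod (coef \<pi> i j x))\<^sup>2))" using v by simp
  also have "\<dots> = (LINT x|haar. (\<Sum>i<?d. \<Sum>j<?d. (cmod (coef \<pi> i j x))\<^sup>2))"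
  proof -
    have "(LINT x|haar. (\<Sum>i<?d. \<Sum>j<?d. (cmod (coef \<pi> i j x))\<^sup>2))
        = (\<Sum>i<?d. LINT x|haar. (\<Sum>j<?d. (cmod (coef \<pi> i j x))\<^sup>2))"
      by (rule Bochner_Integration.integral_sum) (use i in \<open>auto intro!: Bochner_Integration.integrable_sum\<close>)
    also have "\<dots> = (\<Sum>i<?d. \<Sum>j<?d. (LINT x|haar. (cmod (coef \<pi> i j x))\<^sup>2))"
      by (intro sum.cong refl Bochner_Integration.integral_sum) (use i in auto)
    finally show ?thesis by simp
  qed
  also have "\<dots> \<le> (LINT x|haar. real ?d)"
    using i coef_sum_bound[OF coef_rep_coef[OF rep]] by (intro integral_mono Bochner_Integration.integrable_sum) auto
  also have "\<dots> = real ?d" by (simp add: prob_space[unfolded space_haar])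
  finally show ?thesis using k(1) d0 by (simp add: field_simps)
qed

end

section \<open>The Peter--Weyl theorem\<close>

definition sq_integrable :: "'a measure \<Rightarrow> ('a \<Rightarrow> complex) \<Rightarrow> bool" where
  "sq_integrable M f \<longleftrightarrow> f \<in> borel_measurable M \<and> integrable M (\<lambda>x. (cmod (f x))\<^sup>2)"

definition ip :: "'a measure \<Rightarrow> ('a \<Rightarrow> complex) \<Rightarrow> ('a \<Rightarrow> complex) \<Rightarrow> complex" where
  "ip M f g = (LINT x|M. f x * cnj (g x))"

definition nsq :: "'a measure \<Rightarrow> ('a \<Rightarrow> complex) \<Rightarrow> real" where
  "nsq M f = (LINT x|M. (cmod (f x))\<^sup>2)"

lemma nsq_nonneg [simp]: "0 \<le> nsq M f" unfolding nsq_def by simp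

lemma Cauchy_Schwarz_integral:
  fixes F G :: "'a \<Rightarrow> real"
  assumes m: "F \<in> borel_measurable M" "G \<in> borel_measurable M"
    and i: "integrable M (\<lambda>x. (F x)\<^sup>2)" "integrable M (\<lambda>x. (G x)\<^sup>2)"
  shows "integrable M (\<lambda>x. F x * G x)" "(LINT x|M. F x * G x)\<^sup>2 \<le> (LINT x|M. (F x)\<^sup>2) * (LINT x|M. (G x)\<^sup>2)"
proof -
  show fg: "integrable M (\<lambda>x. F x * G x)"
  proof (rule Bochner_Integration.integrable_bound)
    show "integrable M (\<lambda>x. (F x)\<^sup>2 + (G x)\<^sup>2)" using i by simp
    have "\<bar>F x * G x\<bar> \<le> (F x)\<^sup>2 + (G x)\<^sup>2" for x
      using sum_squares_bound[of "\<bar>F x\<bar>" "\<bar>G x\<bar>"] abs_ge_zero[of "F x * G x"] unfolding abs_mult power2_abs by linarith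
    then show "AE x in M. norm (F x * G x) \<le> norm ((F x)\<^sup>2 + (G x)\<^sup>2)" by simp
  qed (use m in measurable)
  define A B c where "A = (LINT x|M. (F x)\<^sup>2)" and "B = (LINT x|M. (G x)\<^sup>2)" and "c = (LINT x|M. F x * G x)"
  have q: "0 \<le> t\<^sup>2 * A - 2 * t * c + B" for t
  proof -
    have "0 \<le> (LINT x|M. (t * F x - G x)\<^sup>2)" by simp
    also have "(LINT x|M. (t * F x - G x)\<^sup>2) = (LINT x|M. t\<^sup>2 * (F x)\<^sup>2 - 2 * t * (F x * G x) + (G x)\<^sup>2)"
      by (intro Bochner_Integration.integral_cong) (auto simp: power2_eq_square algebra_simps)
    also have "\<dots> = t\<^sup>2 * A - 2 * t * c + B" unfolding A_def B_def c_def using i fg by simp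
    finally show ?thesis .
  qed
  have "0 \<le> A" unfolding A_def by simp
  then consider "A > 0" | "A = 0" by linarith
  then have "c\<^sup>2 \<le> A * B"
  proof cases
    case 1
    have "0 \<le> (c / A)\<^sup>2 * A - 2 * (c / A) * c + B" by (rule q)
    also have "\<dots> = B - c\<^sup>2 / A" using 1 by (simp add: field_simps power2_eq_square)
    finally show ?thesis using 1 by (simp add: field_simps)
  next
    case 2
    have "c = 0"
    proof (rule ccontr)
      assume "c \<noteq> 0"
      \<comment> \<open>With A = 0 the quadratic is linear in t, and this t gives it the value
        -1.\<close>
      then show False using q[of "(B + 1) / (2 * c)"] 2 by simp
    qed
    then show ?thesis using 2 by simp
  qed
  then show "(LINT x|M. F x * G x)\<^sup>2 \<le> (LINT x|M. (F x)\<^sup>2) * (LINT x|M. (G x)\<^sup>2)"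
    unfolding A_def B_def c_def .
qed

lemma borel_measurable_cnj: "f \<in> borel_measurable M \<Longrightarrow> (\<lambda>x. cnj (f x)) \<in> borel_measurable M"
  by (rule measurable_compose[OF _ borel_measurable_continuous_onI]) (auto intro: continuous_intros)

lemma integrable_mult_cnj_bounded:
  assumes h: "integrable M h" and u: "u \<in> borel_measurable M" "\<And>x. cmod (u x) \<le> B"
  shows "integrable M (\<lambda>x. h x * cnj (u x))"
proof (rule Bochner_Integration.integrable_bound)
  show "integrable M (\<lambda>x. \<bar>B\<bar> * cmod (h x))" using h by simp
  show "AE x in M. norm (h x * cnj (u x)) \<le> norm (\<bar>B\<bar> * cmod (h x))"
  proof (rule AE_I2)
    fix x
    have "cmod (u x) * cmod (h x) \<le> \<bar>B\<bar> * cmod (h x)" using order_trans[OF u(2) abs_ge_self] by (rule mult_right_mono) simp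
    then show "norm (h x * cnj (u x)) \<le> norm (\<bar>B\<bar> * cmod (h x))" by (simp add: norm_mult mult.commute)
  qed
qed (use u h in \<open>auto intro!: borel_measurable_times borel_measurable_cnj\<close>)

lemma ip_integrable:
  assumes "sq_integrable M f" "sq_integrable M g"
  shows "integrable M (\<lambda>x. f x * cnj (g x))" "cmod (ip M f g) \<le> sqrt (nsq M f) * sqrt (nsq M g)"
proof -
  have m: "f \<in> borel_measurable M" "g \<in> borel_measurable M" using assms unfolding sq_integrable_def by auto
  note CS = Cauchy_Schwarz_integral[of "\<lambda>x. cmod (f x)" M "\<lambda>x. cmod (g x)"]
  have n: "integrable M (\<lambda>x. cmod (f x) * cmod (g x))"
    "(LINT x|M. cmod (f x) * cmod (g x))\<^sup>2 \<le> nsq M f * nsq M g"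
    using CS assms m unfolding sq_integrable_def nsq_def by auto
  show "integrable M (\<lambda>x. f x * cnj (g x))"
    by (rule Bochner_Integration.integrable_bound[OF n(1)]) (use m in \<open>auto simp: norm_mult intro!: borel_measurable_cnj borel_measurable_times\<close>)
  have "cmod (ip M f g) \<le> (LINT x|M. cmod (f x) * cmod (g x))"
    unfolding ip_def using integral_norm_bound[of M "\<lambda>x. f x * cnj (g x)"] by (simp add: norm_mult)
  also have "\<dots> \<le> sqrt (nsq M f * nsq M g)" using n(2) by (rule real_le_rsqrt)
  finally show "cmod (ip M f g) \<le> sqrt (nsq M f) * sqrt (nsq M g)" by (simp add: real_sqrt_mult)
qed

lemma sq_integrable_add:
  assumes "sq_integrable M f" "sq_integrable M g"
  shows "sq_integrable M (\<lambda>x. f x + g x)"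
proof -
  have m: "f \<in> borel_measurable M" "g \<in> borel_measurable M" using assms unfolding sq_integrable_def by auto
  have "integrable M (\<lambda>x. (cmod (f x + g x))\<^sup>2)"
  proof (rule Bochner_Integration.integrable_bound)
    show "integrable M (\<lambda>x. 2 * (cmod (f x))\<^sup>2 + 2 * (cmod (g x))\<^sup>2)"
      using assms unfolding sq_integrable_def by simp
    have "(cmod (f x + g x))\<^sup>2 \<le> 2 * (cmod (f x))\<^sup>2 + 2 * (cmod (g x))\<^sup>2" for x
    proof -
      have "(cmod (f x + g x))\<^sup>2 \<le> (cmod (f x) + cmod (g x))\<^sup>2" by (intro power_mono norm_triangle_ineq) simp
      also have "\<dots> \<le> 2 * (cmod (f x))\<^sup>2 + 2 * (cmod (g x))\<^sup>2"
        using sum_squares_bound[of "cmod (f x)" "cmod (g x)"] by (simp add: power2_sum)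
      finally show ?thesis .
    qed
    then show "AE x in M. norm ((cmod (f x + g x))\<^sup>2) \<le> norm (2 * (cmod (f x))\<^sup>2 + 2 * (cmod (g x))\<^sup>2)" by simp
  qed (use m in measurable)
  then show ?thesis unfolding sq_integrable_def using m by auto
qed

lemma sq_integrable_scale: "sq_integrable M f \<Longrightarrow> sq_integrable M (\<lambda>x. c * f x)"
  unfolding sq_integrable_def by (auto simp: norm_mult power_mult_distrib)

lemma sq_integrable_sum:
  "(\<And>i. i \<in> I \<Longrightarrow> sq_integrable M (f i)) \<Longrightarrow> sq_integrable M (\<lambda>x. \<Sum>i\<in>I. a i * f i x)"
proof (induction I rule: infinite_finite_induct)
  case (insert i I)
  then show ?case by (simp add: sq_integrable_add sq_integrable_scale)
qed (auto simp: sq_integrable_def)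

lemma sq_integrable_diff:
  "sq_integrable M f \<Longrightarrow> sq_integrable M g \<Longrightarrow> sq_integrable M (\<lambda>x. f x - g x)"
  using sq_integrable_add[of M f "\<lambda>x. (-1) * g x"] sq_integrable_scale[of M g "-1"] by simp

lemma ip_sum_left:
  assumes "\<And>i. i \<in> I \<Longrightarrow> sq_integrable M (f i)" "sq_integrable M g"
  shows "ip M (\<lambda>x. \<Sum>i\<in>I. a i * f i x) g = (\<Sum>i\<in>I. a i * ip M (f i) g)"
proof -
  have "ip M (\<lambda>x. \<Sum>i\<in>I. a i * f i x) g = (LINT x|M. (\<Sum>i\<in>I. a i * (f i x * cnj (g x))))"
    unfolding ip_def by (simp add: sum_distrib_right mult.assoc)
  also have "\<dots> = (\<Sum>i\<in>I. (LINT x|M. a i * (f i x * cnj (g x))))"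
    using ip_integrable(1)[OF assms(1) assms(2)] by (intro Bochner_Integration.integral_sum) auto
  finally show ?thesis unfolding ip_def by simp
qed

lemma ip_add_left: "sq_integrable M f \<Longrightarrow> sq_integrable M g \<Longrightarrow> sq_integrable M h \<Longrightarrow>
    ip M (\<lambda>x. f x + g x) h = ip M f h + ip M g h"
  using ip_integrable(1)[of M f h] ip_integrable(1)[of M g h] unfolding ip_def by (simp add: distrib_right)

lemma ip_diff_left: "sq_integrable M f \<Longrightarrow> sq_integrable M g \<Longrightarrow> sq_integrable M h \<Longrightarrow>
    ip M (\<lambda>x. f x - g x) h = ip M f h - ip M g h"
  using ip_integrable(1)[of M f h] ip_integrable(1)[of M g h] unfolding ip_def by (simp add: left_diff_distrib)

lemma ip_scale_left: "ip M (\<lambda>x. c * f x) h = c * ip M f h"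
  unfolding ip_def by (simp add: mult.assoc)

lemma ip_cnj: "ip M g f = cnj (ip M f g)"
  unfolding ip_def using Bochner_Integration.integral_cnj[of M "\<lambda>x. f x * cnj (g x)"] by (simp add: mult.commute)

lemma ip_scale_right: "ip M f (\<lambda>x. c * h x) = cnj c * ip M f h"
  using ip_cnj[of M f "\<lambda>x. c * h x"] ip_scale_left[of M c h f] ip_cnj[of M f h] by simp

lemma ip_diff_right: "sq_integrable M f \<Longrightarrow> sq_integrable M g \<Longrightarrow> sq_integrable M h \<Longrightarrow>
    ip M h (\<lambda>x. f x - g x) = ip M h f - ip M h g"
  using ip_diff_left[of M f g h] ip_cnj[of M h] by simp

lemma ip_self: "ip M f f = complex_of_real (nsq M f)"
  unfolding ip_def nsq_def mult_cnj_cmod by (rule integral_complex_of_real)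

lemma nsq_diff: "sq_integrable M f \<Longrightarrow> sq_integrable M g \<Longrightarrow>
    nsq M (\<lambda>x. f x - g x) = nsq M f - 2 * Re (ip M f g) + nsq M g"
proof -
  assume f: "sq_integrable M f" and g: "sq_integrable M g"
  note d = sq_integrable_diff[OF f g]
  have "complex_of_real (nsq M (\<lambda>x. f x - g x)) = ip M f f - ip M f g - (ip M g f - ip M g g)"
    unfolding ip_self[symmetric] ip_diff_left[OF f g d] ip_diff_right[OF f g f] ip_diff_right[OF f g g] ..
  then have "nsq M (\<lambda>x. f x - g x) = Re (ip M f f - ip M f g - (ip M g f - ip M g g))" by (metis Re_complex_of_real)
  then show ?thesis using ip_cnj[of M g f] by (simp add: ip_self)
qed

lemma nsq_scale: "nsq M (\<lambda>x. c * f x) = (cmod c)\<^sup>2 * nsq M f"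
  unfolding nsq_def by (simp add: norm_mult power_mult_distrib)

lemma Bessel_orthogonal:
  assumes v: "\<And>i. i \<in> I \<Longrightarrow> sq_integrable M (v i)" and k: "\<And>i. i \<in> I \<Longrightarrow> k i > 0"
    and on: "\<And>i j. i \<in> I \<Longrightarrow> j \<in> I \<Longrightarrow> ip M (v i) (v j) = (if i = j then complex_of_real (1 / k i) else 0)"
    and I: "finite I" and f: "sq_integrable M f"
  shows "(\<Sum>i\<in>I. k i * (cmod (ip M f (v i)))\<^sup>2) \<le> nsq M f"
proof -
  \<comment> \<open>The squared norm of \<open>v i\<close> is 1 / \<open>k i\<close>, so
    \<open>s\<close> is the orthogonal projection of \<open>f\<close> to the span of the
    family.\<close>
  define s where "s x = (\<Sum>i\<in>I. (k i * ip M f (v i)) * v i x)" for x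
  have s: "sq_integrable M s" unfolding s_def[abs_def] using v by (intro sq_integrable_sum)
  have sv: "ip M s (v j) = ip M f (v j)" if j: "j \<in> I" for j
  proof -
    have "ip M s (v j) = (\<Sum>i\<in>I. (k i * ip M f (v i)) * ip M (v i) (v j))"
      unfolding s_def[abs_def] by (rule ip_sum_left[OF v v[OF j]])
    also have "\<dots> = (\<Sum>i\<in>I. if i = j then ip M f (v j) else 0)"
      using on j k by (intro sum.cong) (auto simp: less_imp_neq[symmetric])
    finally show ?thesis using I j by simp
  qed
  have sg: "ip M s g = (\<Sum>i\<in>I. (k i * ip M f (v i)) * ip M (v i) g)" if "sq_integrable M g" for g
    unfolding s_def[abs_def] by (rule ip_sum_left[OF v that])
  have sf: "ip M s f = complex_of_real (\<Sum>i\<in>I. k i * (cmod (ip M f (v i)))\<^sup>2)"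
    unfolding sg[OF f] of_real_sum of_real_mult mult_cnj_cmod[symmetric]
    using ip_cnj[of M _ f] by (intro sum.cong) (auto simp: mult.assoc)
  have "ip M s s = complex_of_real (\<Sum>i\<in>I. k i * (cmod (ip M f (v i)))\<^sup>2)"
    unfolding sg[OF s] of_real_sum of_real_mult mult_cnj_cmod[symmetric]
    using ip_cnj[of M _ s] sv by (intro sum.cong) (auto simp: mult.assoc)
  then have ns: "nsq M s = (\<Sum>i\<in>I. k i * (cmod (ip M f (v i)))\<^sup>2)" unfolding ip_self of_real_eq_iff .
  have "0 \<le> nsq M (\<lambda>x. s x - f x)" by simp
  also have "\<dots> = nsq M s - 2 * Re (ip M s f) + nsq M f" by (rule nsq_diff[OF s f])
  finally show ?thesis unfolding ns sf by simp
qed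

lemma Arzela_Ascoli_compact:
  fixes p :: "nat \<Rightarrow> 'a::polish_space \<Rightarrow> complex"
  assumes K: "compact (UNIV :: 'a set)" and B: "\<And>n x. cmod (p n x) \<le> B"
    and eq: "\<And>\<epsilon>. \<epsilon> > 0 \<Longrightarrow> \<exists>\<delta>>0. \<forall>n x y. dist x y < \<delta> \<longrightarrow> cmod (p n x - p n y) \<le> \<epsilon>"
  shows "\<exists>k g. strict_mono k \<and> continuous_on UNIV g \<and> uniform_limit UNIV (\<lambda>n. p (k n)) g sequentially"
proof -
  obtain D :: "'a set" where D: "countable D" "\<And>X. open X \<Longrightarrow> X \<noteq> {} \<Longrightarrow> \<exists>d\<in>D. d \<in> X"
    by (erule countable_dense_setE)
  obtain k where k: "strict_mono (k :: nat \<Rightarrow> nat)" "\<And>x. x \<in> D \<Longrightarrow> \<exists>l. (\<lambda>n. p (k n) x) \<longlonglongrightarrow> l"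
    by (rule function_convergent_subsequence[of D p B]) (use D B in auto)
  have "uniformly_Cauchy_on UNIV (\<lambda>n. p (k n))"
    unfolding uniformly_Cauchy_on_def
  proof (intro allI impI)
    fix \<epsilon> :: real assume e: "\<epsilon> > 0"
    then obtain \<delta> where d: "\<delta> > 0" "\<And>n x y. dist x y < \<delta> \<Longrightarrow> cmod (p n x - p n y) \<le> \<epsilon>/4"
      using eq[of "\<epsilon>/4"] by auto
    have cov: "UNIV \<subseteq> (\<Union>s\<in>D. ball s \<delta>)"
    proof
      fix x :: 'a
      obtain s where "s \<in> D" "s \<in> ball x \<delta>" using D(2)[of "ball x \<delta>"] d(1) by auto
      then show "x \<in> (\<Union>s\<in>D. ball s \<delta>)" by (auto simp: dist_commute)
    qed
    obtain S where S: "S \<subseteq> D" "finite S" "UNIV \<subseteq> (\<Union>s\<in>S. ball s \<delta>)"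
      by (rule compactE_image[OF K, of D "\<lambda>s. ball s \<delta>"]) (use cov in auto)
    have "\<forall>s\<in>S. \<exists>N. \<forall>m\<ge>N. \<forall>n\<ge>N. dist (p (k m) s) (p (k n) s) < \<epsilon>/4"
    proof
      fix s assume "s \<in> S"
      then have "Cauchy (\<lambda>n. p (k n) s)" using k(2)[of s] S(1) LIMSEQ_imp_Cauchy by blast
      then show "\<exists>N. \<forall>m\<ge>N. \<forall>n\<ge>N. dist (p (k m) s) (p (k n) s) < \<epsilon>/4"
        using e unfolding Cauchy_def by (metis divide_pos_pos zero_less_numeral)
    qed
    then obtain N where N: "\<And>s m n. s \<in> S \<Longrightarrow> N s \<le> m \<Longrightarrow> N s \<le> n \<Longrightarrow> dist (p (k m) s) (p (k n) s) < \<epsilon>/4"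
      by metis
    define M where "M = Max (insert 0 (N ` S))"
    have M: "N s \<le> M" if "s \<in> S" for s unfolding M_def using S(2) that by (intro Max_ge) auto
    have "dist (p (k m) x) (p (k n) x) < \<epsilon>" if mn: "m \<ge> M" "n \<ge> M" for x m n
    proof -
      have "x \<in> (\<Union>s\<in>S. ball s \<delta>)" using S(3) by (rule subsetD) simp
      then obtain s where s: "s \<in> S" "dist s x < \<delta>" unfolding UN_iff mem_ball by blast
      have "dist (p (k m) s) (p (k n) s) < \<epsilon>/4" using N[OF s(1)] M[OF s(1)] mn by auto
      moreover have "dist (p (k m) s) (p (k m) x) \<le> \<epsilon>/4" "dist (p (k n) s) (p (k n) x) \<le> \<epsilon>/4"
        using d(2)[OF s(2)] by (auto simp: dist_norm)
      moreover have "dist (p (k m) x) (p (k n) x) \<le> dist (p (k m) s) (p (k m) x) + dist (p (k m) s) (p (k n) s) + dist (p (k n) s) (p (k n) x)"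
        using dist_triangle2[of "p (k m) x" "p (k n) x" "p (k m) s"] dist_triangle[of "p (k m) s" "p (k n) x" "p (k n) s"]
          dist_commute[of "p (k m) s" "p (k m) x"] dist_commute[of "p (k n) x" "p (k m) s"] by linarith
      ultimately show ?thesis using e by linarith
    qed
    then show "\<exists>M. \<forall>x\<in>UNIV. \<forall>m\<ge>M. \<forall>n\<ge>M. dist (p (k m) x) (p (k n) x) < \<epsilon>" by blast
  qed
  then obtain g where g: "uniform_limit UNIV (\<lambda>n. p (k n)) g sequentially"
    using Cauchy_uniformly_convergent unfolding uniformly_convergent_on_def by blast
  have "continuous_on UNIV (p n)" for n
    unfolding continuous_on_iff
  proof (intro ballI allI impI)
    fix x :: 'a and \<epsilon> :: real assume e: "\<epsilon> > 0"
    then obtain \<delta> where d: "\<delta> > 0" "\<And>n x y. dist x y < \<delta> \<Longrightarrow> cmod (p n x - p n y) \<le> \<epsilon>/2"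
      using eq[of "\<epsilon>/2"] by auto
    have "dist (p n x') (p n x) < \<epsilon>" if "dist x' x < \<delta>" for x'
      using d(2)[OF that, of n] e by (simp add: dist_norm)
    then show "\<exists>d>0. \<forall>x'\<in>UNIV. dist x' x < d \<longrightarrow> dist (p n x') (p n x) < \<epsilon>" using d(1) by blast
  qed
  then have "continuous_on UNIV g" by (intro uniform_limit_theorem[OF _ g]) auto
  then show ?thesis using k(1) g by blast
qed

context haar_hypergroup
begin

lemma cts_sq: "cts f \<Longrightarrow> sq_integrable haar f"
proof -
  assume f: "cts f"
  have "integrable haar (\<lambda>x. f x * cnj (f x))" using f by (intro integrable_haar continuous_intros)
  then have "integrable haar (\<lambda>x. (cmod (f x))\<^sup>2)" unfolding mult_cnj_cmod complex_of_real_integrable_eq .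
  moreover have "f \<in> borel_measurable haar"
    by (rule cts_borel_haar[OF f])
  ultimately show ?thesis unfolding sq_integrable_def by blast
qed

lemma integrable_mult_cnj_cts:
  assumes "integrable haar h" "cts u"
  shows "integrable haar (\<lambda>x. h x * cnj (u x))"
  using continuous_on_compact_bounded[OF K assms(2)] integrable_mult_cnj_bounded[OF assms(1) cts_borel_haar[OF assms(2)]] by metis

lemma nsq_zero: "cts f \<Longrightarrow> nsq haar f = 0 \<Longrightarrow> f x = 0"
proof -
  assume "cts f" "nsq haar f = 0"
  then have "(cmod (f x))\<^sup>2 = 0"
    unfolding nsq_def by (intro haar_full_support[of "\<lambda>x. (cmod (f x))\<^sup>2"] continuous_intros) auto
  then show "f x = 0" by simp
qed

lemma L1_le_L2: "sq_integrable haar f \<Longrightarrow> integrable haar f \<and> (LINT x|haar. cmod (f x)) \<le> sqrt (nsq haar f)"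
proof -
  interpret prob_space haar by (rule prob_haar)
  assume f: "sq_integrable haar f"
  then have m: "f \<in> borel_measurable haar" "integrable haar (\<lambda>x. (cmod (f x))\<^sup>2)" unfolding sq_integrable_def by auto
  note CS = Cauchy_Schwarz_integral[of "\<lambda>x. cmod (f x)" haar "\<lambda>_. 1"]
  have 1: "integrable haar (\<lambda>x. cmod (f x))" "(LINT x|haar. cmod (f x))\<^sup>2 \<le> nsq haar f"
    using CS m unfolding nsq_def by (auto simp: prob_space[unfolded space_haar])
  have "integrable haar f" using 1(1) m(1) integrable_norm_cancel by blast
  then show ?thesis using real_le_rsqrt[OF 1(2)] by blast
qed

lemma smooth_sup_bound:
  assumes u: "cts u" and B: "\<And>y z. cmod (ker u y z) \<le> B" "B > 0" and g: "cts g"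
  shows "cmod (smooth u g y) \<le> B * sqrt (nsq haar g)"
  using smooth_bound[OF u B(1) integrable_haar[OF g], of y] L1_le_L2[OF cts_sq[OF g]] B(2)
    mult_left_mono[of "LINT z|haar. cmod (g z)" "sqrt (nsq haar g)" B] by linarith

lemma nsq_sup:
  assumes g: "cts g" and B: "\<And>x. cmod (g x) \<le> B"
  shows "nsq haar g \<le> B\<^sup>2"
proof -
  interpret prob_space haar by (rule prob_haar)
  have "nsq haar g \<le> (LINT x|haar. B\<^sup>2)"
    unfolding nsq_def using cts_sq[OF g] B by (intro integral_mono) (auto simp: sq_integrable_def intro!: power_mono)
  then show ?thesis by (simp add: prob_space[unfolded space_haar])
qed

lemma smooth_sum:
  assumes u: "cts u" and f: "\<And>i. i \<in> I \<Longrightarrow> cts (f i)"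
  shows "smooth u (\<lambda>x. \<Sum>i\<in>I. a i * f i x) y = (\<Sum>i\<in>I. a i * smooth u (f i) y)"
proof -
  have "smooth u (\<lambda>x. \<Sum>i\<in>I. a i * f i x) y = (LINT z|haar. (\<Sum>i\<in>I. a i * (ker u y z * f i z)))"
    unfolding smooth_def by (simp add: sum_distrib_left mult_ac)
  also have "\<dots> = (\<Sum>i\<in>I. (LINT z|haar. a i * (ker u y z * f i z)))"
    using f ker_cts[OF u] by (intro Bochner_Integration.integral_sum integrable_haar continuous_intros)
  finally show ?thesis unfolding smooth_def by simp
qed

lemma smooth_add: "cts u \<Longrightarrow> cts f \<Longrightarrow> cts g \<Longrightarrow> smooth u (\<lambda>t. f t + g t) y = smooth u f y + smooth u g y"
  using smooth_sum[of u "{False, True}" "\<lambda>b. if b then g else f" "\<lambda>_. 1" y] by simp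

lemma smooth_scale: "cts u \<Longrightarrow> cts f \<Longrightarrow> smooth u (\<lambda>t. c * f t) y = c * smooth u f y"
  using smooth_sum[of u "{()}" "\<lambda>_. f" "\<lambda>_. c" y] by simp

lemma smooth_diff: "cts u \<Longrightarrow> cts f \<Longrightarrow> cts g \<Longrightarrow> smooth u (\<lambda>t. f t - g t) y = smooth u f y - smooth u g y"
  using smooth_add[of u f "\<lambda>t. (-1) * g t" y] smooth_scale[of u g "-1" y] by (simp add: continuous_on_minus)

lemma cts_smooth: "sym_unit u \<Longrightarrow> cts f \<Longrightarrow> cts (smooth u f)"
  using smooth_cts[OF sym_unit_cts integrable_haar] by blast

lemma ip_smooth:
  assumes u: "sym_unit u" and f: "cts f" and g: "cts g"
  shows "ip haar (smooth u f) g = ip haar f (smooth u g)"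
proof -
  have "smooth u (\<lambda>x. cnj (g x)) y = cnj (smooth u g y)" for y
    unfolding smooth_def using Bochner_Integration.integral_cnj[of haar "\<lambda>z. ker u y z * g z"] by (simp add: ker_real(3)[OF u])
  then show ?thesis
    unfolding ip_def using smooth_self_adjoint[OF u integrable_haar[OF f] continuous_on_cnj[OF g]] by simp
qed

lemma uniform_limit_smooth:
  assumes u: "sym_unit u" and p: "\<And>n. cts (p n)" and g: "cts g" and l: "uniform_limit UNIV p g sequentially"
  shows "uniform_limit UNIV (\<lambda>n. smooth u (p n)) (smooth u g) sequentially"
proof (rule uniform_limitI)
  fix \<epsilon> :: real assume e: "\<epsilon> > 0"
  note uc = sym_unit_cts[OF u]
  obtain B where B: "B > 0" "\<And>y z. cmod (ker u y z) \<le> B" using ker_bounded[OF uc] by blast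
  have "\<epsilon> / (2 * B) > 0" using e B by simp
  from uniform_limitD[OF l this] show "\<forall>\<^sub>F n in sequentially. \<forall>x\<in>UNIV. dist (smooth u (p n) x) (smooth u g x) < \<epsilon>"
  proof eventually_elim
    case (elim n)
    have c: "cts (\<lambda>t. p n t - g t)" using p g by (intro continuous_intros)
    have "nsq haar (\<lambda>t. p n t - g t) \<le> (\<epsilon> / (2 * B))\<^sup>2"
      using elim by (intro nsq_sup[OF c]) (auto simp: dist_norm less_imp_le)
    then have "sqrt (nsq haar (\<lambda>t. p n t - g t)) \<le> \<epsilon> / (2 * B)" using e B by (simp add: real_le_lsqrt)
    then have "B * sqrt (nsq haar (\<lambda>t. p n t - g t)) \<le> \<epsilon> / 2" using B by (simp add: field_simps)
    then have d2: "dist (smooth u (p n) x) (smooth u g x) \<le> \<epsilon> / 2" for x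
      using smooth_sup_bound[OF uc B(2,1) c, of x] smooth_diff[OF uc p g] by (simp add: dist_norm)
    show ?case
    proof
      fix x show "dist (smooth u (p n) x) (smooth u g x) < \<epsilon>"
        using d2[of x] e by linarith
    qed
  qed
qed

inductive_set trig :: "('a \<Rightarrow> complex) set" where
  zero: "(\<lambda>_. 0) \<in> trig"
| step: "f \<in> trig \<Longrightarrow> irreducible_rep conv e ck \<pi> \<Longrightarrow> i < rep_dim e \<pi> \<Longrightarrow> j < rep_dim e \<pi> \<Longrightarrow>
    (\<lambda>x. f x + c * coef \<pi> i j x) \<in> trig"

lemma irr_rep: "irreducible_rep conv e ck \<pi> \<Longrightarrow> representation conv e ck \<pi>"
  unfolding irreducible_rep_def by simp

lemma trig_cts: "f \<in> trig \<Longrightarrow> cts f"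
  by (induction rule: trig.induct) (auto intro!: continuous_intros coef_cts irr_rep)

lemma trig_add: "g \<in> trig \<Longrightarrow> f \<in> trig \<Longrightarrow> (\<lambda>x. f x + g x) \<in> trig"
proof (induction rule: trig.induct)
  case (step g \<pi> i j c)
  then show ?case using trig.step[of "\<lambda>x. f x + g x" \<pi> i j c] by (simp add: add.assoc)
qed simp

lemma trig_scale: "f \<in> trig \<Longrightarrow> (\<lambda>x. k * f x) \<in> trig"
proof (induction rule: trig.induct)
  case (step g \<pi> i j c)
  then show ?case using trig.step[of "\<lambda>x. k * g x" \<pi> i j "k * c"] by (simp add: distrib_left mult.assoc)
qed (simp add: trig.zero)

lemma trig_coef: "irreducible_rep conv e ck \<pi> \<Longrightarrow> i < rep_dim e \<pi> \<Longrightarrow> j < rep_dim e \<pi> \<Longrightarrow> coef \<pi> i j \<in> trig"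
  using trig.step[OF trig.zero, of \<pi> i j 1] by simp

lemma trig_sum: "(\<And>i. i \<in> I \<Longrightarrow> f i \<in> trig) \<Longrightarrow> (\<lambda>x. \<Sum>i\<in>I. a i * f i x) \<in> trig"
proof (induction I rule: infinite_finite_induct)
  case (insert i I)
  then show ?case using trig_add[OF trig_scale[of "f i" "a i"], of "\<lambda>x. \<Sum>i\<in>I. a i * f i x"]
    by (simp add: add.commute)
qed (auto simp: trig.zero)

text \<open>Moving the translation from \<open>u\<close> to the coefficient turns smoothing into
  multiplication of the matrix from the right by a constant matrix. Hence smoothing preserves
  \<open>trig\<close> and its annihilator.\<close>

lemma smooth_coef:
  assumes u: "cts u" and rep: "representation conv e ck \<pi>" and ij: "i < rep_dim e \<pi>" "j < rep_dim e \<pi>"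
  shows "smooth u (coef \<pi> i j) y = (\<Sum>l<rep_dim e \<pi>. (LINT z|haar. u z * coef \<pi> l j z) * coef \<pi> i l y)"
proof -
  note c = coef_cts[OF rep _ ij(2)]
  have "smooth u (coef \<pi> i j) y = (LINT z|haar. u z * tr (coef \<pi> i j) (ck (ck y)) z)"
    unfolding smooth_def ker_def by (rule tr_adjoint[OF u c[OF ij(1)]])
  also have "\<dots> = (LINT z|haar. (\<Sum>l<rep_dim e \<pi>. coef \<pi> i l y * (u z * coef \<pi> l j z)))"
    using coef_rep_coef[OF rep] ij unfolding coef_rep_def by (simp add: sum_distrib_left mult_ac)
  also have "\<dots> = (\<Sum>l<rep_dim e \<pi>. (LINT z|haar. coef \<pi> i l y * (u z * coef \<pi> l j z)))"
    using c u by (intro Bochner_Integration.integral_sum integrable_haar continuous_intros) auto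
  finally show ?thesis by (simp add: mult.commute)
qed

lemma trig_smooth:
  assumes f: "f \<in> trig" and u: "cts u"
  shows "smooth u f \<in> trig"
  using f
proof (induction rule: trig.induct)
  case zero
  then show ?case by (simp add: smooth_def[abs_def] trig.zero)
next
  case (step f \<pi> i j c)
  have cc: "cts (coef \<pi> i j)" using step by (intro coef_cts irr_rep)
  have fc: "cts f" using step by (intro trig_cts)
  have "smooth u (\<lambda>x. f x + c * coef \<pi> i j x) = (\<lambda>y. smooth u f y + c * smooth u (coef \<pi> i j) y)"
    using smooth_add[OF u fc continuous_on_mult_left[OF cc, of c]] smooth_scale[OF u cc, of c] by auto
  moreover have "smooth u (coef \<pi> i j) = (\<lambda>y. \<Sum>l<rep_dim e \<pi>. (LINT z|haar. u z * coef \<pi> l j z) * coef \<pi> i l y)"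
    using smooth_coef[OF u irr_rep[OF step(2)] step(3,4)] by blast
  moreover have "(\<lambda>y. \<Sum>l<rep_dim e \<pi>. (LINT z|haar. u z * coef \<pi> l j z) * coef \<pi> i l y) \<in> trig"
    using step by (intro trig_sum trig_coef) auto
  ultimately show ?case using trig_add[OF trig_scale[of "smooth u (coef \<pi> i j)" c], of "smooth u f"] step.IH by simp
qed

text \<open>The annihilator of the trigonometric polynomials for the bilinear pairing, without a
  conjugate. Orthogonality of \<open>G\<close> to \<open>trig\<close> in the sense of
  \<open>ip\<close> therefore means that the conjugate of \<open>G\<close> belongs to it.\<close>

definition Worth :: "('a \<Rightarrow> complex) set" where
  "Worth = {h. cts h \<and> (\<forall>\<pi> i j. irreducible_rep conv e ck \<pi> \<longrightarrow> i < rep_dim e \<pi> \<longrightarrow> j < rep_dim e \<pi> \<longrightarrow>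
     (LINT x|haar. h x * coef \<pi> i j x) = 0)}"

lemma Worth_tr:
  assumes h: "h \<in> Worth"
  shows "tr h x \<in> Worth"
  unfolding Worth_def
proof (intro CollectI conjI allI impI)
  have hc: "cts h" using h unfolding Worth_def by simp
  show "cts (tr h x)" by (rule cts_tr(1)[OF hc])
  fix \<pi> i j assume irr: "irreducible_rep conv e ck \<pi>" and ij: "i < rep_dim e \<pi>" "j < rep_dim e \<pi>"
  note rep = irr_rep[OF irr]
  have "(LINT y|haar. tr h x y * coef \<pi> i j y) = (LINT y|haar. h y * tr (coef \<pi> i j) (ck x) y)"
    by (rule tr_adjoint[OF hc coef_cts[OF rep ij]])
  also have "\<dots> = (LINT y|haar. (\<Sum>l<rep_dim e \<pi>. coef \<pi> i l (ck x) * (h y * coef \<pi> l j y)))"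
    using coef_rep_coef[OF rep] ij unfolding coef_rep_def by (simp add: sum_distrib_left mult_ac)
  also have "\<dots> = (\<Sum>l<rep_dim e \<pi>. (LINT y|haar. coef \<pi> i l (ck x) * (h y * coef \<pi> l j y)))"
    using coef_cts[OF rep] hc ij by (intro Bochner_Integration.integral_sum integrable_haar continuous_intros) auto
  also have "\<dots> = 0" using h irr ij unfolding Worth_def by simp
  finally show "(LINT y|haar. tr h x y * coef \<pi> i j y) = 0" .
qed

lemma Worth_smooth:
  assumes u: "sym_unit u" and h: "h \<in> Worth"
  shows "smooth u h \<in> Worth"
  unfolding Worth_def
proof (intro CollectI conjI allI impI)
  have hc: "cts h" using h unfolding Worth_def by simp
  show "cts (smooth u h)" by (rule cts_smooth[OF u hc])
  fix \<pi> i j assume irr: "irreducible_rep conv e ck \<pi>" and ij: "i < rep_dim e \<pi>" "j < rep_dim e \<pi>"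
  note rep = irr_rep[OF irr]
  have "(LINT y|haar. smooth u h y * coef \<pi> i j y) = (LINT y|haar. h y * smooth u (coef \<pi> i j) y)"
    by (rule smooth_self_adjoint[OF u integrable_haar[OF hc] coef_cts[OF rep ij]])
  also have "\<dots> = (LINT y|haar. (\<Sum>l<rep_dim e \<pi>. (LINT z|haar. u z * coef \<pi> l j z) * (h y * coef \<pi> i l y)))"
    unfolding smooth_coef[OF sym_unit_cts[OF u] rep ij] by (simp add: sum_distrib_left mult_ac)
  also have "\<dots> = (\<Sum>l<rep_dim e \<pi>. (LINT y|haar. (LINT z|haar. u z * coef \<pi> l j z) * (h y * coef \<pi> i l y)))"
    using coef_cts[OF rep] hc ij by (intro Bochner_Integration.integral_sum integrable_haar continuous_intros) auto
  also have "\<dots> = 0" using h irr ij unfolding Worth_def by simp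
  finally show "(LINT y|haar. smooth u h y * coef \<pi> i j y) = 0" .
qed

lemma Worth_add: "f \<in> Worth \<Longrightarrow> g \<in> Worth \<Longrightarrow> (\<lambda>x. f x + g x) \<in> Worth"
proof -
  assume f: "f \<in> Worth" and g: "g \<in> Worth"
  have c: "cts f" "cts g" using f g unfolding Worth_def by auto
  have "(LINT x|haar. (f x + g x) * coef \<pi> i j x) = (LINT x|haar. f x * coef \<pi> i j x) + (LINT x|haar. g x * coef \<pi> i j x)"
    if "irreducible_rep conv e ck \<pi>" "i < rep_dim e \<pi>" "j < rep_dim e \<pi>" for \<pi> i j
    unfolding distrib_right using c coef_cts[OF irr_rep[OF that(1)] that(2,3)]
    by (intro Bochner_Integration.integral_add integrable_haar continuous_intros)
  then show ?thesis using f g unfolding Worth_def by (auto intro!: continuous_intros)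
qed

lemma Worth_scale: "f \<in> Worth \<Longrightarrow> (\<lambda>x. c * f x) \<in> Worth"
  unfolding Worth_def by (auto intro!: continuous_intros simp: mult.assoc)

lemma Worth_uniform_limit:
  assumes p: "\<And>n. p n \<in> Worth" and g: "cts g" and l: "uniform_limit UNIV p g sequentially"
  shows "g \<in> Worth"
  unfolding Worth_def
proof (intro CollectI conjI allI impI g)
  fix \<pi> i j assume irr: "irreducible_rep conv e ck \<pi>" and ij: "i < rep_dim e \<pi>" "j < rep_dim e \<pi>"
  note c = coef_cts[OF irr_rep[OF irr] ij]
  have pc: "cts (p n)" for n using p unfolding Worth_def by auto
  obtain B where B: "B > 0" "\<And>x. cmod (coef \<pi> i j x) \<le> B" using continuous_on_compact_bounded[OF K c] by blast
  have small: "cmod (LINT x|haar. g x * coef \<pi> i j x) \<le> \<epsilon>" if e: "\<epsilon> > 0" for \<epsilon>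
  proof -
    interpret prob_space haar by (rule prob_haar)
    have "\<epsilon> / B > 0" using e B by simp
    from uniform_limitD[OF l this] obtain n where n: "\<And>x. dist (p n x) (g x) < \<epsilon> / B"
      unfolding eventually_sequentially by blast
    have i: "integrable haar (\<lambda>x. g x * coef \<pi> i j x)" "integrable haar (\<lambda>x. p n x * coef \<pi> i j x)"
      using g pc c by (auto intro!: integrable_haar continuous_intros)
    have p0: "(LINT x|haar. p n x * coef \<pi> i j x) = 0"
      using p[of n] irr ij unfolding Worth_def by blast
    have "cmod (LINT x|haar. g x * coef \<pi> i j x) = cmod (LINT x|haar. g x * coef \<pi> i j x - p n x * coef \<pi> i j x)"
      unfolding Bochner_Integration.integral_diff[OF i] p0 by simp
    also have "\<dots> \<le> (LINT x|haar. cmod (g x * coef \<pi> i j x - p n x * coef \<pi> i j x))" by (rule integral_norm_bound)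
    also have "\<dots> \<le> (LINT x|haar. \<epsilon>)"
    proof (rule integral_mono)
      show "cmod (g x * coef \<pi> i j x - p n x * coef \<pi> i j x) \<le> \<epsilon>" for x
      proof -
        have "cmod (g x - p n x) \<le> \<epsilon> / B" using n[of x] by (simp add: dist_norm norm_minus_commute)
        then have "cmod (g x - p n x) * cmod (coef \<pi> i j x) \<le> \<epsilon> / B * B"
          using B e by (intro mult_mono) auto
        then show ?thesis using B(1) by (simp add: left_diff_distrib[symmetric] norm_mult)
      qed
    qed (use i in auto)
    finally show ?thesis by (simp add: prob_space[unfolded space_haar])
  qed
  have "cmod (LINT x|haar. g x * coef \<pi> i j x) \<le> 0"
  proof (rule field_le_epsilon)
    fix \<epsilon> :: real assume "0 < \<epsilon>"
    from small[OF this] show "cmod (LINT x|haar. g x * coef \<pi> i j x) \<le> 0 + \<epsilon>" by linarith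
  qed
  then show "(LINT x|haar. g x * coef \<pi> i j x) = 0" by simp
qed

text \<open>A maximizing sequence for the Rayleigh quotient of the compact self-adjoint operator
  \<open>smooth u\<close> on \<open>Worth\<close> produces an eigenvector of its square.\<close>

lemma eigenvector_exists:
  assumes u: "sym_unit u" and h: "h \<in> Worth" "smooth u h x \<noteq> 0"
  shows "\<exists>g m. m > 0 \<and> g \<in> Worth \<and> nsq haar g > 0 \<and> (\<forall>y. smooth u (smooth u g) y = complex_of_real m * g y)"
proof -
  let ?T = "smooth u"
  note uc = sym_unit_cts[OF u]
  have Wc: "cts f" if "f \<in> Worth" for f using that unfolding Worth_def by simp
  note Tc = cts_smooth[OF u]
  obtain B where B: "B > 0" "\<And>y z. cmod (ker u y z) \<le> B" using ker_bounded[OF uc] by blast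
  note sb = smooth_sup_bound[OF uc B(2,1)]
  have nT: "nsq haar (?T f) \<le> B\<^sup>2 * nsq haar f" if f: "cts f" for f
    using nsq_sup[OF Tc[OF f] sb[OF f]] by (simp add: power_mult_distrib)
  \<comment> \<open>The supremum m of this set is the squared norm of the operator on
    \<open>Worth\<close>. Working with the square of the operator avoids the unknown sign of the
    eigenvalue.\<close>
  define S where "S = {nsq haar (?T f) | f. f \<in> Worth \<and> nsq haar f \<le> 1}"
  have bdd: "bdd_above S"
  proof (rule bdd_aboveI[of _ "B\<^sup>2"])
    fix s assume "s \<in> S"
    then obtain f where f: "s = nsq haar (?T f)" "f \<in> Worth" "nsq haar f \<le> 1" unfolding S_def by blast
    then show "s \<le> B\<^sup>2" using nT[OF Wc[OF f(2)]] mult_left_mono[OF f(3), of "B\<^sup>2"] by simp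
  qed
  define m where "m = Sup S"
  have ray: "nsq haar (?T f) \<le> m * nsq haar f" if f: "f \<in> Worth" for f
  proof (cases "nsq haar f = 0")
    case True
    then show ?thesis using nT[OF Wc[OF f]] by simp
  next
    case False
    then have p: "nsq haar f > 0" using nsq_nonneg[of haar f] by linarith
    define c where "c = complex_of_real (1 / sqrt (nsq haar f))"
    have cc: "(cmod c)\<^sup>2 = 1 / nsq haar f" unfolding c_def using p by (simp add: norm_divide power_divide)
    have "nsq haar (\<lambda>x. c * f x) = 1" unfolding nsq_scale cc using p by simp
    moreover have Tcf: "?T (\<lambda>x. c * f x) = (\<lambda>x. c * ?T f x)" using smooth_scale[OF uc Wc[OF f]] by auto
    ultimately have "nsq haar (\<lambda>x. c * ?T f x) \<in> S"
      unfolding S_def using Worth_scale[OF f, of c] by (intro CollectI exI[of _ "\<lambda>x. c * f x"]) simp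
    then have "nsq haar (\<lambda>x. c * ?T f x) \<le> m" unfolding m_def using bdd by (rule cSup_upper)
    then show ?thesis unfolding nsq_scale cc using p by (simp add: field_simps)
  qed
  have "nsq haar (?T h) > 0"
  proof -
    have "nsq haar (?T h) \<noteq> 0" using nsq_zero[OF Tc[OF Wc[OF h(1)]], of x] h(2) by blast
    then show ?thesis using nsq_nonneg[of haar "?T h"] by linarith
  qed
  then have m0: "m > 0"
    using ray[OF h(1)] mult_nonpos_nonneg[OF _ nsq_nonneg[of haar h], of m] by linarith
  have Sne: "S \<noteq> {}" unfolding S_def using Worth_scale[OF h(1), of 0] by (auto simp: nsq_def)
  have "\<forall>n. \<exists>f. f \<in> Worth \<and> nsq haar f \<le> 1 \<and> m - inverse (real (Suc n)) < nsq haar (?T f)"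
  proof
    fix n
    have "m - inverse (real (Suc n)) < Sup S" unfolding m_def by simp
    then obtain s where "s \<in> S" "m - inverse (real (Suc n)) < s" using less_cSup_iff[OF Sne bdd] by blast
    then show "\<exists>f. f \<in> Worth \<and> nsq haar f \<le> 1 \<and> m - inverse (real (Suc n)) < nsq haar (?T f)" unfolding S_def by blast
  qed
  then obtain f where f: "\<And>n. f n \<in> Worth" "\<And>n. nsq haar (f n) \<le> 1" "\<And>n. m - inverse (real (Suc n)) < nsq haar (?T (f n))"
    by metis
  note fc = Wc[OF f(1)]
  have sq1: "sqrt (nsq haar (f n)) \<le> 1" for n using f(2)[of n] real_sqrt_le_mono[of "nsq haar (f n)" 1] by simp
  have Tb: "cmod (?T (f n) y) \<le> B" for n y
    using order_trans[OF sb[OF fc, of n y] mult_left_mono[OF sq1[of n], of B]] B(1) by simp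
  have Teq: "\<exists>\<delta>>0. \<forall>n x y. dist x y < \<delta> \<longrightarrow> cmod (?T (f n) x - ?T (f n) y) \<le> \<epsilon>" if e: "\<epsilon> > 0" for \<epsilon>
  proof -
    obtain d where d: "d > 0" "\<And>x x' y y'. dist x x' < d \<Longrightarrow> dist y y' < d \<Longrightarrow> dist (ker u x y) (ker u x' y') < \<epsilon>"
      using uniformly_continuous_section[OF K ker_continuous[OF uc] e] by blast
    have "cmod (?T (f n) x - ?T (f n) y) \<le> \<epsilon>" if xy: "dist x y < d" for n x y
    proof -
      have i: "integrable haar (\<lambda>z. ker u x z * f n z)" "integrable haar (\<lambda>z. ker u y z * f n z)" "integrable haar (f n)"
        using ker_cts[OF uc] fc by (auto intro!: integrable_haar continuous_intros)
      have "cmod (?T (f n) x - ?T (f n) y) = cmod (LINT z|haar. ker u x z * f n z - ker u y z * f n z)"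
        unfolding smooth_def Bochner_Integration.integral_diff[OF i(1,2)] ..
      also have "\<dots> \<le> (LINT z|haar. cmod (ker u x z * f n z - ker u y z * f n z))" by (rule integral_norm_bound)
      also have "\<dots> \<le> (LINT z|haar. \<epsilon> * cmod (f n z))"
      proof (rule integral_mono)
        show "cmod (ker u x z * f n z - ker u y z * f n z) \<le> \<epsilon> * cmod (f n z)" for z
          using d(2)[OF xy, of z z] d(1) by (auto simp: left_diff_distrib[symmetric] norm_mult dist_norm intro!: mult_right_mono)
      qed (use i in auto)
      also have "\<dots> = \<epsilon> * (LINT z|haar. cmod (f n z))" by simp
      also have "\<dots> \<le> \<epsilon> * 1"
        using order_trans[OF conjunct2[OF L1_le_L2[OF cts_sq[OF fc[of n]]]] sq1[of n]] e by (intro mult_left_mono) auto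
      finally show ?thesis by simp
    qed
    then show ?thesis using d(1) by blast
  qed
  obtain k G where k: "strict_mono (k :: nat \<Rightarrow> nat)" and G: "cts G"
    and ul: "uniform_limit UNIV (\<lambda>n. ?T (f (k n))) G sequentially"
    using Arzela_Ascoli_compact[OF K Tb Teq] by blast
  define p where "p n = ?T (f (k n))" for n
  have p: "p n \<in> Worth" for n unfolding p_def by (rule Worth_smooth[OF u f(1)])
  note pc = Wc[OF p]
  have ulp: "uniform_limit UNIV p G sequentially" using ul unfolding p_def .
  have GW: "G \<in> Worth" by (rule Worth_uniform_limit[OF p G ulp])
  have ulTT: "uniform_limit UNIV (\<lambda>n. ?T (?T (p n))) (?T (?T G)) sequentially"
    by (intro uniform_limit_smooth[OF u] Tc pc G ulp)
  have ks: "inverse (real (Suc (k n))) \<le> inverse (real (Suc n))" for n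
    using strict_mono_imp_increasing[OF k, of n] by (intro le_imp_inverse_le) auto
  \<comment> \<open>Expanding the square and using \<open>ray\<close> for \<open>p n\<close> bounds
    the defect by m (m - \<open>nsq haar (p n)\<close>). So a maximizing sequence consists of
    approximate eigenvectors of the square, in the mean.\<close>
  have q: "nsq haar (\<lambda>y. ?T (p n) y - complex_of_real m * f (k n) y) \<le> m * inverse (real (Suc n))" for n
  proof -
    let ?f = "f (k n)"
    have s: "sq_integrable haar (?T (p n))" "sq_integrable haar (\<lambda>y. complex_of_real m * ?f y)"
      using Tc[OF pc] fc by (auto intro!: cts_sq continuous_intros)
    have i: "ip haar (?T (p n)) (\<lambda>y. complex_of_real m * ?f y) = complex_of_real (m * nsq haar (p n))"
      unfolding ip_scale_right ip_smooth[OF u pc fc] p_def[symmetric] ip_self by simp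
    have "nsq haar (\<lambda>y. ?T (p n) y - complex_of_real m * ?f y)
        = nsq haar (?T (p n)) - 2 * (m * nsq haar (p n)) + m\<^sup>2 * nsq haar ?f"
      unfolding nsq_diff[OF s] i nsq_scale using m0 by simp
    also have "\<dots> \<le> m * nsq haar (p n) - 2 * (m * nsq haar (p n)) + m\<^sup>2 * 1"
      using ray[OF p] f(2)[of "k n"] m0 by (intro add_mono diff_mono mult_left_mono) auto
    also have "\<dots> = m * (m - nsq haar (p n))" by (simp add: power2_eq_square algebra_simps)
    also have "\<dots> \<le> m * inverse (real (Suc n))"
    proof (rule mult_left_mono)
      show "m - nsq haar (p n) \<le> inverse (real (Suc n))" using f(3)[of "k n"] ks[of n] unfolding p_def by linarith
    qed (use m0 in simp)
    finally show ?thesis .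
  qed
  have "?T (?T G) y = complex_of_real m * G y" for y
  proof -
    have l1: "(\<lambda>n. ?T (?T (p n)) y) \<longlonglongrightarrow> ?T (?T G) y" using tendsto_uniform_limitI[OF ulTT] by simp
    have l2: "(\<lambda>n. p n y) \<longlonglongrightarrow> G y" using tendsto_uniform_limitI[OF ulp] by simp
    have l3: "(\<lambda>n. ?T (?T (p n)) y - complex_of_real m * p n y) \<longlonglongrightarrow> ?T (?T G) y - complex_of_real m * G y"
      by (intro tendsto_intros l1 l2)
    \<comment> \<open>One more application of the operator turns the estimate in the mean into a
      uniform one, and replaces \<open>f (k n)\<close> by the convergent sequence
      \<open>p n\<close>.\<close>
    have "cmod (?T (?T (p n)) y - complex_of_real m * p n y) \<le> B * sqrt (m * inverse (real (Suc n)))" for n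
    proof -
      have c: "cts (\<lambda>y. ?T (p n) y - complex_of_real m * f (k n) y)" using Tc[OF pc] fc by (intro continuous_intros)
      have c1: "cts (\<lambda>y. complex_of_real m * f (k n) y)" using fc by (intro continuous_intros)
      have e1: "?T (\<lambda>y. ?T (p n) y - complex_of_real m * f (k n) y) y = ?T (?T (p n)) y - complex_of_real m * p n y"
        unfolding smooth_diff[OF uc Tc[OF pc] c1] smooth_scale[OF uc fc] by (simp only: p_def)
      have "B * sqrt (nsq haar (\<lambda>y. ?T (p n) y - complex_of_real m * f (k n) y)) \<le> B * sqrt (m * inverse (real (Suc n)))"
        using q[of n] B(1) by (intro mult_left_mono real_sqrt_le_mono) auto
      with sb[OF c, of y] show ?thesis unfolding e1 by (rule order_trans)
    qed
    moreover have "(\<lambda>n. B * sqrt (m * inverse (real (Suc n)))) \<longlonglongrightarrow> B * sqrt (m * 0)"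
      by (intro tendsto_intros LIMSEQ_inverse_real_of_nat)
    ultimately have z: "(\<lambda>n. ?T (?T (p n)) y - complex_of_real m * p n y) \<longlonglongrightarrow> 0"
      using Lim_null_comparison[OF always_eventually, of "\<lambda>n. ?T (?T (p n)) y - complex_of_real m * p n y"
        "\<lambda>n. B * sqrt (m * inverse (real (Suc n)))" sequentially] by simp
    show ?thesis using LIMSEQ_unique[OF l3 z] by simp
  qed
  moreover have "nsq haar G > 0"
  proof (rule ccontr)
    assume "\<not> nsq haar G > 0"
    then have "nsq haar G = 0" using nsq_nonneg[of haar G] by linarith
    then have G0: "G y = 0" for y using nsq_zero[OF G] by blast
    \<comment> \<open>If the limit vanished, the \<open>p n\<close> would become uniformly small,
      although their squared norms tend to m.\<close>
    have "sqrt (m/2) / 2 > 0" using m0 by simp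
    from uniform_limitD[OF ulp this] have "\<forall>\<^sub>F n in sequentially. \<forall>y. cmod (p n y) < sqrt (m/2) / 2" by (simp add: G0)
    moreover have "\<forall>\<^sub>F n in sequentially. inverse (real (Suc n)) < m / 2"
      by (rule order_tendstoD(2)[OF LIMSEQ_inverse_real_of_nat]) (use m0 in simp)
    ultimately have "\<forall>\<^sub>F n in sequentially. False"
    proof eventually_elim
      case (elim n)
      have "nsq haar (p n) \<le> (sqrt (m/2))\<^sup>2"
      proof (rule nsq_sup[OF pc])
        fix y show "cmod (p n y) \<le> sqrt (m/2)" using elim(1)[rule_format, of y] \<open>sqrt (m/2) / 2 > 0\<close> by linarith
      qed
      then have "nsq haar (p n) \<le> m / 2" using m0 by simp
      then show ?case using f(3)[of "k n"] ks[of n] elim(2) unfolding p_def by linarith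
    qed
    then show False by simp
  qed
  ultimately show ?thesis using m0 GW by (intro exI[of _ G] exI[of _ m]) simp
qed


section \<open>Finite-dimensional translation-invariant subspaces\<close>

definition tsub :: "('a \<Rightarrow> complex) set \<Rightarrow> bool" where
  "tsub S \<longleftrightarrow> (\<lambda>_. 0) \<in> S \<and> (\<forall>f\<in>S. \<forall>g\<in>S. (\<lambda>x. f x + g x) \<in> S) \<and> (\<forall>f\<in>S. \<forall>c. (\<lambda>x. c * f x) \<in> S) \<and>
     (\<forall>f\<in>S. cts f) \<and> (\<forall>f\<in>S. \<forall>x. tr f x \<in> S)"

text \<open>An orthonormal family of length \<open>d\<close> in \<open>S\<close>. The largest
  possible length takes the place of the dimension of \<open>S\<close>.\<close>

definition onf :: "nat \<Rightarrow> (nat \<Rightarrow> 'a \<Rightarrow> complex) \<Rightarrow> ('a \<Rightarrow> complex) set \<Rightarrow> bool" where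
  "onf d v S \<longleftrightarrow> (\<forall>i<d. v i \<in> S) \<and> (\<forall>i<d. \<forall>j<d. ip haar (v i) (v j) = (if i = j then 1 else 0))"

lemma tsub_add: "tsub S \<Longrightarrow> f \<in> S \<Longrightarrow> g \<in> S \<Longrightarrow> (\<lambda>x. f x + g x) \<in> S"
  and tsub_scale: "tsub S \<Longrightarrow> f \<in> S \<Longrightarrow> (\<lambda>x. c * f x) \<in> S"
  and tsub_cts: "tsub S \<Longrightarrow> f \<in> S \<Longrightarrow> cts f"
  and tsub_tr: "tsub S \<Longrightarrow> f \<in> S \<Longrightarrow> tr f x \<in> S"
  unfolding tsub_def by auto

lemma tsub_sum:
  fixes n :: nat
  assumes S: "tsub S" and f: "\<And>i. i < n \<Longrightarrow> f i \<in> S"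
  shows "(\<lambda>x. \<Sum>i<n. a i * f i x) \<in> S"
  using f
proof (induction n)
  case 0
  then show ?case using S unfolding tsub_def by simp
next
  case (Suc n)
  then have "(\<lambda>x. \<Sum>i<n. a i * f i x) \<in> S" by simp
  from tsub_add[OF S this tsub_scale[OF S Suc.prems[of n], of "a n"]] show ?case by simp
qed

lemma onf_mono: "onf d v S \<Longrightarrow> d' \<le> d \<Longrightarrow> S \<subseteq> S' \<Longrightarrow> onf d' v S'"
  unfolding onf_def by auto

lemma onf_1:
  assumes S: "tsub S" and f: "f \<in> S" "f x \<noteq> 0"
  shows "\<exists>w. onf (Suc 0) w S"
proof -
  have fc: "cts f" using S f unfolding tsub_def by blast
  have "nsq haar f \<noteq> 0" using nsq_zero[OF fc] f(2) by blast
  then have p: "nsq haar f > 0" using nsq_nonneg[of haar f] by linarith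
  define c where "c = complex_of_real (1 / sqrt (nsq haar f))"
  have "(cmod c)\<^sup>2 = 1 / nsq haar f" unfolding c_def using p by (simp add: norm_divide power_divide)
  then have "nsq haar (\<lambda>x. c * f x) = 1" unfolding nsq_scale using p by simp
  then have "ip haar (\<lambda>x. c * f x) (\<lambda>x. c * f x) = 1" unfolding ip_self by simp
  moreover have "(\<lambda>x. c * f x) \<in> S" using S f unfolding tsub_def by blast
  ultimately have "onf (Suc 0) (\<lambda>_ x. c * f x) S" unfolding onf_def by simp
  then show ?thesis by blast
qed

text \<open>If \<open>f\<close> differed from its projection, the normalized difference would extend
  the family, against maximality. Continuity turns a difference of norm zero into equality at every
  point.\<close>

lemma onf_expand:
  assumes S: "tsub S" and v: "onf d v S" and max: "\<And>w. \<not> onf (Suc d) w S" and f: "f \<in> S"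
  shows "f = (\<lambda>x. \<Sum>i<d. ip haar f (v i) * v i x)"
proof -
  define s where "s = (\<lambda>x. \<Sum>i<d. ip haar f (v i) * v i x)"
  define g where "g = (\<lambda>x. f x + (-1) * s x)"
  have sS: "s \<in> S" unfolding s_def using v by (intro tsub_sum[OF S]) (simp add: onf_def)
  have gS: "g \<in> S" unfolding g_def by (rule tsub_add[OF S f tsub_scale[OF S sS]])
  have c: "cts f" "cts s" "cts g" "\<And>i. i < d \<Longrightarrow> cts (v i)" using S f sS gS v unfolding tsub_def onf_def by auto
  have gv: "ip haar g (v j) = 0" if j: "j < d" for j
  proof -
    have "ip haar s (v j) = (\<Sum>i<d. ip haar f (v i) * ip haar (v i) (v j))"
      unfolding s_def using c j by (intro ip_sum_left cts_sq) auto
    also have "\<dots> = (\<Sum>i<d. ip haar f (v i) * (if i = j then 1 else 0))"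
      using v j unfolding onf_def by (intro sum.cong) auto
    also have "\<dots> = ip haar f (v j)" by (rule sum_unit_right[OF j])
    finally have sv: "ip haar s (v j) = ip haar f (v j)" .
    have "g = (\<lambda>x. f x - s x)" unfolding g_def by simp
    then show ?thesis using ip_diff_left[OF cts_sq[OF c(1)] cts_sq[OF c(2)] cts_sq[OF c(4)[OF j]]] sv by simp
  qed
  have "nsq haar g = 0"
  proof (rule ccontr)
    assume "nsq haar g \<noteq> 0"
    then have p: "nsq haar g > 0" using nsq_nonneg[of haar g] by linarith
    define k where "k = complex_of_real (1 / sqrt (nsq haar g))"
    have "(cmod k)\<^sup>2 = 1 / nsq haar g" unfolding k_def using p by (simp add: norm_divide power_divide)
    then have "nsq haar (\<lambda>x. k * g x) = 1" unfolding nsq_scale using p by simp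
    then have n1: "ip haar (\<lambda>x. k * g x) (\<lambda>x. k * g x) = 1" unfolding ip_self by simp
    have n2: "ip haar (\<lambda>x. k * g x) (v j) = 0" if "j < d" for j unfolding ip_scale_left gv[OF that] by simp
    have n3: "ip haar (v j) (\<lambda>x. k * g x) = 0" if "j < d" for j
      using ip_cnj[of haar "v j" "\<lambda>x. k * g x"] n2[OF that] by simp
    have kS: "(\<lambda>x. k * g x) \<in> S" by (rule tsub_scale[OF S gS])
    have "onf (Suc d) (v(d := \<lambda>x. k * g x)) S"
      using v kS n1 n2 n3 unfolding onf_def by (auto simp: less_Suc_eq)
    then show False using max by blast
  qed
  then have "g x = 0" for x using nsq_zero[OF c(3)] by blast
  then show ?thesis unfolding s_def[symmetric] g_def by (auto simp: fun_eq_iff)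
qed

lemma onf_maximal:
  assumes b: "\<And>d v. onf d v S \<Longrightarrow> d \<le> N"
  shows "\<exists>d v. onf d v S \<and> (\<forall>w. \<not> onf (Suc d) w S)"
proof -
  have "\<exists>x. (\<exists>v. onf x v S) \<and> (\<forall>y. (\<exists>v. onf y v S) \<longrightarrow> y \<le> x)"
    by (rule ex_has_greatest_nat[of "\<lambda>d. \<exists>v. onf d v S" 0 "\<lambda>d. d" "Suc N"])
       (use b in \<open>auto simp: onf_def less_Suc_eq_le\<close>)
  then obtain d v where "onf d v S" "\<And>y v. onf y v S \<Longrightarrow> y \<le> d" by blast
  then show ?thesis by (meson Suc_n_not_le_n)
qed

lemma ker_tr: "cts u \<Longrightarrow> tr (\<lambda>t. ker u t z) x y = tr (tr u (ck y)) (ck x) z"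
  unfolding ker_def using tr_check[OF cts_tr(2), of u z "ck y" "ck x"] tr_check[OF cts_tr(2), of u z y x] tr_assoc[of u z "ck y" "ck x"]
  by simp

text \<open>Extends a matrix of continuous functions from points to measures; it inverts the passage
  from a representation to its coefficients.\<close>

definition rep_of :: "nat \<Rightarrow> (nat \<Rightarrow> nat \<Rightarrow> 'a \<Rightarrow> complex) \<Rightarrow> 'a meas_rep" where
  "rep_of d a \<mu> = Matrix.mat d d (\<lambda>(i, j). cm_integral \<mu> (a i j))"

lemma rep_of_dim [simp]: "rep_dim e (rep_of d a) = d" unfolding rep_dim_def rep_of_def by simp

lemma coef_rep_of: "coef_rep d a \<Longrightarrow> i < d \<Longrightarrow> j < d \<Longrightarrow> coef (rep_of d a) i j = a i j"
  unfolding coef_def rep_of_def coef_rep_def by (auto simp: cm_integral_dirac[OF K])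

lemma cm_integral_continuous_map:
  assumes f: "cts f"
  shows "continuous_map weak_topology euclidean (\<lambda>\<mu>. cm_integral \<mu> f)"
  unfolding continuous_map_def
proof (intro conjI allI impI)
  show "(\<lambda>\<mu>. cm_integral \<mu> f) \<in> topspace weak_topology \<rightarrow> topspace euclidean" by simp
  fix V :: "complex set" assume "openin euclidean V"
  then have V: "open V" by simp
  have "topspace weak_topology = (reg_measures :: ('a set \<Rightarrow> complex) set)"
  proof -
    let ?S = "{{\<mu> :: 'a set \<Rightarrow> complex. \<mu> \<in> reg_measures \<and> cm_integral \<mu> f \<in> V} | f V. continuous_on UNIV f \<and> open V}"
    have "{\<mu> \<in> reg_measures. cm_integral \<mu> (\<lambda>_. 0) \<in> UNIV} \<in> ?S"
      by (intro CollectI exI[of _ "\<lambda>_. 0"] exI[of _ UNIV]) simp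
    then have "{\<mu> \<in> reg_measures. cm_integral \<mu> (\<lambda>_. 0) \<in> UNIV} \<subseteq> \<Union> ?S" by (rule Union_upper)
    then have "reg_measures \<subseteq> \<Union> ?S" by simp
    moreover have "\<Union> ?S \<subseteq> reg_measures" by blast
    ultimately show ?thesis unfolding weak_topology_def topology_generated_by_topspace by (rule equalityI[rotated])
  qed
  then have "{\<mu> \<in> topspace weak_topology. cm_integral \<mu> f \<in> V} = {\<mu> \<in> reg_measures. cm_integral \<mu> f \<in> V}" by simp
  moreover have "openin weak_topology {\<mu> \<in> reg_measures. cm_integral \<mu> f \<in> V}"
    unfolding weak_topology_def by (rule topology_generated_by_Basis) (use f V in blast)
  ultimately show "openin weak_topology {\<mu> \<in> topspace weak_topology. cm_integral \<mu> f \<in> V}" by simp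
qed

lemma rep_of_representation:
  assumes a: "coef_rep d a"
  shows "representation conv e ck (rep_of d a)"
proof -
  let ?p = "rep_of d a"
  have ac: "cts (a i j)" if "i < d" "j < d" for i j using a that unfolding coef_rep_def by blast
  have 1: "?p \<mu> \<in> carrier_mat d d" for \<mu> unfolding rep_of_def by simp
  have ix: "?p \<mu> $$ (i, j) = cm_integral \<mu> (a i j)" if "i < d" "j < d" for \<mu> i j using that unfolding rep_of_def by simp
  have 2: "?p (dirac e) = 1\<^sub>m d"
    by (rule eq_matI) (use a ac in \<open>auto simp: rep_of_def cm_integral_dirac[OF K] coef_rep_def\<close>)
  have 3: "?p (\<lambda>A. \<mu> A + \<nu> A) = ?p \<mu> + ?p \<nu>" if "\<mu> \<in> reg_measures" "\<nu> \<in> reg_measures" for \<mu> \<nu>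
    by (rule eq_matI) (use that ac in \<open>auto simp: rep_of_def reg_complex cm_integral_add_measure[OF K]\<close>)
  have 4: "?p (\<lambda>A. c * \<mu> A) = c \<cdot>\<^sub>m ?p \<mu>" if "\<mu> \<in> reg_measures" for \<mu> c
    by (rule eq_matI) (use that ac in \<open>auto simp: rep_of_def reg_complex cm_integral_scale_measure[OF K]\<close>)
  have 5: "?p (\<mu> \<star> \<nu>) = ?p \<mu> * ?p \<nu>" if m: "\<mu> \<in> reg_measures" "\<nu> \<in> reg_measures" for \<mu> \<nu>
  proof (rule eq_matI)
    fix i j assume "i < dim_row (?p \<mu> * ?p \<nu>)" "j < dim_col (?p \<mu> * ?p \<nu>)"
    then have ij: "i < d" "j < d" by (auto simp: rep_of_def)
    have cb: "complex_borel_measure \<mu>" "complex_borel_measure \<nu>" using m reg_complex by auto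
    have "cm_integral \<nu> (tr (a i j) x) = (\<Sum>l<d. a i l x * cm_integral \<nu> (a l j))" for x
    proof -
      have "tr (a i j) x = (\<lambda>y. \<Sum>l<d. a i l x * a l j y)" using a ij unfolding coef_rep_def by blast
      then show ?thesis using cm_integral_sum_fun[OF K cb(2), of "{..<d}" "\<lambda>l. a l j" "\<lambda>l. a i l x"] ac ij by simp
    qed
    then have "cm_integral (\<mu> \<star> \<nu>) (a i j) = cm_integral \<mu> (\<lambda>x. \<Sum>l<d. cm_integral \<nu> (a l j) * a i l x)"
      unfolding conv_integral(1)[OF m ac[OF ij]] by (simp add: mult.commute)
    also have "\<dots> = (\<Sum>l<d. cm_integral \<nu> (a l j) * cm_integral \<mu> (a i l))"
      using ac ij by (intro cm_integral_sum_fun[OF K cb(1)]) auto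
    finally show "?p (\<mu> \<star> \<nu>) $$ (i, j) = (?p \<mu> * ?p \<nu>) $$ (i, j)"
      unfolding mult_mat_index_sum[OF 1 1 ij] using ix ij by (simp add: mult.commute)
  qed (simp_all add: rep_of_def)
  have 6: "?p (\<lambda>A. cnj (check_measure ck \<mu> A)) = mat_adjoint (?p \<mu>)" if m: "\<mu> \<in> reg_measures" for \<mu>
  proof (rule eq_matI)
    fix i j assume "i < dim_row (mat_adjoint (?p \<mu>))" "j < dim_col (mat_adjoint (?p \<mu>))"
    then have ij: "i < d" "j < d" by (auto simp: rep_of_def mat_adjoint_index)
    have cb: "complex_borel_measure \<mu>" using m reg_complex by auto
    note ch = cm_integral_check[OF K cb _ ck_cont ck_ck]
    have cc: "cts (\<lambda>x. cnj (a i j x))" using ac[OF ij] by (intro continuous_intros)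
    have "cm_integral (\<lambda>A. cnj (check_measure ck \<mu> A)) (a i j)
        = cm_integral (\<lambda>A. cnj (check_measure ck \<mu> A)) (\<lambda>x. cnj (cnj (a i j x)))" by simp
    also have "\<dots> = cnj (cm_integral (check_measure ck \<mu>) (\<lambda>x. cnj (a i j x)))"
      by (rule cm_integral_cnj[OF K ch(1)[OF cc] cc])
    also have "\<dots> = cnj (cm_integral \<mu> (\<lambda>x. cnj (a i j (ck x))))" unfolding ch(2)[OF cc] ..
    also have "(\<lambda>x. cnj (a i j (ck x))) = a j i" using a ij unfolding coef_rep_def by auto
    finally show "?p (\<lambda>A. cnj (check_measure ck \<mu> A)) $$ (i, j) = mat_adjoint (?p \<mu>) $$ (i, j)"
      using ij ix mat_adjoint_index(3)[of i "?p \<mu>" j] by (simp add: rep_of_def)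
  qed (simp_all add: rep_of_def mat_adjoint_index)
  have 7: "continuous_map (subtopology weak_topology pos_measures) euclidean (\<lambda>\<mu>. (?p \<mu> *\<^sub>v u) \<bullet>c v)"
    if uv: "u \<in> carrier_vec d" "v \<in> carrier_vec d" for u v
  proof -
    define F where "F i = (\<lambda>x. \<Sum>j<d. vec_index u j * a i j x)" for i
    have Fc: "cts (F i)" if "i < d" for i unfolding F_def using ac that by (intro continuous_intros) auto
    define G where "G = (\<lambda>x. \<Sum>i<d. cnj (vec_index v i) * F i x)"
    have Gc: "cts G" unfolding G_def using Fc by (intro continuous_intros) auto
    have eq: "cm_integral \<mu> G = (?p \<mu> *\<^sub>v u) \<bullet>c v" if m: "\<mu> \<in> reg_measures" for \<mu>
    proof -
      have cb: "complex_borel_measure \<mu>" using m reg_complex by auto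
      have "(?p \<mu> *\<^sub>v u) \<bullet>c v = (\<Sum>i<d. vec_index (?p \<mu> *\<^sub>v u) i * cnj (vec_index v i))"
        using uv by (auto simp: scalar_prod_def atLeast0LessThan intro!: sum.cong)
      also have "\<dots> = (\<Sum>i<d. cnj (vec_index v i) * cm_integral \<mu> (F i))"
      proof (intro sum.cong refl)
        fix i assume i: "i \<in> {..<d}"
        have "vec_index (?p \<mu> *\<^sub>v u) i = (\<Sum>j<d. vec_index u j * cm_integral \<mu> (a i j))"
          using mult_mat_vec_index_sum[OF 1 uv(1)] i ix by (simp add: mult.commute)
        also have "\<dots> = cm_integral \<mu> (F i)" unfolding F_def
          using ac i by (intro cm_integral_sum_fun[OF K cb, symmetric]) auto
        finally show "vec_index (?p \<mu> *\<^sub>v u) i * cnj (vec_index v i) = cnj (vec_index v i) * cm_integral \<mu> (F i)" by simp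
      qed
      also have "\<dots> = cm_integral \<mu> G" unfolding G_def
        using Fc by (intro cm_integral_sum_fun[OF K cb, symmetric]) auto
      finally show ?thesis ..
    qed
    show ?thesis
    proof (rule continuous_map_eq)
      show "continuous_map (subtopology weak_topology pos_measures) euclidean (\<lambda>\<mu>. cm_integral \<mu> G)"
        by (rule continuous_map_from_subtopology[OF cm_integral_continuous_map[OF Gc]])
      show "cm_integral \<mu> G = (?p \<mu> *\<^sub>v u) \<bullet>c v" if "\<mu> \<in> topspace (subtopology weak_topology pos_measures)" for \<mu>
        using that eq pos_reg by auto
    qed
  qed
  show ?thesis unfolding representation_def Let_def rep_of_dim
    using 1 2 3 4 5 6 7 by blast
qed

text \<open>A nonzero invariant subspace of least dimension is acted on irreducibly by translations.
  Evaluating translates at \<open>e\<close> writes its elements as combinations of conjugated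
  coefficients of that representation, which is the form that collides with membership in
  \<open>Worth\<close>.\<close>

lemma irreducible_in_invariant:
  assumes E: "tsub E" and f: "f \<in> E" "f x0 \<noteq> 0" and b: "\<And>d v. onf d v E \<Longrightarrow> d \<le> N"
  shows "\<exists>\<pi> v. irreducible_rep conv e ck \<pi> \<and> (\<forall>j<rep_dim e \<pi>. v j \<in> E \<and> nsq haar (v j) = 1 \<and>
     (\<forall>x. v j x = (\<Sum>i<rep_dim e \<pi>. v i e * cnj (coef \<pi> j i x))))"
proof -
  \<comment> \<open>The possible dimensions of nonzero invariant subspaces of \<open>E\<close>; a
    family without an extension measures the dimension.\<close>
  define Q where "Q d \<longleftrightarrow> (\<exists>S\<subseteq>E. tsub S \<and> 0 < d \<and> (\<exists>v. onf d v S) \<and> (\<forall>w. \<not> onf (Suc d) w S))" for d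
  have Qmax: "\<exists>d v. Q d \<and> onf d v S" if S: "S \<subseteq> E" "tsub S" and g: "g \<in> S" "g x \<noteq> 0" for S g x
  proof -
    have "\<And>d v. onf d v S \<Longrightarrow> d \<le> N" using b onf_mono[OF _ order_refl S(1)] by blast
    then obtain d v where dv: "onf d v S" "\<And>w. \<not> onf (Suc d) w S" using onf_maximal by blast
    have "d \<noteq> 0"
    proof
      assume "d = 0"
      then show False using onf_1[OF S(2) g] dv(2) by blast
    qed
    then have "Q d" unfolding Q_def using S dv by (intro exI[of _ S]) auto
    then show ?thesis using dv(1) by blast
  qed
  define d where "d = (LEAST d. Q d)"
  have "Q d" unfolding d_def using Qmax[OF order_refl E f] by (metis LeastI)
  then obtain S v where S: "S \<subseteq> E" "tsub S" and d0: "0 < d" and v: "onf d v S" and max: "\<And>w. \<not> onf (Suc d) w S"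
    unfolding Q_def by blast
  have Qmin: "d \<le> d'" if "Q d'" for d' unfolding d_def by (rule Least_le[of Q, OF that])
  have vc: "cts (v i)" if "i < d" for i using S(2) v that unfolding tsub_def onf_def by blast
  have on: "ip haar (v i) (v j) = (if i = j then 1 else 0)" if "i < d" "j < d" for i j using v that unfolding onf_def by blast
  \<comment> \<open>The matrix of translation by \<open>ck x\<close> in the basis \<open>v\<close>.
    The reflection is needed for the order of products: translating by \<open>ck y\<close> and then
    by \<open>ck x\<close> corresponds to x * y.\<close>
  define a where "a i j x = ip haar (tr (v j) (ck x)) (v i)" for i j x
  have trv: "tr (v j) (ck x) = (\<lambda>y. \<Sum>i<d. a i j x * v i y)" if "j < d" for j x
    unfolding a_def by (rule onf_expand[OF S(2) v max]) (use S(2) v that in \<open>auto simp: tsub_def onf_def\<close>)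
  have A2: "cts (a i j)" if ij: "i < d" "j < d" for i j
  proof -
    obtain B where B: "B > 0" "\<And>y z. cmod (ker (v j) y z) \<le> B" using ker_bounded[OF vc[OF ij(2)]] by blast
    have "continuous_on UNIV (\<lambda>x. LINT y|haar. ker (v j) x y * cnj (v i y))"
    proof (rule continuous_on_param_integral[where w = "\<lambda>y. B * cmod (v i y)"])
      show "integrable haar (\<lambda>y. B * cmod (v i y))" using integrable_haar[OF vc[OF ij(1)]] by simp
      show "continuous_on UNIV (\<lambda>x. ker (v j) x y * cnj (v i y))" for y
        using continuous_on_section(2)[OF ker_continuous[OF vc[OF ij(2)]]] by (intro continuous_intros)
      show "(\<lambda>y. ker (v j) x y * cnj (v i y)) \<in> borel_measurable borel" for x
        by (intro borel_measurable_continuous_onI continuous_intros vc ij ker_cts)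
      show "cmod (ker (v j) x y * cnj (v i y)) \<le> B * cmod (v i y)" for x y
        using B by (simp add: norm_mult mult_right_mono)
    qed simp
    then show ?thesis unfolding a_def[abs_def] ip_def ker_def .
  qed
  have A3: "tr (a i j) x y = (\<Sum>l<d. a i l x * a l j y)" if ij: "i < d" "j < d" for i j x y
  proof -
    note kc = ker_continuous[OF vc[OF ij(2)]]
    have ci: "cts (\<lambda>z. cnj (v i z))" using vc[OF ij(1)] by (intro continuous_intros)
    have "tr (a i j) x y = (LINT t|tmeas x y. LINT z|haar. ker (v j) t z * cnj (v i z))"
      unfolding tr_integral[OF A2[OF ij]] by (simp only: a_def[abs_def] ip_def ker_def)
    also have "\<dots> = (LINT z|haar. (LINT t|tmeas x y. ker (v j) t z) * cnj (v i z))"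
      by (rule Fubini_continuous_times[OF K finite_tmeas sets_tmeas finite_haar sets_haar kc integrable_haar[OF ci]])
    also have "\<dots> = ip haar (\<lambda>z. \<Sum>l<d. a l j y * tr (v l) (ck x) z) (v i)"
    proof -
      have "(LINT t|tmeas x y. ker (v j) t z) = (\<Sum>l<d. a l j y * tr (v l) (ck x) z)" for z
      proof -
        have "(LINT t|tmeas x y. ker (v j) t z) = tr (\<lambda>t. ker (v j) t z) x y"
          using tr_integral[OF continuous_on_section(2)[OF kc]] by simp
        also have "\<dots> = tr (tr (v j) (ck y)) (ck x) z" by (rule ker_tr[OF vc[OF ij(2)]])
        also have "\<dots> = (\<Sum>l<d. a l j y * tr (v l) (ck x) z)"
          unfolding trv[OF ij(2)] using vc by (intro tr_sum) auto
        finally show ?thesis .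
      qed
      then show ?thesis unfolding ip_def by simp
    qed
    also have "\<dots> = (\<Sum>l<d. a l j y * ip haar (tr (v l) (ck x)) (v i))"
      using vc ij cts_tr(1) by (intro ip_sum_left cts_sq) auto
    finally show ?thesis unfolding a_def[symmetric] by (simp add: mult.commute)
  qed
  have A4: "a i j (ck x) = cnj (a j i x)" if ij: "i < d" "j < d" for i j x
  proof -
    have "a i j (ck x) = (LINT y|haar. tr (v j) x y * cnj (v i y))" unfolding a_def ip_def by simp
    also have "\<dots> = (LINT y|haar. v j y * tr (\<lambda>y. cnj (v i y)) (ck x) y)"
      using vc ij by (intro tr_adjoint continuous_intros)
    also have "\<dots> = ip haar (v j) (tr (v i) (ck x))" unfolding ip_def tr_cnj[OF vc[OF ij(1)]] ..
    finally show ?thesis unfolding a_def using ip_cnj by metis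
  qed
  have A5: "a i j e = (if i = j then 1 else 0)" if ij: "i < d" "j < d" for i j
  proof -
    have "tr (v j) (ck e) = v j" unfolding ck_e using tr_unit(2)[OF vc[OF ij(2)]] by blast
    then show ?thesis unfolding a_def using on ij by simp
  qed
  have cr: "coef_rep d a" unfolding coef_rep_def using A2 A3 A4 A5 by blast
  define \<pi> where "\<pi> = rep_of d a"
  have dim: "rep_dim e \<pi> = d" unfolding \<pi>_def by simp
  have rep: "representation conv e ck \<pi>" unfolding \<pi>_def by (rule rep_of_representation[OF cr])
  have \<pi>c: "\<pi> \<mu> \<in> carrier_mat d d" for \<mu> unfolding \<pi>_def rep_of_def by simp
  have \<pi>i: "\<pi> (dirac x) $$ (i, j) = a i j x" if "i < d" "j < d" for i j x
    using coef_rep_of[OF cr that] unfolding coef_def \<pi>_def by metis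
  define fn where "fn w = (\<lambda>x. \<Sum>i<d. vec_index w i * v i x)" for w
  have fn_ip: "ip haar (fn w) (v j) = vec_index w j" if j: "j < d" for w j
  proof -
    have "ip haar (fn w) (v j) = (\<Sum>i<d. vec_index w i * ip haar (v i) (v j))"
      unfolding fn_def using vc j by (intro ip_sum_left cts_sq) auto
    also have "\<dots> = (\<Sum>i<d. vec_index w i * (if i = j then 1 else 0))" using on j by (intro sum.cong) auto
    finally show ?thesis unfolding sum_unit_right[OF j] .
  qed
  have irr: "irreducible_rep conv e ck \<pi>"
    unfolding irreducible_rep_def dim
  proof (intro conjI allI impI rep d0)
    fix W assume "invariant_subspace e \<pi> W"
    then have W: "W \<subseteq> carrier_vec d" "0\<^sub>v d \<in> W" "\<And>u v. u \<in> W \<Longrightarrow> v \<in> W \<Longrightarrow> u + v \<in> W"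
      "\<And>c v. v \<in> W \<Longrightarrow> c \<cdot>\<^sub>v v \<in> W" "\<And>\<mu> v. \<mu> \<in> reg_measures \<Longrightarrow> v \<in> W \<Longrightarrow> \<pi> \<mu> *\<^sub>v v \<in> W"
      unfolding invariant_subspace_def dim by blast+
    show "W = {0\<^sub>v d} \<or> W = carrier_vec d"
    proof (cases "W = {0\<^sub>v d}")
      case False
      then obtain w0 where w0: "w0 \<in> W" "w0 \<noteq> 0\<^sub>v d" using W(2) by blast
      define S' where "S' = fn ` W"
      have "v i \<in> S" if "i < d" for i using v that unfolding onf_def by blast
      then have S'S: "S' \<subseteq> S" unfolding S'_def fn_def using tsub_sum[OF S(2)] by blast
      have tS': "tsub S'" unfolding tsub_def
      proof (intro conjI ballI allI)
        show "(\<lambda>_. 0) \<in> S'" unfolding S'_def using W(2) by (intro image_eqI[of _ _ "0\<^sub>v d"]) (auto simp: fn_def)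
        show "cts f" if "f \<in> S'" for f using that S'S S(2) unfolding tsub_def by blast
        fix f assume "f \<in> S'"
        then obtain w where w: "w \<in> W" "f = fn w" unfolding S'_def by blast
        then have wc: "w \<in> carrier_vec d" using W(1) by blast
        show "(\<lambda>x. c * f x) \<in> S'" for c
        proof -
          have "(\<lambda>x. c * f x) = fn (c \<cdot>\<^sub>v w)"
            unfolding fn_def w(2) using wc by (auto simp: sum_distrib_left mult.assoc)
          then show ?thesis unfolding S'_def using W(4)[OF w(1), of c] by (rule image_eqI)
        qed
        show "(\<lambda>x. f x + g x) \<in> S'" if g: "g \<in> S'" for g
        proof -
          obtain w' where w': "w' \<in> W" "g = fn w'" using g unfolding S'_def by blast
          then have wc': "w' \<in> carrier_vec d" using W(1) by blast
          have "(\<lambda>x. f x + g x) = fn (w + w')"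
            unfolding fn_def w(2) w'(2) using wc wc' by (auto simp: sum.distrib distrib_right)
          then show ?thesis unfolding S'_def using W(3)[OF w(1) w'(1)] by (rule image_eqI)
        qed
        fix x
        have "tr f x y = fn (\<pi> (dirac (ck x)) *\<^sub>v w) y" for y
        proof -
          have "tr f x y = (\<Sum>j<d. vec_index w j * tr (v j) x y)"
            unfolding w(2) fn_def using vc by (intro tr_sum) auto
          also have "\<dots> = (\<Sum>j<d. vec_index w j * (\<Sum>i<d. a i j (ck x) * v i y))"
            using trv[of _ "ck x"] by (intro sum.cong) auto
          also have "\<dots> = (\<Sum>i<d. (\<Sum>j<d. a i j (ck x) * vec_index w j) * v i y)"
            by (simp add: sum_distrib_left sum_distrib_right mult_ac) (rule sum.swap)
          also have "\<dots> = fn (\<pi> (dirac (ck x)) *\<^sub>v w) y"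
            unfolding fn_def using mult_mat_vec_index_sum[OF \<pi>c wc] \<pi>i by (intro sum.cong) auto
          finally show ?thesis .
        qed
        then have "tr f x = fn (\<pi> (dirac (ck x)) *\<^sub>v w)" by blast
        then show "tr f x \<in> S'" unfolding S'_def using W(5)[OF dirac_reg w(1)] by blast
      qed
      have "\<exists>i<d. vec_index w0 i \<noteq> 0"
      proof (rule ccontr)
        assume "\<not> ?thesis"
        then have "w0 = 0\<^sub>v d" using w0(1) W(1) by (intro eq_vecI) auto
        then show False using w0 by blast
      qed
      then obtain i where "i < d" "vec_index w0 i \<noteq> 0" by blast
      then have "ip haar (fn w0) (v i) \<noteq> 0" using fn_ip by simp
      then have "\<exists>x. fn w0 x \<noteq> 0" by (auto simp: ip_def intro: ccontr)
      then obtain x where "fn w0 x \<noteq> 0" by blast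
      moreover have "fn w0 \<in> S'" unfolding S'_def using w0 by blast
      moreover have "S' \<subseteq> E" using S'S S by blast
      \<comment> \<open>By minimality of \<open>d\<close> the subspace belonging to \<open>W\<close>
        also contains an orthonormal family of length \<open>d\<close>. Such a family is maximal in
        \<open>S\<close> and hence spans it, so \<open>W\<close> is everything.\<close>
      ultimately obtain d' v' where "Q d'" "onf d' v' S'" using Qmax[OF _ tS'] by blast
      then have v': "onf d v' S'" using Qmin onf_mono[OF _ _ order_refl] by blast
      then have v'S: "onf d v' S" using onf_mono[OF _ order_refl S'S] by blast
      have vS': "v i \<in> S'" if i: "i < d" for i
      proof -
        have viS: "v i \<in> S" using v i unfolding onf_def by blast
        show ?thesis
          by (subst onf_expand[OF S(2) v'S max viS]) (intro tsub_sum[OF tS'], use v' in \<open>simp add: onf_def\<close>)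
      qed
      have "w \<in> W" if w: "w \<in> carrier_vec d" for w
      proof -
        have "fn w \<in> S'" unfolding fn_def using vS' by (intro tsub_sum[OF tS'])
        then obtain w' where w': "w' \<in> W" "fn w = fn w'" unfolding S'_def by blast
        have "vec_index w i = vec_index w' i" if "i < d" for i using fn_ip[OF that] w'(2) by metis
        then have "w = w'" using w w'(1) W(1) by (intro eq_vecI) auto
        then show ?thesis using w' by simp
      qed
      then have "W = carrier_vec d" using W(1) by blast
      then show ?thesis ..
    qed blast
  qed
  \<comment> \<open>The value at x is the value at \<open>e\<close> of the translate by x = ck (ck
    x), and the reflection inside the coefficient becomes a conjugate.\<close>
  have F1: "v j x = (\<Sum>i<d. v i e * cnj (coef \<pi> j i x))" if j: "j < d" for j x
  proof -
    have "v j x = tr (v j) (ck (ck x)) e" using tr_unit(1)[OF vc[OF j]] by simp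
    also have "\<dots> = (\<Sum>i<d. a i j (ck x) * v i e)" unfolding trv[OF j] ..
    also have "\<dots> = (\<Sum>i<d. v i e * cnj (coef \<pi> j i x))"
      using A4 j coef_rep_of[OF cr] unfolding \<pi>_def by (intro sum.cong) auto
    finally show ?thesis .
  qed
  have F2: "nsq haar (v j) = 1" if "j < d" for j using on[OF that that] ip_self[of haar "v j"] by simp
  have F3: "v j \<in> E" if "j < d" for j using v S(1) that unfolding onf_def by blast
  have "\<forall>j<rep_dim e \<pi>. v j \<in> E \<and> nsq haar (v j) = 1 \<and>
     (\<forall>x. v j x = (\<Sum>i<rep_dim e \<pi>. v i e * cnj (coef \<pi> j i x)))"
    unfolding dim by (intro allI impI conjI F1 F2 F3)
  then show ?thesis by (intro exI[of _ \<pi>] exI[of _ v] conjI irr)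
qed

text \<open>A nonzero member would survive some smoothing, and then the square of that operator
  would have a nonzero eigenspace inside \<open>Worth\<close>. This space is translation invariant
  and finite dimensional, so it contains a unit vector that is a combination of conjugated
  coefficients; pairing the vector with itself gives 0.\<close>

theorem Worth_trivial:
  assumes h: "h \<in> Worth"
  shows "h x = 0"
proof (rule ccontr)
  assume hx: "h x \<noteq> 0"
  have hc: "cts h" using h unfolding Worth_def by simp
  obtain u where u: "\<And>n::nat. sym_unit (u n)"
    and ap: "\<And>g \<eta>. cts g \<Longrightarrow> \<eta> > 0 \<Longrightarrow> \<forall>\<^sub>F n in sequentially. \<forall>y. cmod (smooth (u n) g y - g y) \<le> \<eta>"
    using approximate_identity by blast
  have "cmod (h x) / 2 > 0" using hx by simp
  from ap[OF hc this] obtain n where n: "\<forall>y. cmod (smooth (u n) h y - h y) \<le> cmod (h x) / 2"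
    unfolding eventually_sequentially by blast
  have "smooth (u n) h x \<noteq> 0"
  proof
    assume "smooth (u n) h x = 0"
    then have "cmod (h x) \<le> cmod (h x) / 2" using n[rule_format, of x] by simp
    then show False using hx by simp
  qed
  then obtain g m where m: "m > 0" and g: "g \<in> Worth" "nsq haar g > 0"
    and eig: "\<forall>y. smooth (u n) (smooth (u n) g) y = complex_of_real m * g y"
    using eigenvector_exists[OF u h] by blast
  let ?T = "smooth (u n)"
  note uc = sym_unit_cts[OF u[of n]]
  have Wc: "cts f" if "f \<in> Worth" for f using that unfolding Worth_def by simp
  note Tc = cts_smooth[OF u[of n]]
  define E where "E = {f \<in> Worth. \<forall>y. ?T (?T f) y = complex_of_real m * f y}"
  have W0: "(\<lambda>_. 0) \<in> Worth" using Worth_scale[OF h, of 0] by simp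
  have E: "tsub E" unfolding tsub_def
  proof (intro conjI ballI allI)
    show "(\<lambda>_. 0) \<in> E" unfolding E_def using W0 by (simp add: smooth_def)
    fix f assume "f \<in> E"
    then have f: "f \<in> Worth" "\<And>y. ?T (?T f) y = complex_of_real m * f y" unfolding E_def by auto
    note fc = Wc[OF f(1)]
    show "cts f" by (rule fc)
    show "(\<lambda>x. c * f x) \<in> E" for c
    proof -
      have "?T (\<lambda>x. c * f x) = (\<lambda>x. c * ?T f x)" using smooth_scale[OF uc fc] by blast
      then show ?thesis unfolding E_def using Worth_scale[OF f(1)] f(2) smooth_scale[OF uc Tc[OF fc]] by simp
    qed
    show "(\<lambda>x. f x + k x) \<in> E" if "k \<in> E" for k
    proof -
      have k: "k \<in> Worth" "\<And>y. ?T (?T k) y = complex_of_real m * k y" using that unfolding E_def by auto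
      note kc = Wc[OF k(1)]
      have "?T (\<lambda>x. f x + k x) = (\<lambda>x. ?T f x + ?T k x)" using smooth_add[OF uc fc kc] by blast
      then show ?thesis unfolding E_def using Worth_add[OF f(1) k(1)] f(2) k(2) smooth_add[OF uc Tc[OF fc] Tc[OF kc]]
        by (simp add: distrib_left)
    qed
    show "tr f x \<in> E" for x
    proof -
      have "?T (tr f x) = tr (?T f) x" using smooth_tr[OF uc fc] by blast
      then have 1: "?T (?T (tr f x)) y = tr (?T (?T f)) x y" for y using smooth_tr[OF uc Tc[OF fc]] by simp
      have 2: "?T (?T f) = (\<lambda>y. complex_of_real m * f y)" using f(2) by blast
      show ?thesis unfolding E_def using Worth_tr[OF f(1)] 1 tr_scale[OF fc] unfolding 2 by simp
    qed
  qed
  obtain B where B: "B > 0" "\<And>y z. cmod (ker (u n) y z) \<le> B" using ker_bounded[OF uc] by blast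
  \<comment> \<open>Bessel's inequality for the kernel as a function of its second variable bounds
    the sum of the squares of the smoothed family by B^2 at each point. Integration gives d m \<le>
    B^2, because each smoothed vector has squared norm m.\<close>
  have bnd: "d \<le> nat \<lceil>B\<^sup>2 / m\<rceil>" if v: "onf d v E" for d v
  proof -
    have vE: "v i \<in> E" if "i < d" for i using v that unfolding onf_def by blast
    have vc: "cts (v i)" if "i < d" for i using vE[OF that] Wc unfolding E_def by blast
    have pw: "(\<Sum>i<d. (cmod (?T (v i) y))\<^sup>2) \<le> B\<^sup>2" for y
    proof -
      have ipc: "ip haar (ker (u n) y) (\<lambda>z. cnj (v i z)) = ?T (v i) y" for i unfolding ip_def smooth_def by simp
      have "(\<Sum>i\<in>{..<d}. 1 * (cmod (ip haar (ker (u n) y) (\<lambda>z. cnj (v i z))))\<^sup>2) \<le> nsq haar (ker (u n) y)"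
      proof (rule Bessel_orthogonal)
        fix i j assume "i \<in> {..<d}" "j \<in> {..<d}"
        then have "ip haar (v j) (v i) = (if i = j then 1 else 0)" using v unfolding onf_def by auto
        then show "ip haar (\<lambda>z. cnj (v i z)) (\<lambda>z. cnj (v j z)) = (if i = j then complex_of_real (1 / 1) else 0)"
          unfolding ip_def by (simp add: mult.commute)
      qed (use vc ker_cts[OF uc] in \<open>auto intro!: cts_sq continuous_intros\<close>)
      also have "\<dots> \<le> B\<^sup>2" by (rule nsq_sup[OF ker_cts[OF uc] B(2)])
      finally show ?thesis unfolding ipc by simp
    qed
    have eq: "nsq haar (?T (v i)) = m" if i: "i < d" for i
    proof -
      have "complex_of_real (nsq haar (?T (v i))) = ip haar (?T (?T (v i))) (v i)"
        unfolding ip_self[symmetric] by (rule ip_smooth[OF u Tc[OF vc[OF i]] vc[OF i], symmetric])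
      also have "?T (?T (v i)) = (\<lambda>y. complex_of_real m * v i y)" using vE[OF i] unfolding E_def by blast
      also have "ip haar (\<lambda>y. complex_of_real m * v i y) (v i) = complex_of_real m"
        unfolding ip_scale_left using v i unfolding onf_def by simp
      finally show ?thesis by (metis of_real_eq_iff)
    qed
    interpret prob_space haar by (rule prob_haar)
    have int: "integrable haar (\<lambda>y. (cmod (?T (v i) y))\<^sup>2)" if "i < d" for i
      using cts_sq[OF Tc[OF vc[OF that]]] unfolding sq_integrable_def by simp
    have "real d * m = (\<Sum>i<d. nsq haar (?T (v i)))" using eq by simp
    also have "\<dots> = (LINT y|haar. (\<Sum>i<d. (cmod (?T (v i) y))\<^sup>2))"
      unfolding nsq_def by (rule Bochner_Integration.integral_sum[symmetric]) (use int in auto)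
    also have "\<dots> \<le> (LINT y|haar. B\<^sup>2)"
      using pw int by (intro integral_mono Bochner_Integration.integrable_sum) auto
    also have "\<dots> = B\<^sup>2" by (simp add: prob_space[unfolded space_haar])
    finally have "real d \<le> B\<^sup>2 / m" using m by (simp add: field_simps)
    then show ?thesis by linarith
  qed
  have "\<exists>y. g y \<noteq> 0" using g(2) by (auto simp: nsq_def intro: ccontr)
  then obtain y where y: "g y \<noteq> 0" by blast
  have gE: "g \<in> E" unfolding E_def using g(1) eig by blast
  obtain \<pi> v where irr: "irreducible_rep conv e ck \<pi>" and v: "\<And>j. j < rep_dim e \<pi> \<Longrightarrow> v j \<in> E" "\<And>j. j < rep_dim e \<pi> \<Longrightarrow> nsq haar (v j) = 1"
    "\<And>j x. j < rep_dim e \<pi> \<Longrightarrow> v j x = (\<Sum>i<rep_dim e \<pi>. v i e * cnj (coef \<pi> j i x))"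
    using irreducible_in_invariant[OF E gE y, of "nat \<lceil>B\<^sup>2 / m\<rceil>"] bnd by blast
  have d0: "0 < rep_dim e \<pi>" using irr unfolding irreducible_rep_def by blast
  have vW: "v 0 \<in> Worth" using v(1)[OF d0] unfolding E_def by blast
  note cc = coef_cts[OF irr_rep[OF irr] d0]
  have "ip haar (v 0) (v 0) = (LINT x|haar. (\<Sum>i<rep_dim e \<pi>. cnj (v i e) * (v 0 x * coef \<pi> 0 i x)))"
  proof -
    have "v 0 x * cnj (v 0 x) = (\<Sum>i<rep_dim e \<pi>. cnj (v i e) * (v 0 x * coef \<pi> 0 i x))" for x
    proof -
      have "cnj (v 0 x) = (\<Sum>i<rep_dim e \<pi>. cnj (v i e) * coef \<pi> 0 i x)"
        using arg_cong[OF v(3)[OF d0, of x], of cnj] by simp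
      then show ?thesis by (simp add: sum_distrib_left mult_ac)
    qed
    then show ?thesis unfolding ip_def by simp
  qed
  also have "\<dots> = (\<Sum>i<rep_dim e \<pi>. (LINT x|haar. cnj (v i e) * (v 0 x * coef \<pi> 0 i x)))"
    using Wc[OF vW] cc by (intro Bochner_Integration.integral_sum integrable_haar continuous_intros) auto
  also have "\<dots> = 0" using vW irr d0 unfolding Worth_def by (intro sum.neutral) simp
  finally show False using v(2)[OF d0] unfolding ip_self by simp
qed

end

section \<open>Uniform density of the trigonometric polynomials\<close>

lemma parallelogram:
  assumes a: "sq_integrable M a" and b: "sq_integrable M b"
  shows "nsq M (\<lambda>x. a x - b x) + nsq M (\<lambda>x. a x + b x) = 2 * nsq M a + 2 * nsq M b"
proof -
  have "nsq M (\<lambda>x. a x - (-1) * b x) = nsq M a - 2 * Re (ip M a (\<lambda>x. (-1) * b x)) + nsq M (\<lambda>x. (-1) * b x)"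
    by (rule nsq_diff[OF a sq_integrable_scale[OF b]])
  then have "nsq M (\<lambda>x. a x + b x) = nsq M a + 2 * Re (ip M a b) + nsq M b"
    unfolding ip_scale_right nsq_scale by simp
  then show ?thesis using nsq_diff[OF a b] by simp
qed

context haar_hypergroup
begin

lemma trig_orthogonal_zero:
  assumes G: "cts G" and o: "\<And>s. s \<in> trig \<Longrightarrow> ip haar G s = 0"
  shows "G x = 0"
proof -
  have "(\<lambda>x. cnj (G x)) \<in> Worth" unfolding Worth_def
  proof (intro CollectI conjI allI impI)
    show "cts (\<lambda>x. cnj (G x))" using G by (intro continuous_intros)
    fix \<pi> i j assume "irreducible_rep conv e ck \<pi>" "i < rep_dim e \<pi>" "j < rep_dim e \<pi>"
    then have "ip haar G (coef \<pi> i j) = 0" by (intro o trig_coef)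
    then have "cnj (ip haar G (coef \<pi> i j)) = 0" by simp
    then show "(LINT x|haar. cnj (G x) * coef \<pi> i j x) = 0"
      unfolding ip_def Bochner_Integration.integral_cnj[symmetric] by simp
  qed
  from Worth_trivial[OF this, of x] show ?thesis by simp
qed

text \<open>A general hypergroup offers no tensor product of representations, so products of
  coefficients are not under control and the route through algebras of functions is closed. Instead,
  a sequence minimizing the mean square distance to \<open>F\<close> is smoothed: the smoothed
  errors converge uniformly to a continuous function orthogonal to \<open>trig\<close>, which is 0.
  No limit in the space of square-integrable functions is needed.\<close>

theorem trig_dense:
  assumes F: "cts F" and eps: "\<epsilon> > 0"
  shows "\<exists>t\<in>trig. \<forall>x. cmod (F x - t x) \<le> \<epsilon>"
proof -
  obtain us where us: "\<And>n::nat. sym_unit (us n)"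
    and ap: "\<And>g \<eta>. cts g \<Longrightarrow> \<eta> > 0 \<Longrightarrow> \<forall>\<^sub>F n in sequentially. \<forall>y. cmod (smooth (us n) g y - g y) \<le> \<eta>"
    using approximate_identity by blast
  have "\<epsilon> / 2 > 0" using eps by simp
  from ap[OF F this] obtain n0 where n0: "\<forall>y. cmod (smooth (us n0) F y - F y) \<le> \<epsilon> / 2"
    unfolding eventually_sequentially by blast
  define u where "u = us n0"
  have u: "sym_unit u" unfolding u_def by (rule us)
  have uF: "cmod (smooth u F y - F y) \<le> \<epsilon> / 2" for y using n0 unfolding u_def by blast
  note uc = sym_unit_cts[OF u]
  obtain B where B: "B > 0" "\<And>y z. cmod (ker u y z) \<le> B" using ker_bounded[OF uc] by blast
  note sb = smooth_sup_bound[OF uc B(2,1)]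
  define S where "S = (\<lambda>t. nsq haar (\<lambda>x. F x - t x)) ` trig"
  have bdd: "bdd_below S" unfolding S_def by (intro bdd_belowI[of _ 0]) auto
  have Sne: "S \<noteq> {}" unfolding S_def using trig.zero by blast
  define \<delta> where "\<delta> = Inf S"
  have low: "\<delta> \<le> nsq haar (\<lambda>x. F x - t x)" if "t \<in> trig" for t
    unfolding \<delta>_def S_def by (rule cInf_lower[OF imageI[OF that] bdd[unfolded S_def]])
  have "\<forall>n. \<exists>t. t \<in> trig \<and> nsq haar (\<lambda>x. F x - t x) < \<delta> + inverse (real (Suc n))"
  proof
    fix n
    have "Inf S < \<delta> + inverse (real (Suc n))" unfolding \<delta>_def by simp
    then obtain s where "s \<in> S" "s < \<delta> + inverse (real (Suc n))" using cInf_less_iff[OF Sne bdd] by blast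
    then show "\<exists>t. t \<in> trig \<and> nsq haar (\<lambda>x. F x - t x) < \<delta> + inverse (real (Suc n))" unfolding S_def by blast
  qed
  then obtain t where t: "\<And>n. t n \<in> trig" "\<And>n. nsq haar (\<lambda>x. F x - t n x) < \<delta> + inverse (real (Suc n))" by metis
  note tc = trig_cts[OF t(1)]
  have dc: "cts (\<lambda>x. F x - t n x)" for n using F tc by (intro continuous_intros)
  \<comment> \<open>The midpoint of two almost minimizers is again in \<open>trig\<close> and cannot
    beat the infimum; the parallelogram law then makes the sequence Cauchy in the mean.\<close>
  have key: "nsq haar (\<lambda>x. t n x - t m x) \<le> 2 * inverse (real (Suc n)) + 2 * inverse (real (Suc m))" for n m
  proof -
    have h: "(\<lambda>x. (1/2) * (t n x + t m x)) \<in> trig" by (rule trig_scale[OF trig_add[OF t(1) t(1)]])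
    have e1: "(\<lambda>x. (F x - t m x) + (F x - t n x)) = (\<lambda>x. 2 * (F x - (1/2) * (t n x + t m x)))" by (auto simp: field_simps)
    have "nsq haar (\<lambda>x. (F x - t m x) + (F x - t n x)) = 4 * nsq haar (\<lambda>x. F x - (1/2) * (t n x + t m x))"
      unfolding e1 nsq_scale by simp
    moreover have e2: "(\<lambda>x. (F x - t m x) - (F x - t n x)) = (\<lambda>x. t n x - t m x)" by auto
    ultimately have "nsq haar (\<lambda>x. t n x - t m x) + 4 * nsq haar (\<lambda>x. F x - (1/2) * (t n x + t m x))
        = 2 * nsq haar (\<lambda>x. F x - t m x) + 2 * nsq haar (\<lambda>x. F x - t n x)"
      using parallelogram[OF cts_sq[OF dc[of m]] cts_sq[OF dc[of n]]] unfolding e2 by linarith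
    then show ?thesis using low[OF h] t(2)[of n] t(2)[of m] by linarith
  qed
  define q where "q n = smooth u (\<lambda>x. F x - t n x)" for n
  have qc: "cts (q n)" for n unfolding q_def by (rule cts_smooth[OF u dc])
  have qd: "cmod (q n y - q m y) \<le> B * sqrt (nsq haar (\<lambda>x. t m x - t n x))" for n m y
  proof -
    have "q n y - q m y = smooth u (\<lambda>x. (F x - t n x) - (F x - t m x)) y"
      unfolding q_def using smooth_diff[OF uc dc dc] by simp
    also have "(\<lambda>x. (F x - t n x) - (F x - t m x)) = (\<lambda>x. t m x - t n x)" by auto
    finally have eq: "q n y - q m y = smooth u (\<lambda>x. t m x - t n x) y" .
    show ?thesis unfolding eq by (intro sb continuous_intros tc)
  qed
  have "uniformly_Cauchy_on UNIV q"
    unfolding uniformly_Cauchy_on_def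
  proof (intro allI impI)
    fix \<eta> :: real assume eta: "\<eta> > 0"
    have "(\<eta> / B)\<^sup>2 / 8 > 0" using eta B(1) by simp
    from order_tendstoD(2)[OF LIMSEQ_inverse_real_of_nat this] obtain N where N: "\<And>n. n \<ge> N \<Longrightarrow> inverse (real (Suc n)) < (\<eta> / B)\<^sup>2 / 8"
      unfolding eventually_sequentially by blast
    have "dist (q m x) (q n x) < \<eta>" if mn: "m \<ge> N" "n \<ge> N" for m n x
    proof -
      have "(\<eta> / B)\<^sup>2 > 0" using eta B(1) by simp
      then have "nsq haar (\<lambda>x. t n x - t m x) < (\<eta> / B)\<^sup>2"
        using key[of n m] N[OF mn(1)] N[OF mn(2)] by linarith
      then have "sqrt (nsq haar (\<lambda>x. t n x - t m x)) < sqrt ((\<eta> / B)\<^sup>2)" by (rule real_sqrt_less_mono)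
      also have "sqrt ((\<eta> / B)\<^sup>2) = \<eta> / B" using eta B(1) by simp
      finally have "B * sqrt (nsq haar (\<lambda>x. t n x - t m x)) < \<eta>" using B(1) by (simp add: field_simps)
      then show ?thesis using qd[of m x n] unfolding dist_norm by linarith
    qed
    then show "\<exists>M. \<forall>x\<in>UNIV. \<forall>m\<ge>M. \<forall>n\<ge>M. dist (q m x) (q n x) < \<eta>" by blast
  qed
  then obtain G where G: "uniform_limit UNIV q G sequentially"
    using Cauchy_uniformly_convergent unfolding uniformly_convergent_on_def by blast
  have Gc: "cts G" by (rule uniform_limit_theorem[OF _ G]) (use qc in auto)
  have orth: "(cmod (ip haar (\<lambda>x. F x - t n x) s))\<^sup>2 \<le> (nsq haar s + 1) * inverse (real (Suc n))" if s: "s \<in> trig" for s n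
  proof -
    define w where "w = ip haar (\<lambda>x. F x - t n x) s"
    \<comment> \<open>The competitor \<open>t n + c s\<close> with c = w / M lowers the distance by
      at least |w|^2 / M, so an almost minimal error is almost orthogonal to \<open>s\<close>. The
      summand 1 allows s = 0.\<close>
    define M where "M = nsq haar s + 1"
    have M: "M > 0" "nsq haar s \<le> M" unfolding M_def using nsq_nonneg[of haar s] by linarith+
    define c where "c = w / complex_of_real M"
    have sc: "cts s" by (rule trig_cts[OF s])
    have "(\<lambda>x. t n x + c * s x) \<in> trig" by (rule trig_add[OF trig_scale[OF s] t(1)])
    from low[OF this] have "\<delta> \<le> nsq haar (\<lambda>x. (F x - t n x) - c * s x)" by (simp add: diff_diff_eq)
    also have "\<dots> = nsq haar (\<lambda>x. F x - t n x) - 2 * Re (cnj c * w) + (cmod c)\<^sup>2 * nsq haar s"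
      unfolding nsq_diff[OF cts_sq[OF dc[of n]] sq_integrable_scale[OF cts_sq[OF sc]]] ip_scale_right nsq_scale w_def ..
    finally have 1: "\<delta> \<le> nsq haar (\<lambda>x. F x - t n x) - 2 * Re (cnj c * w) + (cmod c)\<^sup>2 * nsq haar s" .
    have "cnj c * w = complex_of_real ((cmod w)\<^sup>2 / M)" unfolding c_def using mult_cnj_cmod[of w] by (simp add: mult.commute)
    then have 2: "Re (cnj c * w) = (cmod w)\<^sup>2 / M" by (metis Re_complex_of_real)
    have "(cmod c)\<^sup>2 = (cmod w)\<^sup>2 / M\<^sup>2" unfolding c_def using M by (simp add: norm_divide power_divide)
    then have "(cmod c)\<^sup>2 * nsq haar s \<le> (cmod w)\<^sup>2 / M\<^sup>2 * M" using M(2) by (simp only:) (intro mult_left_mono, auto)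
    also have "\<dots> = (cmod w)\<^sup>2 / M" using M by (simp add: power2_eq_square)
    finally have "(cmod w)\<^sup>2 / M \<le> nsq haar (\<lambda>x. F x - t n x) - \<delta>" using 1 unfolding 2 by linarith
    then have "(cmod w)\<^sup>2 / M \<le> inverse (real (Suc n))" using t(2)[of n] by linarith
    then show ?thesis unfolding w_def[symmetric] M_def[symmetric] using M by (simp add: pos_divide_le_eq mult.commute)
  qed
  have "ip haar G s = 0" if s: "s \<in> trig" for s
  proof -
    have sc: "cts s" by (rule trig_cts[OF s])
    have ss: "smooth u s \<in> trig" by (rule trig_smooth[OF s uc])
    have "(\<lambda>n. ip haar (q n) s) \<longlonglongrightarrow> 0"
    proof (rule Lim_null_comparison)
      show "\<forall>\<^sub>F n in sequentially. norm (ip haar (q n) s) \<le> sqrt ((nsq haar (smooth u s) + 1) * inverse (real (Suc n)))"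
      proof (rule always_eventually, rule allI)
        fix n show "norm (ip haar (q n) s) \<le> sqrt ((nsq haar (smooth u s) + 1) * inverse (real (Suc n)))"
          unfolding q_def ip_smooth[OF u dc sc] by (rule real_le_rsqrt[OF orth[OF ss]])
      qed
      have "(\<lambda>n. sqrt ((nsq haar (smooth u s) + 1) * inverse (real (Suc n)))) \<longlonglongrightarrow> sqrt ((nsq haar (smooth u s) + 1) * 0)"
        by (intro tendsto_intros LIMSEQ_inverse_real_of_nat)
      then show "(\<lambda>n. sqrt ((nsq haar (smooth u s) + 1) * inverse (real (Suc n)))) \<longlonglongrightarrow> 0" by simp
    qed
    moreover have "(\<lambda>n. ip haar (q n) s) \<longlonglongrightarrow> ip haar G s"
    proof (rule tendstoI)
      fix \<eta> :: real assume eta: "\<eta> > 0"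
      define M where "M = sqrt (nsq haar s) + 1"
      have M: "M > 0" "sqrt (nsq haar s) \<le> M" unfolding M_def using nsq_nonneg[of haar s] real_sqrt_ge_zero[of "nsq haar s"] by linarith+
      have "\<eta> / (2 * M) > 0" using eta M by simp
      from uniform_limitD[OF G this] show "\<forall>\<^sub>F n in sequentially. dist (ip haar (q n) s) (ip haar G s) < \<eta>"
      proof eventually_elim
        case (elim n)
        have c: "cts (\<lambda>x. q n x - G x)" using qc Gc by (intro continuous_intros)
        have "nsq haar (\<lambda>x. q n x - G x) \<le> (\<eta> / (2 * M))\<^sup>2"
        proof (rule nsq_sup[OF c])
          fix x show "cmod (q n x - G x) \<le> \<eta> / (2 * M)" using elim[rule_format, of x] by (simp add: dist_norm)
        qed
        then have "sqrt (nsq haar (\<lambda>x. q n x - G x)) \<le> \<eta> / (2 * M)" using eta M by (simp add: real_le_lsqrt)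
        then have b: "sqrt (nsq haar (\<lambda>x. q n x - G x)) * sqrt (nsq haar s) \<le> \<eta> / (2 * M) * M"
          using M eta by (intro mult_mono) auto
        have "dist (ip haar (q n) s) (ip haar G s) = cmod (ip haar (\<lambda>x. q n x - G x) s)"
          unfolding ip_diff_left[OF cts_sq[OF qc] cts_sq[OF Gc] cts_sq[OF sc]] dist_norm ..
        also have "\<dots> \<le> \<eta> / (2 * M) * M" by (rule order_trans[OF ip_integrable(2)[OF cts_sq[OF c] cts_sq[OF sc]] b])
        also have "\<dots> < \<eta>" using M eta by simp
        finally show ?case .
      qed
    qed
    ultimately show ?thesis using LIMSEQ_unique by blast
  qed
  then have G0: "G x = 0" for x using trig_orthogonal_zero[OF Gc] by blast
  have "\<epsilon> / 2 > 0" using eps by simp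
  from uniform_limitD[OF G this] obtain n where n: "\<And>x. dist (q n x) (G x) < \<epsilon> / 2"
    unfolding eventually_sequentially by blast
  have "cmod (F x - smooth u (t n) x) \<le> \<epsilon>" for x
  proof -
    have "q n x = smooth u F x - smooth u (t n) x" unfolding q_def by (rule smooth_diff[OF uc F tc])
    then have "cmod (smooth u F x - smooth u (t n) x) < \<epsilon> / 2" using n[of x] G0 by simp
    moreover have "cmod (F x - smooth u (t n) x) \<le> cmod (smooth u F x - F x) + cmod (smooth u F x - smooth u (t n) x)"
      using norm_triangle_ineq4[of "smooth u F x - smooth u (t n) x" "smooth u F x - F x"] by simp
    ultimately show ?thesis using uF[of x] by linarith
  qed
  moreover have "smooth u (t n) \<in> trig" by (rule trig_smooth[OF t(1) uc])
  ultimately show ?thesis by blast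
qed

end

section \<open>Paley's inequality\<close>

text \<open>Counted downwards from the largest index the terms are dominated by a geometric series,
  so only the largest term matters; \<open>X\<close> bounds that term.\<close>

lemma sum_geometric_le:
  fixes J :: "int set" and b X :: real
  assumes J: "finite J" and b: "b > 1" and X: "0 \<le> X" "\<And>j. j \<in> J \<Longrightarrow> b powr (real_of_int j) \<le> X"
  shows "(\<Sum>j\<in>J. b powr (real_of_int j)) \<le> X * (b / (b - 1))"
proof (cases "J = {}")
  case True
  then show ?thesis using b X by simp
next
  case False
  define m where "m = Max J"
  have m: "m \<in> J" "\<And>j. j \<in> J \<Longrightarrow> j \<le> m" unfolding m_def using J False by auto
  have b1: "norm (1 / b) < 1" using b by simp
  have sm: "summable (\<lambda>n. (1 / b) ^ n)" by (rule summable_geometric[OF b1])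
  have "(\<Sum>j\<in>J. b powr (real_of_int j)) = (\<Sum>j\<in>J. b powr (real_of_int m) * (1 / b) ^ nat (m - j))"
  proof (rule sum.cong[OF refl])
    fix j assume j: "j \<in> J"
    have "(1 / b) ^ nat (m - j) = b powr (- real_of_int (m - j))"
      using m(2)[OF j] b powr_minus_divide[of b "real_of_int m - real_of_int j"]
      by (simp add: powr_realpow[symmetric] power_one_over)
    then show "b powr (real_of_int j) = b powr (real_of_int m) * (1 / b) ^ nat (m - j)"
      by (simp add: powr_add[symmetric])
  qed
  also have "\<dots> = b powr (real_of_int m) * (\<Sum>n\<in>(\<lambda>j. nat (m - j)) ` J. (1 / b) ^ n)"
  proof -
    have "inj_on (\<lambda>j. nat (m - j)) J"
    proof (rule inj_onI)
      fix x y assume "x \<in> J" "y \<in> J" "nat (m - x) = nat (m - y)"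
      then show "x = y" using m(2)[of x] m(2)[of y] by simp
    qed
    then show ?thesis by (subst sum.reindex) (auto simp: sum_distrib_left)
  qed
  also have "\<dots> \<le> X * (b / (b - 1))"
  proof (rule mult_mono)
    have "(\<Sum>n\<in>(\<lambda>j. nat (m - j)) ` J. (1 / b) ^ n) \<le> (\<Sum>n. (1 / b) ^ n)"
      using J b by (intro sum_le_suminf sm) auto
    also have "\<dots> = b / (b - 1)" unfolding suminf_geometric[OF b1] using b by (simp add: field_simps)
    finally show "(\<Sum>n\<in>(\<lambda>j. nat (m - j)) ` J. (1 / b) ^ n) \<le> b / (b - 1)" .
    show "0 \<le> (\<Sum>n\<in>(\<lambda>j. nat (m - j)) ` J. (1 / b) ^ n)" using b by (intro sum_nonneg) auto
  qed (use X m in auto)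
  finally show ?thesis .
qed

text \<open>Bounded measurable functions. Unlike continuous functions they are closed under the cut
  at a given height on which the Paley argument rests.\<close>

definition bmeas :: "'a measure \<Rightarrow> ('a \<Rightarrow> complex) \<Rightarrow> bool" where
  "bmeas M f \<longleftrightarrow> f \<in> borel_measurable M \<and> (\<exists>B. \<forall>x. cmod (f x) \<le> B)"

lemma bmeas_powr_integrable:
  assumes M: "finite_measure M" and f: "bmeas M f" and r: "r > 0"
  shows "integrable M (\<lambda>x. cmod (f x) powr r)"
proof -
  obtain B where B: "\<And>x. cmod (f x) \<le> B" using f unfolding bmeas_def by blast
  have m: "(\<lambda>x. cmod (f x) powr r) \<in> borel_measurable M" using f unfolding bmeas_def by (intro powr_real_measurable borel_measurable_const) auto
  show ?thesis
    by (rule finite_measure.integrable_const_bound[OF M, of _ "B powr r"])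
       (use B r m in \<open>auto intro!: AE_I2 powr_mono2\<close>)
qed

lemma bmeas_sq: "finite_measure M \<Longrightarrow> bmeas M f \<Longrightarrow> sq_integrable M f"
  using bmeas_powr_integrable[of M f 2] unfolding sq_integrable_def bmeas_def by auto

lemma bmeas_integrable: "finite_measure M \<Longrightarrow> bmeas M f \<Longrightarrow> integrable M f"
  unfolding bmeas_def using finite_measure.integrable_const_bound[of M f] by auto

lemma bmeas_scale: "bmeas M f \<Longrightarrow> bmeas M (\<lambda>x. c * f x)"
  unfolding bmeas_def by (auto simp: norm_mult intro!: mult_left_mono exI[of _ "cmod c * _"])

lemma bmeas_restrict:
  assumes f: "bmeas M f" and P: "{x \<in> space M. P x} \<in> sets M"
  shows "bmeas M (\<lambda>x. if P x then f x else 0)"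
proof -
  obtain B where B: "\<And>x. cmod (f x) \<le> B" and m: "f \<in> borel_measurable M" using f unfolding bmeas_def by blast
  have "(\<lambda>x. if P x then f x else 0) \<in> borel_measurable M" using m P by (intro measurable_If) auto
  moreover have "cmod (if P x then f x else 0) \<le> max B 0" for x using B[of x] by auto
  ultimately show ?thesis unfolding bmeas_def by blast
qed

text \<open>Below 2 the constant collects 4 from the width of a dyadic block, 2 from the almost
  additivity of \<open>hs\<close>, and the two geometric series with ratios 4 and 2^(r - 2), where r
  = 2p / (2 - p). At p = 2 Bessel's inequality gives 1.\<close>

definition paley_const :: "real \<Rightarrow> real" where
  "paley_const p = (if p < 2 then 8 * (4 / 3 + 2 powr (2 * p / (2 - p) - 2) / (2 powr (2 * p / (2 - p) - 2) - 1)) else 1)"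

lemma paley_const_pos: "1 < p \<Longrightarrow> p \<le> 2 \<Longrightarrow> 0 < paley_const p"
proof (cases "p < 2")
  assume p: "1 < p" "p \<le> 2"
  case True
  define X where "X = 2 powr (2 * p / (2 - p) - 2)"
  have "2 * p / (2 - p) - 2 > 0" using p True by (simp add: field_simps)
  then have "X > 1" unfolding X_def by (intro gr_one_powr) auto
  then have "0 \<le> X / (X - 1)" by simp
  then show ?thesis unfolding paley_const_def X_def[symmetric] by simp
qed (simp add: paley_const_def)

text \<open>The Hardy--Littlewood--Paley inequality in an abstract form: \<open>hs i f\<close> plays the role of the
  squared Hilbert--Schmidt norm of the \<open>i\<close>-th Fourier coefficient. For \<open>v i\<close> of size \<open>2\<^sup>j\<close> the function is
  cut at height \<open>2\<^sup>-\<^sup>j\<^sup>a\<close>; the small part is controlled by Bessel's inequality, the large part by the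
  trivial \<open>L\<^sup>1\<close> bound.\<close>

locale paley_system =
  fixes M :: "'a measure" and F :: "'i set" and k :: "'i \<Rightarrow> real" and hs :: "'i \<Rightarrow> ('a \<Rightarrow> complex) \<Rightarrow> real"
  assumes M: "finite_measure M" and F: "finite F" and kpos: "\<And>i. i \<in> F \<Longrightarrow> 0 < k i"
    and hs_nonneg: "\<And>i f. i \<in> F \<Longrightarrow> 0 \<le> hs i f"
    and bessel: "\<And>G f. G \<subseteq> F \<Longrightarrow> bmeas M f \<Longrightarrow> (\<Sum>i\<in>G. k i * hs i f) \<le> (LINT x|M. (cmod (f x))\<^sup>2)"
    and L1: "\<And>i f. i \<in> F \<Longrightarrow> bmeas M f \<Longrightarrow> hs i f \<le> k i * (LINT x|M. cmod (f x))\<^sup>2"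
    and add: "\<And>i f g. i \<in> F \<Longrightarrow> bmeas M f \<Longrightarrow> bmeas M g \<Longrightarrow> hs i (\<lambda>x. f x + g x) \<le> 2 * hs i f + 2 * hs i g"
    and scale: "\<And>i f c. i \<in> F \<Longrightarrow> bmeas M f \<Longrightarrow> hs i (\<lambda>x. c * f x) = (cmod c)\<^sup>2 * hs i f"
begin

text \<open>The level sets of \<open>v\<close> are assumed to have weak-type growth with exponent r
  = 1 / (1/p - 1/2). All estimates are made homogeneous enough that the sum over the dyadic blocks
  can be carried out pointwise under the integral, where it reproduces |f|^p.\<close>

lemma paley_normalized:
  assumes p: "1 < p" "p < 2" and f: "bmeas M f" and fp: "(LINT x|M. cmod (f x) powr p) \<le> 1"
    and v: "\<And>i. i \<in> F \<Longrightarrow> 0 < v i"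
    and weak: "\<And>y. 0 < y \<Longrightarrow> (\<Sum>i\<in>{i\<in>F. y \<le> v i}. (k i)\<^sup>2) \<le> y powr (- (2 * p / (2 - p)))"
  shows "(\<Sum>i\<in>F. k i * (v i)\<^sup>2 * hs i f) \<le>
    8 * (4 / 3 + 2 powr (2 * p / (2 - p) - 2) / (2 powr (2 * p / (2 - p) - 2) - 1))"
proof -
  interpret finite_measure M by (rule M)
  define r where "r = 2 * p / (2 - p)"
  \<comment> \<open>With this cutting exponent both dyadic sums have the same size. At a point where
    |f| = t the small part gives t^(p - 2) t^2 and the large part t^(2p - 2) t^(2 - p), and both are
    t^p.\<close>
  define a where "a = 2 / (2 - p)"
  have a: "a > 0" unfolding a_def using p by simp
  have r2: "r - 2 > 0" unfolding r_def using p by (simp add: field_simps)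
  have ra: "(r - 2) / a = 2 * p - 2" unfolding r_def a_def using p by (simp add: field_simps)
  have a2: "2 / a = 2 - p" unfolding a_def using p by simp
  define D where "D = 2 powr (r - 2) / (2 powr (r - 2) - 1)"
  have fm: "f \<in> borel_measurable M" using f unfolding bmeas_def by blast
  define J where "J i = \<lfloor>log 2 (v i)\<rfloor>" for i
  define s where "s j = 2 powr (- (real_of_int j * a))" for j :: int
  define lo where "lo j x = (if cmod (f x) \<le> s j then f x else 0)" for j x
  define hi where "hi j x = (if s j < cmod (f x) then f x else 0)" for j x
  have lob: "bmeas M (lo j)" and hib: "bmeas M (hi j)" for j
    unfolding lo_def[abs_def] hi_def[abs_def] using fm by (auto intro!: bmeas_restrict[OF f])
  have lohi: "f = (\<lambda>x. lo j x + hi j x)" for j unfolding lo_def hi_def by auto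
  have vJ: "2 powr (real_of_int (J i)) \<le> v i" "v i \<le> 2 * 2 powr (real_of_int (J i))" if i: "i \<in> F" for i
  proof -
    have "real_of_int (J i) \<le> log 2 (v i)" "log 2 (v i) \<le> real_of_int (J i) + 1" unfolding J_def by linarith+
    then show "2 powr (real_of_int (J i)) \<le> v i" "v i \<le> 2 * 2 powr (real_of_int (J i))"
      using v[OF i] by (simp_all add: le_log_iff log_le_iff powr_add)
  qed
  define Fj where "Fj j = {i \<in> F. J i = j}" for j
  have i_hi: "integrable M (\<lambda>x. cmod (hi j x) powr (2 - p))" "integrable M (\<lambda>x. (cmod (lo j x))\<^sup>2)" for j
    using bmeas_powr_integrable[OF M hib, of "2 - p" j] bmeas_sq[OF M lob, of j] p unfolding sq_integrable_def by auto
  \<comment> \<open>Splitting |f| as |f|^(p/2) |f|^(1 - p/2) on the large part replaces the square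
    of an integral by a single integral, which can be summed over \<open>j\<close> under the
    integral sign; the first factor is absorbed by the normalization.\<close>
  have hi1: "(LINT x|M. cmod (hi j x))\<^sup>2 \<le> (LINT x|M. cmod (hi j x) powr (2 - p))" for j
  proof -
    have e1: "(cmod (f x) powr (p/2))\<^sup>2 = cmod (f x) powr p" "(cmod (hi j x) powr (1 - p/2))\<^sup>2 = cmod (hi j x) powr (2 - p)" for x
      by (simp_all add: powr_powr flip: powr_numeral[of "_ powr _" "num.Bit0 num.One"])
    have e2: "cmod (f x) powr (p/2) * cmod (hi j x) powr (1 - p/2) = cmod (hi j x)" for x
      unfolding hi_def by (simp add: powr_add[symmetric])
    have "(LINT x|M. cmod (f x) powr (p/2) * cmod (hi j x) powr (1 - p/2))\<^sup>2
      \<le> (LINT x|M. (cmod (f x) powr (p/2))\<^sup>2) * (LINT x|M. (cmod (hi j x) powr (1 - p/2))\<^sup>2)"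
    proof (rule Cauchy_Schwarz_integral(2))
      show "(\<lambda>x. cmod (f x) powr (p/2)) \<in> borel_measurable M" "(\<lambda>x. cmod (hi j x) powr (1 - p/2)) \<in> borel_measurable M"
        using fm hib[of j] unfolding bmeas_def by (auto intro!: powr_real_measurable)
    qed (use bmeas_powr_integrable[OF M f, of p] i_hi p in \<open>auto simp: e1\<close>)
    then have "(LINT x|M. cmod (hi j x))\<^sup>2 \<le> (LINT x|M. cmod (f x) powr p) * (LINT x|M. cmod (hi j x) powr (2 - p))"
      unfolding e1 e2 .
    also have "\<dots> \<le> 1 * (LINT x|M. cmod (hi j x) powr (2 - p))"
      using fp by (intro mult_right_mono) auto
    finally show ?thesis by simp
  qed
  \<comment> \<open>Within one block the small part is bounded by Bessel's inequality. The large
    part is bounded termwise, and the sum of the k^2 that arises is the weak-type quantity at level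
    2^j.\<close>
  have block: "(\<Sum>i\<in>Fj j. k i * (v i)\<^sup>2 * hs i f) \<le>
     8 * (4 powr (real_of_int j) * (LINT x|M. (cmod (lo j x))\<^sup>2) + 2 powr (- (real_of_int j * (r - 2))) * (LINT x|M. cmod (hi j x) powr (2 - p)))" for j
  proof -
    let ?c = "4 powr (real_of_int j)"
    have c2: "(2 powr (real_of_int j))\<^sup>2 = ?c" by (simp add: powr_powr powr_mult[symmetric] power2_eq_square)
    have "(\<Sum>i\<in>Fj j. k i * (v i)\<^sup>2 * hs i f) \<le> (\<Sum>i\<in>Fj j. 4 * ?c * (2 * (k i * hs i (lo j)) + 2 * ((k i)\<^sup>2 * (LINT x|M. cmod (hi j x))\<^sup>2)))"
    proof (rule sum_mono)
      fix i assume "i \<in> Fj j"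
      then have i: "i \<in> F" "J i = j" unfolding Fj_def by auto
      have "(v i)\<^sup>2 \<le> (2 * 2 powr (real_of_int j))\<^sup>2" using vJ[OF i(1)] v[OF i(1)] i(2) by (intro power_mono) auto
      also have "\<dots> = 4 * ?c" unfolding power_mult_distrib c2 by simp
      finally have v2: "(v i)\<^sup>2 \<le> 4 * ?c" .
      have "hs i f \<le> 2 * hs i (lo j) + 2 * hs i (hi j)"
        using add[OF i(1) lob[of j] hib[of j]] lohi[of j] by simp
      also have "\<dots> \<le> 2 * hs i (lo j) + 2 * (k i * (LINT x|M. cmod (hi j x))\<^sup>2)"
        using L1[OF i(1) hib[of j]] by simp
      finally have h: "hs i f \<le> 2 * hs i (lo j) + 2 * (k i * (LINT x|M. cmod (hi j x))\<^sup>2)" .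
      have "(v i)\<^sup>2 * (k i * hs i f) \<le> (4 * ?c) * (k i * (2 * hs i (lo j) + 2 * (k i * (LINT x|M. cmod (hi j x))\<^sup>2)))"
        using v2 h kpos[OF i(1)] hs_nonneg[OF i(1), of f] by (intro mult_mono mult_left_mono mult_nonneg_nonneg) auto
      then show "k i * (v i)\<^sup>2 * hs i f \<le> 4 * ?c * (2 * (k i * hs i (lo j)) + 2 * ((k i)\<^sup>2 * (LINT x|M. cmod (hi j x))\<^sup>2))"
        by (simp add: power2_eq_square algebra_simps)
    qed
    also have "\<dots> = 8 * ?c * ((\<Sum>i\<in>Fj j. k i * hs i (lo j)) + (\<Sum>i\<in>Fj j. (k i)\<^sup>2) * (LINT x|M. cmod (hi j x))\<^sup>2)"
      by (simp add: sum_distrib_left sum_distrib_right sum.distrib algebra_simps)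
    also have "\<dots> \<le> 8 * ?c * ((LINT x|M. (cmod (lo j x))\<^sup>2) + 2 powr (- (real_of_int j * r)) * (LINT x|M. cmod (hi j x) powr (2 - p)))"
    proof (intro mult_left_mono add_mono mult_mono hi1)
      show "(\<Sum>i\<in>Fj j. k i * hs i (lo j)) \<le> (LINT x|M. (cmod (lo j x))\<^sup>2)"
        by (rule bessel[OF _ lob]) (auto simp: Fj_def)
      have "(\<Sum>i\<in>Fj j. (k i)\<^sup>2) \<le> (\<Sum>i\<in>{i\<in>F. 2 powr (real_of_int j) \<le> v i}. (k i)\<^sup>2)"
        using F vJ(1) by (intro sum_mono2) (auto simp: Fj_def)
      also have "\<dots> \<le> (2 powr (real_of_int j)) powr (- r)" unfolding r_def by (rule weak) simp
      finally show "(\<Sum>i\<in>Fj j. (k i)\<^sup>2) \<le> 2 powr (- (real_of_int j * r))" by (simp add: powr_powr)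
    qed auto
    also have "\<dots> = 8 * (?c * (LINT x|M. (cmod (lo j x))\<^sup>2) + (?c * 2 powr (- (real_of_int j * r))) * (LINT x|M. cmod (hi j x) powr (2 - p)))"
      by (simp add: algebra_simps)
    also have "?c * 2 powr (- (real_of_int j * r)) = 2 powr (- (real_of_int j * (r - 2)))"
    proof -
      have "?c = 2 powr (2 * real_of_int j)" unfolding c2[symmetric] by (simp add: power2_eq_square powr_add[symmetric])
      then show ?thesis by (simp add: powr_add[symmetric] algebra_simps)
    qed
    finally show ?thesis .
  qed
  have geo1: "(\<Sum>j\<in>J ` F. 4 powr (real_of_int j) * (cmod (lo j x))\<^sup>2) \<le> 4 / 3 * cmod (f x) powr p" for x
  proof (cases "f x = 0")
    case True then show ?thesis by (simp add: lo_def)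
  next
    case False
    define t where "t = cmod (f x)"
    have t: "t > 0" unfolding t_def using False by simp
    define J' where "J' = {j \<in> J ` F. t \<le> s j}"
    have "(\<Sum>j\<in>J ` F. 4 powr (real_of_int j) * (cmod (lo j x))\<^sup>2) = (\<Sum>j\<in>J ` F. if t \<le> s j then 4 powr (real_of_int j) * t\<^sup>2 else 0)"
      by (intro sum.cong) (auto simp: lo_def t_def)
    also have "\<dots> = (\<Sum>j\<in>J'. 4 powr (real_of_int j)) * t\<^sup>2"
      unfolding J'_def sum_distrib_right by (rule sum.inter_filter[symmetric]) (use F in simp)
    also have "\<dots> \<le> (t powr (p - 2) * (4 / (4 - 1))) * t\<^sup>2"
    proof (intro mult_right_mono sum_geometric_le)
      fix j assume "j \<in> J'"
      then have "t \<le> 2 powr (- (real_of_int j * a))" unfolding J'_def s_def by simp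
      then have "(2 powr (- (real_of_int j * a))) powr (- (2 / a)) \<le> t powr (- (2 / a))"
        using t a by (intro powr_mono2') auto
      moreover have "(2 powr (- (real_of_int j * a))) powr (- (2 / a)) = 2 powr (2 * real_of_int j)"
        using a by (simp add: powr_powr field_simps)
      moreover have "2 powr (2 * real_of_int j) = 4 powr (real_of_int j)"
        by (simp add: powr_powr[symmetric])
      ultimately show "4 powr (real_of_int j) \<le> t powr (p - 2)" unfolding a2 by simp
    qed (use F J'_def in auto)
    also have "\<dots> = 4 / 3 * t powr p"
    proof -
      have "t\<^sup>2 = t powr 2" using t by (simp add: powr_numeral)
      then have "t powr (p - 2) * t\<^sup>2 = t powr p" by (simp add: powr_add[symmetric])
      then show ?thesis by simp
    qed
    finally show ?thesis unfolding t_def .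
  qed
  \<comment> \<open>The indices are negated because these terms grow as \<open>j\<close> decreases;
    the condition s j < |f x| bounds \<open>j\<close> from below.\<close>
  have geo2: "(\<Sum>j\<in>J ` F. 2 powr (- (real_of_int j * (r - 2))) * cmod (hi j x) powr (2 - p)) \<le> D * cmod (f x) powr p" for x
  proof (cases "f x = 0")
    case True then show ?thesis by (simp add: hi_def)
  next
    case False
    define t where "t = cmod (f x)"
    have t: "t > 0" unfolding t_def using False by simp
    define b where "b = 2 powr (r - 2)"
    have b: "b > 1" unfolding b_def using r2 by (simp add: gr_one_powr)
    define J' where "J' = {j \<in> J ` F. s j < t}"
    have "(\<Sum>j\<in>J ` F. 2 powr (- (real_of_int j * (r - 2))) * cmod (hi j x) powr (2 - p))
        = (\<Sum>j\<in>J ` F. if s j < t then 2 powr (- (real_of_int j * (r - 2))) * t powr (2 - p) else 0)"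
      using p by (intro sum.cong) (auto simp: hi_def t_def)
    also have "\<dots> = (\<Sum>j\<in>J'. 2 powr (- (real_of_int j * (r - 2)))) * t powr (2 - p)"
      unfolding J'_def sum_distrib_right by (rule sum.inter_filter[symmetric]) (use F in simp)
    also have "(\<Sum>j\<in>J'. 2 powr (- (real_of_int j * (r - 2)))) = (\<Sum>j\<in>uminus ` J'. b powr (real_of_int j))"
      unfolding b_def by (subst sum.reindex) (auto simp: powr_powr algebra_simps)
    also have "\<dots> * t powr (2 - p) \<le> (t powr (2 * p - 2) * (b / (b - 1))) * t powr (2 - p)"
    proof (intro mult_right_mono sum_geometric_le b)
      fix j assume "j \<in> uminus ` J'"
      then obtain i where i: "j = - i" "i \<in> J'" by blast
      then have "2 powr (- (real_of_int i * a)) < t" unfolding J'_def s_def by simp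
      then have "(2 powr (- (real_of_int i * a))) powr ((r - 2) / a) \<le> t powr ((r - 2) / a)"
        using r2 a by (intro powr_mono2) auto
      moreover have "(2 powr (- (real_of_int i * a))) powr ((r - 2) / a) = b powr (real_of_int j)"
      proof -
        have "- (real_of_int i * a) * ((r - 2) / a) = (r - 2) * real_of_int (- i)" using a by simp
        then show ?thesis unfolding b_def i(1) powr_powr by simp
      qed
      ultimately show "b powr (real_of_int j) \<le> t powr (2 * p - 2)" unfolding ra by simp
    qed (use F J'_def in auto)
    also have "\<dots> = D * t powr p"
    proof -
      have "t powr (2 * p - 2) * t powr (2 - p) = t powr p" by (simp add: powr_add[symmetric])
      then show ?thesis unfolding D_def b_def by (simp add: mult.assoc mult.commute)
    qed
    finally show ?thesis unfolding t_def .
  qed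
  have "(\<Sum>i\<in>F. k i * (v i)\<^sup>2 * hs i f) = (\<Sum>j\<in>J ` F. \<Sum>i\<in>Fj j. k i * (v i)\<^sup>2 * hs i f)"
    unfolding Fj_def by (rule sum.image_gen[OF F])
  also have "\<dots> \<le> (\<Sum>j\<in>J ` F. 8 * (4 powr (real_of_int j) * (LINT x|M. (cmod (lo j x))\<^sup>2) + 2 powr (- (real_of_int j * (r - 2))) * (LINT x|M. cmod (hi j x) powr (2 - p))))"
    by (rule sum_mono[OF block])
  also have "\<dots> = 8 * ((LINT x|M. (\<Sum>j\<in>J ` F. 4 powr (real_of_int j) * (cmod (lo j x))\<^sup>2)) +
      (LINT x|M. (\<Sum>j\<in>J ` F. 2 powr (- (real_of_int j * (r - 2))) * cmod (hi j x) powr (2 - p))))"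
    using i_hi by (simp add: sum.distrib sum_distrib_left[symmetric] Bochner_Integration.integral_sum)
  also have "\<dots> \<le> 8 * ((LINT x|M. 4 / 3 * cmod (f x) powr p) + (LINT x|M. D * cmod (f x) powr p))"
    using i_hi bmeas_powr_integrable[OF M f, of p] p geo1 geo2
    by (intro mult_left_mono add_mono integral_mono Bochner_Integration.integrable_sum) auto
  also have "\<dots> = 8 * (4 / 3 + D) * (LINT x|M. cmod (f x) powr p)" by (simp add: algebra_simps)
  also have "\<dots> \<le> 8 * (4 / 3 + D) * 1"
  proof (rule mult_left_mono[OF fp])
    have "2 powr (r - 2) > 1" using r2 by (simp add: gr_one_powr)
    then show "0 \<le> 8 * (4 / 3 + D)" unfolding D_def by (simp add: field_simps)
  qed
  finally show ?thesis unfolding D_def r_def by simp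
qed

text \<open>Dividing \<open>v\<close> by \<open>H\<close> and \<open>f\<close> by its norm reduces
  to the normalized case. A function of norm zero cannot be normalized, but then the termwise bound
  makes every \<open>hs i f\<close> vanish. At p = 2 the weak condition degenerates into a bound on
  the supremum.\<close>

lemma paley:
  assumes p: "1 < p" "p \<le> 2" and f: "bmeas M f" and v: "\<And>i. i \<in> F \<Longrightarrow> 0 < v i" and H: "0 < H"
    and weak: "\<And>y. p < 2 \<Longrightarrow> 0 < y \<Longrightarrow> (\<Sum>i\<in>{i\<in>F. y \<le> v i}. (k i)\<^sup>2) \<le> (H / y) powr (1 / (1 / p - 1 / 2))"
    and sup: "\<And>i. p = 2 \<Longrightarrow> i \<in> F \<Longrightarrow> v i \<le> H"
  shows "(\<Sum>i\<in>F. k i * (v i)\<^sup>2 * hs i f) \<le> paley_const p * (H * Lp_norm M p f)\<^sup>2"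
proof (cases "p = 2")
  case True
  have sq: "(Lp_norm M p f)\<^sup>2 = (LINT x|M. (cmod (f x))\<^sup>2)"
    unfolding Lp_norm_def True by (simp add: powr_half_sqrt)
  have "(\<Sum>i\<in>F. k i * (v i)\<^sup>2 * hs i f) \<le> (\<Sum>i\<in>F. H\<^sup>2 * (k i * hs i f))"
  proof (rule sum_mono)
    fix i assume i: "i \<in> F"
    have "(v i)\<^sup>2 * (k i * hs i f) \<le> H\<^sup>2 * (k i * hs i f)"
      using sup[OF True i] v[OF i] kpos[OF i] hs_nonneg[OF i, of f] by (intro mult_right_mono power_mono) auto
    then show "k i * (v i)\<^sup>2 * hs i f \<le> H\<^sup>2 * (k i * hs i f)" by (simp add: mult_ac)
  qed
  also have "\<dots> \<le> H\<^sup>2 * (LINT x|M. (cmod (f x))\<^sup>2)"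
    unfolding sum_distrib_left[symmetric] using bessel[OF order_refl f] by (intro mult_left_mono) auto
  finally show ?thesis unfolding power_mult_distrib sq paley_const_def using True by simp
next
  case False
  then have p2: "p < 2" using p by simp
  define N where "N = Lp_norm M p f"
  have N0: "0 \<le> N" unfolding N_def Lp_norm_def by simp
  have pc: "0 \<le> paley_const p" using paley_const_pos[OF p] by simp
  show ?thesis
  proof (cases "N = 0")
    case True
    have "(LINT x|M. cmod (f x) powr p) = 0"
      using True unfolding N_def Lp_norm_def by simp
    then have "AE x in M. cmod (f x) powr p = 0"
      using integral_nonneg_eq_0_iff_AE[OF bmeas_powr_integrable[OF M f, of p]] p by simp
    then have "AE x in M. cmod (f x) = 0" by eventually_elim simp
    then have z: "(LINT x|M. cmod (f x)) = 0" by (rule integral_eq_zero_AE)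
    have "hs i f = 0" if "i \<in> F" for i using L1[OF that f] hs_nonneg[OF that, of f] unfolding z by simp
    then show ?thesis using pc by simp
  next
    case False
    then have N: "N > 0" using N0 by simp
    define f' where "f' x = complex_of_real (1 / N) * f x" for x
    have f': "bmeas M f'" unfolding f'_def[abs_def] by (rule bmeas_scale[OF f])
    have Np: "N powr p = (LINT x|M. cmod (f x) powr p)"
      unfolding N_def Lp_norm_def using p by (simp add: powr_powr)
    have nrm: "(LINT x|M. cmod (f' x) powr p) \<le> 1"
    proof -
      have "cmod (f' x) powr p = (1 / N) powr p * cmod (f x) powr p" for x
        unfolding f'_def using N by (simp add: norm_mult powr_mult norm_divide powr_divide)
      then have "(LINT x|M. cmod (f' x) powr p) = (1 / N) powr p * N powr p" unfolding Np by simp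
      also have "\<dots> = 1" using N by (simp add: powr_mult[symmetric])
      finally show ?thesis by simp
    qed
    have e: "1 / (1 / p - 1 / 2) = 2 * p / (2 - p)" using p p2 by (simp add: field_simps)
    have "(\<Sum>i\<in>F. k i * (v i / H)\<^sup>2 * hs i f') \<le>
      8 * (4 / 3 + 2 powr (2 * p / (2 - p) - 2) / (2 powr (2 * p / (2 - p) - 2) - 1))"
    proof (rule paley_normalized[OF p(1) p2 f' nrm])
      show "0 < v i / H" if "i \<in> F" for i using v[OF that] H by simp
      fix y :: real assume y: "0 < y"
      have "{i\<in>F. y \<le> v i / H} = {i\<in>F. y * H \<le> v i}" using H by (auto simp: field_simps)
      then have "(\<Sum>i\<in>{i\<in>F. y \<le> v i / H}. (k i)\<^sup>2) \<le> (H / (y * H)) powr (2 * p / (2 - p))"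
        using weak[OF p2, of "y * H"] y H unfolding e by simp
      also have "H / (y * H) = 1 / y" using H by simp
      also have "(1 / y) powr (2 * p / (2 - p)) = y powr (- (2 * p / (2 - p)))"
        using y by (simp add: powr_minus_divide powr_divide)
      finally show "(\<Sum>i\<in>{i\<in>F. y \<le> v i / H}. (k i)\<^sup>2) \<le> y powr (- (2 * p / (2 - p)))" .
    qed
    then have le: "(\<Sum>i\<in>F. k i * (v i / H)\<^sup>2 * hs i f') \<le> paley_const p" unfolding paley_const_def using p2 by simp
    have eq: "k i * (v i)\<^sup>2 * hs i f = (H * N)\<^sup>2 * (k i * (v i / H)\<^sup>2 * hs i f')" if i: "i \<in> F" for i
    proof -
      have "hs i f' = (1 / N)\<^sup>2 * hs i f" unfolding f'_def[abs_def] scale[OF i f] using N by (simp add: norm_divide)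
      then show ?thesis using N H by (simp add: power_mult_distrib power_divide)
    qed
    have "(\<Sum>i\<in>F. k i * (v i)\<^sup>2 * hs i f) = (H * N)\<^sup>2 * (\<Sum>i\<in>F. k i * (v i / H)\<^sup>2 * hs i f')"
      unfolding sum_distrib_left by (intro sum.cong refl eq)
    also have "\<dots> \<le> (H * N)\<^sup>2 * paley_const p" using le by (intro mult_left_mono) auto
    finally show ?thesis unfolding N_def by (simp add: mult.commute)
  qed
qed

text \<open>A power w^t of the weight has weak exponent 1 / (t \<kappa>), with \<kappa> = 1/p - 1/q.
  The split into w^\<theta> and w^(1 - \<theta>) is chosen so that the two factors meet Paley's
  condition exactly at p and at the conjugate exponent of q; Cauchy-Schwarz joins them.\<close>

lemma paley_bilinear:
  assumes p: "1 < p" "p \<le> 2" and q: "2 \<le> q" and f: "bmeas M f" and g: "bmeas M g"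
    and w: "\<And>i. i \<in> F \<Longrightarrow> 0 < w i" and H: "0 < H"
    and weak: "\<And>y. 1 / p - 1 / q > 0 \<Longrightarrow> 0 < y \<Longrightarrow> (\<Sum>i\<in>{i\<in>F. y \<le> w i}. (k i)\<^sup>2) \<le> (H / y) powr (1 / (1 / p - 1 / q))"
    and sup: "\<And>i. 1 / p - 1 / q = 0 \<Longrightarrow> i \<in> F \<Longrightarrow> w i \<le> H"
  shows "(\<Sum>i\<in>F. k i * w i * sqrt (hs i f) * sqrt (hs i g)) \<le>
    sqrt (paley_const p) * sqrt (paley_const (q / (q - 1))) * H * Lp_norm M p f * Lp_norm M (q / (q - 1)) g"
proof -
  define p' where "p' = q / (q - 1)"
  have p': "1 < p'" "p' \<le> 2" unfolding p'_def using q by (auto simp: field_simps)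
  have p'e: "1 / p' - 1 / 2 = 1 / 2 - 1 / q" unfolding p'_def using q by (simp add: field_simps)
  define \<kappa> where "\<kappa> = 1 / p - 1 / q"
  \<comment> \<open>For p = q = 2 the quotient is 0 / 0 and has the value 0. The whole weight then
    goes to the second factor, which is covered by the bound on the supremum.\<close>
  define \<theta> where "\<theta> = (1 / p - 1 / 2) / \<kappa>"
  have k1: "0 \<le> 1 / p - 1 / 2" "0 \<le> 1 / 2 - 1 / q" using p q by (auto simp: field_simps)
  have kk: "\<kappa> = (1 / p - 1 / 2) + (1 / 2 - 1 / q)" unfolding \<kappa>_def by simp
  have power_weak: "(\<Sum>i\<in>{i\<in>F. y \<le> w i powr t}. (k i)\<^sup>2) \<le> (H powr t / y) powr (1 / (t * \<kappa>))"
    if t: "t > 0" and y: "y > 0" and kp: "\<kappa> > 0" for t y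
  proof -
    have "{i\<in>F. y \<le> w i powr t} = {i\<in>F. y powr (1 / t) \<le> w i}"
    proof -
      have "y \<le> w i powr t \<longleftrightarrow> y powr (1 / t) \<le> w i" if i: "i \<in> F" for i
      proof
        assume "y \<le> w i powr t"
        then have "y powr (1 / t) \<le> (w i powr t) powr (1 / t)" using y t by (intro powr_mono2) auto
        then show "y powr (1 / t) \<le> w i" using t w[OF i] by (simp add: powr_powr)
      next
        assume "y powr (1 / t) \<le> w i"
        then have "(y powr (1 / t)) powr t \<le> w i powr t" using t by (intro powr_mono2) auto
        then show "y \<le> w i powr t" using t y by (simp add: powr_powr)
      qed
      then show ?thesis by auto
    qed
    then have "(\<Sum>i\<in>{i\<in>F. y \<le> w i powr t}. (k i)\<^sup>2) \<le> (H / y powr (1 / t)) powr (1 / \<kappa>)"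
      using weak[of "y powr (1 / t)"] y kp unfolding \<kappa>_def by simp
    also have "H / y powr (1 / t) = (H powr t / y) powr (1 / t)"
      using H y t by (simp add: powr_divide powr_powr)
    also have "\<dots> powr (1 / \<kappa>) = (H powr t / y) powr (1 / (t * \<kappa>))" by (simp add: powr_powr)
    finally show ?thesis .
  qed
  \<comment> \<open>A common form for both factors that includes the endpoints: when s = 2 but
    \<kappa> > 0, the relation for \<open>t\<close> forces t = 0 and the weight disappears.\<close>
  have pr: "(\<Sum>i\<in>F. k i * (w i powr t)\<^sup>2 * hs i h) \<le> paley_const s * (H powr t * Lp_norm M s h)\<^sup>2"
    if s: "1 < s" "s \<le> 2" and h: "bmeas M h" and ts: "\<kappa> > 0 \<Longrightarrow> t * \<kappa> = 1 / s - 1 / 2"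
      and t0: "\<kappa> = 0 \<Longrightarrow> t = 0 \<or> t = 1" and s2: "\<kappa> = 0 \<Longrightarrow> s = 2" for s t h
  proof (rule paley[OF s h])
    show "0 < w i powr t" if "i \<in> F" for i using w[OF that] by simp
    show "0 < H powr t" using H by simp
    show "(\<Sum>i\<in>{i\<in>F. y \<le> w i powr t}. (k i)\<^sup>2) \<le> (H powr t / y) powr (1 / (1 / s - 1 / 2))"
      if "s < 2" "0 < y" for y
    proof -
      have "\<kappa> \<noteq> 0" using s2 that by auto
      then have kp: "\<kappa> > 0" using k1 kk by linarith
      have "1 / s - 1 / 2 > 0" using s that by (simp add: field_simps)
      then have "t * \<kappa> > 0" using ts[OF kp] by simp
      then have "t > 0" using kp by (simp add: zero_less_mult_iff)
      from power_weak[OF this that(2) kp] show ?thesis unfolding ts[OF kp] .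
    qed
    show "w i powr t \<le> H powr t" if "s = 2" "i \<in> F" for i
    proof (cases "\<kappa> = 0")
      case True
      then have "w i \<le> H" using sup that unfolding \<kappa>_def by blast
      then show ?thesis using t0[OF True] w[OF that(2)] H by (auto intro: powr_mono2)
    next
      case False
      then have "\<kappa> > 0" using k1 kk by linarith
      then have "t = 0" using ts that by auto
      then show ?thesis using w[OF that(2)] H by simp
    qed
  qed
  have s2: "p = 2" "p' = 2" "\<theta> = 0" if "\<kappa> = 0"
  proof -
    have "1 / p - 1 / 2 = 0" "1 / p' - 1 / 2 = 0" using that k1 kk p'e by linarith+
    then show "p = 2" "p' = 2" using p p' by (auto simp: field_simps)
    show "\<theta> = 0" unfolding \<theta>_def using that by simp
  qed
  have 1: "(\<Sum>i\<in>F. k i * (w i powr \<theta>)\<^sup>2 * hs i f) \<le> paley_const p * (H powr \<theta> * Lp_norm M p f)\<^sup>2"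
    by (rule pr[OF p f]) (use s2 in \<open>auto simp: \<theta>_def\<close>)
  have 2: "(\<Sum>i\<in>F. k i * (w i powr (1 - \<theta>))\<^sup>2 * hs i g) \<le> paley_const p' * (H powr (1 - \<theta>) * Lp_norm M p' g)\<^sup>2"
  proof (rule pr[OF p' g])
    show "(1 - \<theta>) * \<kappa> = 1 / p' - 1 / 2" if "\<kappa> > 0"
    proof -
      have "\<theta> * \<kappa> = 1 / p - 1 / 2" unfolding \<theta>_def using that by simp
      then show ?thesis unfolding p'e using kk by (simp add: left_diff_distrib)
    qed
  qed (use s2 in auto)
  have "(\<Sum>i\<in>F. k i * w i * sqrt (hs i f) * sqrt (hs i g)) =
      (\<Sum>i\<in>F. (sqrt (k i) * w i powr \<theta> * sqrt (hs i f)) * (sqrt (k i) * w i powr (1 - \<theta>) * sqrt (hs i g)))"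
  proof (rule sum.cong[OF refl])
    fix i assume i: "i \<in> F"
    have "w i powr \<theta> * w i powr (1 - \<theta>) = w i" using w[OF i] by (simp add: powr_add[symmetric])
    moreover have "sqrt (k i) * sqrt (k i) = k i" using kpos[OF i] by simp
    ultimately show "k i * w i * sqrt (hs i f) * sqrt (hs i g) =
      (sqrt (k i) * w i powr \<theta> * sqrt (hs i f)) * (sqrt (k i) * w i powr (1 - \<theta>) * sqrt (hs i g))"
      by (metis (no_types, opaque_lifting) mult.assoc mult.left_commute)
  qed
  also have "\<dots> \<le> L2_set (\<lambda>i. sqrt (k i) * w i powr \<theta> * sqrt (hs i f)) F * L2_set (\<lambda>i. sqrt (k i) * w i powr (1 - \<theta>) * sqrt (hs i g)) F"
    by (rule order_trans[OF _ L2_set_mult_ineq], rule sum_mono) (simp only: abs_mult[symmetric] abs_ge_self)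
  also have "L2_set (\<lambda>i. sqrt (k i) * w i powr \<theta> * sqrt (hs i f)) F = sqrt (\<Sum>i\<in>F. k i * (w i powr \<theta>)\<^sup>2 * hs i f)"
    unfolding L2_set_def using kpos hs_nonneg by (intro arg_cong[of _ _ sqrt] sum.cong) (auto simp: power_mult_distrib less_imp_le)
  also have "L2_set (\<lambda>i. sqrt (k i) * w i powr (1 - \<theta>) * sqrt (hs i g)) F = sqrt (\<Sum>i\<in>F. k i * (w i powr (1 - \<theta>))\<^sup>2 * hs i g)"
    unfolding L2_set_def using kpos hs_nonneg by (intro arg_cong[of _ _ sqrt] sum.cong) (auto simp: power_mult_distrib less_imp_le)
  also have "sqrt (\<Sum>i\<in>F. k i * (w i powr \<theta>)\<^sup>2 * hs i f) * sqrt (\<Sum>i\<in>F. k i * (w i powr (1 - \<theta>))\<^sup>2 * hs i g)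
      \<le> sqrt (paley_const p * (H powr \<theta> * Lp_norm M p f)\<^sup>2) * sqrt (paley_const p' * (H powr (1 - \<theta>) * Lp_norm M p' g)\<^sup>2)"
  proof (intro mult_mono real_sqrt_le_mono 1 2)
    show "0 \<le> sqrt (paley_const p * (H powr \<theta> * Lp_norm M p f)\<^sup>2)" using paley_const_pos[OF p] by simp
    have "0 \<le> (\<Sum>i\<in>F. k i * (w i powr (1 - \<theta>))\<^sup>2 * hs i g)"
      using kpos hs_nonneg by (intro sum_nonneg mult_nonneg_nonneg) (auto intro: less_imp_le)
    then show "0 \<le> sqrt (\<Sum>i\<in>F. k i * (w i powr (1 - \<theta>))\<^sup>2 * hs i g)" by simp
  qed
  also have "\<dots> = sqrt (paley_const p) * sqrt (paley_const p') * (H powr \<theta> * H powr (1 - \<theta>)) * Lp_norm M p f * Lp_norm M p' g"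
    by (simp add: real_sqrt_mult Lp_norm_def)
  also have "H powr \<theta> * H powr (1 - \<theta>) = H" using H by (simp add: powr_add[symmetric])
  finally show ?thesis unfolding p'_def .
qed

end

section \<open>Fourier coefficients on the dual\<close>

lemma mat_adjoint_mult:
  fixes A B :: "complex mat"
  assumes A: "A \<in> carrier_mat n n" and B: "B \<in> carrier_mat n n"
  shows "mat_adjoint (A * B) = mat_adjoint B * mat_adjoint A"
proof -
  have a: "mat_adjoint A \<in> carrier_mat n n" "mat_adjoint B \<in> carrier_mat n n"
    using A B mat_adjoint_index(1,2)[of A] mat_adjoint_index(1,2)[of B] by auto
  show ?thesis
  proof (rule eq_matI)
    fix i j assume "i < dim_row (mat_adjoint B * mat_adjoint A)" "j < dim_col (mat_adjoint B * mat_adjoint A)"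
    then have ij: "i < n" "j < n" using a by auto
    have "mat_adjoint (A * B) $$ (i, j) = cnj ((A * B) $$ (j, i))"
      using A B ij by (intro mat_adjoint_index(3)) auto
    also have "\<dots> = (\<Sum>k<n. mat_adjoint B $$ (i, k) * mat_adjoint A $$ (k, j))"
      unfolding mult_mat_index_sum[OF A B ij(2,1)] using A B ij mat_adjoint_index(3)[of _ A] mat_adjoint_index(3)[of _ B]
      by (simp add: mult.commute)
    finally show "mat_adjoint (A * B) $$ (i, j) = (mat_adjoint B * mat_adjoint A) $$ (i, j)"
      unfolding mult_mat_index_sum[OF a(2,1) ij] .
  qed (use A B a in \<open>auto simp: mat_adjoint_index\<close>)
qed

lemma mat_adjoint_adjoint:
  fixes A :: "complex mat"
  shows "mat_adjoint (mat_adjoint A) = A"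
  by (rule eq_matI) (auto simp: mat_adjoint_index)

lemma mat_adjoint_carrier: "(A :: complex mat) \<in> carrier_mat n n \<Longrightarrow> mat_adjoint A \<in> carrier_mat n n"
  using mat_adjoint_index(1,2)[of A] by auto

lemma cvec_norm_mult_mat_le:
  assumes M: "M \<in> carrier_mat n n" and v: "v \<in> carrier_vec n"
  shows "cvec_norm (M *\<^sub>v v) \<le> mat_op_norm M * cvec_norm v"
proof -
  let ?U = "{v \<in> carrier_vec (dim_col M). cvec_norm v \<le> 1}"
  have cn: "cvec_norm u = L2_set (\<lambda>i. cmod (vec_index u i)) {..<n}" if "u \<in> carrier_vec n" for u
    using that unfolding cvec_norm_def by simp
  have Mc: "M *\<^sub>v u \<in> carrier_vec n" for u by (intro carrier_vecI) (use M in auto)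
  \<comment> \<open>\<open>mat_op_norm\<close> is a supremum of real numbers and means something
    only once it is bounded; the sum of the moduli of all entries serves as a bound.\<close>
  have bdd: "bdd_above ((\<lambda>u. cvec_norm (M *\<^sub>v u)) ` ?U)"
  proof (rule bdd_aboveI2)
    fix u assume "u \<in> ?U"
    then have u: "u \<in> carrier_vec n" "cvec_norm u \<le> 1" using M by auto
    have uj: "cmod (vec_index u j) \<le> 1" if "j < n" for j
      using member_le_L2_set[of "{..<n}" j "\<lambda>i. cmod (vec_index u i)"] that u cn[OF u(1)] by simp
    have "cvec_norm (M *\<^sub>v u) \<le> (\<Sum>i<n. cmod (vec_index (M *\<^sub>v u) i))"
      unfolding cn[OF Mc] by (rule L2_set_le_sum) simp
    also have "\<dots> \<le> (\<Sum>i<n. \<Sum>j<n. cmod (M $$ (i, j)))"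
    proof (rule sum_mono)
      fix i assume i: "i \<in> {..<n}"
      have "vec_index (M *\<^sub>v u) i = (\<Sum>j<n. M $$ (i, j) * vec_index u j)"
        using mult_mat_vec_index_sum[OF M u(1)] i by simp
      also have "cmod (\<Sum>j<n. M $$ (i, j) * vec_index u j) \<le> (\<Sum>j<n. cmod (M $$ (i, j)))"
        using uj by (intro sum_norm_le) (auto simp: norm_mult intro!: mult_left_le)
      finally show "cmod (vec_index (M *\<^sub>v u) i) \<le> (\<Sum>j<n. cmod (M $$ (i, j)))" .
    qed
    finally show "cvec_norm (M *\<^sub>v u) \<le> (\<Sum>i<n. \<Sum>j<n. cmod (M $$ (i, j)))" .
  qed
  have smult: "cvec_norm (complex_of_real c \<cdot>\<^sub>v u) = c * cvec_norm u" if u: "u \<in> carrier_vec n" and c: "c \<ge> 0" for c u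
  proof -
    have "complex_of_real c \<cdot>\<^sub>v u \<in> carrier_vec n" using u by simp
    then have "cvec_norm (complex_of_real c \<cdot>\<^sub>v u) = L2_set (\<lambda>i. c * cmod (vec_index u i)) {..<n}"
      unfolding cn[OF \<open>complex_of_real c \<cdot>\<^sub>v u \<in> carrier_vec n\<close>] using u c by (intro L2_set_cong) (auto simp: norm_mult)
    also have "\<dots> = c * cvec_norm u" unfolding cn[OF u] using c by (simp add: L2_set_right_distrib)
    finally show ?thesis .
  qed
  show ?thesis
  proof (cases "cvec_norm v = 0")
    case True
    then have "\<And>i. i < n \<Longrightarrow> vec_index v i = 0" unfolding cn[OF v] by (subst (asm) L2_set_eq_0_iff) auto
    then have "v = 0\<^sub>v n" using v by (intro eq_vecI) auto
    then have "M *\<^sub>v v = 0\<^sub>v n" using M by auto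
    then show ?thesis using True by (simp add: cvec_norm_def L2_set_def)
  next
    case False
    have "0 \<le> cvec_norm v" unfolding cvec_norm_def by (rule L2_set_nonneg)
    then have c: "cvec_norm v > 0" using False by simp
    define u where "u = complex_of_real (1 / cvec_norm v) \<cdot>\<^sub>v v"
    have u: "u \<in> carrier_vec n" "cvec_norm u = 1" unfolding u_def using v c smult[OF v, of "1 / cvec_norm v"] by auto
    have vu: "v = complex_of_real (cvec_norm v) \<cdot>\<^sub>v u" unfolding u_def using c v by (auto simp: smult_smult_assoc)
    have "cvec_norm (M *\<^sub>v u) \<le> mat_op_norm M"
      unfolding mat_op_norm_def by (rule cSUP_upper[OF _ bdd]) (use u M in auto)
    moreover have "M *\<^sub>v v = complex_of_real (cvec_norm v) \<cdot>\<^sub>v (M *\<^sub>v u)"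
      by (subst vu) (rule mult_mat_vec[OF M u(1)])
    then have "cvec_norm (M *\<^sub>v v) = cvec_norm v * cvec_norm (M *\<^sub>v u)" using smult[OF Mc, of "cvec_norm v" u] c by simp
    ultimately show ?thesis using c by (simp add: mult.commute)
  qed
qed

lemma mat_op_norm_nonneg:
  assumes M: "M \<in> carrier_mat n n" and n: "0 < n"
  shows "0 \<le> mat_op_norm M"
proof -
  have u: "unit_vec n 0 \<in> carrier_vec n" by simp
  have "cvec_norm (unit_vec n 0) > 0"
  proof -
    have "cmod (vec_index (unit_vec n 0) 0) \<le> cvec_norm (unit_vec n 0)"
      unfolding cvec_norm_def using n by (intro member_le_L2_set) auto
    then show ?thesis using n by simp
  qed
  moreover have "0 \<le> cvec_norm (M *\<^sub>v unit_vec n 0)" unfolding cvec_norm_def by (rule L2_set_nonneg)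
  ultimately show ?thesis using cvec_norm_mult_mat_le[OF M u] by (metis linorder_not_le mult_neg_pos order_le_less_trans)
qed

text \<open>The product acts on each column of \<open>X\<close> separately, so the vector estimate
  is applied column by column.\<close>

lemma frobenius_mult_le:
  assumes S: "S \<in> carrier_mat n n" and X: "X \<in> carrier_mat n n" and n: "0 < n"
  shows "(\<Sum>i<n. \<Sum>j<n. (cmod ((S * X) $$ (i, j)))\<^sup>2) \<le> (mat_op_norm S)\<^sup>2 * (\<Sum>i<n. \<Sum>j<n. (cmod (X $$ (i, j)))\<^sup>2)"
proof -
  have col: "(\<Sum>i<n. (cmod ((S * X) $$ (i, j)))\<^sup>2) \<le> (mat_op_norm S)\<^sup>2 * (\<Sum>i<n. (cmod (X $$ (i, j)))\<^sup>2)" if j: "j < n" for j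
  proof -
    have cX: "col X j \<in> carrier_vec n" using X by auto
    have sq: "(cvec_norm u)\<^sup>2 = (\<Sum>i<n. (cmod (vec_index u i))\<^sup>2)" if "u \<in> carrier_vec n" for u
      using that unfolding cvec_norm_def L2_set_def by (simp add: sum_nonneg)
    have Sc: "S *\<^sub>v col X j \<in> carrier_vec n" by (intro carrier_vecI) (use S in auto)
    have "0 \<le> cvec_norm (S *\<^sub>v col X j)" unfolding cvec_norm_def by (rule L2_set_nonneg)
    then have "(cvec_norm (S *\<^sub>v col X j))\<^sup>2 \<le> (mat_op_norm S * cvec_norm (col X j))\<^sup>2"
      by (intro power_mono cvec_norm_mult_mat_le[OF S cX])
    then show ?thesis unfolding power_mult_distrib sq[OF cX] sq[OF Sc] using S X j by (simp add: index_mult_mat)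
  qed
  have "(\<Sum>i<n. \<Sum>j<n. (cmod ((S * X) $$ (i, j)))\<^sup>2) = (\<Sum>j<n. \<Sum>i<n. (cmod ((S * X) $$ (i, j)))\<^sup>2)" by (rule sum.swap)
  also have "\<dots> \<le> (\<Sum>j<n. (mat_op_norm S)\<^sup>2 * (\<Sum>i<n. (cmod (X $$ (i, j)))\<^sup>2))" by (intro sum_mono col) simp
  also have "\<dots> = (mat_op_norm S)\<^sup>2 * (\<Sum>i<n. \<Sum>j<n. (cmod (X $$ (i, j)))\<^sup>2)"
    unfolding sum_distrib_left[symmetric] by (subst sum.swap) simp
  finally show ?thesis .
qed

lemma rep_equiv_sym:
  assumes "rep_equiv e \<pi> \<pi>'" and c: "\<And>\<mu>. \<mu> \<in> reg_measures \<Longrightarrow> \<pi> \<mu> \<in> carrier_mat (rep_dim e \<pi>) (rep_dim e \<pi>)"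
  shows "rep_equiv e \<pi>' \<pi>"
proof -
  let ?d = "rep_dim e \<pi>"
  obtain U where U: "U \<in> carrier_mat ?d ?d" "U * mat_adjoint U = 1\<^sub>m ?d" "mat_adjoint U * U = 1\<^sub>m ?d"
    "\<And>\<mu>. \<mu> \<in> reg_measures \<Longrightarrow> \<pi>' \<mu> = U * \<pi> \<mu> * mat_adjoint U" and d: "rep_dim e \<pi>' = ?d"
    using assms(1) unfolding rep_equiv_def by blast
  note Us = mat_adjoint_carrier[OF U(1)]
  have "\<pi> \<mu> = mat_adjoint U * \<pi>' \<mu> * U" if m: "\<mu> \<in> reg_measures" for \<mu>
  proof -
    have "mat_adjoint U * \<pi>' \<mu> * U = mat_adjoint U * ((U * \<pi> \<mu>) * (mat_adjoint U * U))"
      unfolding U(4)[OF m] using U(1) Us c[OF m] by (simp add: assoc_mult_mat[of _ ?d ?d _ ?d _ ?d])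
    also have "\<dots> = (mat_adjoint U * U) * \<pi> \<mu>"
    proof -
      have "(U * \<pi> \<mu>) * 1\<^sub>m ?d = U * \<pi> \<mu>" using U(1) c[OF m] by simp
      then show ?thesis unfolding U(3)[symmetric] using assoc_mult_mat[OF Us U(1) c[OF m]] by simp
    qed
    also have "\<dots> = \<pi> \<mu>" unfolding U(3) using c[OF m] by simp
    finally show ?thesis by simp
  qed
  then show ?thesis unfolding rep_equiv_def d using U Us by (intro conjI bexI[of _ "mat_adjoint U"]) (auto simp: mat_adjoint_adjoint)
qed

lemma rep_equiv_trans:
  assumes 1: "rep_equiv e \<pi> \<pi>'" and 2: "rep_equiv e \<pi>' \<pi>''"
    and c: "\<And>\<mu>. \<mu> \<in> reg_measures \<Longrightarrow> \<pi> \<mu> \<in> carrier_mat (rep_dim e \<pi>) (rep_dim e \<pi>)"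
  shows "rep_equiv e \<pi> \<pi>''"
proof -
  let ?d = "rep_dim e \<pi>"
  obtain U where U: "U \<in> carrier_mat ?d ?d" "U * mat_adjoint U = 1\<^sub>m ?d" "mat_adjoint U * U = 1\<^sub>m ?d"
    "\<And>\<mu>. \<mu> \<in> reg_measures \<Longrightarrow> \<pi>' \<mu> = U * \<pi> \<mu> * mat_adjoint U" and d: "rep_dim e \<pi>' = ?d"
    using 1 unfolding rep_equiv_def by blast
  obtain V where V: "V \<in> carrier_mat ?d ?d" "V * mat_adjoint V = 1\<^sub>m ?d" "mat_adjoint V * V = 1\<^sub>m ?d"
    "\<And>\<mu>. \<mu> \<in> reg_measures \<Longrightarrow> \<pi>'' \<mu> = V * \<pi>' \<mu> * mat_adjoint V" and d2: "rep_dim e \<pi>'' = ?d"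
    using 2 unfolding rep_equiv_def d by blast
  note Us = mat_adjoint_carrier[OF U(1)] and Vs = mat_adjoint_carrier[OF V(1)]
  note as = assoc_mult_mat[of _ ?d ?d _ ?d _ ?d]
  have adj: "mat_adjoint (V * U) = mat_adjoint U * mat_adjoint V" by (rule mat_adjoint_mult[OF V(1) U(1)])
  have VU: "V * U \<in> carrier_mat ?d ?d" using V U by auto
  have "(V * U) * mat_adjoint (V * U) = V * ((U * mat_adjoint U) * mat_adjoint V)"
    unfolding adj using U(1) V(1) Us Vs by (simp add: as)
  also have "\<dots> = 1\<^sub>m ?d" unfolding U(2) using V(2) Vs by simp
  finally have a: "(V * U) * mat_adjoint (V * U) = 1\<^sub>m ?d" .
  have "mat_adjoint (V * U) * (V * U) = mat_adjoint U * ((mat_adjoint V * V) * U)"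
    unfolding adj using U(1) V(1) Us Vs by (simp add: as)
  also have "\<dots> = 1\<^sub>m ?d" unfolding V(3) using U(1,3) by simp
  finally have b: "mat_adjoint (V * U) * (V * U) = 1\<^sub>m ?d" .
  have "\<pi>'' \<mu> = (V * U) * \<pi> \<mu> * mat_adjoint (V * U)" if m: "\<mu> \<in> reg_measures" for \<mu>
    unfolding V(4)[OF m] U(4)[OF m] adj using U(1) V(1) Us Vs c[OF m] by (simp add: as)
  then show ?thesis unfolding rep_equiv_def d2 using VU a b by blast
qed

lemma L2_double_sum_Cauchy_Schwarz:
  fixes a b :: "nat \<Rightarrow> nat \<Rightarrow> real"
  shows "(\<Sum>i<n. \<Sum>j<n. \<bar>a i j\<bar> * \<bar>b i j\<bar>) \<le> sqrt (\<Sum>i<n. \<Sum>j<n. (a i j)\<^sup>2) * sqrt (\<Sum>i<n. \<Sum>j<n. (b i j)\<^sup>2)"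
  using L2_set_mult_ineq[of "\<lambda>z. a (fst z) (snd z)" "\<lambda>z. b (fst z) (snd z)" "{..<n} \<times> {..<n}"]
  unfolding L2_set_def sum.cartesian_product by (simp add: case_prod_beta)

section \<open>Fourier matrices at the chosen representatives\<close>

locale hypergroup_dual = haar_hypergroup +
  fixes rep :: "'a meas_rep set \<Rightarrow> 'a meas_rep"
  assumes rep_in: "\<forall>c \<in> dual conv e ck. rep c \<in> c"
begin

abbreviation "D \<equiv> dual conv e ck"
abbreviation "dm c \<equiv> rep_dim e (rep c)"
abbreviation "hdim c \<equiv> hyperdim e haar (rep c)"
abbreviation "mc c \<equiv> coef (rep c)"

lemma rep_carrier: "irreducible_rep conv e ck \<pi> \<Longrightarrow> \<mu> \<in> reg_measures \<Longrightarrow> \<pi> \<mu> \<in> carrier_mat (rep_dim e \<pi>) (rep_dim e \<pi>)"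
proof -
  assume irr: "irreducible_rep conv e ck \<pi>" and m: "\<mu> \<in> reg_measures"
  have "\<forall>\<mu>\<in>reg_measures. \<pi> \<mu> \<in> carrier_mat (rep_dim e \<pi>) (rep_dim e \<pi>)"
    using irr unfolding irreducible_rep_def representation_def Let_def by (elim conjE)
  then show "\<pi> \<mu> \<in> carrier_mat (rep_dim e \<pi>) (rep_dim e \<pi>)" using m by (rule bspec)
qed

lemma dual_eq_class:
  assumes "c \<in> D"
  shows "irreducible_rep conv e ck (rep c)"
    "c = {\<pi>'. irreducible_rep conv e ck \<pi>' \<and> rep_equiv e (rep c) \<pi>'}"
proof -
  obtain x where x: "irreducible_rep conv e ck x" "c = {\<pi>'. irreducible_rep conv e ck \<pi>' \<and> rep_equiv e x \<pi>'}"
    using assms unfolding dual_def by (auto elim!: quotientE)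
  have r: "rep c \<in> c" using rep_in assms by blast
  then show irr: "irreducible_rep conv e ck (rep c)" using x(2) by auto
  have xr: "rep_equiv e x (rep c)" using r x(2) by auto
  then have rx: "rep_equiv e (rep c) x" by (rule rep_equiv_sym) (rule rep_carrier[OF x(1)])
  have eqv: "rep_equiv e x \<pi>' \<longleftrightarrow> rep_equiv e (rep c) \<pi>'" for \<pi>'
  proof
    show "rep_equiv e x \<pi>' \<Longrightarrow> rep_equiv e (rep c) \<pi>'" by (rule rep_equiv_trans[OF rx _ rep_carrier[OF irr]])
    show "rep_equiv e (rep c) \<pi>' \<Longrightarrow> rep_equiv e x \<pi>'" by (rule rep_equiv_trans[OF xr _ rep_carrier[OF x(1)]])
  qed
  show "c = {\<pi>'. irreducible_rep conv e ck \<pi>' \<and> rep_equiv e (rep c) \<pi>'}" by (rule x(2)[unfolded eqv])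
qed

lemma dual_inequivalent:
  assumes c: "c \<in> D" "c' \<in> D" "c \<noteq> c'"
  shows "\<not> rep_equiv e (rep c') (rep c)"
proof
  assume r: "rep_equiv e (rep c') (rep c)"
  note i = dual_eq_class(1)[OF c(1)] dual_eq_class(1)[OF c(2)]
  have r': "rep_equiv e (rep c) (rep c')" by (rule rep_equiv_sym[OF r rep_carrier[OF i(2)]])
  have eqv: "rep_equiv e (rep c) \<pi>' \<longleftrightarrow> rep_equiv e (rep c') \<pi>'" for \<pi>'
  proof
    show "rep_equiv e (rep c) \<pi>' \<Longrightarrow> rep_equiv e (rep c') \<pi>'" by (rule rep_equiv_trans[OF r _ rep_carrier[OF i(2)]])
    show "rep_equiv e (rep c') \<pi>' \<Longrightarrow> rep_equiv e (rep c) \<pi>'" by (rule rep_equiv_trans[OF r' _ rep_carrier[OF i(1)]])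
  qed
  have "{\<pi>'. irreducible_rep conv e ck \<pi>' \<and> rep_equiv e (rep c) \<pi>'} = {\<pi>'. irreducible_rep conv e ck \<pi>' \<and> rep_equiv e (rep c') \<pi>'}"
    unfolding eqv ..
  then have "c = c'" by (rule trans[OF dual_eq_class(2)[OF c(1)] trans[OF _ dual_eq_class(2)[OF c(2), symmetric]]])
  then show False using c(3) by simp
qed

text \<open>Conjugation by the unitary matrix of an equivalence mixes the entries linearly, so every
  irreducible coefficient is a combination of coefficients of the chosen member of its class. This
  links \<open>trig\<close> to the representatives.\<close>

lemma irreducible_coef_span:
  assumes irr: "irreducible_rep conv e ck \<pi>" and ij: "i < rep_dim e \<pi>" "j < rep_dim e \<pi>"
  shows "\<exists>c\<in>D. \<exists>b. coef \<pi> i j = (\<lambda>x. \<Sum>k<dm c. \<Sum>l<dm c. b k l * mc c k l x)"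
proof -
  define c where "c = {\<pi>'. irreducible_rep conv e ck \<pi>' \<and> rep_equiv e \<pi> \<pi>'}"
  have c: "c \<in> D" unfolding dual_def quotient_def c_def using irr by auto
  note ic = dual_eq_class(1)[OF c]
  have "rep_equiv e \<pi> \<pi>'" if "\<pi>' \<in> c" for \<pi>' using that unfolding c_def by simp
  moreover have "rep c \<in> c" using rep_in c by simp
  ultimately have "rep_equiv e \<pi> (rep c)" by simp
  then have "rep_equiv e (rep c) \<pi>" by (rule rep_equiv_sym) (rule rep_carrier[OF irr])
  then obtain U where U: "U \<in> carrier_mat (dm c) (dm c)" "\<And>\<mu>. \<mu> \<in> reg_measures \<Longrightarrow> \<pi> \<mu> = U * rep c \<mu> * mat_adjoint U"
    and d: "rep_dim e \<pi> = dm c" unfolding rep_equiv_def by blast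
  note Us = mat_adjoint_carrier[OF U(1)]
  have eq: "coef \<pi> i j x = (\<Sum>k<dm c. \<Sum>l<dm c. (U $$ (i, k) * mat_adjoint U $$ (l, j)) * mc c k l x)" for x
  proof -
    have R: "rep c (dirac x) \<in> carrier_mat (dm c) (dm c)" by (rule rep_carrier[OF ic dirac_reg])
    have UR: "U * rep c (dirac x) \<in> carrier_mat (dm c) (dm c)" using U R by auto
    have ij': "i < dm c" "j < dm c" using ij d by auto
    have "coef \<pi> i j x = (\<Sum>l<dm c. (\<Sum>k<dm c. U $$ (i, k) * rep c (dirac x) $$ (k, l)) * mat_adjoint U $$ (l, j))"
      unfolding coef_def U(2)[OF dirac_reg] mult_mat_index_sum[OF UR Us ij']
      using mult_mat_index_sum[OF U(1) R ij'(1)] by simp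
    also have "\<dots> = (\<Sum>l<dm c. \<Sum>k<dm c. (U $$ (i, k) * mat_adjoint U $$ (l, j)) * mc c k l x)"
      unfolding coef_def sum_distrib_right by (simp add: mult_ac)
    finally show ?thesis by (subst sum.swap)
  qed
  show ?thesis
    by (rule bexI[OF _ c], rule exI[of _ "\<lambda>k l. U $$ (i, k) * mat_adjoint U $$ (l, j)"], rule ext, rule eq)
qed

lemma mc_cts: "c \<in> D \<Longrightarrow> i < dm c \<Longrightarrow> j < dm c \<Longrightarrow> cts (mc c i j)"
  by (intro coef_cts irr_rep dual_eq_class(1))

lemma hd_pos: "c \<in> D \<Longrightarrow> 0 < hdim c"
  by (rule hyperdim_orthogonality(1)[OF dual_eq_class(1)])

lemma mc_orthogonal:
  assumes "c \<in> D" "c' \<in> D" "i < dm c" "j < dm c" "k < dm c'" "l < dm c'"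
  shows "ip haar (mc c i j) (mc c' k l) = (if c = c' \<and> i = k \<and> j = l then complex_of_real (1 / hdim c) else 0)"
proof (cases "c = c'")
  case True
  then show ?thesis unfolding ip_def
    using hyperdim_orthogonality(2)[OF dual_eq_class(1)[OF assms(1)], of i j k l] assms by simp
next
  case False
  then show ?thesis unfolding ip_def
    using orthogonality_inequivalent[OF dual_eq_class(1)[OF assms(1)] dual_eq_class(1)[OF assms(2)]
      dual_inequivalent[OF assms(1,2) False] assms(3,4,5,6)] by simp
qed

definition hs :: "'a meas_rep set \<Rightarrow> ('a \<Rightarrow> complex) \<Rightarrow> real" where
  "hs c f = (\<Sum>i<dm c. \<Sum>j<dm c. (cmod (ip haar f (mc c i j)))\<^sup>2)"

lemma hs_fourier: "hs c f = (\<Sum>i<dm c. \<Sum>j<dm c. (cmod (fourier e haar f (rep c) $$ (i, j)))\<^sup>2)"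
  unfolding hs_def fourier_def ip_def coef_def by (intro sum.cong) auto

lemma hs_bessel:
  assumes G: "finite G" "G \<subseteq> D" and f: "sq_integrable haar f"
  shows "(\<Sum>c\<in>G. hdim c * hs c f) \<le> nsq haar f"
proof -
  define I where "I = (SIGMA c:G. {..<dm c} \<times> {..<dm c})"
  have I: "finite I" unfolding I_def using G by (intro finite_SigmaI) auto
  have "(\<Sum>x\<in>I. hdim (fst x) * (cmod (ip haar f (mc (fst x) (fst (snd x)) (snd (snd x)))))\<^sup>2) \<le> nsq haar f"
  proof (rule Bessel_orthogonal[OF _ _ _ I f])
    fix x assume x: "x \<in> I"
    then have xD: "fst x \<in> D" "fst (snd x) < dm (fst x)" "snd (snd x) < dm (fst x)" using G unfolding I_def by auto
    show "sq_integrable haar (mc (fst x) (fst (snd x)) (snd (snd x)))" by (rule cts_sq[OF mc_cts[OF xD]])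
    show "hdim (fst x) > 0" by (rule hd_pos[OF xD(1)])
    fix y assume y: "y \<in> I"
    then have yD: "fst y \<in> D" "fst (snd y) < dm (fst y)" "snd (snd y) < dm (fst y)" using G unfolding I_def by auto
    show "ip haar (mc (fst x) (fst (snd x)) (snd (snd x))) (mc (fst y) (fst (snd y)) (snd (snd y))) =
        (if x = y then complex_of_real (1 / hdim (fst x)) else 0)"
      unfolding mc_orthogonal[OF xD(1) yD(1) xD(2,3) yD(2,3)] by (auto simp: prod_eq_iff)
  qed
  also have "(\<Sum>x\<in>I. hdim (fst x) * (cmod (ip haar f (mc (fst x) (fst (snd x)) (snd (snd x)))))\<^sup>2)
      = (\<Sum>c\<in>G. \<Sum>ij\<in>{..<dm c} \<times> {..<dm c}. hdim c * (cmod (ip haar f (mc c (fst ij) (snd ij))))\<^sup>2)"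
    unfolding I_def using G by (subst sum.Sigma) (auto simp: case_prod_beta)
  also have "\<dots> = (\<Sum>c\<in>G. hdim c * hs c f)"
    unfolding hs_def sum.cartesian_product sum_distrib_left by (simp add: case_prod_beta)
  finally show ?thesis .
qed

text \<open>The quantity \<open>hs c f\<close> is the integral of \<open>f\<close> against the
  conjugate of the combination of coefficients with weights \<open>z i j\<close>. Pointwise
  Cauchy-Schwarz and d \<le> k bound that combination by the root of k times \<open>hs c f\<close>,
  and one factor cancels.\<close>

lemma hs_L1:
  assumes c: "c \<in> D" and f: "integrable haar f"
  shows "hs c f \<le> hdim c * (LINT x|haar. cmod (f x))\<^sup>2"
proof -
  note irr = dual_eq_class(1)[OF c]
  define z where "z i j = ip haar f (mc c i j)" for i j
  define L where "L = (LINT x|haar. cmod (f x))"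
  have d: "(\<Sum>i<dm c. \<Sum>j<dm c. (cmod (mc c i j x))\<^sup>2) \<le> hdim c" for x
    using coef_sum_bound[OF coef_rep_coef[OF irr_rep[OF irr]], of x] dim_le_hyperdim[OF irr] by linarith
  have hs0: "0 \<le> hs c f" unfolding hs_def by (intro sum_nonneg) auto
  have int: "integrable haar (\<lambda>x. f x * cnj (mc c i j x))" if "i < dm c" "j < dm c" for i j
    by (rule integrable_mult_cnj_cts[OF f mc_cts[OF c that]])
  define W where "W x = (\<Sum>i<dm c. \<Sum>j<dm c. cnj (z i j) * (f x * cnj (mc c i j x)))" for x
  have Wi: "integrable haar W" unfolding W_def using int by (intro Bochner_Integration.integrable_sum) auto
  have "complex_of_real (hs c f) = (\<Sum>i<dm c. \<Sum>j<dm c. cnj (z i j) * z i j)"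
    unfolding hs_def z_def[symmetric] of_real_sum mult_cnj_cmod[symmetric] by (simp add: mult.commute)
  also have "\<dots> = (\<Sum>i<dm c. \<Sum>j<dm c. (LINT x|haar. cnj (z i j) * (f x * cnj (mc c i j x))))"
    unfolding z_def ip_def by simp
  also have "\<dots> = (LINT x|haar. W x)"
  proof -
    have "(LINT x|haar. W x) = (\<Sum>i<dm c. LINT x|haar. (\<Sum>j<dm c. cnj (z i j) * (f x * cnj (mc c i j x))))"
      unfolding W_def by (rule Bochner_Integration.integral_sum) (use int in \<open>auto intro!: Bochner_Integration.integrable_sum\<close>)
    also have "\<dots> = (\<Sum>i<dm c. \<Sum>j<dm c. (LINT x|haar. cnj (z i j) * (f x * cnj (mc c i j x))))"
      by (intro sum.cong refl Bochner_Integration.integral_sum) (use int in auto)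
    finally show ?thesis ..
  qed
  finally have "hs c f = cmod (LINT x|haar. W x)" using hs0 by (metis norm_of_real abs_of_nonneg)
  also have "\<dots> \<le> (LINT x|haar. cmod (W x))" by (rule integral_norm_bound)
  also have "\<dots> \<le> (LINT x|haar. cmod (f x) * (sqrt (hdim c) * sqrt (hs c f)))"
  proof (rule integral_mono)
    show "cmod (W x) \<le> cmod (f x) * (sqrt (hdim c) * sqrt (hs c f))" for x
    proof -
      have "cmod (W x) \<le> (\<Sum>i<dm c. \<Sum>j<dm c. cmod (f x) * (cmod (z i j) * cmod (mc c i j x)))"
        unfolding W_def by (intro sum_norm_le) (auto simp: norm_mult intro!: sum_norm_le)
      also have "\<dots> = cmod (f x) * (\<Sum>i<dm c. \<Sum>j<dm c. \<bar>cmod (z i j)\<bar> * \<bar>cmod (mc c i j x)\<bar>)"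
        by (simp add: sum_distrib_left)
      also have "\<dots> \<le> cmod (f x) * (sqrt (hs c f) * sqrt (\<Sum>i<dm c. \<Sum>j<dm c. (cmod (mc c i j x))\<^sup>2))"
        unfolding hs_def z_def by (intro mult_left_mono L2_double_sum_Cauchy_Schwarz) simp
      also have "\<dots> \<le> cmod (f x) * (sqrt (hs c f) * sqrt (hdim c))"
        using d[of x] hs0 by (intro mult_left_mono real_sqrt_le_mono) auto
      finally show ?thesis by (simp add: mult.commute)
    qed
  qed (use Wi f in auto)
  also have "\<dots> = L * (sqrt (hdim c) * sqrt (hs c f))" unfolding L_def by simp
  finally have le: "hs c f \<le> L * sqrt (hdim c) * sqrt (hs c f)" by (simp add: mult.assoc)
  show ?thesis
  proof (cases "hs c f = 0")
    case True
    then show ?thesis using hd_pos[OF c] by simp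
  next
    case False
    then have p: "sqrt (hs c f) > 0" using hs0 by simp
    have "sqrt (hs c f) * sqrt (hs c f) \<le> (L * sqrt (hdim c)) * sqrt (hs c f)" using le hs0 by simp
    then have "sqrt (hs c f) \<le> L * sqrt (hdim c)" using p by (rule mult_right_le_imp_le)
    then have "(sqrt (hs c f))\<^sup>2 \<le> (L * sqrt (hdim c))\<^sup>2" using p by (intro power_mono) auto
    then show ?thesis using hs0 hd_pos[OF c] unfolding L_def by (simp add: power_mult_distrib mult.commute)
  qed
qed

lemma paley_system_dual:
  assumes F: "finite F" "F \<subseteq> D"
  shows "paley_system haar F hdim hs"
proof (rule paley_system.intro)
  fix i f g c
  show "finite_measure haar" by (rule finite_haar)
  show "finite F" by (rule F)
  show "0 < hdim i" if "i \<in> F" using hd_pos F that by blast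
  show "0 \<le> hs i f" if "i \<in> F" unfolding hs_def by (intro sum_nonneg) auto
  show "(\<Sum>i\<in>G. hdim i * hs i f) \<le> (LINT x|haar. (cmod (f x))\<^sup>2)" if "G \<subseteq> F" "bmeas haar f" for G
    using hs_bessel[of G f] that F bmeas_sq[OF finite_haar that(2)] finite_subset[OF that(1) F(1)] unfolding nsq_def by blast
  show "hs i f \<le> hdim i * (LINT x|haar. cmod (f x))\<^sup>2" if "i \<in> F" "bmeas haar f"
    using hs_L1[of i f] that F bmeas_integrable[OF finite_haar that(2)] by blast
  show "hs i (\<lambda>x. f x + g x) \<le> 2 * hs i f + 2 * hs i g" if i: "i \<in> F" and f: "bmeas haar f" and g: "bmeas haar g"
  proof -
    have iD: "i \<in> D" using i F by blast
    have "hs i (\<lambda>x. f x + g x) \<le> (\<Sum>k<dm i. \<Sum>l<dm i. 2 * (cmod (ip haar f (mc i k l)))\<^sup>2 + 2 * (cmod (ip haar g (mc i k l)))\<^sup>2)"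
      unfolding hs_def
    proof (intro sum_mono)
      fix k l assume kl: "k \<in> {..<dm i}" "l \<in> {..<dm i}"
      have "ip haar (\<lambda>x. f x + g x) (mc i k l) = ip haar f (mc i k l) + ip haar g (mc i k l)"
        using kl by (intro ip_add_left bmeas_sq[OF finite_haar] f g cts_sq mc_cts iD) auto
      moreover have "(cmod (a + b))\<^sup>2 \<le> 2 * (cmod a)\<^sup>2 + 2 * (cmod b)\<^sup>2" for a b :: complex
      proof -
        have "(cmod (a + b))\<^sup>2 \<le> (cmod a + cmod b)\<^sup>2" by (intro power_mono norm_triangle_ineq) simp
        also have "\<dots> \<le> 2 * (cmod a)\<^sup>2 + 2 * (cmod b)\<^sup>2"
          using sum_squares_bound[of "cmod a" "cmod b"] by (simp add: power2_sum)
        finally show ?thesis .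
      qed
      ultimately show "(cmod (ip haar (\<lambda>x. f x + g x) (mc i k l)))\<^sup>2 \<le> 2 * (cmod (ip haar f (mc i k l)))\<^sup>2 + 2 * (cmod (ip haar g (mc i k l)))\<^sup>2"
        by simp
    qed
    also have "\<dots> = 2 * hs i f + 2 * hs i g" unfolding hs_def by (simp add: sum.distrib sum_distrib_left)
    finally show ?thesis .
  qed
  show "hs i (\<lambda>x. c * f x) = (cmod c)\<^sup>2 * hs i f" if "i \<in> F" "bmeas haar f"
    unfolding hs_def ip_scale_left norm_mult power_mult_distrib sum_distrib_left ..
qed

section \<open>Finite Fourier sums and Parseval's identity\<close>

definition proj :: "'a meas_rep set set \<Rightarrow> ('a \<Rightarrow> complex) \<Rightarrow> 'a \<Rightarrow> complex" where
  "proj F g x = (\<Sum>c\<in>F. \<Sum>i<dm c. \<Sum>j<dm c. hdim c * ip haar g (mc c i j) * mc c i j x)"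

text \<open>Reproduction is demanded for every larger finite set of classes, so that for a sum of
  two such functions the union of their sets can be used.\<close>

definition finite_spectrum :: "('a \<Rightarrow> complex) \<Rightarrow> bool" where
  "finite_spectrum g \<longleftrightarrow> cts g \<and> (\<exists>F. finite F \<and> F \<subseteq> D \<and> (\<forall>F'. finite F' \<longrightarrow> F \<subseteq> F' \<longrightarrow> F' \<subseteq> D \<longrightarrow> proj F' g = g))"

lemma finite_spectrum_add:
  assumes f: "finite_spectrum f" and g: "finite_spectrum g"
  shows "finite_spectrum (\<lambda>x. f x + g x)"
proof -
  obtain F where F: "finite F" "F \<subseteq> D" "\<And>F'. finite F' \<Longrightarrow> F \<subseteq> F' \<Longrightarrow> F' \<subseteq> D \<Longrightarrow> proj F' f = f" and fc: "cts f"
    using f unfolding finite_spectrum_def by blast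
  obtain G where G: "finite G" "G \<subseteq> D" "\<And>F'. finite F' \<Longrightarrow> G \<subseteq> F' \<Longrightarrow> F' \<subseteq> D \<Longrightarrow> proj F' g = g" and gc: "cts g"
    using g unfolding finite_spectrum_def by blast
  have "proj F' (\<lambda>x. f x + g x) = (\<lambda>x. f x + g x)" if F': "finite F'" "F \<union> G \<subseteq> F'" "F' \<subseteq> D" for F'
  proof
    fix x
    have "proj F' (\<lambda>x. f x + g x) x = proj F' f x + proj F' g x"
      unfolding proj_def sum.distrib[symmetric]
    proof (intro sum.cong refl)
      fix c i j assume "c \<in> F'" "i \<in> {..<dm c}" "j \<in> {..<dm c}"
      then have "cts (mc c i j)" using F' by (intro mc_cts) auto
      then show "hdim c * ip haar (\<lambda>x. f x + g x) (mc c i j) * mc c i j x =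
         hdim c * ip haar f (mc c i j) * mc c i j x + hdim c * ip haar g (mc c i j) * mc c i j x"
        by (subst ip_add_left) (auto intro!: cts_sq fc gc simp: algebra_simps)
    qed
    then show "proj F' (\<lambda>x. f x + g x) x = f x + g x" using F(3)[of F'] G(3)[of F'] F' by simp
  qed
  then show ?thesis unfolding finite_spectrum_def using F(1,2) G(1,2) fc gc
    by (intro conjI exI[of _ "F \<union> G"]) (auto intro!: continuous_intros)
qed

lemma finite_spectrum_scale:
  assumes f: "finite_spectrum f"
  shows "finite_spectrum (\<lambda>x. k * f x)"
proof -
  obtain F where F: "finite F" "F \<subseteq> D" "\<And>F'. finite F' \<Longrightarrow> F \<subseteq> F' \<Longrightarrow> F' \<subseteq> D \<Longrightarrow> proj F' f = f" and fc: "cts f"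
    using f unfolding finite_spectrum_def by blast
  have "proj F' (\<lambda>x. k * f x) x = k * proj F' f x" for F' x
    unfolding proj_def ip_scale_left sum_distrib_left by (simp add: mult_ac)
  then show ?thesis unfolding finite_spectrum_def using F fc
    by (intro conjI exI[of _ F]) (auto intro!: continuous_intros)
qed

lemma finite_spectrum_zero: "finite_spectrum (\<lambda>_. 0)"
  unfolding finite_spectrum_def proj_def ip_def by (intro conjI exI[of _ "{}"]) auto

lemma finite_spectrum_sum: "finite I \<Longrightarrow> (\<And>i. i \<in> I \<Longrightarrow> finite_spectrum (f i)) \<Longrightarrow> finite_spectrum (\<lambda>x. \<Sum>i\<in>I. f i x)"
proof (induction I rule: finite_induct)
  case (insert i I)
  then have "finite_spectrum (\<lambda>x. f i x + (\<Sum>i\<in>I. f i x))" by (intro finite_spectrum_add) auto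
  then show ?case using insert by simp
qed (simp add: finite_spectrum_zero)

lemma finite_spectrum_mc:
  assumes c: "c \<in> D" and ij: "i < dm c" "j < dm c"
  shows "finite_spectrum (mc c i j)"
  unfolding finite_spectrum_def
proof (intro conjI exI[of _ "{c}"] allI impI)
  show "cts (mc c i j)" by (rule mc_cts[OF c ij])
  fix F' assume F': "finite F'" "{c} \<subseteq> F'" "F' \<subseteq> D"
  have "proj F' (mc c i j) x = mc c i j x" for x
  proof -
    have "proj F' (mc c i j) x = (\<Sum>c'\<in>F'. if c' = c then mc c i j x else 0)"
      unfolding proj_def
    proof (rule sum.cong[OF refl])
      fix c' assume c': "c' \<in> F'"
      then have cD: "c' \<in> D" using F' by blast
      show "(\<Sum>k<dm c'. \<Sum>l<dm c'. hdim c' * ip haar (mc c i j) (mc c' k l) * mc c' k l x) = (if c' = c then mc c i j x else 0)"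
      proof (cases "c' = c")
        case False
        have "ip haar (mc c i j) (mc c' k l) = 0" if "k < dm c'" "l < dm c'" for k l
          using mc_orthogonal[OF c cD ij that] False by simp
        then show ?thesis using False by simp
      next
        case True
        have "(\<Sum>k<dm c. \<Sum>l<dm c. hdim c * ip haar (mc c i j) (mc c k l) * mc c k l x)
           = (\<Sum>k<dm c. \<Sum>l<dm c. if k = i \<and> l = j then mc c i j x else 0)"
          using mc_orthogonal[OF c c ij] hd_pos[OF c] by (intro sum.cong refl) auto
        also have "\<dots> = (\<Sum>k<dm c. if k = i then (\<Sum>l<dm c. if l = j then mc c i j x else 0) else 0)"
          by (intro sum.cong refl) auto
        also have "\<dots> = mc c i j x" using ij by simp
        finally show ?thesis using True by simp
      qed
    qed
    then show ?thesis using F' by simp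
  qed
  then show "proj F' (mc c i j) = mc c i j" by blast
qed (use c in auto)

lemma trig_finite_spectrum: "g \<in> trig \<Longrightarrow> finite_spectrum g"
proof (induction rule: trig.induct)
  case zero
  show ?case by (rule finite_spectrum_zero)
next
  case (step f \<pi> i j k)
  obtain c b where c: "c \<in> D" and eq: "coef \<pi> i j = (\<lambda>x. \<Sum>k<dm c. \<Sum>l<dm c. b k l * mc c k l x)"
    using irreducible_coef_span[OF step(2-4)] by blast
  have "finite_spectrum (coef \<pi> i j)"
    unfolding eq by (intro finite_spectrum_sum finite_spectrum_scale finite_spectrum_mc c) auto
  then show ?case by (intro finite_spectrum_add finite_spectrum_scale step)
qed

text \<open>Only \<open>g\<close> is expanded, into a finite sum of continuous functions, so
  \<open>h\<close> may be merely integrable. This matters because \<open>A f\<close> is at first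
  only known to be in the space of exponent 1.\<close>

lemma parseval:
  assumes h: "integrable haar h" and g: "proj F g = g" and F: "finite F" "F \<subseteq> D"
  shows "(LINT x|haar. h x * cnj (g x)) = (\<Sum>c\<in>F. \<Sum>i<dm c. \<Sum>j<dm c. hdim c * ip haar h (mc c i j) * cnj (ip haar g (mc c i j)))"
proof -
  have int: "integrable haar (\<lambda>x. h x * cnj (mc c i j x))" if "c \<in> F" "i < dm c" "j < dm c" for c i j
    using that F by (intro integrable_mult_cnj_cts[OF h] mc_cts) auto
  have "h x * cnj (g x) = (\<Sum>c\<in>F. \<Sum>i<dm c. \<Sum>j<dm c. (hdim c * cnj (ip haar g (mc c i j))) * (h x * cnj (mc c i j x)))" for x
    by (subst g[symmetric]) (simp add: proj_def sum_distrib_left mult_ac)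
  then have "(LINT x|haar. h x * cnj (g x)) = (LINT x|haar. (\<Sum>c\<in>F. \<Sum>i<dm c. \<Sum>j<dm c. (hdim c * cnj (ip haar g (mc c i j))) * (h x * cnj (mc c i j x))))"
    by simp
  also have "\<dots> = (\<Sum>c\<in>F. (LINT x|haar. (\<Sum>i<dm c. \<Sum>j<dm c. (hdim c * cnj (ip haar g (mc c i j))) * (h x * cnj (mc c i j x)))))"
    using int by (intro Bochner_Integration.integral_sum Bochner_Integration.integrable_sum integrable_mult_right) auto
  also have "\<dots> = (\<Sum>c\<in>F. \<Sum>i<dm c. (LINT x|haar. (\<Sum>j<dm c. (hdim c * cnj (ip haar g (mc c i j))) * (h x * cnj (mc c i j x)))))"
    using int by (intro sum.cong refl Bochner_Integration.integral_sum Bochner_Integration.integrable_sum integrable_mult_right) auto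
  also have "\<dots> = (\<Sum>c\<in>F. \<Sum>i<dm c. \<Sum>j<dm c. (LINT x|haar. (hdim c * cnj (ip haar g (mc c i j))) * (h x * cnj (mc c i j x))))"
    using int by (intro sum.cong refl Bochner_Integration.integral_sum integrable_mult_right) auto
  finally show ?thesis unfolding ip_def integral_mult_right_zero by (simp only: mult_ac)
qed

end

section \<open>Lebesgue spaces\<close>

lemma Lp_norm_nonneg [simp]: "0 \<le> Lp_norm M p f"
  unfolding Lp_norm_def by simp

lemma Lp_norm_powr:
  assumes "0 < p"
  shows "Lp_norm M p f powr p = (LINT x|M. cmod (f x) powr p)"
  unfolding Lp_norm_def powr_powr using assms by simp

lemma Lp_norm_le_iff:
  assumes "0 < p" "0 \<le> B"
  shows "Lp_norm M p f \<le> B \<longleftrightarrow> (LINT x|M. cmod (f x) powr p) \<le> B powr p"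
  unfolding Lp_norm_powr[OF assms(1), symmetric] using assms powr_mono2[of p "Lp_norm M p f" B]
    powr_less_mono2[of p B "Lp_norm M p f"] by force

lemma powr_add_le:
  assumes "0 \<le> a" "0 \<le> b" "0 \<le> (p::real)"
  shows "(a + b) powr p \<le> 2 powr p * (a powr p + b powr p)"
proof -
  have "(a + b) powr p \<le> (2 * max a b) powr p" using assms by (intro powr_mono2) auto
  also have "\<dots> = 2 powr p * max a b powr p" using assms by (intro powr_mult)
  also have "\<dots> \<le> 2 powr p * (a powr p + b powr p)" using assms by (intro mult_left_mono) (auto simp: max_def)
  finally show ?thesis .
qed

lemma Lp_space_add:
  assumes f: "f \<in> Lp_space M p" and g: "g \<in> Lp_space M p" and p: "0 \<le> p"
  shows "(\<lambda>x. f x + g x) \<in> Lp_space M p"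
proof -
  have m: "f \<in> borel_measurable M" "g \<in> borel_measurable M"
    and i: "integrable M (\<lambda>x. cmod (f x) powr p)" "integrable M (\<lambda>x. cmod (g x) powr p)"
    using f g unfolding Lp_space_def by auto
  have "integrable M (\<lambda>x. cmod (f x + g x) powr p)"
  proof (rule Bochner_Integration.integrable_bound)
    show "integrable M (\<lambda>x. 2 powr p * (cmod (f x) powr p + cmod (g x) powr p))" using i by simp
    show "AE x in M. norm (cmod (f x + g x) powr p) \<le> norm (2 powr p * (cmod (f x) powr p + cmod (g x) powr p))"
    proof (rule AE_I2)
      fix x
      have "cmod (f x + g x) powr p \<le> (cmod (f x) + cmod (g x)) powr p"
        using p by (intro powr_mono2 norm_triangle_ineq) auto
      also have "\<dots> \<le> 2 powr p * (cmod (f x) powr p + cmod (g x) powr p)" using p by (intro powr_add_le) auto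
      finally show "norm (cmod (f x + g x) powr p) \<le> norm (2 powr p * (cmod (f x) powr p + cmod (g x) powr p))" by simp
    qed
    show "(\<lambda>x. cmod (f x + g x) powr p) \<in> borel_measurable M"
      using m by (intro powr_real_measurable borel_measurable_const) auto
  qed
  then show ?thesis unfolding Lp_space_def using m by simp
qed

lemma Lp_space_scale: "f \<in> Lp_space M p \<Longrightarrow> (\<lambda>x. c * f x) \<in> Lp_space M p"
  unfolding Lp_space_def by (auto simp: norm_mult powr_mult)

lemma Lp_space_diff:
  assumes "f \<in> Lp_space M p" "g \<in> Lp_space M p" "0 \<le> p"
  shows "(\<lambda>x. f x - g x) \<in> Lp_space M p"
  using Lp_space_add[OF assms(1) Lp_space_scale[OF assms(2), of "-1"] assms(3)] by simp

lemma Lp_norm_scale: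
  assumes "0 < p"
  shows "Lp_norm M p (\<lambda>x. c * f x) = cmod c * Lp_norm M p f"
  unfolding Lp_norm_def using assms by (simp add: norm_mult powr_mult powr_powr)

lemma Lp_norm_minus_commute: "Lp_norm M p (\<lambda>x. f x - g x) = Lp_norm M p (\<lambda>x. g x - f x)"
  unfolding Lp_norm_def by (simp add: norm_minus_commute)

text \<open>A crude constant in place of Minkowski's inequality does no harm, as \<open>C\<close> is arbitrary in the theorem.\<close>

lemma Lp_norm_add_le:
  assumes f: "f \<in> Lp_space M p" and g: "g \<in> Lp_space M p" and p: "1 \<le> p"
  shows "Lp_norm M p (\<lambda>x. f x + g x) \<le> 4 * (Lp_norm M p f + Lp_norm M p g)"
proof -
  define m where "m = max (Lp_norm M p f) (Lp_norm M p g)"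
  have m0: "0 \<le> m" unfolding m_def by (simp add: le_max_iff_disj)
  have p0: "0 < p" "0 \<le> p" using p by auto
  have i: "integrable M (\<lambda>x. cmod (f x) powr p)" "integrable M (\<lambda>x. cmod (g x) powr p)"
    "integrable M (\<lambda>x. cmod (f x + g x) powr p)"
    using f g Lp_space_add[OF f g p0(2)] unfolding Lp_space_def by auto
  have "(LINT x|M. cmod (f x + g x) powr p) \<le> (LINT x|M. 2 powr p * (cmod (f x) powr p + cmod (g x) powr p))"
  proof (rule integral_mono)
    show "integrable M (\<lambda>x. 2 powr p * (cmod (f x) powr p + cmod (g x) powr p))" using i by simp
    fix x
    have "cmod (f x + g x) powr p \<le> (cmod (f x) + cmod (g x)) powr p"
      using p0 by (intro powr_mono2 norm_triangle_ineq) auto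
    then show "cmod (f x + g x) powr p \<le> 2 powr p * (cmod (f x) powr p + cmod (g x) powr p)"
      using powr_add_le[of "cmod (f x)" "cmod (g x)" p] p0 by auto
  qed (rule i(3))
  then have "(LINT x|M. cmod (f x + g x) powr p) \<le> 2 powr p * (Lp_norm M p f powr p + Lp_norm M p g powr p)"
    using i by (simp add: Lp_norm_powr[OF p0(1)])
  also have "\<dots> \<le> 2 powr p * (m powr p + m powr p)"
    using p0 by (intro mult_left_mono add_mono powr_mono2) (auto simp: m_def)
  also have "\<dots> = 2 * (2 * m) powr p" using m0 by (simp add: powr_mult)
  also have "\<dots> \<le> 2 powr p * (2 * m) powr p" using powr_mono[of 1 p 2] p by (intro mult_right_mono) auto
  also have "\<dots> = (4 * m) powr p" using m0 by (simp add: powr_mult[symmetric])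
  finally have "Lp_norm M p (\<lambda>x. f x + g x) \<le> 4 * m" using Lp_norm_le_iff[OF p0(1), of "4 * m" M "\<lambda>x. f x + g x"] m0 by simp
  also have "\<dots> \<le> 4 * (Lp_norm M p f + Lp_norm M p g)" unfolding m_def by (intro mult_left_mono) auto
  finally show ?thesis .
qed

lemma Lp_norm_diff_le:
  assumes "f \<in> Lp_space M p" "g \<in> Lp_space M p" "1 \<le> p"
  shows "Lp_norm M p (\<lambda>x. f x - g x) \<le> 4 * (Lp_norm M p f + Lp_norm M p g)"
  using Lp_norm_add_le[OF assms(1) Lp_space_scale[OF assms(2), of "-1"] assms(3)]
    Lp_norm_scale[of p M "-1" g] assms(3) by simp

lemma Lp_norm_cong_AE:
  assumes "AE x in M. f x = g x" "f \<in> borel_measurable M" "g \<in> borel_measurable M"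
  shows "Lp_norm M p f = Lp_norm M p g"
proof -
  have "(LINT x|M. cmod (f x) powr p) = (LINT x|M. cmod (g x) powr p)"
  proof (rule integral_cong_AE)
    show "AE x in M. cmod (f x) powr p = cmod (g x) powr p" using assms(1) by eventually_elim simp
  qed (use assms in \<open>auto intro!: powr_real_measurable borel_measurable_const\<close>)
  then show ?thesis unfolding Lp_norm_def by simp
qed

lemma Lp_norm_eq_0:
  assumes "f \<in> Lp_space M p" "Lp_norm M p f \<le> 0"
  shows "AE x in M. f x = 0"
proof -
  have i: "integrable M (\<lambda>x. cmod (f x) powr p)" using assms unfolding Lp_space_def by auto
  have "Lp_norm M p f = 0" using assms(2) by (intro antisym) auto
  then have "(LINT x|M. cmod (f x) powr p) = 0" unfolding Lp_norm_def by simp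
  then have "AE x in M. cmod (f x) powr p = 0" using i by (subst (asm) integral_nonneg_eq_0_iff_AE) auto
  then show ?thesis by eventually_elim simp
qed

text \<open>The bound survives almost everywhere convergence; it serves both completeness and the
  removal of a truncation in the duality argument.\<close>

lemma Fatou_powr:
  assumes u: "\<And>n::nat. u n \<in> borel_measurable M" and f: "f \<in> borel_measurable M"
    and lim: "AE x in M. (\<lambda>n. u n x) \<longlonglongrightarrow> f x"
    and i: "\<And>n. integrable M (\<lambda>x. cmod (u n x) powr r)"
    and le: "\<And>n. (LINT x|M. cmod (u n x) powr r) \<le> B" and r: "0 < r" and B: "0 \<le> B"
  shows "integrable M (\<lambda>x. cmod (f x) powr r)" "(LINT x|M. cmod (f x) powr r) \<le> B"
proof -
  have m: "(\<lambda>x. cmod (f x) powr r) \<in> borel_measurable M" "\<And>n. (\<lambda>x. cmod (u n x) powr r) \<in> borel_measurable M"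
    using u f by (auto intro!: powr_real_measurable borel_measurable_const)
  have "(\<integral>\<^sup>+x. ennreal (cmod (f x) powr r) \<partial>M) = (\<integral>\<^sup>+x. liminf (\<lambda>n. ennreal (cmod (u n x) powr r)) \<partial>M)"
  proof (rule nn_integral_cong_AE)
    show "AE x in M. ennreal (cmod (f x) powr r) = liminf (\<lambda>n. ennreal (cmod (u n x) powr r))"
      using lim
    proof eventually_elim
      case (elim x)
      have "(\<lambda>n. cmod (u n x) powr r) \<longlonglongrightarrow> cmod (f x) powr r"
        using r by (intro tendsto_powr2 tendsto_norm elim tendsto_const) auto
      then have "(\<lambda>n. ennreal (cmod (u n x) powr r)) \<longlonglongrightarrow> ennreal (cmod (f x) powr r)" by (rule tendsto_ennrealI)
      then show ?case using lim_imp_Liminf[OF trivial_limit_sequentially] by metis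
    qed
  qed
  also have "\<dots> \<le> liminf (\<lambda>n. \<integral>\<^sup>+x. ennreal (cmod (u n x) powr r) \<partial>M)"
    using m by (intro nn_integral_liminf) auto
  also have "\<dots> \<le> liminf (\<lambda>n::nat. ennreal B)"
  proof (rule Liminf_mono, rule always_eventually, rule allI)
    fix n
    show "(\<integral>\<^sup>+x. ennreal (cmod (u n x) powr r) \<partial>M) \<le> ennreal B"
      using nn_integral_eq_integral[OF i[of n]] le[of n] by (simp add: ennreal_leI)
  qed
  finally have le': "(\<integral>\<^sup>+x. ennreal (cmod (f x) powr r) \<partial>M) \<le> ennreal B" by (simp add: Liminf_const)
  then have "(\<integral>\<^sup>+x. ennreal (cmod (f x) powr r) \<partial>M) < \<infinity>" using ennreal_less_top le_less_trans by (metis infinity_ennreal_def)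
  then show i': "integrable M (\<lambda>x. cmod (f x) powr r)" using m by (intro integrableI_nonneg) auto
  show "(LINT x|M. cmod (f x) powr r) \<le> B"
    using le' nn_integral_eq_integral[OF i'] B by (simp add: ennreal_le_iff)
qed

context prob_space
begin

text \<open>In place of Hoelder's inequality: t \<le> a + a^(1 - q) t^q for all t \<ge> 0, since
  beyond a the second term alone suffices. On a probability space each of the two terms integrates
  to at most a.\<close>

lemma Lp_integrable:
  assumes f: "f \<in> Lp_space M q" and q: "1 \<le> q" and le: "Lp_norm M q f \<le> a" and a: "0 < a"
  shows "integrable M f" "(LINT x|M. cmod (f x)) \<le> 2 * a"
proof -
  have m: "f \<in> borel_measurable M" and i: "integrable M (\<lambda>x. cmod (f x) powr q)" using f unfolding Lp_space_def by auto
  have pt: "t \<le> a + a powr (1 - q) * t powr q" if t: "0 \<le> t" for t :: real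
  proof (cases "t \<le> a")
    case True
    then show ?thesis by (simp add: add_increasing2)
  next
    case False
    then have "t = t powr (1 - q) * t powr q" using a by (simp add: powr_add[symmetric])
    also have "\<dots> \<le> a powr (1 - q) * t powr q" using False a q by (intro mult_right_mono powr_mono2') auto
    finally show ?thesis using a by simp
  qed
  have ib: "integrable M (\<lambda>x. a + a powr (1 - q) * cmod (f x) powr q)" using i by simp
  show int: "integrable M f"
    by (rule Bochner_Integration.integrable_bound[OF ib m]) (use pt order_trans[OF pt abs_ge_self] in auto)
  have "(LINT x|M. cmod (f x)) \<le> (LINT x|M. a + a powr (1 - q) * cmod (f x) powr q)"
    using int ib pt by (intro integral_mono) auto
  also have "\<dots> = a + a powr (1 - q) * Lp_norm M q f powr q"
    using i q by (simp add: Lp_norm_powr prob_space)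
  also have "\<dots> \<le> a + a powr (1 - q) * a powr q" using le q by (intro add_left_mono mult_left_mono powr_mono2) auto
  also have "\<dots> = 2 * a" using a by (simp add: powr_add[symmetric])
  finally show "(LINT x|M. cmod (f x)) \<le> 2 * a" .
qed

text \<open>The geometric rate makes the increments summable in the mean, hence the sequence
  converges almost everywhere; Fatou's lemma for fixed \<open>n\<close> then bounds the distance to
  the limit at the same rate.\<close>

lemma Lp_complete:
  assumes u: "\<And>n::nat. u n \<in> Lp_space M q" and q: "1 \<le> q"
    and C: "\<And>m n. n \<le> m \<Longrightarrow> Lp_norm M q (\<lambda>x. u m x - u n x) \<le> c * (1 / 2) ^ n" and c: "0 < c"
  obtains h where "h \<in> Lp_space M q" "\<And>n. Lp_norm M q (\<lambda>x. h x - u n x) \<le> c * (1 / 2) ^ n"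
proof -
  have q0: "0 < q" "0 \<le> q" using q by auto
  have m: "u n \<in> borel_measurable M" for n using u[of n] unfolding Lp_space_def by auto
  define d where "d n x = u (Suc n) x - u n x" for n x
  have dL: "d n \<in> Lp_space M q" for n unfolding d_def by (intro Lp_space_diff u q0)
  have dm: "d n \<in> borel_measurable M" for n using dL[of n] unfolding Lp_space_def by auto
  have dn: "Lp_norm M q (d n) \<le> c * (1 / 2) ^ n" for n using C[of n "Suc n"] unfolding d_def by simp
  have dI: "integrable M (d n)" "(LINT x|M. cmod (d n x)) \<le> 2 * c * (1 / 2) ^ n" for n
    using Lp_integrable[OF dL q dn] c by (simp_all add: mult.assoc)
  have "(\<integral>\<^sup>+x. (\<Sum>n. ennreal (cmod (d n x))) \<partial>M) = (\<Sum>n. \<integral>\<^sup>+x. ennreal (cmod (d n x)) \<partial>M)"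
    using dm by (intro nn_integral_suminf) auto
  also have "\<dots> \<le> (\<Sum>n. ennreal (2 * c * (1 / 2) ^ n))"
  proof (rule suminf_le)
    fix n
    have "(\<integral>\<^sup>+x. ennreal (cmod (d n x)) \<partial>M) = ennreal (LINT x|M. cmod (d n x))"
      using dI(1)[of n] by (intro nn_integral_eq_integral) auto
    then show "(\<integral>\<^sup>+x. ennreal (cmod (d n x)) \<partial>M) \<le> ennreal (2 * c * (1 / 2) ^ n)" using dI(2)[of n] by (simp add: ennreal_leI)
  qed auto
  also have "\<dots> < \<infinity>"
  proof -
    have "summable (\<lambda>n. 2 * c * (1 / 2) ^ n :: real)" by (intro summable_mult summable_geometric) auto
    then have "(\<Sum>n. ennreal (2 * c * (1 / 2) ^ n)) = ennreal (\<Sum>n. 2 * c * (1 / 2) ^ n)"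
      using c by (intro suminf_ennreal2) auto
    then show ?thesis by simp
  qed
  finally have "(\<integral>\<^sup>+x. (\<Sum>n. ennreal (cmod (d n x))) \<partial>M) \<noteq> \<infinity>" by simp
  then have "AE x in M. (\<Sum>n. ennreal (cmod (d n x))) \<noteq> \<infinity>"
    using dm by (intro nn_integral_PInf_AE) auto
  then have conv: "AE x in M. convergent (\<lambda>n. u n x)"
  proof eventually_elim
    case (elim x)
    have "summable (\<lambda>n. cmod (d n x))" using elim by (intro summable_suminf_not_top) auto
    then have "summable (\<lambda>n. d n x)" by (rule summable_norm_cancel)
    then have "convergent (\<lambda>n. \<Sum>i<n. d i x)" by (simp add: summable_iff_convergent)
    moreover have "(\<lambda>n. \<Sum>i<n. d i x) = (\<lambda>n. u n x - u 0 x)" unfolding d_def by (intro ext sum_lessThan_telescope)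
    ultimately have "convergent (\<lambda>n. (u n x - u 0 x) + u 0 x)" by (intro convergent_add convergent_const) simp
    then show ?case by simp
  qed
  define h where "h x = lim (\<lambda>n. u n x)" for x
  have hm: "h \<in> borel_measurable M" unfolding h_def using m by (rule borel_measurable_lim_metric)
  have hl: "AE x in M. (\<lambda>n. u n x) \<longlonglongrightarrow> h x"
    using conv unfolding h_def by eventually_elim (simp add: convergent_LIMSEQ_iff)
  have F: "integrable M (\<lambda>x. cmod (h x - u n x) powr q) \<and> (LINT x|M. cmod (h x - u n x) powr q) \<le> (c * (1 / 2) ^ n) powr q" for n
  proof -
    have "integrable M (\<lambda>x. cmod (u (m + n) x - u n x) powr q)" for m
      using Lp_space_diff[OF u[of "m + n"] u[of n] q0(2)] unfolding Lp_space_def by auto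
    moreover have "(LINT x|M. cmod (u (m + n) x - u n x) powr q) \<le> (c * (1 / 2) ^ n) powr q" for m
      using C[of n "m + n"] Lp_norm_le_iff[OF q0(1), of "c * (1 / 2) ^ n" M "\<lambda>x. u (m + n) x - u n x"] c by simp
    moreover have "AE x in M. (\<lambda>m. u (m + n) x - u n x) \<longlonglongrightarrow> h x - u n x"
      using hl by eventually_elim (intro tendsto_intros LIMSEQ_ignore_initial_segment)
    moreover have "(\<lambda>x. u (m + n) x - u n x) \<in> borel_measurable M" for m using m by simp
    moreover have "(\<lambda>x. h x - u n x) \<in> borel_measurable M" using m hm by simp
    ultimately show ?thesis
      using Fatou_powr[of "\<lambda>m x. u (m + n) x - u n x" M "\<lambda>x. h x - u n x" q "(c * (1 / 2) ^ n) powr q"] q0(1) by simp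
  qed
  have hL: "h \<in> Lp_space M q"
  proof -
    have "(\<lambda>x. h x - u 0 x) \<in> Lp_space M q" unfolding Lp_space_def using F[of 0] hm m by simp
    from Lp_space_add[OF this u[of 0] q0(2)] show ?thesis by simp
  qed
  have "Lp_norm M q (\<lambda>x. h x - u n x) \<le> c * (1 / 2) ^ n" for n
    using F[of n] Lp_norm_le_iff[OF q0(1), of "c * (1 / 2) ^ n" M "\<lambda>x. h x - u n x"] c by simp
  with hL show ?thesis by (rule that)
qed

end

section \<open>Density of continuous functions and duality\<close>

lemma urysohn_metric:
  fixes C U :: "'a::metric_space set"
  assumes C: "closed C" and U: "open U" and CU: "C \<subseteq> U"
  obtains \<phi> :: "'a \<Rightarrow> real" where "continuous_on UNIV \<phi>" "\<And>x. 0 \<le> \<phi> x" "\<And>x. \<phi> x \<le> 1"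
    "\<And>x. x \<in> C \<Longrightarrow> \<phi> x = 1" "\<And>x. x \<notin> U \<Longrightarrow> \<phi> x = 0"
\<comment> \<open>\<open>infdist\<close> to the empty set is 0, so the quotient of distances is used
  only when both sets are nonempty.\<close>
proof (cases "C = {} \<or> U = UNIV")
  case True
  show ?thesis
  proof (rule that)
    show "continuous_on UNIV (\<lambda>_::'a. if C = {} then 0 else 1 :: real)" by (rule continuous_on_const)
  qed (use True in auto)
next
  case False
  have cU: "closed (- U)" "- U \<noteq> {}" using U False by auto
  define \<phi> where "\<phi> x = infdist x (- U) / (infdist x C + infdist x (- U))" for x
  have pos: "0 < infdist x C + infdist x (- U)" for x
  proof (rule ccontr)
    assume "\<not> 0 < infdist x C + infdist x (- U)"
    then have "infdist x C = 0" "infdist x (- U) = 0" using infdist_nonneg[of x C] infdist_nonneg[of x "- U"] by linarith+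
    then have "x \<in> C" "x \<in> - U" using in_closed_iff_infdist_zero[OF C] in_closed_iff_infdist_zero[OF cU] False by auto
    then show False using CU by auto
  qed
  show ?thesis
  proof (rule that[of \<phi>])
    show "continuous_on UNIV \<phi>" unfolding \<phi>_def using pos
      by (intro continuous_on_divide continuous_on_add continuous_on_infdist continuous_on_id) (auto simp: less_le)
    show "0 \<le> \<phi> x" for x unfolding \<phi>_def by (intro divide_nonneg_nonneg add_nonneg_nonneg infdist_nonneg)
    show "\<phi> x \<le> 1" for x unfolding \<phi>_def using pos[of x] infdist_nonneg[of x C] by (simp add: divide_le_eq_1)
    show "\<phi> x = 1" if "x \<in> C" for x unfolding \<phi>_def using pos[of x] that by simp
    show "\<phi> x = 0" if "x \<notin> U" for x unfolding \<phi>_def using that by simp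
  qed
qed

lemma continuous_dense_L1:
  fixes M :: "'a::polish_space measure"
  assumes K: "compact (UNIV :: 'a set)" and M: "finite_measure M" "sets M = sets borel"
    and f: "integrable M (f :: 'a \<Rightarrow> complex)" and \<epsilon>: "0 < \<epsilon>"
  shows "\<exists>\<phi>. continuous_on UNIV \<phi> \<and> (LINT x|M. cmod (f x - \<phi> x)) < \<epsilon>"
  using f \<epsilon>
proof (induction arbitrary: \<epsilon> rule: integrable_induct)
  case (base A c)
  interpret finite_measure M by (rule M)
  define \<eta> where "\<eta> = \<epsilon> / (cmod c + 1)"
  have \<eta>: "0 < \<eta>" "cmod c * \<eta> < \<epsilon>"
  proof -
    have c1: "0 < cmod c + 1" by (simp add: add_nonneg_pos)
    then show "0 < \<eta>" unfolding \<eta>_def using base by simp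
    have "cmod c * \<epsilon> < \<epsilon> * (cmod c + 1)" using base by (simp add: algebra_simps)
    then show "cmod c * \<eta> < \<epsilon>" unfolding \<eta>_def using c1 by (simp add: pos_divide_less_eq)
  qed
  have AB: "A \<in> sets borel" using base M by simp
  obtain C U where C: "compact C" and U: "open U" and CAU: "C \<subseteq> A" "A \<subseteq> U" and mUC: "measure M (U - C) < \<eta>"
  proof -
    have "\<exists>C U. compact C \<and> open U \<and> C \<subseteq> A \<and> A \<subseteq> U \<and> (\<forall>i\<in>{()}. measure M (U - C) < \<eta>)"
      by (rule measure_regular_finite_family) (use M AB \<eta> in auto)
    then show thesis using that by blast
  qed
  obtain \<phi> :: "'a \<Rightarrow> real" where \<phi>: "continuous_on UNIV \<phi>" "\<And>x. 0 \<le> \<phi> x" "\<And>x. \<phi> x \<le> 1"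
    "\<And>x. x \<in> C \<Longrightarrow> \<phi> x = 1" "\<And>x. x \<notin> U \<Longrightarrow> \<phi> x = 0"
    by (rule urysohn_metric[OF compact_imp_closed[OF C] U]) (use CAU in auto)
  have UCM: "U - C \<in> sets M" unfolding M(2) by (intro sets.Diff borel_open U borel_closed compact_imp_closed C)
  have pt: "cmod (indicat_real A x *\<^sub>R c - \<phi> x *\<^sub>R c) \<le> cmod c * indicat_real (U - C) x" for x
  proof -
    have "\<bar>indicat_real A x - \<phi> x\<bar> \<le> indicat_real (U - C) x"
      using \<phi>(2,3)[of x] \<phi>(4,5)[of x] CAU by (auto simp: indicator_def)
    then have "\<bar>indicat_real A x - \<phi> x\<bar> * cmod c \<le> indicat_real (U - C) x * cmod c" by (intro mult_right_mono) auto
    then show ?thesis unfolding scaleR_left_diff_distrib[symmetric] norm_scaleR by (simp only: mult.commute)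
  qed
  have c: "continuous_on UNIV (\<lambda>x. \<phi> x *\<^sub>R c)" using \<phi>(1) by (intro continuous_intros)
  have "(LINT x|M. cmod (indicat_real A x *\<^sub>R c - \<phi> x *\<^sub>R c)) \<le> (LINT x|M. cmod c * indicat_real (U - C) x)"
  proof (rule integral_mono)
    have iA: "integrable M (indicat_real A)" using base by (intro integrable_real_indicator) auto
    show "integrable M (\<lambda>x. cmod (indicat_real A x *\<^sub>R c - \<phi> x *\<^sub>R c))"
      using integrable_scaleR_left[of c M "indicat_real A"] iA integrable_continuous[OF K M c]
      by (intro integrable_norm Bochner_Integration.integrable_diff) auto
    show "integrable M (\<lambda>x. cmod c * indicat_real (U - C) x)" using UCM by (intro integrable_mult_right integrable_real_indicator) (auto simp: less_top[symmetric])
  qed (rule pt)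
  also have "\<dots> = cmod c * measure M (U - C)" using UCM by (simp add: sets.Int_space_eq2)
  also have "\<dots> \<le> cmod c * \<eta>" using mUC by (intro mult_left_mono) auto
  finally have "(LINT x|M. cmod (indicat_real A x *\<^sub>R c - \<phi> x *\<^sub>R c)) < \<epsilon>" using \<eta>(2) by simp
  with c show ?case by (intro exI[of _ "\<lambda>x. \<phi> x *\<^sub>R c"] conjI)
next
  case (add f g)
  obtain \<phi> where \<phi>: "continuous_on UNIV \<phi>" "(LINT x|M. cmod (f x - \<phi> x)) < \<epsilon> / 2" using add(3)[of "\<epsilon> / 2"] add.prems by auto
  obtain \<psi> where \<psi>: "continuous_on UNIV \<psi>" "(LINT x|M. cmod (g x - \<psi> x)) < \<epsilon> / 2" using add(4)[of "\<epsilon> / 2"] add.prems by auto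
  have c: "continuous_on UNIV (\<lambda>x. \<phi> x + \<psi> x)" by (intro continuous_intros \<phi> \<psi>)
  have i: "integrable M (\<lambda>x. cmod (f x - \<phi> x))" "integrable M (\<lambda>x. cmod (g x - \<psi> x))" "integrable M (\<lambda>x. cmod (f x + g x - (\<phi> x + \<psi> x)))"
    using add(1,2) integrable_continuous[OF K M \<phi>(1)] integrable_continuous[OF K M \<psi>(1)] by simp_all
  have "(LINT x|M. cmod (f x + g x - (\<phi> x + \<psi> x))) \<le> (LINT x|M. cmod (f x - \<phi> x) + cmod (g x - \<psi> x))"
    using i by (intro integral_mono) (auto simp: norm_diff_triangle_ineq)
  also have "\<dots> < \<epsilon>" using i \<phi>(2) \<psi>(2) by simp
  finally show ?case using c by (intro exI[of _ "\<lambda>x. \<phi> x + \<psi> x"] conjI)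
next
  case (lim f s)
  have "(\<lambda>n. LINT x|M. cmod (f x - s n x)) \<longlonglongrightarrow> (LINT x|M. cmod (f x - f x))"
  proof (rule integral_dominated_convergence)
    show "integrable M (\<lambda>x. 3 * cmod (f x))" using lim by simp
    show "AE x in M. (\<lambda>n. cmod (f x - s n x)) \<longlonglongrightarrow> cmod (f x - f x)" by (intro AE_I2 tendsto_intros lim(2))
    show "AE x in M. norm (cmod (f x - s n x)) \<le> 3 * cmod (f x)" for n
    proof (rule AE_I2)
      fix x assume x: "x \<in> space M"
      have "cmod (s n x) \<le> 2 * cmod (f x)" by (rule lim(3)[OF x])
      then show "norm (cmod (f x - s n x)) \<le> 3 * cmod (f x)" using norm_triangle_ineq4[of "f x" "s n x"] by simp
    qed
  qed (use lim in auto)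
  then have "\<forall>\<^sub>F n in sequentially. (LINT x|M. cmod (f x - s n x)) < \<epsilon> / 2"
    using lim.prems by (intro order_tendstoD(2)[of _ 0]) auto
  then obtain n where n: "(LINT x|M. cmod (f x - s n x)) < \<epsilon> / 2" unfolding eventually_sequentially by blast
  obtain \<phi> where \<phi>: "continuous_on UNIV \<phi>" "(LINT x|M. cmod (s n x - \<phi> x)) < \<epsilon> / 2" using lim(5)[of "\<epsilon> / 2" n] lim.prems by auto
  have i: "integrable M (\<lambda>x. cmod (f x - s n x))" "integrable M (\<lambda>x. cmod (s n x - \<phi> x))" "integrable M (\<lambda>x. cmod (f x - \<phi> x))"
    using lim(1,4) integrable_continuous[OF K M \<phi>(1)] by simp_all
  have "(LINT x|M. cmod (f x - \<phi> x)) \<le> (LINT x|M. cmod (f x - s n x) + cmod (s n x - \<phi> x))"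
  proof (rule integral_mono)
    show "cmod (f x - \<phi> x) \<le> cmod (f x - s n x) + cmod (s n x - \<phi> x)" for x
      using norm_triangle_ineq[of "f x - s n x" "s n x - \<phi> x"] by simp
  qed (use i in auto)
  also have "\<dots> < \<epsilon>" using i n \<phi>(2) by simp
  finally show ?case using \<phi>(1) by (intro exI[of _ \<phi>] conjI)
qed

text \<open>The approximant is pulled back radially to the disc of radius \<open>L\<close>, which
  contains the values of \<open>f\<close>; this at most doubles the error. The uniform bound is what
  later converts smallness in the mean into smallness for other exponents.\<close>

lemma continuous_dense_bounded:
  fixes M :: "'a::polish_space measure"
  assumes K: "compact (UNIV :: 'a set)" and M: "finite_measure M" "sets M = sets borel"
    and f: "f \<in> borel_measurable M" and L: "\<And>x. cmod (f x) \<le> L" "0 < L" and \<epsilon>: "0 < \<epsilon>"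
  shows "\<exists>\<phi>. continuous_on UNIV \<phi> \<and> (\<forall>x. cmod (\<phi> x) \<le> L) \<and> (LINT x|M. cmod (f x - \<phi> x)) < \<epsilon>"
proof -
  interpret finite_measure M by (rule M)
  have fi: "integrable M f" using f L by (intro integrable_const_bound[of _ L]) auto
  obtain \<phi> where \<phi>: "continuous_on UNIV \<phi>" "(LINT x|M. cmod (f x - \<phi> x)) < \<epsilon> / 2"
    using continuous_dense_L1[OF K M fi, of "\<epsilon> / 2"] \<epsilon> by auto
  define \<psi> where "\<psi> x = (L / max L (cmod (\<phi> x))) *\<^sub>R \<phi> x" for x
  have m0: "0 < max L (cmod (\<phi> x))" for x using L(2) by (simp add: less_max_iff_disj)
  have c: "continuous_on UNIV \<psi>" unfolding \<psi>_def using m0 by (intro continuous_intros \<phi>) (simp add: less_imp_neq[symmetric])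
  have nb: "cmod (\<psi> x) \<le> L" for x
  proof -
    have "cmod (\<psi> x) = L * (cmod (\<phi> x) / max L (cmod (\<phi> x)))" unfolding \<psi>_def using L m0[of x] by simp
    also have "\<dots> \<le> L * 1" using L m0[of x] by (intro mult_left_mono) (auto simp: divide_le_eq_1)
    finally show ?thesis by simp
  qed
  have pt: "cmod (f x - \<psi> x) \<le> 2 * cmod (f x - \<phi> x)" for x
  proof (cases "cmod (\<phi> x) \<le> L")
    case True
    then have "\<psi> x = \<phi> x" unfolding \<psi>_def using L by (simp add: max_def)
    then show ?thesis by simp
  next
    case False
    then have e: "\<psi> x = (L / cmod (\<phi> x)) *\<^sub>R \<phi> x" and pp: "0 < cmod (\<phi> x)" unfolding \<psi>_def using L by (auto simp: max_def)
    have "\<phi> x - \<psi> x = (1 - L / cmod (\<phi> x)) *\<^sub>R \<phi> x" unfolding e by (simp add: scaleR_left_diff_distrib)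
    then have "cmod (\<phi> x - \<psi> x) = (1 - L / cmod (\<phi> x)) * cmod (\<phi> x)" using False pp by simp
    also have "\<dots> = cmod (\<phi> x) - L" using pp by (simp add: field_simps)
    finally have "cmod (\<phi> x - \<psi> x) \<le> cmod (\<phi> x) - cmod (f x)" using L(1)[of x] by simp
    also have "\<dots> \<le> cmod (f x - \<phi> x)" using norm_triangle_ineq2[of "\<phi> x" "f x"] by (simp add: norm_minus_commute)
    finally show ?thesis using norm_triangle_ineq[of "f x - \<phi> x" "\<phi> x - \<psi> x"] by simp
  qed
  have i: "integrable M (\<lambda>x. cmod (f x - \<psi> x))" "integrable M (\<lambda>x. 2 * cmod (f x - \<phi> x))"
    using fi integrable_continuous[OF K M c] integrable_continuous[OF K M \<phi>(1)] by simp_all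
  have "(LINT x|M. cmod (f x - \<psi> x)) \<le> (LINT x|M. 2 * cmod (f x - \<phi> x))" by (rule integral_mono[OF i pt])
  also have "\<dots> < \<epsilon>" using \<phi>(2) by simp
  finally show ?thesis using c nb by (intro exI[of _ \<psi>]) auto
qed

text \<open>All but one power of |f| is estimated by \<open>L\<close>. For uniformly bounded
  functions, smallness in the mean therefore implies smallness in every exponent r \<ge> 1.\<close>

lemma Lp_norm_bounded_le:
  assumes f: "f \<in> borel_measurable M" and i: "integrable M f" and L: "\<And>x. cmod (f x) \<le> L" and r: "1 \<le> r"
  shows "(LINT x|M. cmod (f x) powr r) \<le> L powr (r - 1) * (LINT x|M. cmod (f x))"
proof -
  have pt: "cmod (f x) powr r \<le> L powr (r - 1) * cmod (f x)" for x
  proof -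
    have "cmod (f x) powr r = cmod (f x) powr (r - 1) * cmod (f x)"
      using powr_add[of "cmod (f x)" "r - 1" 1] by simp
    also have "\<dots> \<le> L powr (r - 1) * cmod (f x)" using L r by (intro mult_right_mono powr_mono2) auto
    finally show ?thesis .
  qed
  have ii: "integrable M (\<lambda>x. L powr (r - 1) * cmod (f x))" using i by simp
  have "integrable M (\<lambda>x. cmod (f x) powr r)"
    by (rule Bochner_Integration.integrable_bound[OF ii])
       (use f pt order_trans[OF pt abs_ge_self] in \<open>auto intro!: powr_real_measurable borel_measurable_const\<close>)
  then have "(LINT x|M. cmod (f x) powr r) \<le> (LINT x|M. L powr (r - 1) * cmod (f x))"
    using ii pt by (intro integral_mono)
  then show ?thesis by simp
qed

lemma continuous_in_Lp:
  fixes M :: "'a::polish_space measure"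
  assumes K: "compact (UNIV :: 'a set)" and M: "finite_measure M" "sets M = sets borel"
    and c: "continuous_on UNIV f" and p: "0 < p"
  shows "f \<in> Lp_space M p" "bmeas M f"
proof -
  obtain B where "\<And>x. cmod (f x) \<le> B" using continuous_on_compact_bounded[OF K c] by blast
  moreover have m: "f \<in> borel_measurable M"
    using borel_measurable_continuous_onI[OF c] measurable_cong_sets[OF M(2)] by blast
  ultimately show b: "bmeas M f" unfolding bmeas_def by blast
  show "f \<in> Lp_space M p" unfolding Lp_space_def using m bmeas_powr_integrable[OF M(1) b p] by simp
qed

lemma continuous_dense_Lp:
  fixes M :: "'a::polish_space measure"
  assumes K: "compact (UNIV :: 'a set)" and M: "finite_measure M" "sets M = sets borel"
    and p: "1 \<le> p" and f: "f \<in> Lp_space M p" and \<epsilon>: "0 < \<epsilon>"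
  shows "\<exists>\<phi>. continuous_on UNIV \<phi> \<and> Lp_norm M p (\<lambda>x. f x - \<phi> x) < \<epsilon>"
proof -
  interpret finite_measure M by (rule M)
  have p0: "0 < p" "0 \<le> p" using p by auto
  have fm: "f \<in> borel_measurable M" and fi: "integrable M (\<lambda>x. cmod (f x) powr p)" using f unfolding Lp_space_def by auto
  define g where "g n x = (if cmod (f x) \<le> real n then f x else 0)" for n x
  have gm: "g n \<in> borel_measurable M" for n unfolding g_def using fm by measurable
  \<comment> \<open>The truncation and the approximation each cost \<eta>, and the crude triangle
    inequality multiplies their sum by 4, leaving \<epsilon> / 2.\<close>
  define \<eta> where "\<eta> = \<epsilon> / 16"
  have \<eta>: "0 < \<eta>" unfolding \<eta>_def using \<epsilon> by simp
  have "(\<lambda>n. LINT x|M. cmod (f x - g n x) powr p) \<longlonglongrightarrow> (LINT x|M. 0)"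
  proof (rule integral_dominated_convergence[where w = "\<lambda>x. cmod (f x) powr p"])
    show "AE x in M. (\<lambda>n. cmod (f x - g n x) powr p) \<longlonglongrightarrow> 0"
    proof (intro AE_I2 tendsto_eventually)
      fix x
      obtain N where "cmod (f x) \<le> real N" using real_arch_simple by blast
      then have "\<forall>n\<ge>N. cmod (f x - g n x) powr p = 0" unfolding g_def by auto
      then show "\<forall>\<^sub>F n in sequentially. cmod (f x - g n x) powr p = 0" unfolding eventually_sequentially by blast
    qed
    show "AE x in M. norm (cmod (f x - g n x) powr p) \<le> cmod (f x) powr p" for n
      using p0 by (intro AE_I2) (auto simp: g_def)
    show "(\<lambda>x. cmod (f x - g n x) powr p) \<in> borel_measurable M" for n
      using fm gm[of n] by (intro powr_real_measurable borel_measurable_const) auto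
  qed (use fi in auto)
  then have "\<forall>\<^sub>F n in sequentially. (LINT x|M. cmod (f x - g n x) powr p) < \<eta> powr p"
    using \<eta> by (intro order_tendstoD(2)[of _ 0]) auto
  then obtain n where n: "(LINT x|M. cmod (f x - g n x) powr p) < \<eta> powr p" unfolding eventually_sequentially by blast
  have n': "Lp_norm M p (\<lambda>x. f x - g n x) \<le> \<eta>" using n \<eta> p0 Lp_norm_le_iff[of p \<eta> M "\<lambda>x. f x - g n x"] by simp
  define L where "L = real n + 1"
  have L: "0 < L" "\<And>x. cmod (g n x) \<le> L" unfolding L_def g_def by auto
  define \<delta> where "\<delta> = \<eta> powr p / (2 * L) powr (p - 1)"
  have \<delta>: "0 < \<delta>" unfolding \<delta>_def using \<eta> L by simp
  obtain \<phi> where \<phi>: "continuous_on UNIV \<phi>" "\<And>x. cmod (\<phi> x) \<le> L" "(LINT x|M. cmod (g n x - \<phi> x)) < \<delta>"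
    using continuous_dense_bounded[OF K M gm L(2,1) \<delta>] by blast
  have gL: "g n \<in> Lp_space M p"
    using bmeas_powr_integrable[OF M(1), of "g n" p] gm[of n] L(2) p0 unfolding Lp_space_def bmeas_def by auto
  have \<phi>L: "\<phi> \<in> Lp_space M p" by (rule continuous_in_Lp(1)[OF K M \<phi>(1) p0(1)])
  have dm: "(\<lambda>x. g n x - \<phi> x) \<in> borel_measurable M" using gL \<phi>L unfolding Lp_space_def by auto
  have db: "cmod (g n x - \<phi> x) \<le> 2 * L" for x using norm_triangle_ineq4[of "g n x" "\<phi> x"] L(2)[of x] \<phi>(2)[of x] by linarith
  have di: "integrable M (\<lambda>x. g n x - \<phi> x)" using dm db by (intro integrable_const_bound[of _ "2 * L"]) auto
  have "(LINT x|M. cmod (g n x - \<phi> x) powr p) \<le> (2 * L) powr (p - 1) * (LINT x|M. cmod (g n x - \<phi> x))"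
    by (rule Lp_norm_bounded_le[OF dm di db p])
  also have "\<dots> \<le> (2 * L) powr (p - 1) * \<delta>" using \<phi>(3) by (intro mult_left_mono) auto
  also have "\<dots> = \<eta> powr p" unfolding \<delta>_def using L by simp
  finally have n2: "Lp_norm M p (\<lambda>x. g n x - \<phi> x) \<le> \<eta>" using \<eta> p0 Lp_norm_le_iff[of p \<eta> M "\<lambda>x. g n x - \<phi> x"] by simp
  have "Lp_norm M p (\<lambda>x. (f x - g n x) + (g n x - \<phi> x)) \<le> 4 * (\<eta> + \<eta>)"
    using order_trans[OF Lp_norm_add_le[OF Lp_space_diff[OF f gL p0(2)] Lp_space_diff[OF gL \<phi>L p0(2)] p]] n' n2 by simp
  also have "\<dots> < \<epsilon>" unfolding \<eta>_def using \<epsilon> by simp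
  finally show ?thesis using \<phi>(1) by (intro exI[of _ \<phi>]) simp
qed

text \<open>Carries the bound from continuous to bounded measurable test functions. The approximant
  must be close in the norm of exponent \<open>r\<close> and also when paired with \<open>h\<close>,
  which is only integrable. The factor 4 stems from the crude triangle inequality.\<close>

lemma Lq_duality_bounded:
  fixes M :: "'a::polish_space measure"
  assumes K: "compact (UNIV :: 'a set)" and M: "finite_measure M" "sets M = sets borel"
    and r: "1 \<le> r" and h: "integrable M h" and N: "0 \<le> N"
    and bd: "\<And>g. continuous_on UNIV g \<Longrightarrow> cmod (LINT x|M. h x * cnj (g x)) \<le> N * Lp_norm M r g"
    and g: "g \<in> borel_measurable M" and gL: "\<And>x. cmod (g x) \<le> L"
  shows "cmod (LINT x|M. h x * cnj (g x)) \<le> 4 * N * Lp_norm M r g"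
proof (rule field_le_epsilon)
  fix \<epsilon> :: real assume \<epsilon>: "0 < \<epsilon>"
  interpret finite_measure M by (rule M)
  have r0: "0 < r" "0 \<le> r" using r by auto
  define L' where "L' = \<bar>L\<bar> + 1"
  have L': "0 < L'" "\<And>x. cmod (g x) \<le> L'" unfolding L'_def using gL by (auto intro: order_trans[OF gL])
  define \<delta> where "\<delta> = \<epsilon> / (8 * (N + 1))"
  have \<delta>: "0 < \<delta>" "4 * N * \<delta> \<le> \<epsilon> / 2"
  proof -
    show "0 < \<delta>" unfolding \<delta>_def using \<epsilon> N by simp
    have "4 * N * \<delta> \<le> 4 * (N + 1) * \<delta>" using \<open>0 < \<delta>\<close> N by (intro mult_right_mono mult_left_mono) auto
    also have "\<dots> = \<epsilon> / 2" unfolding \<delta>_def using N by (simp add: field_simps)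
    finally show "4 * N * \<delta> \<le> \<epsilon> / 2" .
  qed
  \<comment> \<open>The first entry controls the pairing with \<open>h\<close>, the second makes the
    error in exponent \<open>r\<close> at most \<delta>.\<close>
  define \<eta> where "\<eta> = min (\<epsilon> / 2) (\<delta> powr r / (2 * L') powr (r - 1))"
  have "0 < \<eta>" unfolding \<eta>_def using \<epsilon> \<delta>(1) L'(1) by simp
  moreover have "\<eta> \<le> \<epsilon> / 2" "\<eta> \<le> \<delta> powr r / (2 * L') powr (r - 1)" unfolding \<eta>_def by (rule min.cobounded1, rule min.cobounded2)
  ultimately have \<eta>: "0 < \<eta>" "\<eta> \<le> \<epsilon> / 2" "\<eta> \<le> \<delta> powr r / (2 * L') powr (r - 1)" .
  have hm: "h \<in> borel_measurable M" using h by auto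
  \<comment> \<open>Approximation in the mean with respect to the density 1 + |h| controls the plain
    integral of the error and its integral against |h| at the same time.\<close>
  define w where "w x = 1 + cmod (h x)" for x
  have w: "w \<in> borel_measurable M" "\<And>x. 0 \<le> w x" "integrable M w" unfolding w_def using h hm by auto
  define M1 where "M1 = density M (\<lambda>x. ennreal (w x))"
  have M1: "finite_measure M1" "sets M1 = sets borel"
  proof -
    have "emeasure M1 (space M1) = (\<integral>\<^sup>+x. ennreal (w x) \<partial>M)"
      unfolding M1_def using w by (simp add: emeasure_density cong: nn_integral_cong)
    then have "emeasure M1 (space M1) \<noteq> \<infinity>" using nn_integral_eq_integral[OF w(3)] w(2) by simp
    then show "finite_measure M1" by (rule finite_measureI)
    show "sets M1 = sets borel" unfolding M1_def using M by simp
  qed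
  have gM1: "g \<in> borel_measurable M1" unfolding M1_def using g by simp
  obtain \<phi> where \<phi>: "continuous_on UNIV \<phi>" "\<And>x. cmod (\<phi> x) \<le> L'" "(LINT x|M1. cmod (g x - \<phi> x)) < \<eta>"
    using continuous_dense_bounded[OF K M1 gM1 L'(2,1) \<eta>(1)] by blast
  have \<phi>L: "\<phi> \<in> Lp_space M r" "bmeas M \<phi>" using continuous_in_Lp[OF K M \<phi>(1) r0(1)] by auto
  have \<phi>m: "\<phi> \<in> borel_measurable M" using \<phi>L unfolding bmeas_def by blast
  have gb: "bmeas M g" unfolding bmeas_def using g gL by blast
  have gLp: "g \<in> Lp_space M r" unfolding Lp_space_def using bmeas_powr_integrable[OF M(1) gb r0(1)] g by simp
  have dm: "(\<lambda>x. g x - \<phi> x) \<in> borel_measurable M" using g \<phi>m by simp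
  have db: "cmod (g x - \<phi> x) \<le> 2 * L'" for x using norm_triangle_ineq4[of "g x" "\<phi> x"] L'(2)[of x] \<phi>(2)[of x] by linarith
  have di: "integrable M (\<lambda>x. g x - \<phi> x)" using dm db by (intro integrable_const_bound[of _ "2 * L'"]) auto
  have hd: "integrable M (\<lambda>x. cmod (h x) * cmod (g x - \<phi> x))"
  proof (rule Bochner_Integration.integrable_bound)
    show "integrable M (\<lambda>x. 2 * L' * cmod (h x))" using h by simp
    show "AE x in M. norm (cmod (h x) * cmod (g x - \<phi> x)) \<le> norm (2 * L' * cmod (h x))"
    proof (rule AE_I2)
      fix x
      have "cmod (g x - \<phi> x) * cmod (h x) \<le> 2 * L' * cmod (h x)" by (intro mult_right_mono db) simp
      then show "norm (cmod (h x) * cmod (g x - \<phi> x)) \<le> norm (2 * L' * cmod (h x))" using L' by (simp add: mult.commute)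
    qed
  qed (use hm dm in auto)
  have "(LINT x|M1. cmod (g x - \<phi> x)) = (LINT x|M. w x *\<^sub>R cmod (g x - \<phi> x))"
    unfolding M1_def using w dm by (intro integral_density) auto
  also have "\<dots> = (LINT x|M. cmod (g x - \<phi> x) + cmod (h x) * cmod (g x - \<phi> x))"
    by (simp add: w_def distrib_right)
  also have "\<dots> = (LINT x|M. cmod (g x - \<phi> x)) + (LINT x|M. cmod (h x) * cmod (g x - \<phi> x))"
    using di hd by simp
  finally have "(LINT x|M. cmod (g x - \<phi> x)) + (LINT x|M. cmod (h x) * cmod (g x - \<phi> x)) < \<eta>" using \<phi>(3) by simp
  moreover have "0 \<le> (LINT x|M. cmod (g x - \<phi> x))" "0 \<le> (LINT x|M. cmod (h x) * cmod (g x - \<phi> x))" by simp_all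
  ultimately have d1: "(LINT x|M. cmod (g x - \<phi> x)) \<le> \<eta>" and d2: "(LINT x|M. cmod (h x) * cmod (g x - \<phi> x)) \<le> \<epsilon> / 2"
    using \<eta>(2) by linarith+
  have "(LINT x|M. cmod (g x - \<phi> x) powr r) \<le> (2 * L') powr (r - 1) * (LINT x|M. cmod (g x - \<phi> x))"
    by (rule Lp_norm_bounded_le[OF dm di db r])
  also have "\<dots> \<le> (2 * L') powr (r - 1) * (\<delta> powr r / (2 * L') powr (r - 1))" using d1 \<eta>(3) by (intro mult_left_mono) auto
  also have "\<dots> = \<delta> powr r" using L' by simp
  finally have dn: "Lp_norm M r (\<lambda>x. g x - \<phi> x) \<le> \<delta>" using \<delta> r0 Lp_norm_le_iff[of r \<delta> M "\<lambda>x. g x - \<phi> x"] by simp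
  have \<phi>n: "Lp_norm M r \<phi> \<le> 4 * (Lp_norm M r g + \<delta>)"
    using Lp_norm_diff_le[OF gLp Lp_space_diff[OF gLp \<phi>L(1) r0(2)] r] dn by simp
  have i1: "integrable M (\<lambda>x. h x * cnj (\<phi> x))" and i2: "integrable M (\<lambda>x. h x * cnj (g x - \<phi> x))"
    by (rule integrable_mult_cnj_bounded[OF h \<phi>m \<phi>(2)], rule integrable_mult_cnj_bounded[OF h dm db])
  have "(LINT x|M. h x * cnj (g x)) = (LINT x|M. h x * cnj (\<phi> x) + h x * cnj (g x - \<phi> x))"
    by (intro Bochner_Integration.integral_cong) (simp_all add: algebra_simps)
  then have "(LINT x|M. h x * cnj (g x)) = (LINT x|M. h x * cnj (\<phi> x)) + (LINT x|M. h x * cnj (g x - \<phi> x))"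
    using i1 i2 by simp
  then have "cmod (LINT x|M. h x * cnj (g x)) \<le> cmod (LINT x|M. h x * cnj (\<phi> x)) + cmod (LINT x|M. h x * cnj (g x - \<phi> x))"
    using norm_triangle_ineq by simp
  moreover have "cmod (LINT x|M. h x * cnj (g x - \<phi> x)) \<le> (LINT x|M. cmod (h x * cnj (g x - \<phi> x)))"
    by (rule integral_norm_bound)
  moreover have "(LINT x|M. cmod (h x * cnj (g x - \<phi> x))) = (LINT x|M. cmod (h x) * cmod (g x - \<phi> x))"
    unfolding norm_mult complex_mod_cnj ..
  moreover have "cmod (LINT x|M. h x * cnj (\<phi> x)) \<le> N * (4 * (Lp_norm M r g + \<delta>))"
    using bd[OF \<phi>(1)] mult_left_mono[OF \<phi>n N] by linarith
  moreover have "N * (4 * (Lp_norm M r g + \<delta>)) = 4 * N * Lp_norm M r g + 4 * N * \<delta>" by (simp add: algebra_simps)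
  ultimately show "cmod (LINT x|M. h x * cnj (g x)) \<le> 4 * N * Lp_norm M r g + \<epsilon>"
    using d2 \<delta>(2) by linarith
qed

text \<open>The converse of Hoelder's inequality is tested on \<open>h |h|\<^sup>q\<^sup>-\<^sup>2\<close> cut off at height \<open>n\<close>.\<close>

lemma Lq_duality:
  fixes M :: "'a::polish_space measure"
  assumes K: "compact (UNIV :: 'a set)" and M: "finite_measure M" "sets M = sets borel"
    and q: "1 < q" and h: "integrable M h" and N: "0 \<le> N"
    and bd: "\<And>g. continuous_on UNIV g \<Longrightarrow> cmod (LINT x|M. h x * cnj (g x)) \<le> N * Lp_norm M (q / (q - 1)) g"
  shows "h \<in> Lp_space M q" "Lp_norm M q h \<le> 4 * N"
proof -
  \<comment> \<open>The conjugate exponent: (q - 1) r = q, so the test function of modulus |u|^(q -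
    1) has r-th power integral I.\<close>
  define r where "r = q / (q - 1)"
  have r: "1 \<le> r" "(q - 1) * r = q" "1 / r = (q - 1) / q" unfolding r_def using q by (auto simp: field_simps)
  interpret finite_measure M by (rule M)
  have hm: "h \<in> borel_measurable M" using h by auto
  define u where "u n x = (if cmod (h x) \<le> real n then h x else 0)" for n x
  have um: "u n \<in> borel_measurable M" for n unfolding u_def using hm by measurable
  have uN: "cmod (u n x) \<le> real n" for n x unfolding u_def by auto
  have ui: "integrable M (\<lambda>x. cmod (u n x) powr q)" for n
    by (rule bmeas_powr_integrable[OF M(1)]) (use um uN q in \<open>auto simp: bmeas_def\<close>)
  have ub: "(LINT x|M. cmod (u n x) powr q) \<le> (4 * N) powr q" for n
  proof -
    define I where "I = (LINT x|M. cmod (u n x) powr q)"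
    define g where "g x = u n x * complex_of_real (cmod (u n x) powr (q - 2))" for x
    have gc: "cmod (g x) = cmod (u n x) powr (q - 1)" for x
      unfolding g_def norm_mult using powr_add[of "cmod (u n x)" 1 "q - 2"] by simp
    have gm: "g \<in> borel_measurable M" unfolding g_def using um[of n]
      by (intro borel_measurable_times borel_measurable_of_real powr_real_measurable borel_measurable_const) auto
    have gb: "cmod (g x) \<le> real n powr (q - 1)" for x unfolding gc using uN[of n x] q by (intro powr_mono2) auto
    have hg: "h x * cnj (g x) = complex_of_real (cmod (u n x) powr q)" for x
    proof -
      have "h x * cnj (g x) = (u n x * cnj (u n x)) * complex_of_real (cmod (u n x) powr (q - 2))"
        unfolding g_def by (simp add: u_def)
      also have "\<dots> = complex_of_real ((cmod (u n x))\<^sup>2 * cmod (u n x) powr (q - 2))" unfolding mult_cnj_cmod by simp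
      also have "(cmod (u n x))\<^sup>2 * cmod (u n x) powr (q - 2) = cmod (u n x) powr q"
        using powr_add[of "cmod (u n x)" 2 "q - 2"] by simp
      finally show ?thesis .
    qed
    have I0: "0 \<le> I" unfolding I_def by simp
    have "Lp_norm M r g = I powr (1 / r)" unfolding Lp_norm_def gc I_def powr_powr r(2) ..
    moreover have "cmod (LINT x|M. h x * cnj (g x)) = I"
      unfolding hg I_def integral_complex_of_real using I0 unfolding I_def by simp
    ultimately have "I \<le> 4 * N * I powr (1 / r)"
      using Lq_duality_bounded[OF K M r(1) h N bd[folded r_def] gm gb] by simp
    then have le: "I \<le> 4 * N * I powr ((q - 1) / q)" unfolding r(3) .
    \<comment> \<open>The integral I is finite thanks to the truncation, so its power can be
      cancelled.\<close>
    show "I \<le> (4 * N) powr q"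
    proof (cases "I = 0")
      case False
      then have Ip: "0 < I" using I0 by simp
      have "I powr (1 / q) * I powr ((q - 1) / q) = I" using Ip q by (simp add: powr_add[symmetric] add_divide_distrib[symmetric])
      then have "I powr (1 / q) * I powr ((q - 1) / q) \<le> 4 * N * I powr ((q - 1) / q)" using le by simp
      then have "I powr (1 / q) \<le> 4 * N" using Ip by simp
      then have "(I powr (1 / q)) powr q \<le> (4 * N) powr q" using q by (intro powr_mono2) auto
      then show ?thesis using Ip q by (simp add: powr_powr)
    qed simp
  qed
  have lim: "AE x in M. (\<lambda>n. u n x) \<longlonglongrightarrow> h x"
  proof (intro AE_I2 tendsto_eventually)
    fix x
    obtain n0 where "cmod (h x) \<le> real n0" using real_arch_simple by blast
    then have "\<forall>n\<ge>n0. u n x = h x" unfolding u_def by auto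
    then show "\<forall>\<^sub>F n in sequentially. u n x = h x" unfolding eventually_sequentially by blast
  qed
  have q0: "0 < q" using q by simp
  note F = Fatou_powr[OF um hm lim ui ub q0 powr_ge_zero]
  show "h \<in> Lp_space M q" unfolding Lp_space_def using hm F(1) by simp
  show "Lp_norm M q h \<le> 4 * N" using Lp_norm_le_iff[of q "4 * N" M h] F(2) N q0 by simp
qed

section \<open>Fourier multipliers\<close>

context hypergroup_dual
begin

abbreviation "multiplier A \<sigma> \<equiv> left_fourier_multiplier conv e ck haar rep A \<sigma>"
abbreviation "hbound p q \<sigma> \<equiv> hoermander_bound conv e ck haar rep p q \<sigma>"

lemma dm_pos: "c \<in> D \<Longrightarrow> 0 < dm c"
  using dual_eq_class(1) unfolding irreducible_rep_def by blast

lemma hoermander_level: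
  assumes "hbound p q \<sigma> = ennreal H" "0 < y"
  shows "ennreal y * sum_power {c \<in> D. y \<le> mat_op_norm (\<sigma> c)} (\<lambda>c. (hdim c)\<^sup>2) (1 / p - 1 / q) \<le> ennreal H"
  unfolding assms(1)[symmetric] hoermander_bound_def using assms(2) by (intro SUP_upper2[of y]) auto

text \<open>A single level y of the supremum bounds y times a power of the total of the k^2 by H.
  Solving for the total gives the weak-type condition of Paley's inequality, here on finite sets of
  classes.\<close>

lemma hoermander_weak:
  assumes H: "hbound p q \<sigma> = ennreal H" "0 \<le> H" and y: "0 < y" and \<kappa>: "0 < 1 / p - 1 / q" and F: "finite F" "F \<subseteq> D"
  shows "(\<Sum>c\<in>{c\<in>F. y \<le> mat_op_norm (\<sigma> c)}. (hdim c)\<^sup>2) \<le> (H / y) powr (1 / (1 / p - 1 / q))"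
proof -
  define \<kappa> where "\<kappa> = 1 / p - 1 / q"
  define I where "I = {c \<in> D. y \<le> mat_op_norm (\<sigma> c)}"
  define S where "S = {c\<in>F. y \<le> mat_op_norm (\<sigma> c)}"
  define T where "T = (\<Sum>\<^sub>\<infinity>c\<in>I. ennreal ((hdim c)\<^sup>2))"
  have S: "finite S" "S \<subseteq> I" unfolding S_def I_def using F by auto
  show ?thesis unfolding S_def[symmetric] \<kappa>_def[symmetric]
  proof (cases "I = {}")
    case True
    then show "(\<Sum>c\<in>S. (hdim c)\<^sup>2) \<le> (H / y) powr (1 / \<kappa>)" using S by simp
  next
    case False
    have lev: "ennreal y * (if T = \<infinity> then \<infinity> else ennreal (enn2real T powr \<kappa>)) \<le> ennreal H"
      using hoermander_level[OF H(1) y] \<kappa> False unfolding sum_power_def Let_def I_def[symmetric] T_def[symmetric] \<kappa>_def[symmetric] by simp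
    \<comment> \<open>An infinite sum would make the level itself infinite, since y > 0.\<close>
    have Tf: "T \<noteq> \<infinity>" using lev y by (auto simp: ennreal_mult_top top_unique split: if_splits)
    define t where "t = enn2real T"
    have t0: "0 \<le> t" unfolding t_def by simp
    have Tt: "T = ennreal t" unfolding t_def using Tf by (simp add: less_top)
    have "ennreal (y * t powr \<kappa>) \<le> ennreal H" using lev Tf y unfolding t_def by (simp add: ennreal_mult)
    then have "y * t powr \<kappa> \<le> H" using H(2) by (simp add: ennreal_le_iff)
    then have "t powr \<kappa> \<le> H / y" using y by (simp add: field_simps)
    then have "(t powr \<kappa>) powr (1 / \<kappa>) \<le> (H / y) powr (1 / \<kappa>)" using \<kappa> unfolding \<kappa>_def by (intro powr_mono2) auto
    then have tle: "t \<le> (H / y) powr (1 / \<kappa>)" using t0 \<kappa>[folded \<kappa>_def] unfolding powr_powr by simp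
    have "(\<Sum>c\<in>S. ennreal ((hdim c)\<^sup>2)) \<le> T" unfolding T_def
      using S by (subst nonneg_infsum_complete) (auto intro!: SUP_upper)
    then have "(\<Sum>c\<in>S. (hdim c)\<^sup>2) \<le> t" using t0 unfolding Tt by (simp add: sum_ennreal)
    with tle show "(\<Sum>c\<in>S. (hdim c)\<^sup>2) \<le> (H / y) powr (1 / \<kappa>)" by simp
  qed
qed

text \<open>With exponent 0 the bracket is 1 on a nonempty index set, so the level y equal to the
  norm of \<open>\<sigma> c\<close> already shows the bound.\<close>

lemma hoermander_sup:
  assumes H: "hbound p q \<sigma> = ennreal H" "0 \<le> H" and \<kappa>: "1 / p - 1 / q = 0" and c: "c \<in> D" "0 < mat_op_norm (\<sigma> c)"
  shows "mat_op_norm (\<sigma> c) \<le> H"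
proof -
  have "{d \<in> D. mat_op_norm (\<sigma> c) \<le> mat_op_norm (\<sigma> d)} \<noteq> {}" using c by auto
  then have "ennreal (mat_op_norm (\<sigma> c)) \<le> ennreal H"
    using hoermander_level[OF H(1) c(2)] unfolding sum_power_def Let_def \<kappa> by (simp only: if_False if_True refl mult_1_right)
  then show ?thesis using H(2) by (simp add: ennreal_le_iff)
qed

lemma hs_multiplier:
  assumes A: "multiplier A \<sigma>" and f: "cts f" and c: "c \<in> D"
  shows "sqrt (hs c (A f)) \<le> mat_op_norm (\<sigma> c) * sqrt (hs c f)"
proof -
  have s: "\<sigma> c \<in> carrier_mat (dm c) (dm c)" and fe: "fourier e haar (A f) (rep c) = \<sigma> c * fourier e haar f (rep c)"
    using A f c unfolding left_fourier_multiplier_def by auto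
  have fc: "fourier e haar f (rep c) \<in> carrier_mat (dm c) (dm c)" unfolding fourier_def by simp
  have "hs c (A f) \<le> (mat_op_norm (\<sigma> c))\<^sup>2 * hs c f"
    unfolding hs_fourier fe by (rule frobenius_mult_le[OF s fc dm_pos[OF c]])
  then have "sqrt (hs c (A f)) \<le> sqrt ((mat_op_norm (\<sigma> c))\<^sup>2 * hs c f)" by (rule real_sqrt_le_mono)
  then show ?thesis using mat_op_norm_nonneg[OF s dm_pos[OF c]] by (simp add: real_sqrt_mult)
qed

lemma hs_Cauchy_Schwarz:
  "cmod (\<Sum>i<dm c. \<Sum>j<dm c. ip haar f (mc c i j) * cnj (ip haar g (mc c i j))) \<le> sqrt (hs c f) * sqrt (hs c g)"
proof -
  have "cmod (\<Sum>i<dm c. \<Sum>j<dm c. ip haar f (mc c i j) * cnj (ip haar g (mc c i j)))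
      \<le> (\<Sum>i<dm c. \<Sum>j<dm c. \<bar>cmod (ip haar f (mc c i j))\<bar> * \<bar>cmod (ip haar g (mc c i j))\<bar>)"
    by (intro sum_norm_le) (simp add: norm_mult)
  also have "\<dots> \<le> sqrt (hs c f) * sqrt (hs c g)"
    unfolding hs_def by (rule L2_double_sum_Cauchy_Schwarz)
  finally show ?thesis .
qed

lemma multiplier_bilinear_trig:
  assumes pq: "1 < p" "p \<le> 2" "2 \<le> q" and A: "multiplier A \<sigma>" and H: "hbound p q \<sigma> = ennreal H" "0 \<le> H"
    and f: "cts f" and g: "g \<in> trig"
  shows "cmod (LINT x|haar. A f x * cnj (g x)) \<le>
    sqrt (paley_const p) * sqrt (paley_const (q / (q - 1))) * H * Lp_norm haar p f * Lp_norm haar (q / (q - 1)) g"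
proof -
  define w where "w c = mat_op_norm (\<sigma> c)" for c
  obtain F where F: "finite F" "F \<subseteq> D" and gF: "proj F g = g"
    using trig_finite_spectrum[OF g] unfolding finite_spectrum_def by blast
  have w0: "0 \<le> w c" if "c \<in> D" for c
    unfolding w_def by (rule mat_op_norm_nonneg[OF _ dm_pos[OF that]]) (use A that in \<open>auto simp: left_fourier_multiplier_def\<close>)
  have hs0: "0 \<le> hs c f" for c f unfolding hs_def by (intro sum_nonneg) auto
  have "bmeas haar u" if "cts u" for u by (rule continuous_in_Lp(2)[OF K finite_haar sets_haar that, of 1]) simp
  then have gb: "bmeas haar g" and fb: "bmeas haar f" using trig_cts[OF g] f by blast+
  \<comment> \<open>The Paley estimate takes powers of the weights and wants them positive; classes
    with vanishing symbol contribute nothing to the sum.\<close>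
  define G where "G = {c \<in> F. 0 < w c}"
  have G: "finite G" "G \<subseteq> D" "G \<subseteq> F" unfolding G_def using F by auto
  have Af: "A f \<in> Lp_space haar 1" using A f unfolding left_fourier_multiplier_def by blast
  have "integrable haar (\<lambda>x. cmod (A f x))" using Af unfolding Lp_space_def by simp
  then have Ai: "integrable haar (A f)" using Af unfolding Lp_space_def by (auto dest: integrable_norm_cancel)
  have "(LINT x|haar. A f x * cnj (g x)) = (\<Sum>c\<in>F. hdim c * (\<Sum>i<dm c. \<Sum>j<dm c. ip haar (A f) (mc c i j) * cnj (ip haar g (mc c i j))))"
    unfolding parseval[OF Ai gF F] sum_distrib_left by (simp only: mult.assoc)
  then have "cmod (LINT x|haar. A f x * cnj (g x)) \<le> (\<Sum>c\<in>F. hdim c * w c * sqrt (hs c f) * sqrt (hs c g))"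
  proof (simp only:, intro sum_norm_le)
    fix c assume cF: "c \<in> F"
    then have c: "c \<in> D" using F by blast
    have "cmod (\<Sum>i<dm c. \<Sum>j<dm c. ip haar (A f) (mc c i j) * cnj (ip haar g (mc c i j))) \<le> sqrt (hs c (A f)) * sqrt (hs c g)"
      by (rule hs_Cauchy_Schwarz)
    moreover have "sqrt (hs c (A f)) * sqrt (hs c g) \<le> w c * sqrt (hs c f) * sqrt (hs c g)"
      unfolding w_def by (intro mult_right_mono hs_multiplier[OF A f c]) (simp add: hs0)
    ultimately have "cmod (\<Sum>i<dm c. \<Sum>j<dm c. ip haar (A f) (mc c i j) * cnj (ip haar g (mc c i j))) \<le> w c * sqrt (hs c f) * sqrt (hs c g)"
      by linarith
    then have "hdim c * cmod (\<Sum>i<dm c. \<Sum>j<dm c. ip haar (A f) (mc c i j) * cnj (ip haar g (mc c i j))) \<le> hdim c * (w c * sqrt (hs c f) * sqrt (hs c g))"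
      using hd_pos[OF c] by (intro mult_left_mono) auto
    then show "cmod (hdim c * (\<Sum>i<dm c. \<Sum>j<dm c. ip haar (A f) (mc c i j) * cnj (ip haar g (mc c i j)))) \<le> hdim c * w c * sqrt (hs c f) * sqrt (hs c g)"
      using hd_pos[OF c] by (simp only: norm_mult norm_of_real abs_of_pos mult.assoc)
  qed
  also have "(\<Sum>c\<in>F. hdim c * w c * sqrt (hs c f) * sqrt (hs c g)) = (\<Sum>c\<in>G. hdim c * w c * sqrt (hs c f) * sqrt (hs c g))"
  proof (rule sum.mono_neutral_right)
    show "\<forall>c\<in>F - G. hdim c * w c * sqrt (hs c f) * sqrt (hs c g) = 0"
    proof
      fix c assume c: "c \<in> F - G"
      then have "w c = 0" using w0[of c] F unfolding G_def by force
      then show "hdim c * w c * sqrt (hs c f) * sqrt (hs c g) = 0" by simp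
    qed
  qed (use F G in auto)
  also have "\<dots> \<le> sqrt (paley_const p) * sqrt (paley_const (q / (q - 1))) * H * Lp_norm haar p f * Lp_norm haar (q / (q - 1)) g"
  proof (cases "G = {}")
    case True
    have "1 < q / (q - 1)" "q / (q - 1) \<le> 2" using pq by (auto simp: field_simps)
    then have "0 < paley_const (q / (q - 1))" "0 < paley_const p" using paley_const_pos pq by auto
    then show ?thesis using True H by (auto intro!: mult_nonneg_nonneg)
  next
    case False
    then obtain c0 where c0: "c0 \<in> G" by blast
    have w00: "0 < w c0" "c0 \<in> D" using c0 G unfolding G_def by auto
    \<comment> \<open>A class with nonzero symbol forces H > 0: at exponent 0 by the bound on the
      supremum, otherwise because H = 0 would make the weak-type bound 0 although the hyperdimension
      is positive.\<close>
    have Hp: "0 < H"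
    proof (cases "1 / p - 1 / q = 0")
      case True
      have "w c0 \<le> H" unfolding w_def by (rule hoermander_sup[OF H True w00(2)]) (use w00 in \<open>simp add: w_def\<close>)
      then show ?thesis using w00 by simp
    next
      case False
      have "1 / p \<ge> 1 / 2" "1 / q \<le> 1 / 2" using pq by (auto simp: field_simps)
      then have k: "0 < 1 / p - 1 / q" using False by argo
      have "(hdim c0)\<^sup>2 \<le> (\<Sum>c\<in>{c\<in>G. w c0 \<le> w c}. (hdim c)\<^sup>2)"
        using c0 G by (intro member_le_sum) auto
      moreover have "\<dots> \<le> (H / w c0) powr (1 / (1 / p - 1 / q))"
        unfolding w_def by (rule hoermander_weak[OF H _ k G(1,2)]) (use w00 in \<open>simp add: w_def\<close>)
      ultimately have "(hdim c0)\<^sup>2 \<le> (H / w c0) powr (1 / (1 / p - 1 / q))" by linarith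
      moreover have "0 < (hdim c0)\<^sup>2" using hd_pos[OF w00(2)] by simp
      ultimately have "H \<noteq> 0" by auto
      then show ?thesis using H by simp
    qed
    interpret paley_system haar G hdim hs by (rule paley_system_dual[OF G(1,2)])
    show ?thesis
    proof (rule paley_bilinear[OF pq fb gb _ Hp])
      show "0 < w c" if "c \<in> G" for c using that unfolding G_def by simp
      show "(\<Sum>c\<in>{c\<in>G. y \<le> w c}. (hdim c)\<^sup>2) \<le> (H / y) powr (1 / (1 / p - 1 / q))" if "0 < 1 / p - 1 / q" "0 < y" for y
        unfolding w_def by (rule hoermander_weak[OF H that(2,1) G(1,2)])
      show "w c \<le> H" if "1 / p - 1 / q = 0" "c \<in> G" for c
        unfolding w_def by (rule hoermander_sup[OF H that(1)]) (use that G in \<open>auto simp: G_def w_def\<close>)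
    qed
  qed
  finally show ?thesis .
qed

end

section \<open>Extension of an operator by closing its graph\<close>

definition graph_closure :: "'a::topological_space measure \<Rightarrow> real \<Rightarrow> real \<Rightarrow> (('a \<Rightarrow> complex) \<Rightarrow> 'a \<Rightarrow> complex) \<Rightarrow> ('a \<Rightarrow> complex) \<Rightarrow> ('a \<Rightarrow> complex) \<Rightarrow> bool" where
  "graph_closure M p q A f h \<longleftrightarrow> f \<in> Lp_space M p \<and> h \<in> Lp_space M q \<and>
     (\<forall>\<delta>>0. \<exists>g. continuous_on UNIV g \<and> Lp_norm M p (\<lambda>x. f x - g x) \<le> \<delta> \<and> Lp_norm M q (\<lambda>x. h x - A g x) \<le> \<delta>)"

locale densely_bounded_operator = prob_space M for M :: "'a::polish_space measure" +
  fixes A :: "('a \<Rightarrow> complex) \<Rightarrow> 'a \<Rightarrow> complex" and p q B :: real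
  assumes K: "compact (UNIV :: 'a set)" and M: "sets M = sets borel" and p: "1 \<le> p" and q: "1 \<le> q" and B: "0 \<le> B"
    and lin: "linear_op_on M {f. continuous_on UNIV f} A"
    and A_Lq: "\<And>f. continuous_on UNIV f \<Longrightarrow> A f \<in> Lp_space M q"
    and A_le: "\<And>f. continuous_on UNIV f \<Longrightarrow> Lp_norm M q (A f) \<le> B * Lp_norm M p f"
begin

abbreviation "cts f \<equiv> continuous_on UNIV f"
abbreviation "R \<equiv> graph_closure M p q A"

lemma p0: "0 < p" "0 \<le> p" and q0: "0 < q" "0 \<le> q" using p q by auto

lemma cLp: "cts f \<Longrightarrow> f \<in> Lp_space M p"
  by (rule continuous_in_Lp(1)[OF K finite_measure_axioms M _ p0(1)])

lemma Lp_meas: "f \<in> Lp_space M r \<Longrightarrow> f \<in> borel_measurable M" unfolding Lp_space_def by simp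

lemma A_add: "cts f \<Longrightarrow> cts g \<Longrightarrow> AE x in M. A (\<lambda>t. f t + g t) x = A f x + A g x"
  and A_scale: "cts f \<Longrightarrow> AE x in M. A (\<lambda>t. c * f t) x = c * A f x"
  using lin unfolding linear_op_on_def by blast+

lemma A_diff_le:
  assumes f: "cts f" and g: "cts g"
  shows "Lp_norm M q (\<lambda>x. A f x - A g x) \<le> B * Lp_norm M p (\<lambda>x. f x - g x)"
proof -
  have c: "cts (\<lambda>x. -1 * g x)" "cts (\<lambda>x. f x - g x)" using f g by (auto intro!: continuous_intros)
  have "AE x in M. A (\<lambda>t. f t + -1 * g t) x = A f x - A g x"
    using A_add[OF f c(1)] A_scale[OF g, of "-1"] by eventually_elim simp
  then have "AE x in M. A f x - A g x = A (\<lambda>t. f t - g t) x" by eventually_elim simp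
  then have "Lp_norm M q (\<lambda>x. A f x - A g x) = Lp_norm M q (A (\<lambda>x. f x - g x))"
    by (rule Lp_norm_cong_AE) (intro Lp_meas[of _ q] Lp_space_diff A_Lq f g c q0)+
  then show ?thesis using A_le[OF c(2)] by simp
qed

lemma Lp_norm_triangle:
  assumes "1 \<le> r" "f \<in> Lp_space M r" "g \<in> Lp_space M r" "h \<in> Lp_space M r"
  shows "Lp_norm M r (\<lambda>x. f x - h x) \<le> 4 * (Lp_norm M r (\<lambda>x. f x - g x) + Lp_norm M r (\<lambda>x. g x - h x))"
proof -
  have "0 \<le> r" using assms by simp
  then show ?thesis using Lp_norm_add_le[OF Lp_space_diff[of f M r g] Lp_space_diff[of g M r h] assms(1)] assms by simp
qed

text \<open>Continuous approximants at the rate 2^(-n) have images that are Cauchy at a geometric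
  rate, and the limit given by \<open>Lp_complete\<close> is the required partner.\<close>

lemma R_exists:
  assumes f: "f \<in> Lp_space M p"
  shows "\<exists>h. R f h"
proof -
  have "\<forall>n::nat. \<exists>\<phi>. cts \<phi> \<and> Lp_norm M p (\<lambda>x. f x - \<phi> x) < (1 / 2) ^ n"
    using continuous_dense_Lp[OF K finite_measure_axioms M p f] by simp
  then obtain \<phi> where \<phi>: "\<And>n. cts (\<phi> n)" "\<And>n. Lp_norm M p (\<lambda>x. f x - \<phi> n x) < (1 / 2) ^ n" by metis
  \<comment> \<open>Two approximants with indices at least n differ by at most 4 (2^(-n) + 2^(-n)),
    whence 8 B; the summand 1 keeps the constant positive when B = 0.\<close>
  define c where "c = 8 * B + 1"
  have c0: "0 < c" unfolding c_def using B by simp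
  have C: "Lp_norm M q (\<lambda>x. A (\<phi> m) x - A (\<phi> n) x) \<le> c * (1 / 2) ^ n" if mn: "n \<le> m" for m n
  proof -
    have "Lp_norm M p (\<lambda>x. \<phi> m x - \<phi> n x) \<le> 4 * (Lp_norm M p (\<lambda>x. \<phi> m x - f x) + Lp_norm M p (\<lambda>x. f x - \<phi> n x))"
      by (intro Lp_norm_triangle p f cLp \<phi>)
    moreover have "(1 / 2 :: real) ^ m \<le> (1 / 2) ^ n" using mn by (intro power_decreasing) auto
    ultimately have "Lp_norm M p (\<lambda>x. \<phi> m x - \<phi> n x) \<le> 8 * (1 / 2) ^ n"
      using \<phi>(2)[of m] \<phi>(2)[of n] unfolding Lp_norm_minus_commute[of M p "\<phi> m" f] by argo
    then have "Lp_norm M q (\<lambda>x. A (\<phi> m) x - A (\<phi> n) x) \<le> B * (8 * (1 / 2) ^ n)"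
      using order_trans[OF A_diff_le[OF \<phi>(1) \<phi>(1)] mult_left_mono[OF _ B]] by blast
    also have "\<dots> \<le> c * (1 / 2) ^ n" unfolding c_def by (simp add: algebra_simps)
    finally show ?thesis .
  qed
  obtain h where h: "h \<in> Lp_space M q" "\<And>n. Lp_norm M q (\<lambda>x. h x - A (\<phi> n) x) \<le> c * (1 / 2) ^ n"
    by (rule Lp_complete[of "\<lambda>n. A (\<phi> n)" q c]) (use A_Lq \<phi> q C c0 in auto)
  have "R f h" unfolding graph_closure_def
  proof (intro conjI allI impI f h(1))
    fix \<delta> :: real assume \<delta>: "0 < \<delta>"
    have "0 < \<delta> / (c + 1)" using \<delta> c0 by simp
    then obtain n where n: "(1 / 2) ^ n < \<delta> / (c + 1)" using real_arch_pow_inv[of "\<delta> / (c + 1)" "1 / 2"] by auto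
    then have "(c + 1) * (1 / 2) ^ n < \<delta>" using c0 by (simp add: field_simps)
    then have "c * (1 / 2) ^ n + (1 / 2) ^ n \<le> \<delta>" by (simp add: algebra_simps)
    moreover have "0 \<le> c * (1 / 2) ^ n" "0 \<le> (1 / 2 :: real) ^ n" using c0 by auto
    ultimately have "Lp_norm M p (\<lambda>x. f x - \<phi> n x) \<le> \<delta>" "Lp_norm M q (\<lambda>x. h x - A (\<phi> n) x) \<le> \<delta>"
      using \<phi>(2)[of n] h(2)[of n] by linarith+
    then show "\<exists>g. cts g \<and> Lp_norm M p (\<lambda>x. f x - g x) \<le> \<delta> \<and> Lp_norm M q (\<lambda>x. h x - A g x) \<le> \<delta>"
      using \<phi>(1) by (intro exI[of _ "\<phi> n"] conjI)
  qed
  then show ?thesis by (intro exI[of _ h])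
qed

text \<open>The factor 16 is 4 times 4: the crude triangle inequality is applied once to pass from
  \<open>h\<close> to \<open>A g\<close> and once to pass from \<open>g\<close> to
  \<open>f\<close>.\<close>

lemma R_bounded:
  assumes "R f h"
  shows "Lp_norm M q h \<le> 16 * B * Lp_norm M p f"
proof (rule field_le_epsilon)
  fix \<epsilon> :: real assume \<epsilon>: "0 < \<epsilon>"
  have f: "f \<in> Lp_space M p" and h: "h \<in> Lp_space M q" using assms unfolding graph_closure_def by auto
  define \<delta> where "\<delta> = \<epsilon> / (4 + 16 * B)"
  have \<delta>: "0 < \<delta>" "(4 + 16 * B) * \<delta> = \<epsilon>" unfolding \<delta>_def using \<epsilon> B by (auto simp: field_simps)
  obtain g where g: "cts g" "Lp_norm M p (\<lambda>x. f x - g x) \<le> \<delta>" "Lp_norm M q (\<lambda>x. h x - A g x) \<le> \<delta>"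
    using assms \<delta> unfolding graph_closure_def by blast
  have "Lp_norm M q h \<le> 4 * (Lp_norm M q (\<lambda>x. h x - A g x) + Lp_norm M q (A g))"
    using Lp_norm_add_le[OF Lp_space_diff[OF h A_Lq[OF g(1)] q0(2)] A_Lq[OF g(1)] q] by simp
  moreover have "Lp_norm M p g \<le> 4 * (Lp_norm M p f + Lp_norm M p (\<lambda>x. f x - g x))"
    using Lp_norm_diff_le[OF f Lp_space_diff[OF f cLp[OF g(1)] p0(2)] p] by simp
  then have "B * Lp_norm M p g \<le> B * (4 * (Lp_norm M p f + \<delta>))" using g(2) B by (intro mult_left_mono) auto
  ultimately have "Lp_norm M q h \<le> 4 * (\<delta> + B * (4 * (Lp_norm M p f + \<delta>)))"
    using A_le[OF g(1)] g(3) by argo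
  also have "\<dots> = 16 * B * Lp_norm M p f + (4 + 16 * B) * \<delta>" by (simp add: algebra_simps)
  finally show "Lp_norm M q h \<le> 16 * B * Lp_norm M p f + \<epsilon>" unfolding \<delta>(2) .
qed

lemma R_add:
  assumes R: "R f h" "R f' h'"
  shows "R (\<lambda>x. f x + f' x) (\<lambda>x. h x + h' x)"
  unfolding graph_closure_def
proof (intro conjI allI impI)
  have f: "f \<in> Lp_space M p" "f' \<in> Lp_space M p" and h: "h \<in> Lp_space M q" "h' \<in> Lp_space M q"
    using R unfolding graph_closure_def by auto
  show "(\<lambda>x. f x + f' x) \<in> Lp_space M p" "(\<lambda>x. h x + h' x) \<in> Lp_space M q"
    by (intro Lp_space_add f h p0 q0)+
  fix \<delta> :: real assume \<delta>: "0 < \<delta>"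
  \<comment> \<open>Two errors of \<delta> / 8 become \<delta> after the triangle inequality with
    constant 4.\<close>
  then have \<delta>8: "0 < \<delta> / 8" by simp
  obtain g where g: "cts g" "Lp_norm M p (\<lambda>x. f x - g x) \<le> \<delta> / 8" "Lp_norm M q (\<lambda>x. h x - A g x) \<le> \<delta> / 8"
    using R(1) \<delta>8 unfolding graph_closure_def by blast
  obtain g' where g': "cts g'" "Lp_norm M p (\<lambda>x. f' x - g' x) \<le> \<delta> / 8" "Lp_norm M q (\<lambda>x. h' x - A g' x) \<le> \<delta> / 8"
    using R(2) \<delta>8 unfolding graph_closure_def by blast
  have c: "cts (\<lambda>x. g x + g' x)" by (intro continuous_intros g g')
  have 1: "Lp_norm M p (\<lambda>x. (f x - g x) + (f' x - g' x)) \<le> 4 * (Lp_norm M p (\<lambda>x. f x - g x) + Lp_norm M p (\<lambda>x. f' x - g' x))"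
    by (intro Lp_norm_add_le Lp_space_diff cLp f g g' p p0)
  have 2: "Lp_norm M q (\<lambda>x. (h x - A g x) + (h' x - A g' x)) \<le> 4 * (Lp_norm M q (\<lambda>x. h x - A g x) + Lp_norm M q (\<lambda>x. h' x - A g' x))"
    by (intro Lp_norm_add_le Lp_space_diff A_Lq h g g' q q0)
  have "Lp_norm M q (\<lambda>x. (h x + h' x) - A (\<lambda>x. g x + g' x) x) = Lp_norm M q (\<lambda>x. (h x - A g x) + (h' x - A g' x))"
  proof (rule Lp_norm_cong_AE)
    show "AE x in M. h x + h' x - A (\<lambda>x. g x + g' x) x = (h x - A g x) + (h' x - A g' x)"
      using A_add[OF g(1) g'(1)] by eventually_elim simp
  qed (intro Lp_meas[of _ q] Lp_space_diff Lp_space_add A_Lq h g g' c q0)+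
  moreover have "(\<lambda>x. (f x + f' x) - (g x + g' x)) = (\<lambda>x. (f x - g x) + (f' x - g' x))" by (simp add: fun_eq_iff)
  ultimately show "\<exists>g. cts g \<and> Lp_norm M p (\<lambda>x. f x + f' x - g x) \<le> \<delta> \<and> Lp_norm M q (\<lambda>x. h x + h' x - A g x) \<le> \<delta>"
    using 1 2 g g' c by (intro exI[of _ "\<lambda>x. g x + g' x"] conjI) auto
qed

lemma R_scale:
  assumes R: "R f h"
  shows "R (\<lambda>x. c * f x) (\<lambda>x. c * h x)"
  unfolding graph_closure_def
proof (intro conjI allI impI)
  have f: "f \<in> Lp_space M p" and h: "h \<in> Lp_space M q" using R unfolding graph_closure_def by auto
  show "(\<lambda>x. c * f x) \<in> Lp_space M p" "(\<lambda>x. c * h x) \<in> Lp_space M q" by (intro Lp_space_scale f h)+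
  fix \<delta> :: real assume \<delta>: "0 < \<delta>"
  have c0: "0 < cmod c + 1" by (simp add: add_nonneg_pos)
  then have \<delta>c: "0 < \<delta> / (cmod c + 1)" using \<delta> by simp
  obtain g where g: "cts g" "Lp_norm M p (\<lambda>x. f x - g x) \<le> \<delta> / (cmod c + 1)" "Lp_norm M q (\<lambda>x. h x - A g x) \<le> \<delta> / (cmod c + 1)"
    using R \<delta>c unfolding graph_closure_def by blast
  have cc: "cts (\<lambda>x. c * g x)" by (intro continuous_intros g)
  have le: "cmod c * t \<le> \<delta>" if "t \<le> \<delta> / (cmod c + 1)" "0 \<le> t" for t
  proof -
    have "cmod c * t \<le> (cmod c + 1) * t" using that(2) by (intro mult_right_mono) auto
    also have "\<dots> \<le> (cmod c + 1) * (\<delta> / (cmod c + 1))" using that(1) c0 by (intro mult_left_mono) auto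
    also have "\<dots> = \<delta>" using c0 by simp
    finally show ?thesis .
  qed
  have "Lp_norm M q (\<lambda>x. c * h x - A (\<lambda>x. c * g x) x) = Lp_norm M q (\<lambda>x. c * (h x - A g x))"
  proof (rule Lp_norm_cong_AE)
    show "AE x in M. c * h x - A (\<lambda>x. c * g x) x = c * (h x - A g x)"
      using A_scale[OF g(1), of c] by eventually_elim (simp add: right_diff_distrib)
  qed (intro Lp_meas[of _ q] Lp_space_diff Lp_space_scale A_Lq h g cc q0)+
  moreover have "(\<lambda>x. c * f x - c * g x) = (\<lambda>x. c * (f x - g x))" by (simp add: right_diff_distrib)
  ultimately show "\<exists>g. cts g \<and> Lp_norm M p (\<lambda>x. c * f x - g x) \<le> \<delta> \<and> Lp_norm M q (\<lambda>x. c * h x - A g x) \<le> \<delta>"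
    using le[OF g(2)] le[OF g(3)] cc Lp_norm_scale[OF p0(1), of M c] Lp_norm_scale[OF q0(1), of M c]
    by (intro exI[of _ "\<lambda>x. c * g x"] conjI) auto
qed

lemma R_cts: "cts f \<Longrightarrow> R f (A f)"
  unfolding graph_closure_def using cLp A_Lq by (auto intro!: exI[of _ f] simp: Lp_norm_def)

lemma R_cong_AE:
  assumes R: "R f h" and f': "f' \<in> Lp_space M p" and ae: "AE x in M. f x = f' x"
  shows "R f' h"
proof -
  have f: "f \<in> Lp_space M p" using R unfolding graph_closure_def by blast
  have "Lp_norm M p (\<lambda>x. f' x - g x) = Lp_norm M p (\<lambda>x. f x - g x)" if g: "cts g" for g
  proof (rule Lp_norm_cong_AE)
    show "AE x in M. f' x - g x = f x - g x" using ae by eventually_elim simp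
  qed (intro Lp_meas[of _ p] Lp_space_diff cLp f f' g p0)+
  then show ?thesis using R f' unfolding graph_closure_def by metis
qed

text \<open>The difference of two partners of \<open>f\<close> is a partner of the zero function, so
  the bound makes its norm vanish. Every identity for the extension is obtained by exhibiting two
  partners of the same function.\<close>

lemma R_unique:
  assumes R: "R f h" "R f h'"
  shows "AE x in M. h x = h' x"
proof -
  have h: "h \<in> Lp_space M q" "h' \<in> Lp_space M q" using R unfolding graph_closure_def by auto
  have "R (\<lambda>x. f x + -1 * f x) (\<lambda>x. h x + -1 * h' x)" by (intro R_add R_scale R)
  then have "Lp_norm M q (\<lambda>x. h x + -1 * h' x) \<le> 16 * B * Lp_norm M p (\<lambda>x. f x + -1 * f x)" by (rule R_bounded)
  also have "\<dots> = 0" by (simp add: Lp_norm_def)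
  finally have "Lp_norm M q (\<lambda>x. h x - h' x) \<le> 0" by simp
  from Lp_norm_eq_0[OF Lp_space_diff[OF h q0(2)] this] show ?thesis by eventually_elim simp
qed

lemma extension:
  "\<exists>T. bounded_Lp_Lq M p q T \<and> (\<forall>f. cts f \<longrightarrow> (AE x in M. T f x = A f x)) \<and>
     (\<forall>f\<in>Lp_space M p. Lp_norm M q (T f) \<le> 16 * B * Lp_norm M p f)"
proof -
  \<comment> \<open>An arbitrary choice of representative suffices: linearity is required only
    almost everywhere and follows from uniqueness.\<close>
  define T where "T f = (SOME h. R f h)" for f
  have T: "R f (T f)" if "f \<in> Lp_space M p" for f unfolding T_def by (rule someI_ex[OF R_exists[OF that]])
  have le: "\<forall>f\<in>Lp_space M p. Lp_norm M q (T f) \<le> 16 * B * Lp_norm M p f" using R_bounded[OF T] by blast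
  have "linear_op_on M (Lp_space M p) T" unfolding linear_op_on_def
  proof (intro conjI ballI allI impI)
    fix f g assume fg: "f \<in> Lp_space M p" "g \<in> Lp_space M p"
    show "AE x in M. T f x = T g x" if "AE x in M. f x = g x"
      by (rule R_unique[OF R_cong_AE[OF T[OF fg(1)] fg(2) that] T[OF fg(2)]])
    show "AE x in M. T (\<lambda>t. f t + g t) x = T f x + T g x"
      by (rule R_unique[OF T[OF Lp_space_add[OF fg p0(2)]] R_add[OF T[OF fg(1)] T[OF fg(2)]]])
  next
    fix c f assume f: "f \<in> Lp_space M p"
    show "AE x in M. T (\<lambda>t. c * f t) x = c * T f x"
      by (rule R_unique[OF T[OF Lp_space_scale[OF f]] R_scale[OF T[OF f]]])
  qed
  moreover have "T ` Lp_space M p \<subseteq> Lp_space M q" using T unfolding graph_closure_def by blast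
  moreover have "AE x in M. T f x = A f x" if "cts f" for f
    by (rule R_unique[OF T[OF cLp[OF that]] R_cts[OF that]])
  ultimately show ?thesis using le unfolding bounded_Lp_Lq_def by (intro exI[of _ T] conjI) auto
qed

end

section \<open>From the bilinear estimate to the bound for multipliers\<close>

context hypergroup_dual
begin

text \<open>Passes from trigonometric to continuous test functions. A uniform approximation is used
  because the error is paired with \<open>A f\<close>, whose integral norm is all that is available
  at this stage.\<close>

lemma multiplier_bilinear:
  assumes pq: "1 < p" "p \<le> 2" "2 \<le> q" and A: "multiplier A \<sigma>" and H: "hbound p q \<sigma> = ennreal H" "0 \<le> H"
    and f: "cts f" and g: "cts g"
    and N_def: "N = sqrt (paley_const p) * sqrt (paley_const (q / (q - 1))) * H * Lp_norm haar p f" and N: "0 \<le> N"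
    and Af: "integrable haar (A f)"
  shows "cmod (LINT x|haar. A f x * cnj (g x)) \<le> 4 * N * Lp_norm haar (q / (q - 1)) g"
proof (rule field_le_epsilon)
  fix \<epsilon> :: real assume \<epsilon>: "0 < \<epsilon>"
  interpret prob_space haar by (rule prob_haar)
  define r where "r = q / (q - 1)"
  have r: "1 \<le> r" "0 < r" "0 \<le> r" unfolding r_def using pq by auto
  define a where "a = (LINT x|haar. cmod (A f x))"
  have a: "0 \<le> a" unfolding a_def by simp
  \<comment> \<open>The error enters twice: through the norm of the approximant with factor 4 N, and
    through the pairing with \<open>A f\<close> with factor \<open>a\<close>. The summand 1 keeps
    the denominator positive.\<close>
  define \<delta> where "\<delta> = \<epsilon> / (4 * N + a + 1)"
  have \<delta>: "0 < \<delta>" "(4 * N + a) * \<delta> \<le> \<epsilon>"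
  proof -
    show "0 < \<delta>" unfolding \<delta>_def using \<epsilon> N a by simp
    then have "(4 * N + a) * \<delta> \<le> (4 * N + a + 1) * \<delta>" by (intro mult_right_mono) auto
    also have "\<dots> = \<epsilon>" unfolding \<delta>_def using N a by simp
    finally show "(4 * N + a) * \<delta> \<le> \<epsilon>" .
  qed
  obtain t where t: "t \<in> trig" "\<And>x. cmod (g x - t x) \<le> \<delta>" using trig_dense[OF g \<delta>(1)] by blast
  have ct: "cts t" by (rule trig_cts[OF t(1)])
  have cd: "cts (\<lambda>x. g x - t x)" by (intro continuous_intros g ct)
  have L: "u \<in> Lp_space haar r" if "cts u" for u by (rule continuous_in_Lp(1)[OF K finite_haar sets_haar that r(2)])
  have "(LINT x|haar. cmod (g x - t x) powr r) \<le> (LINT x|haar. \<delta> powr r)"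
    using L[OF cd] t(2) r unfolding Lp_space_def by (intro integral_mono powr_mono2) auto
  then have "Lp_norm haar r (\<lambda>x. g x - t x) \<le> \<delta>"
    using Lp_norm_le_iff[OF r(2), of \<delta> haar "\<lambda>x. g x - t x"] \<delta>(1) by (simp add: prob_space[unfolded space_haar])
  then have tn: "Lp_norm haar r t \<le> 4 * (Lp_norm haar r g + \<delta>)"
    using Lp_norm_diff_le[OF L[OF g] L[OF cd] r(1)] by simp
  have "(LINT x|haar. A f x * cnj (g x)) = (LINT x|haar. A f x * cnj (t x) + A f x * cnj (g x - t x))"
    by (intro Bochner_Integration.integral_cong) (simp_all add: algebra_simps)
  then have "(LINT x|haar. A f x * cnj (g x)) = (LINT x|haar. A f x * cnj (t x)) + (LINT x|haar. A f x * cnj (g x - t x))"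
    using integrable_mult_cnj_cts[OF Af ct] integrable_mult_cnj_cts[OF Af cd] by simp
  then have "cmod (LINT x|haar. A f x * cnj (g x)) \<le> cmod (LINT x|haar. A f x * cnj (t x)) + cmod (LINT x|haar. A f x * cnj (g x - t x))"
    using norm_triangle_ineq by simp
  moreover have "cmod (LINT x|haar. A f x * cnj (g x - t x)) \<le> a * \<delta>"
  proof -
    have "cmod (LINT x|haar. A f x * cnj (g x - t x)) \<le> (LINT x|haar. cmod (A f x * cnj (g x - t x)))" by (rule integral_norm_bound)
    also have "\<dots> \<le> (LINT x|haar. cmod (A f x) * \<delta>)"
    proof (rule integral_mono)
      show "cmod (A f x * cnj (g x - t x)) \<le> cmod (A f x) * \<delta>" for x
        unfolding norm_mult complex_mod_cnj by (intro mult_left_mono t(2)) simp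
    qed (use integrable_mult_cnj_cts[OF Af cd] Af in auto)
    also have "\<dots> = a * \<delta>" unfolding a_def by simp
    finally show ?thesis .
  qed
  moreover have "cmod (LINT x|haar. A f x * cnj (t x)) \<le> N * (4 * (Lp_norm haar r g + \<delta>))"
    using multiplier_bilinear_trig[OF pq A H f t(1), folded N_def r_def] mult_left_mono[OF tn N] by linarith
  moreover have "N * (4 * (Lp_norm haar r g + \<delta>)) + a * \<delta> = 4 * N * Lp_norm haar r g + (4 * N + a) * \<delta>"
    by (simp add: algebra_simps)
  ultimately show "cmod (LINT x|haar. A f x * cnj (g x)) \<le> 4 * N * Lp_norm haar (q / (q - 1)) g + \<epsilon>"
    using \<delta>(2) unfolding r_def[symmetric] by linarith
qed

text \<open>Of the factor 16, one 4 comes from the change to continuous test functions and one from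
  the duality; no continuity of \<open>A\<close> beforehand is used.\<close>

lemma multiplier_Lp_Lq:
  assumes pq: "1 < p" "p \<le> 2" "2 \<le> q" and A: "multiplier A \<sigma>" and H: "hbound p q \<sigma> = ennreal H" "0 \<le> H"
    and f: "cts f"
  shows "A f \<in> Lp_space haar q"
    "Lp_norm haar q (A f) \<le> 16 * (sqrt (paley_const p) * sqrt (paley_const (q / (q - 1)))) * H * Lp_norm haar p f"
proof -
  define N where "N = sqrt (paley_const p) * sqrt (paley_const (q / (q - 1))) * H * Lp_norm haar p f"
  have "1 < q / (q - 1)" "q / (q - 1) \<le> 2" using pq by (auto simp: field_simps)
  then have "0 < paley_const (q / (q - 1))" "0 < paley_const p" using paley_const_pos pq by auto
  then have N: "0 \<le> N" unfolding N_def using H by simp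
  then have N4: "0 \<le> 4 * N" by simp
  have q: "1 < q" using pq by simp
  have AL: "A f \<in> Lp_space haar 1" using A f unfolding left_fourier_multiplier_def by blast
  then have "integrable haar (\<lambda>x. cmod (A f x))" unfolding Lp_space_def by simp
  then have Af: "integrable haar (A f)" using AL unfolding Lp_space_def by (auto dest: integrable_norm_cancel)
  note D = Lq_duality[OF K finite_haar sets_haar q Af N4 multiplier_bilinear[OF pq A H f _ N_def N Af]]
  show "A f \<in> Lp_space haar q" by (rule D(1))
  show "Lp_norm haar q (A f) \<le> 16 * (sqrt (paley_const p) * sqrt (paley_const (q / (q - 1)))) * H * Lp_norm haar p f"
    using D(2) unfolding N_def by simp
qed

end

theorem theorem4p1:
  fixes conv :: "('a::polish_space set \<Rightarrow> complex) \<Rightarrow> ('a set \<Rightarrow> complex) \<Rightarrow> 'a set \<Rightarrow> complex"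
    and e :: 'a and ck :: "'a \<Rightarrow> 'a" and haar :: "'a measure"
    and rep :: "'a meas_rep set \<Rightarrow> 'a meas_rep"
    and p q :: real
  assumes "compact_hypergroup conv e ck"
    and "haar_measure conv haar"
    and "\<forall>c \<in> dual conv e ck. rep c \<in> c"
    and "1 < p" "p \<le> 2" "2 \<le> q"
  shows "\<exists>C>0. \<forall>A \<sigma>. left_fourier_multiplier conv e ck haar rep A \<sigma> \<longrightarrow>
           hoermander_bound conv e ck haar rep p q \<sigma> < \<infinity> \<longrightarrow>
           (\<exists>B. bounded_Lp_Lq haar p q B \<and>
              (\<forall>f. continuous_on UNIV f \<longrightarrow> (AE x in haar. B f x = A f x)) \<and>
              Lp_Lq_norm haar p q B \<le> ennreal C * hoermander_bound conv e ck haar rep p q \<sigma>)"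
proof -
  interpret compact_hypergroup conv e ck by (rule assms(1))
  interpret hypergroup_dual conv e ck haar rep
    by unfold_locales (rule assms(2,3))+
  define C0 where "C0 = sqrt (paley_const p) * sqrt (paley_const (q / (q - 1)))"
  have "1 < q / (q - 1)" "q / (q - 1) \<le> 2" using assms(6) by (auto simp: field_simps)
  then have C0: "0 < C0" unfolding C0_def using paley_const_pos assms(4,5) by simp
  \<comment> \<open>256 is 16 times 16: one factor from the bound on continuous functions, the other
    from closing the graph. It depends on neither \<open>A\<close> nor \<open>\<sigma>\<close>, so
    the constant is uniform in the multiplier.\<close>
  have main: "\<exists>B. bounded_Lp_Lq haar p q B \<and> (\<forall>f. continuous_on UNIV f \<longrightarrow> (AE x in haar. B f x = A f x)) \<and>
      Lp_Lq_norm haar p q B \<le> ennreal (256 * C0) * hbound p q \<sigma>"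
    if A: "multiplier A \<sigma>" and fin: "hbound p q \<sigma> < \<infinity>" for A \<sigma>
  proof -
    define H where "H = enn2real (hbound p q \<sigma>)"
    have H: "hbound p q \<sigma> = ennreal H" "0 \<le> H" unfolding H_def using fin by simp_all
    note bd = multiplier_Lp_Lq[OF assms(4-6) A H, folded C0_def]
    interpret op: densely_bounded_operator haar A p q "16 * C0 * H"
      by (rule densely_bounded_operator.intro[OF prob_haar], unfold_locales)
         (use K sets_haar assms(4-6) C0 H A bd in \<open>auto simp: left_fourier_multiplier_def\<close>)
    obtain T where T: "bounded_Lp_Lq haar p q T" "\<forall>f. cts f \<longrightarrow> (AE x in haar. T f x = A f x)"
      "\<forall>f\<in>Lp_space haar p. Lp_norm haar q (T f) \<le> 16 * (16 * C0 * H) * Lp_norm haar p f"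
      using op.extension by blast
    have "Lp_Lq_norm haar p q T \<le> ennreal (256 * C0) * hbound p q \<sigma>"
      unfolding Lp_Lq_norm_def
    proof (rule SUP_least)
      fix f assume f: "f \<in> {f \<in> Lp_space haar p. Lp_norm haar p f \<le> 1}"
      have "16 * (16 * C0 * H) * Lp_norm haar p f \<le> 16 * (16 * C0 * H) * 1" using f C0 H by (intro mult_left_mono) auto
      then have "Lp_norm haar q (T f) \<le> 256 * C0 * H" using T(3) f by force
      then have "ennreal (Lp_norm haar q (T f)) \<le> ennreal (256 * C0 * H)" by (rule ennreal_leI)
      also have "\<dots> = ennreal (256 * C0) * hbound p q \<sigma>" unfolding H(1) using C0 H by (intro ennreal_mult) auto
      finally show "ennreal (Lp_norm haar q (T f)) \<le> ennreal (256 * C0) * hbound p q \<sigma>" .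
    qed
    with T show ?thesis by blast
  qed
  show ?thesis using C0 main by (intro exI[of _ "256 * C0"]) auto
qed

end
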